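(* Let $X$ be a separable Banach space which is not near Hilbert. Then $X$ satisfies the Cantorized-Enflo criterion, and therefore $X$ is ergodic. Furthermore, the reduction uses subspaces without the approximation property: there is a Borel map $\phi:2^{\mathbb N}\to\mathcal{SB}(X)$ such that for all $s,t\in 2^{\mathbb N}$ one has $sE_0t$ if and only if $\phi(s)$ and $\phi(t)$ are isomorphic, and such that $\phi(t)$ fails the approximation property for every $t\in 2^{\mathbb N}$.
   Context: Near Hilbert: for a Banach space $X$ let $p(X)=\sup\{p: X \text{ has type } p\}$ and $q(X)=\inf\{q: X\text{ has cotype } q\}$. $X$ is near Hilbert if $p(X)=q(X)=2$. Approximation property (AP): a Banach space has the AP if its identity operator can be approximated uniformly on compact subsets by bounded linear operators of finite rank. Ergodic: for a separable Banach space $X$, $\mathcal{SB}(X)$ is the set of infinite-dimensional closed linear subspaces of $X$, equipped with the (relative) Effros Borel structure, i.e. the $\sigma$-algebra generated by the sets $\{F: F\cap U\neq\emptyset\}$, $U\subseteq X$ open. $E_0$ is the equivalence relation on $2^{\mathbb N}$ given by $xE_0y$ iff there is $N$ with $x(n)=y(n)$ for all $n\ge N$. A separable Banach space $X$ is ergodic if there is a Borel map $\phi:2^{\mathbb N}\to\mathcal{SB}(X)$ such that for all $x,y$: $xE_0y$ iff $\phi(x)$ is (linearly) isomorphic to $\phi(y)$. Cantorized-Enflo criterion: $\mathbb N=\{1,2,\dots\}$, and for $n\in\mathbb N$ let $I_n=\{2^n,2^n+1,\dots,2^{n+1}-1\}$. Given sequences $(z_{j,\epsilon})_{j\in\mathbb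 N}$ in $X$ and $(z^*_{j,\epsilon})_{j\in\mathbb N}$ in $X^*$ ($\epsilon=0,1$), put $Z=\overline{\mathrm{span}}\{z_{j,\epsilon}: j\in\mathbb N,\ \epsilon=0,1\}$ and, for $t\in2^{\mathbb N}$, $X_t=\overline{\mathrm{span}}\{z_{j,t(n)}: j\in I_n,\ n=1,2,3,\dots\}$. For a bounded linear operator $T:X_t\to Z$ put $\beta^n_t(T)=2^{-n}\sum_{j\in I_n}z^*_{j,t(n)}(T(z_{j,t(n)}))$. The Banach space $X$ satisfies the Cantorized-Enflo criterion if there exist bounded sequences $(z_{j,\epsilon})_{j}$ in $X$ and $(z^*_{j,\epsilon})_{j}$ in $X^*$ ($\epsilon=0,1$) and a sequence of real scalars $(\alpha_n)_n$ such that: (1) $z^*_{i,\epsilon}(z_{j,\tau})=\delta_{ij}\delta_{\epsilon\tau}$ for all $i,j\in\mathbb N$ and $\epsilon,\tau\in\{0,1\}$; (2) for all $t,s\in2^{\mathbb N}$, every bounded linear operator $T:X_t\to X_s$ and every $n\ge2$, $|\beta^n_t(T)-\beta^{n-1}_t(T)|\le\alpha_n\|T\|$; (3) $\sum_n\alpha_n<\infty$. *)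

theory Defs
  imports "HOL-Analysis.Analysis"
begin

section \<open>Operators between subspaces\<close>

text \<open>
  A Banach space is a type of class \<^class>\<open>banach\<close>, and its subspaces are sets.
  An operator between subspaces \<open>V\<close> and \<open>W\<close> is a function on the ambient type that is only
  constrained on \<open>V\<close>, so that operators need not extend linearly to the whole space.
\<close>

definition bounded_linear_on :: "'a::real_normed_vector set \<Rightarrow> 'a set \<Rightarrow> ('a \<Rightarrow> 'a) \<Rightarrow> bool" where
  "bounded_linear_on V W T \<longleftrightarrow>
     (\<forall>x\<in>V. T x \<in> W) \<and>
     (\<forall>x\<in>V. \<forall>y\<in>V. T (x + y) = T x + T y) \<and>
     (\<forall>c. \<forall>x\<in>V. T (c *\<^sub>R x) = c *\<^sub>R T x) \<and>
     (\<exists>K. \<forall>x\<in>V. norm (T x) \<le> K * norm x)"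

text \<open>The analogue of \<^const>\<open>onorm\<close> for operators defined on a subspace.\<close>

definition onorm_on :: "'a::real_normed_vector set \<Rightarrow> ('a \<Rightarrow> 'a) \<Rightarrow> real" where
  "onorm_on V T = (SUP x\<in>V. norm (T x) / norm x)"

definition isomorphic_subspaces :: "'a::real_normed_vector set \<Rightarrow> 'a set \<Rightarrow> bool" where
  "isomorphic_subspaces V W \<longleftrightarrow>
     (\<exists>T S. bounded_linear_on V W T \<and> bounded_linear_on W V S \<and>
        (\<forall>x\<in>V. S (T x) = x) \<and> (\<forall>y\<in>W. T (S y) = y))"

definition finite_dimensional_set :: "'a::real_vector set \<Rightarrow> bool" where
  "finite_dimensional_set S \<longleftrightarrow> (\<exists>B. finite B \<and> S \<subseteq> span B)"

definition approximation_property :: "'a::real_normed_vector set \<Rightarrow> bool" where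
  "approximation_property V \<longleftrightarrow>
     (\<forall>K e. compact K \<and> K \<subseteq> V \<and> 0 < e \<longrightarrow>
        (\<exists>T. bounded_linear_on V V T \<and> finite_dimensional_set (T ` V) \<and>
             (\<forall>x\<in>K. norm (T x - x) \<le> e)))"

section \<open>Type, cotype and near Hilbert spaces\<close>

text \<open>
  The expected norm of \<open>\<epsilon>\<^sub>0 x\<^sub>0 + \<dots> + \<epsilon>\<^sub>n\<^sub>-\<^sub>1 x\<^sub>n\<^sub>-\<^sub>1\<close> for independent
  uniformly distributed signs, written as the average over all \<open>2\<^sup>n\<close> choices of signs.
\<close>

definition rademacher_mean :: "nat \<Rightarrow> (nat \<Rightarrow> 'a::real_normed_vector) \<Rightarrow> real" where
  "rademacher_mean n x =
     (\<Sum>\<epsilon>\<in>{..<n} \<rightarrow>\<^sub>E {-1, 1::real}. norm (\<Sum>i<n. \<epsilon> i *\<^sub>R x i)) / 2 ^ n"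

definition has_type :: "'a::real_normed_vector itself \<Rightarrow> real \<Rightarrow> bool" where
  "has_type _ p \<longleftrightarrow> 1 \<le> p \<and> p \<le> 2 \<and>
     (\<exists>C. \<forall>n (x :: nat \<Rightarrow> 'a).
        rademacher_mean n x \<le> C * (\<Sum>i<n. norm (x i) powr p) powr (1 / p))"

text \<open>
  Only finite exponents are considered: every space has cotype \<open>\<infinity>\<close>, and including it would
  not change the infimum in \<open>cotype_index\<close>, since the infimum of the empty set is \<open>\<infinity>\<close>.
\<close>

definition has_cotype :: "'a::real_normed_vector itself \<Rightarrow> real \<Rightarrow> bool" where
  "has_cotype _ q \<longleftrightarrow> 2 \<le> q \<and>
     (\<exists>C. \<forall>n (x :: nat \<Rightarrow> 'a).
        (\<Sum>i<n. norm (x i) powr q) powr (1 / q) \<le> C * rademacher_mean n x)"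

definition type_index :: "'a::real_normed_vector itself \<Rightarrow> ereal" where
  "type_index X = (SUP p\<in>{p. has_type X p}. ereal p)"

definition cotype_index :: "'a::real_normed_vector itself \<Rightarrow> ereal" where
  "cotype_index X = (INF q\<in>{q. has_cotype X q}. ereal q)"

definition near_hilbert :: "'a::real_normed_vector itself \<Rightarrow> bool" where
  "near_hilbert X \<longleftrightarrow> type_index X = 2 \<and> cotype_index X = 2"

section \<open>Ergodic spaces\<close>

definition SB :: "'a::real_normed_vector set set" where
  "SB = {F. subspace F \<and> closed F \<and> \<not> finite_dimensional_set F}"

definition effros_borel :: "'a::real_normed_vector set measure" where
  "effros_borel = sigma SB {{F \<in> SB. F \<inter> U \<noteq> {}} | U. open U}"

text \<open>
  The Cantor space is \<^typ>\<open>nat \<Rightarrow> bool\<close> with the product topology.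
\<close>

definition E0 :: "(nat \<Rightarrow> bool) \<Rightarrow> (nat \<Rightarrow> bool) \<Rightarrow> bool" where
  "E0 x y \<longleftrightarrow> (\<exists>N. \<forall>n\<ge>N. x n = y n)"

definition ergodic :: "'a::real_normed_vector itself \<Rightarrow> bool" where
  "ergodic _ \<longleftrightarrow>
     (\<exists>\<phi> :: (nat \<Rightarrow> bool) \<Rightarrow> 'a set. \<phi> \<in> borel \<rightarrow>\<^sub>M effros_borel \<and>
        (\<forall>x y. E0 x y \<longleftrightarrow> isomorphic_subspaces (\<phi> x) (\<phi> y)))"

section \<open>The Cantorized-Enflo criterion\<close>

text \<open>
  Sequences are indexed from \<open>1\<close>, so the values \<open>z 0\<close>, \<open>z' 0\<close>, \<open>t 0\<close> (and \<open>\<alpha> 0\<close>) are junk that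
  is never constrained or used; \<open>False\<close> and \<open>True\<close> stand for the indices \<open>0\<close> and \<open>1\<close>.
\<close>

definition dyadic_block :: "nat \<Rightarrow> nat set" where
  "dyadic_block n = {2 ^ n ..< 2 ^ (n + 1)}"

definition cantor_subspace ::
    "(nat \<Rightarrow> bool \<Rightarrow> 'a::real_normed_vector) \<Rightarrow> (nat \<Rightarrow> bool) \<Rightarrow> 'a set" where
  "cantor_subspace z t = closure (span {z j (t n) | j n. 1 \<le> n \<and> j \<in> dyadic_block n})"

definition enflo_beta ::
    "(nat \<Rightarrow> bool \<Rightarrow> 'a::real_normed_vector) \<Rightarrow> (nat \<Rightarrow> bool \<Rightarrow> 'a \<Rightarrow>\<^sub>L real) \<Rightarrow>
     (nat \<Rightarrow> bool) \<Rightarrow> nat \<Rightarrow> ('a \<Rightarrow> 'a) \<Rightarrow> real" where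
  "enflo_beta z z' t n T =
     (\<Sum>j\<in>dyadic_block n. blinfun_apply (z' j (t n)) (T (z j (t n)))) / 2 ^ n"

definition cantorized_enflo :: "'a::real_normed_vector itself \<Rightarrow> bool" where
  "cantorized_enflo _ \<longleftrightarrow>
     (\<exists>(z :: nat \<Rightarrow> bool \<Rightarrow> 'a) (z' :: nat \<Rightarrow> bool \<Rightarrow> 'a \<Rightarrow>\<^sub>L real) (\<alpha> :: nat \<Rightarrow> real).
        (\<forall>\<epsilon>. bounded ((\<lambda>j. z j \<epsilon>) ` {1..}) \<and> bounded ((\<lambda>j. z' j \<epsilon>) ` {1..})) \<and>
        (\<forall>i\<ge>1. \<forall>j\<ge>1. \<forall>\<epsilon> \<tau>.
           blinfun_apply (z' i \<epsilon>) (z j \<tau>) = (if i = j \<and> \<epsilon> = \<tau> then 1 else 0)) \<and>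
        (\<forall>t s T. bounded_linear_on (cantor_subspace z t) (cantor_subspace z s) T \<longrightarrow>
           (\<forall>n\<ge>2. \<bar>enflo_beta z z' t n T - enflo_beta z z' t (n - 1) T\<bar>
                    \<le> \<alpha> n * onorm_on (cantor_subspace z t) T)) \<and>
        summable \<alpha>)"

end

(*
  The elementary analysis behind type and cotype produces, from a failing exponent, long unconditional
  spreading sequences whose sums of k terms grow faster (type) or slower (cotype) than k^(1/2) by a
  fixed power, at a prescribed scale and inside any subspace of finite codimension: take nearly
  extremal vectors for the failing inequality, split them by Ramsey's theorem into sets on which
  norms of linear combinations depend only on the coefficients, and pass to differences of
  consecutive terms. Stacking such sequences gives a finite-dimensional decomposition whose n-th
  block is indexed by the subsets w of {..<n} (bit strings) and two copy bits.

  On this decomposition Szankowski's averaged vectors x_w are better than a Hilbert space along one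
  family of coordinate directions and not worse along the others. Each z_w is a sum of vectors of two
  consecutive levels, with the copy bits chosen so that the biorthogonal functional can be computed
  on either level; hence beta^n - beta^(n-1) is an average of x*_w (T y_w) in which y_w has no
  component along x_w. Averaging over lines in the good directions, signed by bent functions,
  makes the difference summable. This uses only finitely many values of T for each n.

  Consequently the spaces X_t fail the approximation property. If X_t and X_s are isomorphic with
  constants at most K, compose a finite-dimensional approximation of this isomorphism with the
  inverse of one for a pair (t', s') close to (t, s) such that t' and t first differ at a late
  level: beta is almost 1 at an early level and 0 at the late one, a contradiction. So isomorphic pairs
  form a countable union of nowhere dense sets, which an E_0-preserving map of the Cantor space can
  avoid outside E_0.
*)
theory Submission
  imports Defs "HOL-Library.Ramsey"
begin

section \<open>Extension of functionals\<close>

text \<open>Why the square root is the threshold: a difference of consecutive traces is an average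
  over lines of \<open>2 ^ (2 * h)\<close> indices, and the sum over a line is bounded by the
  product of two signed sums, one of functionals and one of vectors. In a Hilbert space each factor
  has order \<open>2 ^ h\<close>; the product is then as large as the number of terms and nothing is
  gained. Averaging the vectors over one family of positions makes one factor of order
  \<open>2 ^ h\<close> whatever the norm is, and the deviation of the growth from the square root
  makes the other smaller than \<open>2 ^ h\<close> by a power of it. The signs have to serve two
  purposes at once. Characters decouple functionals from vectors, but a character alone concentrates
  on a single index; multiplied by a bent function it keeps all Fourier coefficients equal in size.
  The direction of a line has to be the own one for the functional and a foreign one for each of the
  remaining terms of the vector. This is why every level reserves 32 disjoint sets of positions.
  Each is a fixed fraction of the level, so the errors decay geometrically and their square roots
  are summable too.\<close>

definition sublinear :: "('a::real_vector => real) => bool" where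
 "sublinear p \<longleftrightarrow> (\<forall>x y. p (x + y) <= p x + p y) \<and> (\<forall>c x. c > 0 --> p (c *\<^sub>R x) = c * p x)"

lemma sublinearI:
 assumes "!!x y. p (x + y) <= p x + p y" "!!c x. c > 0 ==> p (c *\<^sub>R x) <= c * p x"
 shows "sublinear p"
proof -
 have "p (c *\<^sub>R x) = c * p x" if "c > 0" for c x
 proof (rule antisym)
  show "p (c *\<^sub>R x) <= c * p x" using assms(2) that by blast
  have "p (inverse c *\<^sub>R (c *\<^sub>R x)) <= inverse c * p (c *\<^sub>R x)"
   using assms(2)[of "inverse c" "c *\<^sub>R x"] that by simp
  then show "c * p x <= p (c *\<^sub>R x)" using that by (simp add: field_simps)
 qed
 then show ?thesis using assms(1) by (auto simp: sublinear_def)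
qed

lemma sublinear_add: "sublinear p ==> p (x + y) <= p x + p y"
 and sublinear_scale: "sublinear p ==> c > 0 ==> p (c *\<^sub>R x) = c * p x"
 by (auto simp: sublinear_def)

lemma sublinear_0: "sublinear p ==> p 0 = 0"
 using sublinear_scale[of p 2 0] by simp

lemma sublinear_minus: "sublinear p ==> - p (- x) <= p x"
 using sublinear_add[of p x "-x"] sublinear_0[of p] by simp

text \<open>Zorn's lemma for the reversed pointwise order, in which a maximal element is a minimal
  sublinear functional. The bound of a chain is its pointwise infimum, which is finite because a
  sublinear \<open>q\<close> below \<open>p\<close> satisfies
  \<open>- p (- x) <= q x\<close>.\<close>

lemma sublinear_minimal_exists:
 fixes p :: "'a::real_vector => real"
 assumes p: "sublinear p"
 obtains q where "sublinear q" "!!x. q x <= p x"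
  "\<forall>q'. sublinear q' --> (\<forall>x. q' x <= q x) --> q' = q"
proof -
 define A where "A = {q. sublinear q \<and> (\<forall>x. q x <= p x)}"
 define P where "P = (%q q'. \<forall>x::'a. q' x <= (q x :: real))"
 have "\<exists>m\<in>A. \<forall>a\<in>A. P m a --> a = m"
 proof (rule predicate_Zorn)
  show "partial_order_on A (relation_of P A)"
   by (rule partial_order_on_relation_ofI) (auto simp: P_def fun_eq_iff intro: order_trans antisym)
 next
  fix C assume C: "C \<in> Chains (relation_of P A)"
  show "\<exists>u\<in>A. \<forall>a\<in>C. P a u"
  proof (cases "C = {}")
   case True then show ?thesis using p by (auto simp: A_def)
  next
   case False
   have CA: "C \<subseteq> A" and ch: "!!a b. a \<in> C ==> b \<in> C ==> P a b \<or> P b a"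
    using C by (auto simp: Chains_def relation_of_def)
   define u where "u x = (INF q\<in>C. q x)" for x
   have bdd: "bdd_below ((%q. q x) ` C)" for x
   proof (rule bdd_belowI2)
    fix q assume "q \<in> C"
    then have "sublinear q" "q (-x) <= p (-x)" using CA by (auto simp: A_def)
    then show "- p (- x) <= q x" using sublinear_minus[of q x] by simp
   qed
   have le: "u x <= q x" if "q \<in> C" for q x
    unfolding u_def using that bdd by (intro cINF_lower) auto
   have ge: "b <= u x" if "!!q. q \<in> C ==> b <= q x" for b x
    unfolding u_def using that False by (intro cINF_greatest) auto
   have "sublinear u"
   proof (rule sublinearI)
    fix x y
    have "u (x + y) - q' y <= q x" if q: "q \<in> C" "q' \<in> C" for q q'
    proof -
     \<comment> \<open>Two members of a chain are comparable, so the lower one serves for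
       \<open>x\<close> and \<open>y\<close> at once.\<close>
     obtain q'' where q'': "q'' \<in> C" "q'' x <= q x" "q'' y <= q' y"
      using ch[OF q] q by (auto simp: P_def)
     then have "sublinear q''" using CA by (auto simp: A_def)
     then have "q'' (x + y) <= q'' x + q'' y" by (rule sublinear_add)
     with q'' le[OF q''(1), of "x + y"] show ?thesis by linarith
    qed
    then have "u (x + y) - q' y <= u x" if "q' \<in> C" for q' using that by (intro ge) auto
    then have "u (x + y) - u x <= u y" by (intro ge) (simp add: algebra_simps)
    then show "u (x + y) <= u x + u y" by simp
   next
    fix c :: real and x assume c: "c > 0"
    have "u (c *\<^sub>R x) / c <= u x"
    proof (rule ge)
     fix q assume "q \<in> C"
     then have "sublinear q" using CA by (auto simp: A_def)
     then show "u (c *\<^sub>R x) / c <= q x"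
      using le[OF \<open>q \<in> C\<close>, of "c *\<^sub>R x"] c by (simp add: sublinear_scale field_simps)
    qed
    then show "u (c *\<^sub>R x) <= c * u x" using c by (simp add: field_simps)
   qed
   moreover have "u x <= p x" for x
    using False le CA by (metis (mono_tags, lifting) A_def equals0I mem_Collect_eq order_trans subsetD)
   ultimately show ?thesis using le by (auto simp: A_def P_def)
  qed
 qed
 then obtain q where q: "q \<in> A" "!!a. a \<in> A ==> P q a ==> a = q" by blast
 show ?thesis
 proof (rule that[of q])
  show "\<forall>q'. sublinear q' --> (\<forall>x. q' x <= q x) --> q' = q"
   using q by (auto simp: A_def P_def intro!: q(2)) (meson order_trans)
 qed (use q in \<open>auto simp: A_def\<close>)
qed

text \<open>Taking the infimum along the ray in direction \<open>a\<close> gives a sublinear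
  \<open>r\<close> below \<open>q\<close>, hence \<open>r = q\<close> by minimality. Reading
  \<open>r\<close> at \<open>- a\<close> with \<open>t = 1\<close> gives
  \<open>q (- a) <= - q a\<close>; an odd sublinear functional is linear.\<close>

lemma sublinear_minimal_linear:
 fixes q :: "'a::real_vector => real"
 assumes q: "sublinear q" and min: "!!q'. sublinear q' ==> (!!x. q' x <= q x) ==> q' = q"
 shows "linear q"
proof -
 have neg: "q (- a) = - q a" for a
 proof -
  define r where "r x = (INF t\<in>{0..}. q (x + t *\<^sub>R a) - t * q a)" for x
  have bdd: "bdd_below ((%t. q (x + t *\<^sub>R a) - t * q a) ` {0..})" for x
  proof (rule bdd_belowI2)
   fix t :: real assume "t \<in> {0..}"
   then have "q (t *\<^sub>R a) = t * q a"
    using q by (cases "t = 0") (auto simp: sublinear_scale sublinear_0)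
   moreover have "q (t *\<^sub>R a) <= q (x + t *\<^sub>R a) + q (- x)"
    using sublinear_add[OF q, of "x + t *\<^sub>R a" "- x"] by (simp add: algebra_simps)
   ultimately show "- q (- x) <= q (x + t *\<^sub>R a) - t * q a" by simp
  qed
  have le: "r x <= q (x + t *\<^sub>R a) - t * q a" if "t \<ge> 0" for t x
   unfolding r_def using that bdd by (intro cINF_lower) auto
  have ge: "b <= r x" if "!!t. t \<ge> 0 ==> b <= q (x + t *\<^sub>R a) - t * q a" for b x
   unfolding r_def using that by (intro cINF_greatest) auto
  have "sublinear r"
  proof (rule sublinearI)
   fix x y
   have "r (x + y) - (q (y + t *\<^sub>R a) - t * q a) <= q (x + s *\<^sub>R a) - s * q a"
    if "s \<ge> 0" "t \<ge> 0" for s t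
    using le[of "s + t" "x + y"] that
     sublinear_add[OF q, of "x + s *\<^sub>R a" "y + t *\<^sub>R a"]
    by (simp add: algebra_simps)
   then have "r (x + y) - (q (y + t *\<^sub>R a) - t * q a) <= r x" if "t \<ge> 0" for t
    using that by (intro ge) auto
   then have "r (x + y) - r x <= r y" by (intro ge) (simp add: algebra_simps)
   then show "r (x + y) <= r x + r y" by simp
  next
   fix c :: real and x assume c: "c > 0"
   have "r (c *\<^sub>R x) / c <= r x"
   proof (rule ge)
    fix t :: real assume "t \<ge> 0"
    have "r (c *\<^sub>R x) <= q (c *\<^sub>R x + (c * t) *\<^sub>R a) - c * t * q a"
     using le[of "c * t" "c *\<^sub>R x"] c \<open>t \<ge> 0\<close> by simp
    also have "q (c *\<^sub>R x + (c * t) *\<^sub>R a) = c * q (x + t *\<^sub>R a)"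
     using sublinear_scale[OF q c, of "x + t *\<^sub>R a"] by (simp add: algebra_simps)
    finally show "r (c *\<^sub>R x) / c <= q (x + t *\<^sub>R a) - t * q a"
     using c by (simp add: field_simps)
   qed
   then show "r (c *\<^sub>R x) <= c * r x" using c by (simp add: field_simps)
  qed
  moreover have "r x <= q x" for x using le[of 0 x] by simp
  ultimately have "r = q" by (rule min)
  then have "q (- a) <= - q a" using le[of 1 "- a"] sublinear_0[OF q] by simp
  then show ?thesis using sublinear_minus[OF q, of a] by simp
 qed
 show ?thesis
 proof (rule linearI)
  fix x y
  show "q (x + y) = q x + q y"
   using sublinear_add[OF q, of x y] sublinear_add[OF q, of "-x" "-y"] neg[of x] neg[of y] neg[of "x + y"]
   by simp
 next
  fix c :: real and x
  consider "c > 0" | "c = 0" | "c < 0" by linarith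
  then show "q (c *\<^sub>R x) = c *\<^sub>R q x"
  proof cases
   case 3
   have "q (c *\<^sub>R x) = - q ((- c) *\<^sub>R x)" using neg[of "c *\<^sub>R x"] by simp
   then show ?thesis using 3 sublinear_scale[OF q, of "- c" x] by simp
  qed (auto simp: sublinear_scale q sublinear_0)
 qed
qed

text \<open>The functional to be extended is given by its graph.\<close>

lemma hahn_banach_graph:
 fixes G :: "('a::real_normed_vector \<times> real) set"
 assumes G0: "G ~= {}"
  and add: "!!x r y s. (x, r) \<in> G ==> (y, s) \<in> G ==> (x + y, r + s) \<in> G"
  and scale: "!!c x r. (x, r) \<in> G ==> (c *\<^sub>R x, c * r) \<in> G"
  and bd: "!!x r. (x, r) \<in> G ==> \<bar>r\<bar> <= K * norm x"
  and K: "K \<ge> 0"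
 obtains f :: "'a \<Rightarrow>\<^sub>L real" where "!!x r. (x, r) \<in> G ==> blinfun_apply f x = r" "norm f <= K"
proof -
 have zero: "(0, 0) \<in> G" using G0 scale[of _ _ 0] by force
 \<comment> \<open>The infimal convolution of \<open>K * norm\<close> with the functional of the
   graph. A linear functional below \<open>p\<close> is below \<open>K * norm\<close>, by the point
   \<open>(0, 0)\<close> of \<open>G\<close>, and below the prescribed values, by
   \<open>y = x\<close>; applied to \<open>- x\<close> the latter becomes equality.\<close>
 define p where "p x = (INF g\<in>G. K * norm (x - fst g) + snd g)" for x
 have bdd: "bdd_below ((%g. K * norm (x - fst g) + snd g) ` G)" for x
 proof (rule bdd_belowI2)
  fix g assume "g \<in> G"
  then have "\<bar>snd g\<bar> <= K * norm (fst g)" by (cases g) (auto dest: bd)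
  moreover have "K * norm (fst g) <= K * (norm (x - fst g) + norm x)"
   using K norm_triangle_ineq4[of x "x - fst g"] by (intro mult_left_mono) auto
  ultimately show "- (K * norm x) <= K * norm (x - fst g) + snd g" by (simp add: algebra_simps)
 qed
 have le: "p x <= K * norm (x - y) + r" if "(y, r) \<in> G" for x y r
  unfolding p_def using bdd that by (metis (no_types, lifting) cINF_lower fst_conv snd_conv)
 have ge: "b <= p x" if "!!y r. (y, r) \<in> G ==> b <= K * norm (x - y) + r" for b x
  unfolding p_def using that G0 by (intro cINF_greatest) auto
 have "sublinear p"
 proof (rule sublinearI)
  fix x y
  have "p (x + y) - (K * norm (y - v) + s) <= K * norm (x - u) + r"
   if "(u, r) \<in> G" "(v, s) \<in> G" for u r v s
  proof -
   have "p (x + y) <= K * norm (x + y - (u + v)) + (r + s)" using le add that by blast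
   also have "K * norm (x + y - (u + v)) <= K * (norm (x - u) + norm (y - v))"
    using K by (intro mult_left_mono) (simp_all add: norm_diff_triangle_ineq)
   finally show ?thesis by (simp add: algebra_simps)
  qed
  then have "p (x + y) - (K * norm (y - v) + s) <= p x" if "(v, s) \<in> G" for v s
   using that by (intro ge) auto
  then have "p (x + y) - p x <= p y" by (intro ge) (simp add: algebra_simps)
  then show "p (x + y) <= p x + p y" by simp
 next
  fix c :: real and x assume c: "c > 0"
  have "p (c *\<^sub>R x) / c <= p x"
  proof (rule ge)
   fix y r assume "(y, r) \<in> G"
   then have "p (c *\<^sub>R x) <= K * norm (c *\<^sub>R x - c *\<^sub>R y) + c * r" using le scale by blast
   also have "norm (c *\<^sub>R x - c *\<^sub>R y) = c * norm (x - y)"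
    using c by (simp flip: scaleR_diff_right)
   finally show "p (c *\<^sub>R x) / c <= K * norm (x - y) + r" using c by (simp add: field_simps)
  qed
  then show "p (c *\<^sub>R x) <= c * p x" using c by (simp add: field_simps)
 qed
 then obtain q where q: "sublinear q" "!!x. q x <= p x"
   "\<forall>q'. sublinear q' --> (\<forall>x. q' x <= q x) --> q' = q"
  by (rule sublinear_minimal_exists) (rule that)
 have lin: "linear q" using q by (intro sublinear_minimal_linear) auto
 have up: "q x <= K * norm x" for x using le[OF zero, of x] q(2)[of x] by simp
 have bound: "norm (q x) <= K * norm x" for x
  using up[of x] up[of "- x"] linear_neg[OF lin, of x] by simp
 have bl: "bounded_linear q"
  by (rule bounded_linear_intro[of q K])
    (use bound lin in \<open>auto simp: linear_add linear_scale mult.commute\<close>)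
 have Glow: "q x <= r" if "(x, r) \<in> G" for x r using le[OF that, of x] q(2)[of x] by simp
 show ?thesis
 proof (rule that[of "Blinfun q"])
  fix x r assume g: "(x, r) \<in> G"
  have "q (- x) <= - r" using scale[OF g, of "-1"] by (intro Glow) simp
  then show "blinfun_apply (Blinfun q) x = r"
   using Glow[OF g] linear_neg[OF lin, of x] by (simp add: bounded_linear_Blinfun_apply bl)
 next
  show "norm (Blinfun q) <= K"
   using bound K by (intro norm_blinfun_bound) (auto simp: bounded_linear_Blinfun_apply bl)
 qed
qed

lemma norming_functional:
 fixes x :: "'a::real_normed_vector"
 obtains f :: "'a \<Rightarrow>\<^sub>L real" where "blinfun_apply f x = norm x" "norm f <= 1"
proof -
 define G where "G = range (%c. (c *\<^sub>R x, c * norm x))"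
 have G: "(y, r) \<in> G \<longleftrightarrow> (\<exists>c. y = c *\<^sub>R x \<and> r = c * norm x)" for y r
  by (auto simp: G_def)
 obtain f :: "'a \<Rightarrow>\<^sub>L real" where
  f: "!!y r. (y, r) \<in> G ==> blinfun_apply f y = r" "norm f <= 1"
 proof (rule hahn_banach_graph[of G 1])
  show "\<bar>r\<bar> <= 1 * norm y" if "(y, r) \<in> G" for y r
   using that by (auto simp: G abs_mult)
  show "(y + z, r + s) \<in> G" if "(y, r) \<in> G" "(z, s) \<in> G" for y r z s
   using that unfolding G by (metis distrib_right scaleR_left_distrib)
  show "(c *\<^sub>R y, c * r) \<in> G" if "(y, r) \<in> G" for c y r
   using that unfolding G by (metis mult.assoc scaleR_scaleR)
 qed (auto simp: G_def)
 then show ?thesis using that[of f] by (metis G mult_1 scaleR_one)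
qed

section \<open>Averages over signs\<close>

definition signs :: "'i set => ('i => real) set" where
 "signs I = I \<rightarrow>\<^sub>E {-1, 1}"

definition sign_avg :: "'i set => (('i => real) => real) => real" where
 "sign_avg I f = (\<Sum>\<xi>\<in>signs I. f \<xi>) / 2 ^ card I"

lemma finite_signs [simp]: "finite I ==> finite (signs I)"
 by (simp add: signs_def finite_PiE)

lemma card_signs: "finite I ==> card (signs I) = 2 ^ card I"
 by (simp add: signs_def card_PiE numeral_2_eq_2)

lemma signs_empty [simp]: "signs {} = {%_. undefined}"
 by (simp add: signs_def)

lemma signs_cases: "\<xi> \<in> signs I ==> i \<in> I ==> \<xi> i = 1 \<or> \<xi> i = -1"
 by (auto simp: signs_def)

lemma sign_avg_empty [simp]: "sign_avg {} f = f (%_. undefined)"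
 by (simp add: sign_avg_def)

lemma sign_avg_cong: "(!!\<xi>. \<xi> \<in> signs I ==> f \<xi> = g \<xi>) ==> sign_avg I f = sign_avg I g"
 by (simp add: sign_avg_def)

lemma sign_avg_const [simp]: "finite I ==> sign_avg I (%_. c) = c"
 by (simp add: sign_avg_def card_signs)

lemma sign_avg_mono:
 "finite I ==> (!!\<xi>. \<xi> \<in> signs I ==> f \<xi> <= g \<xi>) ==> sign_avg I f <= sign_avg I g"
 by (simp add: sign_avg_def divide_right_mono sum_mono)

lemma sign_avg_add: "sign_avg I (%\<xi>. f \<xi> + g \<xi>) = sign_avg I f + sign_avg I g"
 by (simp add: sign_avg_def sum.distrib add_divide_distrib)

lemma sign_avg_cmult: "sign_avg I (%\<xi>. c * f \<xi>) = c * sign_avg I f"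
 by (simp add: sign_avg_def sum_distrib_left)

lemma sign_avg_half: "sign_avg I (%\<xi>. f \<xi> / c) = sign_avg I f / c"
 using sign_avg_cmult[of I "inverse c" f] by (simp add: field_simps)

lemma sign_avg_sum: "sign_avg I (%\<xi>. \<Sum>k\<in>A. f k \<xi>) = (\<Sum>k\<in>A. sign_avg I (f k))"
 unfolding sign_avg_def by (subst sum.swap) (simp add: sum_divide_distrib)

lemma sign_avg_swap:
 "sign_avg I (%\<xi>. sign_avg J (%\<delta>. f \<xi> \<delta>)) = sign_avg J (%\<delta>. sign_avg I (%\<xi>. f \<xi> \<delta>))"
 unfolding sign_avg_def sum_divide_distrib[symmetric]
 by (subst sum.swap) (simp add: mult.commute)

lemma sign_avg_nonneg: "(!!\<xi>. \<xi> \<in> signs I ==> 0 <= f \<xi>) ==> 0 <= sign_avg I f"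
 by (simp add: sign_avg_def sum_nonneg)

lemma sign_avg_exists_ge:
 assumes "finite I" obtains \<xi> where "\<xi> \<in> signs I" "sign_avg I f <= f \<xi>"
proof (rule ccontr)
 note * = that
 assume "\<not> thesis"
 then have "f \<xi> < sign_avg I f" if "\<xi> \<in> signs I" for \<xi>
  using *[OF that] \<open>\<not> thesis\<close> by (meson not_less)
 moreover have "signs I ~= {}" by (simp add: signs_def PiE_eq_empty_iff)
 ultimately have "sum f (signs I) < (\<Sum>\<xi>\<in>signs I. sign_avg I f)"
  using assms by (intro sum_strict_mono) auto
 then show False using assms by (simp add: card_signs sign_avg_def field_simps)
qed

lemma sign_avg_exists_le:
 assumes "finite I" obtains \<xi> where "\<xi> \<in> signs I" "f \<xi> <= sign_avg I f"
proof -
 obtain \<xi> where "\<xi> \<in> signs I" "sign_avg I (%\<xi>. (-1) * f \<xi>) <= (-1) * f \<xi>"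
  using sign_avg_exists_ge[OF assms, of "%\<xi>. (-1) * f \<xi>"] by blast
 then show thesis using that[of \<xi>] by (simp only: sign_avg_cmult)
qed

lemma sign_avg_insert:
 assumes "finite I" "i \<notin> I"
 shows "sign_avg (insert i I) f = (sign_avg I (%\<xi>. f (\<xi>(i := 1))) + sign_avg I (%\<xi>. f (\<xi>(i := -1)))) / 2"
proof -
 have inj: "inj_on (%(y, g). g(i := y)) ({-1, 1} \<times> signs I)"
  unfolding inj_on_def
 proof clarify
  fix y y' :: real and g g' assume *: "g \<in> signs I" "g' \<in> signs I" "g(i := y) = g'(i := y')"
  have "y = y'" using *(3) by (metis fun_upd_same)
  moreover have "g j = g' j" for j
  proof (cases "j = i")
   case True then show ?thesis using * assms by (auto simp: signs_def PiE_def extensional_def)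
  next
   case False then show ?thesis using *(3) by (metis fun_upd_other)
  qed
  ultimately show "y = y' \<and> g = g'" by auto
 qed
 have "sum f (signs (insert i I)) = (\<Sum>(y, g)\<in>{-1, 1} \<times> signs I. f (g(i := y)))"
  unfolding signs_def PiE_insert_eq
  using sum.reindex[OF inj, of f] by (simp add: signs_def case_prod_beta comp_def)
 also have "... = (\<Sum>y\<in>{-1, 1}. \<Sum>g\<in>signs I. f (g(i := y)))"
  by (simp add: sum.cartesian_product)
 also have "... = (\<Sum>g\<in>signs I. f (g(i := -1))) + (\<Sum>g\<in>signs I. f (g(i := 1)))" by simp
 finally show ?thesis using assms by (simp add: sign_avg_def field_simps)
qed

text \<open>\<open>F\<close> is left free because adding one index replaces it by its translates by
  \<open>x i\<close> and \<open>- x i\<close>; inductions on the index set therefore run over all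
  \<open>F\<close>.\<close>

definition lin_avg :: "'i set => ('i => 'a::real_vector) => ('a => real) => real" where
 "lin_avg I x F = sign_avg I (%\<xi>. F (\<Sum>i\<in>I. \<xi> i *\<^sub>R x i))"

lemma lin_avg_empty [simp]: "lin_avg {} x F = F 0"
 by (simp add: lin_avg_def)

lemma lin_avg_insert:
 assumes "finite I" "i \<notin> I"
 shows "lin_avg (insert i I) x F = (lin_avg I x (%v. F (v + x i)) + lin_avg I x (%v. F (v - x i))) / 2"
proof -
 have *: "(\<Sum>j\<in>I. (\<xi>(i := c)) j *\<^sub>R x j) = (\<Sum>j\<in>I. \<xi> j *\<^sub>R x j)" for \<xi> c
  using assms by (intro sum.cong) auto
 show ?thesis
  unfolding lin_avg_def sign_avg_insert[OF assms]
  using assms by (simp add: * del: fun_upd_apply) (simp add: add.commute)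
qed

lemma lin_avg_mono: "finite I ==> (!!v. F v <= G v) ==> lin_avg I x F <= lin_avg I x G"
 by (simp add: lin_avg_def sign_avg_mono)

lemma lin_avg_add: "lin_avg I x (%v. F v + G v) = lin_avg I x F + lin_avg I x G"
 by (simp add: lin_avg_def sign_avg_add)

lemma lin_avg_cmult: "lin_avg I x (%v. c * F v) = c * lin_avg I x F"
 by (simp add: lin_avg_def sign_avg_cmult)

lemma lin_avg_const [simp]: "finite I ==> lin_avg I x (%_. c) = c"
 by (simp add: lin_avg_def)

lemma lin_avg_cong: "(!!i. i \<in> I ==> x i = y i) ==> lin_avg I x F = lin_avg I y F"
 by (simp add: lin_avg_def)

lemma lin_avg_reindex:
 assumes "finite J" "inj_on h J"
 shows "lin_avg (h ` J) x F = lin_avg J (%j. x (h j)) F"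
 using assms
proof (induction J arbitrary: F rule: finite_induct)
 case (insert j J)
 then have "h j \<notin> h ` J" by (auto simp: inj_on_def)
 with insert show ?case by (simp add: lin_avg_insert)
qed simp

lemma lin_avg_flip:
 assumes "finite I" "!!i. i \<in> I ==> \<delta> i = 1 \<or> \<delta> i = (-1::real)"
 shows "lin_avg I (%i. \<delta> i *\<^sub>R x i) F = lin_avg I x F"
 using assms
proof (induction I arbitrary: F rule: finite_induct)
 case (insert i I)
 have "lin_avg (insert i I) (%i. \<delta> i *\<^sub>R x i) F =
   (lin_avg I x (%v. F (v + \<delta> i *\<^sub>R x i)) + lin_avg I x (%v. F (v - \<delta> i *\<^sub>R x i))) / 2"
  using insert by (simp add: lin_avg_insert)
 also have "... = lin_avg (insert i I) x F"
  using insert.prems[of i] insert.hyps by (auto simp: lin_avg_insert)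
 finally show ?case .
qed simp

text \<open>One extra sign per group does not change the average, by \<open>lin_avg_flip\<close>.
  After exchanging the two averages the extra signs are the random signs of the group sums.\<close>

lemma lin_avg_group:
 assumes "finite I" "finite J" "g ` I \<subseteq> J"
 shows "lin_avg I x F =
  sign_avg I (%\<xi>. lin_avg J (%j. \<Sum>i\<in>{i\<in>I. g i = j}. \<xi> i *\<^sub>R x i) F)"
proof -
 have "lin_avg I x F = sign_avg J (%\<delta>. lin_avg I (%i. \<delta> (g i) *\<^sub>R x i) F)"
 proof -
  have "lin_avg I (%i. \<delta> (g i) *\<^sub>R x i) F = lin_avg I x F" if "\<delta> \<in> signs J" for \<delta>
  proof (rule lin_avg_flip[OF assms(1)])
   fix i assume "i \<in> I"
   then show "\<delta> (g i) = 1 \<or> \<delta> (g i) = - 1"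
    using assms(3) that by (intro signs_cases[of \<delta> J]) auto
  qed
  then have "sign_avg J (%\<delta>. lin_avg I (%i. \<delta> (g i) *\<^sub>R x i) F) = sign_avg J (%\<delta>. lin_avg I x F)"
   by (intro sign_avg_cong) auto
  then show ?thesis using assms by simp
 qed
 also have "... = sign_avg I (%\<xi>. lin_avg J (%j. \<Sum>i\<in>{i\<in>I. g i = j}. \<xi> i *\<^sub>R x i) F)"
 proof -
  have "(\<Sum>i\<in>I. \<xi> i *\<^sub>R \<delta> (g i) *\<^sub>R x i) = (\<Sum>j\<in>J. \<delta> j *\<^sub>R (\<Sum>i\<in>{i\<in>I. g i = j}. \<xi> i *\<^sub>R x i))"
   for \<xi> \<delta>
  proof -
   have "(\<Sum>i\<in>I. \<xi> i *\<^sub>R \<delta> (g i) *\<^sub>R x i) =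
     (\<Sum>j\<in>J. \<Sum>i\<in>{i\<in>I. g i = j}. \<xi> i *\<^sub>R \<delta> (g i) *\<^sub>R x i)"
    using assms by (intro sum.group[symmetric]) auto
   also have "... = (\<Sum>j\<in>J. \<delta> j *\<^sub>R (\<Sum>i\<in>{i\<in>I. g i = j}. \<xi> i *\<^sub>R x i))"
    by (intro sum.cong refl) (auto simp: scaleR_sum_right mult.commute intro!: sum.cong)
   finally show ?thesis .
  qed
  then show ?thesis unfolding lin_avg_def by (subst sign_avg_swap) simp
 qed
 finally show ?thesis .
qed

text \<open>The two signs of a pair are replaced by a common sign and a relative sign
  \<open>\<theta> q\<close>. The relative signs form the outer average, so they can be fixed
  first.\<close>

lemma lin_avg_pairs:
 assumes "finite Q" "inj_on a Q" "inj_on b Q" "a ` Q \<inter> b ` Q = {}"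
 shows "lin_avg (a ` Q \<union> b ` Q) x F = sign_avg Q (%\<theta>. lin_avg Q (%q. x (a q) + \<theta> q *\<^sub>R x (b q)) F)"
 using assms
proof (induction Q arbitrary: F rule: finite_induct)
 case (insert q Q)
 let ?I = "a ` Q \<union> b ` Q"
 have fresh: "a q \<notin> insert (b q) ?I" "b q \<notin> ?I"
  using insert.prems insert.hyps by (auto simp: inj_on_def)
 have IH: "lin_avg ?I x F = sign_avg Q (%\<theta>. lin_avg Q (%q. x (a q) + \<theta> q *\<^sub>R x (b q)) F)" for F
  using insert.prems by (intro insert.IH) (auto simp: inj_on_def)
 have eq: "a ` insert q Q \<union> b ` insert q Q = insert (a q) (insert (b q) ?I)" by auto
 have upd: "lin_avg Q (%r. x (a r) + (\<theta>(q := c)) r *\<^sub>R x (b r)) G =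
   lin_avg Q (%r. x (a r) + \<theta> r *\<^sub>R x (b r)) G" for \<theta> c G
  using insert.hyps by (intro lin_avg_cong) auto
 show ?case
  unfolding eq using insert.hyps fresh
  by (simp add: lin_avg_insert sign_avg_insert upd IH del: fun_upd_apply)
    (simp add: sign_avg_add sign_avg_half algebra_simps add_divide_distrib)
qed simp

section \<open>Rademacher averages of vectors\<close>

definition rad :: "'i set => ('i => 'a::real_normed_vector) => real" where
 "rad I x = lin_avg I x norm"

lemma rademacher_mean_eq_rad: "rademacher_mean n x = rad {..<n} x"
 by (simp add: rademacher_mean_def rad_def lin_avg_def sign_avg_def signs_def)

lemma rad_nonneg: "0 <= rad I x"
 by (simp add: rad_def lin_avg_def sign_avg_nonneg)

lemma rad_empty [simp]: "rad {} x = 0"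
 by (simp add: rad_def)

lemma rad_cong: "(!!i. i \<in> I ==> x i = y i) ==> rad I x = rad I y"
 unfolding rad_def by (rule lin_avg_cong)

lemma rad_insert_ge:
 assumes "finite I" "i \<notin> I" shows "rad I x <= rad (insert i I) x"
proof -
 have "2 * norm v <= norm (v + x i) + norm (v - x i)" for v
  using norm_triangle_ineq[of "v + x i" "v - x i"] by (simp flip: scaleR_2)
 then have "lin_avg I x (%v. 2 * norm v) <= lin_avg I x (%v. norm (v + x i) + norm (v - x i))"
  using assms by (intro lin_avg_mono) auto
 then show ?thesis using assms by (simp add: rad_def lin_avg_insert lin_avg_cmult lin_avg_add)
qed

lemma rad_mono:
 assumes "finite I" "J \<subseteq> I" shows "rad J x <= rad I x"
proof -
 have fJ: "finite J" using assms finite_subset by blast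
 have "rad J x <= rad (J \<union> W) x" if "finite W" "W \<inter> J = {}" for W
  using that
 proof (induction W rule: finite_induct)
  case (insert i W)
  then have "rad (J \<union> W) x <= rad (insert i (J \<union> W)) x" using fJ by (intro rad_insert_ge) auto
  then show ?case using insert by simp
 qed simp
 from this[of "I - J"] show ?thesis using assms by (simp add: Un_absorb1 Int_commute)
qed

lemma norm_le_rad: "finite I ==> i \<in> I ==> norm (x i) <= rad I x"
 using rad_mono[of I "{i}" x] by (simp add: rad_def lin_avg_insert)

lemma rad_union_le:
 assumes "finite I" "finite W" "I \<inter> W = {}"
 shows "rad (I \<union> W) x <= rad I x + (\<Sum>i\<in>W. norm (x i))"
 using assms(2,3)
proof (induction W rule: finite_induct)
 case (insert i W)
 have "norm (v + x i) + norm (v - x i) <= 2 * norm v + 2 * norm (x i)" for v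
  using norm_triangle_ineq[of v "x i"] norm_triangle_ineq4[of v "x i"] by simp
 then have "lin_avg (I \<union> W) x (%v. norm (v + x i) + norm (v - x i)) <= lin_avg (I \<union> W) x (%v. 2 * norm v + 2 * norm (x i))"
  using assms insert by (intro lin_avg_mono) auto
 then have "rad (insert i (I \<union> W)) x <= rad (I \<union> W) x + norm (x i)"
  using assms insert by (simp add: rad_def lin_avg_insert lin_avg_cmult lin_avg_add)
 then show ?case using insert by simp
qed simp

lemma rad_le_sum: "finite W ==> rad W x <= (\<Sum>i\<in>W. norm (x i))"
 using rad_union_le[of "{}" W x] by simp

lemma rad_reindex: "finite J ==> inj_on h J ==> rad (h ` J) x = rad J (%j. x (h j))"
 by (simp add: rad_def lin_avg_reindex)

lemma rad_triangle: "finite I ==> rad I (%i. x i + y i) <= rad I x + rad I y"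
 unfolding rad_def lin_avg_def sign_avg_add[symmetric]
 by (intro sign_avg_mono) (auto simp: scaleR_add_right sum.distrib norm_triangle_ineq)

lemma rad_bounded_linear:
 assumes "finite I" "linear f" "!!v. norm (f v) <= K * norm v"
 shows "rad I (%i. f (x i)) <= K * rad I x"
proof -
 have "norm (\<Sum>i\<in>I. \<xi> i *\<^sub>R f (x i)) <= K * norm (\<Sum>i\<in>I. \<xi> i *\<^sub>R x i)" for \<xi>
  using assms(3)[of "\<Sum>i\<in>I. \<xi> i *\<^sub>R x i"] by (simp add: linear_sum[OF assms(2)] linear_scale[OF assms(2)])
 then show ?thesis
  unfolding rad_def lin_avg_def sign_avg_cmult[symmetric] using assms by (intro sign_avg_mono) auto
qed

section \<open>Moments of scalar sign sums and Khinchine's inequality\<close>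

lemma lin_avg_power2:
 fixes a :: "'i => real"
 assumes "finite I" shows "lin_avg I a (%s. s\<^sup>2) = (\<Sum>i\<in>I. (a i)\<^sup>2)"
 using assms
proof (induction I rule: finite_induct)
 case (insert i I)
 have "lin_avg (insert i I) a (%s. s\<^sup>2) = lin_avg I a (%s. (s + a i)\<^sup>2 + (s - a i)\<^sup>2) / 2"
  using insert by (simp add: lin_avg_insert lin_avg_add)
 also have "(%s. (s + a i)\<^sup>2 + (s - a i)\<^sup>2) = (%s. 2 * s\<^sup>2 + 2 * (a i)\<^sup>2)"
  by (auto simp: power2_eq_square algebra_simps)
 finally show ?case using insert by (simp add: lin_avg_add lin_avg_cmult)
qed simp

lemma lin_avg_power4:
 fixes a :: "'i => real"
 assumes "finite I" shows "lin_avg I a (%s. s ^ 4) <= 3 * (\<Sum>i\<in>I. (a i)\<^sup>2)\<^sup>2"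
 using assms
proof (induction I rule: finite_induct)
 case (insert i I)
 have a4: "0 <= (a i) ^ 4" by simp
 have "lin_avg (insert i I) a (%s. s ^ 4) = lin_avg I a (%s. (s + a i) ^ 4 + (s - a i) ^ 4) / 2"
  using insert by (simp add: lin_avg_insert lin_avg_add)
 also have "(%s. (s + a i) ^ 4 + (s - a i) ^ 4) = (%s. (2 * s ^ 4 + (12 * (a i)\<^sup>2) * s\<^sup>2) + 2 * (a i) ^ 4)"
  by (auto simp: power2_eq_square power4_eq_xxxx algebra_simps)
 also have "lin_avg I a ... / 2 = lin_avg I a (%s. s ^ 4) + 6 * (a i)\<^sup>2 * (\<Sum>i\<in>I. (a i)\<^sup>2) + (a i) ^ 4"
  using insert by (simp add: lin_avg_add lin_avg_cmult lin_avg_power2)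
 also have "... <= 3 * (\<Sum>i\<in>I. (a i)\<^sup>2)\<^sup>2 + 6 * (a i)\<^sup>2 * (\<Sum>i\<in>I. (a i)\<^sup>2) + 3 * (a i) ^ 4"
  using insert.IH a4 by linarith
 also have "... = 3 * (\<Sum>i\<in>insert i I. (a i)\<^sup>2)\<^sup>2"
  using insert by (simp add: power2_eq_square power4_eq_xxxx algebra_simps)
 finally show ?case .
qed simp

text \<open>The fourth moment method as a pointwise inequality: the absolute value of
  \<open>s\<close> is at least \<open>s^2 / \<sigma> - s^4 / (6 * \<sigma>^3)\<close>, and by the
  second and fourth moments the average of the right side is at least
  \<open>\<sigma> - \<sigma> / 2\<close>.\<close>

lemma khinchine_L1:
 fixes a :: "'i => real"
 assumes "finite I" shows "sqrt (\<Sum>i\<in>I. (a i)\<^sup>2) <= 2 * rad I a"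
proof (cases "(\<Sum>i\<in>I. (a i)\<^sup>2) = 0")
 case True
 then show ?thesis by (simp add: rad_nonneg)
next
 case False
 define \<sigma> where "\<sigma> = sqrt (\<Sum>i\<in>I. (a i)\<^sup>2)"
 have s2: "\<sigma>\<^sup>2 = (\<Sum>i\<in>I. (a i)\<^sup>2)" by (simp add: \<sigma>_def sum_nonneg)
 have s: "\<sigma> > 0" using False by (simp add: \<sigma>_def sum_nonneg order.not_eq_order_implies_strict)
 have key: "s\<^sup>2 / \<sigma> + (- 1 / (6 * \<sigma> ^ 3)) * s ^ 4 <= \<bar>s\<bar>" for s
 proof -
  define u where "u = \<bar>s\<bar> / \<sigma>"
  have u: "u \<ge> 0" "\<bar>s\<bar> = \<sigma> * u" using s by (simp_all add: u_def)
  have "0 <= u * (1 - u + u ^ 3 / 6)"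
  proof -
   \<comment> \<open>The cubic \<open>u ^ 3 - 6 * u + 6\<close> has its minimum over the nonnegative
     reals at \<open>sqrt 2\<close>, where it is \<open>6 - 4 * sqrt 2\<close>.\<close>
   have "0 <= (u - sqrt 2)\<^sup>2 * (u + 2 * sqrt 2)" using u by simp
   also have "... = u ^ 3 - 6 * u + 4 * sqrt 2"
    by (simp add: power2_eq_square power3_eq_cube algebra_simps)
   also have "4 * sqrt 2 <= (6 :: real)"
   proof -
    have "sqrt 2 <= (3/2 :: real)" by (rule real_le_lsqrt) (simp_all add: power2_eq_square)
    then show ?thesis by simp
   qed
   finally show ?thesis using u by (intro mult_nonneg_nonneg) auto
  qed
  then have "u\<^sup>2 - u ^ 4 / 6 <= u" by (simp add: power2_eq_square power3_eq_cube power4_eq_xxxx algebra_simps)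
  then have "\<sigma> * (u\<^sup>2 - u ^ 4 / 6) <= \<sigma> * u" using s by simp
  moreover have "s\<^sup>2 = \<sigma>\<^sup>2 * u\<^sup>2" "s ^ 4 = \<sigma> ^ 4 * u ^ 4"
   using u(2) power2_abs[of s] power_even_abs[of 4 s] by (simp_all add: power_mult_distrib)
  ultimately have "s\<^sup>2 / \<sigma> = \<sigma> * u\<^sup>2" "(- 1 / (6 * \<sigma> ^ 3)) * s ^ 4 = - (\<sigma> * u ^ 4 / 6)"
   using s by (simp_all add: power2_eq_square power3_eq_cube power4_eq_xxxx)
  with \<open>\<sigma> * (u\<^sup>2 - u ^ 4 / 6) <= \<sigma> * u\<close> u show ?thesis by (simp add: algebra_simps)
 qed
 have "\<sigma> / 2 = \<sigma>\<^sup>2 / \<sigma> + (- 1 / (6 * \<sigma> ^ 3)) * (3 * (\<sigma>\<^sup>2)\<^sup>2)"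
  using s by (simp add: field_simps power2_eq_square power3_eq_cube)
 also have "... <= lin_avg I a (%s. (1 / \<sigma>) * s\<^sup>2) + lin_avg I a (%s. (- 1 / (6 * \<sigma> ^ 3)) * s ^ 4)"
  unfolding lin_avg_cmult lin_avg_power2[OF assms] s2[symmetric]
  using lin_avg_power4[OF assms, of a, folded s2] s
  by (intro add_mono mult_left_mono_neg) auto
 also have "... <= rad I a"
  unfolding lin_avg_add[symmetric] rad_def using key assms by (intro lin_avg_mono) auto
 finally show ?thesis by (simp add: \<sigma>_def)
qed

text \<open>The variance of the absolute value of the signed sum is nonnegative.\<close>

lemma rad_real_le:
 fixes a :: "'i => real"
 assumes "finite I" shows "rad I a <= sqrt (\<Sum>i\<in>I. (a i)\<^sup>2)"
proof -
 define m where "m = rad I a"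
 have "0 <= lin_avg I a (%s. (s\<^sup>2 + (- 2 * m) * norm s) + m\<^sup>2)"
  unfolding lin_avg_def
 proof (intro sign_avg_nonneg)
  fix \<xi>
  have "(\<bar>t\<bar> - m)\<^sup>2 = t\<^sup>2 + (- 2 * m) * norm t + m\<^sup>2" for t
   by (simp add: power2_eq_square algebra_simps)
  then show "0 <= (\<Sum>i\<in>I. \<xi> i *\<^sub>R a i)\<^sup>2 + (- 2 * m) * norm (\<Sum>i\<in>I. \<xi> i *\<^sub>R a i) + m\<^sup>2"
   by (metis zero_le_power2)
 qed
 also have "... = lin_avg I a (%s. s\<^sup>2) + (- 2 * m) * rad I a + m\<^sup>2"
  unfolding lin_avg_add lin_avg_cmult rad_def using assms by (simp del: real_norm_def)
 also have "... = (\<Sum>i\<in>I. (a i)\<^sup>2) - m\<^sup>2"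
  unfolding lin_avg_power2[OF assms] m_def[symmetric] by (simp add: power2_eq_square)
 finally show ?thesis by (intro real_le_rsqrt) (simp add: m_def)
qed


section \<open>Type and cotype of subspaces\<close>

definition lp :: "'i set => real => ('i => 'a::real_normed_vector) => real" where
 "lp I p x = (\<Sum>i\<in>I. norm (x i) powr p) powr (1 / p)"

text \<open>Restricted to at most \<open>n\<close> vectors the best constant is finite and nearly
  attained. The bound can then be applied again, with the same constant, to any regrouping into at
  most \<open>n\<close> vectors.\<close>

definition type_bound :: "'a::real_normed_vector set => real => nat => real => bool" where
 "type_bound Y p n A \<longleftrightarrow> (\<forall>m\<le>n. \<forall>x. (\<forall>i<m. x i \<in> Y) --> rad {..<m} x <= A * lp {..<m} p x)"

definition cotype_bound :: "'a::real_normed_vector set => real => nat => real => bool" where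
 "cotype_bound Y p n A \<longleftrightarrow> (\<forall>m\<le>n. \<forall>x. (\<forall>i<m. x i \<in> Y) --> lp {..<m} p x <= A * rad {..<m} x)"

definition type_on :: "'a::real_normed_vector set => real => bool" where
 "type_on Y p \<longleftrightarrow> (\<exists>C. \<forall>n. type_bound Y p n C)"

definition cotype_on :: "'a::real_normed_vector set => real => bool" where
 "cotype_on Y p \<longleftrightarrow> (\<exists>C. \<forall>n. cotype_bound Y p n C)"

lemma has_type_iff: "has_type TYPE('a::real_normed_vector) p \<longleftrightarrow> 1 <= p \<and> p <= 2 \<and> type_on (UNIV :: 'a set) p"
 by (auto simp: has_type_def type_on_def type_bound_def rademacher_mean_eq_rad lp_def)

lemma has_cotype_iff: "has_cotype TYPE('a::real_normed_vector) p \<longleftrightarrow> 2 <= p \<and> cotype_on (UNIV :: 'a set) p"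
 by (auto simp: has_cotype_def cotype_on_def cotype_bound_def rademacher_mean_eq_rad lp_def)

lemma lp_nonneg [simp]: "0 <= lp I p x"
 by (simp add: lp_def)

lemma lp_reindex: "inj_on h J ==> lp (h ` J) p x = lp J p (%j. x (h j))"
 by (simp add: lp_def sum.reindex)

lemma lp_powr: "p > 0 ==> lp I p x powr p = (\<Sum>i\<in>I. norm (x i) powr p)"
 by (simp add: lp_def powr_powr sum_nonneg)

lemma norm_le_lp:
 assumes "finite I" "i \<in> I" "p > 0" shows "norm (x i) <= lp I p x"
proof -
 have "norm (x i) = (norm (x i) powr p) powr (1 / p)" using assms by (simp add: powr_powr)
 also have "... <= lp I p x"
  unfolding lp_def using assms by (intro powr_mono2 member_le_sum) auto
 finally show ?thesis .
qed

lemma lp_le: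
 assumes "finite I" "p \<ge> 1" "!!i. i \<in> I ==> norm (x i) <= b" "b \<ge> 0"
 shows "lp I p x <= real (card I) powr (1 / p) * b"
proof -
 have "(\<Sum>i\<in>I. norm (x i) powr p) <= (\<Sum>i\<in>I. b powr p)"
  using assms by (intro sum_mono powr_mono2) auto
 then have "lp I p x <= (real (card I) * b powr p) powr (1 / p)"
  unfolding lp_def using assms by (intro powr_mono2) (auto intro: sum_nonneg)
 also have "... = real (card I) powr (1 / p) * b"
  using assms by (simp add: powr_mult powr_powr)
 finally show ?thesis .
qed

lemma type_boundD:
 assumes "type_bound Y p n A" "finite I" "card I <= n" "!!i. i \<in> I ==> x i \<in> Y"
 shows "rad I x <= A * lp I p x"
proof -
 obtain h where h: "bij_betw h {..<card I} I"
  using ex_bij_betw_nat_finite[OF assms(2)] by (auto simp: atLeast0LessThan)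
 have "rad {..<card I} (%j. x (h j)) <= A * lp {..<card I} p (%j. x (h j))"
  using assms(1,3,4) bij_betwE[OF h] unfolding type_bound_def by simp
 then show ?thesis
  using rad_reindex[of "{..<card I}" h x] lp_reindex[of h "{..<card I}" p x] h by (simp add: bij_betw_def)
qed

lemma cotype_boundD:
 assumes "cotype_bound Y p n A" "finite I" "card I <= n" "!!i. i \<in> I ==> x i \<in> Y"
 shows "lp I p x <= A * rad I x"
proof -
 obtain h where h: "bij_betw h {..<card I} I"
  using ex_bij_betw_nat_finite[OF assms(2)] by (auto simp: atLeast0LessThan)
 have "lp {..<card I} p (%j. x (h j)) <= A * rad {..<card I} (%j. x (h j))"
  using assms(1,3,4) bij_betwE[OF h] unfolding cotype_bound_def by simp
 then show ?thesis
  using rad_reindex[of "{..<card I}" h x] lp_reindex[of h "{..<card I}" p x] h by (simp add: bij_betw_def)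
qed

text \<open>\<open>A\<close> is the supremum of the quotients: finite by the crude bound
  \<open>B\<close>, and at least \<open>C\<close> by the witness \<open>s0\<close>.\<close>

lemma near_extremal:
 fixes N D :: "'s => real"
 assumes "!!s. s \<in> S ==> 0 <= D s" "!!s. s \<in> S ==> N s <= B * D s"
  and s0: "s0 \<in> S" "C * D s0 < N s0" and C: "0 < C" and \<eta>: "0 < \<eta>"
 obtains A s where "C <= A" "s \<in> S" "!!s'. s' \<in> S ==> N s' <= A * D s'"
  "(1 - \<eta>) * A * D s <= N s" "0 < D s"
proof -
 define R where "R = (%s. N s / D s) ` {s\<in>S. 0 < D s}"
 define A where "A = Sup R"
 have D0: "D s0 > 0"
 proof (rule ccontr)
  assume "\<not> D s0 > 0"
  then have "D s0 = 0" using assms(1) s0 by force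
  then show False using assms(2)[of s0] s0 by simp
 qed
 have bdd: "bdd_above R"
  by (rule bdd_aboveI[of _ B]) (use assms(2) in \<open>auto simp: R_def field_simps\<close>)
 have ne: "R ~= {}" using D0 s0 by (auto simp: R_def)
 have up: "N s <= A * D s" if "s \<in> S" for s
 proof (cases "D s > 0")
  case True
  then have "N s / D s <= A" using that bdd by (auto simp: A_def R_def intro!: cSup_upper)
  then show ?thesis using True by (simp add: field_simps)
 next
  case False
  then have "D s = 0" using assms(1) that by force
  then show ?thesis using assms(2)[of s] that by simp
 qed
 have "C < A" using up[OF s0(1)] s0(2) D0 by (metis mult_less_cancel_right_pos order_less_le_trans)
 then have "(1 - \<eta>) * A < A" using C \<eta> by (simp add: algebra_simps)
 then obtain r where "r \<in> R" "(1 - \<eta>) * A < r"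
  using less_cSup_iff[OF ne bdd] by (auto simp: A_def)
 then obtain s where "s \<in> S" "D s > 0" "(1 - \<eta>) * A <= N s / D s" by (auto simp: R_def)
 then show thesis using up \<open>C < A\<close> by (intro that[of A s]) (auto simp: field_simps)
qed

lemma type_near_extremal:
 assumes "\<not> type_on Y p" "1 <= p" "0 < C" "0 < \<eta>"
 obtains n A x where "C <= A" "type_bound Y p n A" "!!i. i < n ==> x i \<in> Y"
  "(1 - \<eta>) * A * lp {..<n} p x <= rad {..<n} x" "0 < lp {..<n} p x"
proof -
 obtain n where "\<not> type_bound Y p n C" using assms(1) by (auto simp: type_on_def)
 then obtain m0 x0 where 0: "m0 <= n" "!!i. i < m0 ==> x0 i \<in> Y" "C * lp {..<m0} p x0 < rad {..<m0} x0"
  by (auto simp: type_bound_def not_le)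
 let ?S = "{(m, x). m <= n \<and> (\<forall>i<m. x i \<in> Y)}"
 have bd: "rad {..<m} x <= real n * lp {..<m} p x" if "m <= n" for m and x :: "nat => 'a"
 proof -
  have "rad {..<m} x <= (\<Sum>i<m. norm (x i))" by (simp add: rad_le_sum)
  also have "... <= (\<Sum>i<m. lp {..<m} p x)" using assms by (intro sum_mono norm_le_lp) auto
  also have "... <= real n * lp {..<m} p x" using that by (simp add: mult_right_mono)
  finally show ?thesis .
 qed
 show thesis
 proof (rule near_extremal[of ?S "%(m, x). lp {..<m} p x" "%(m, x). rad {..<m} x" "real n" "(m0, x0)" C \<eta>])
  fix A s assume *: "C <= A" "s \<in> ?S" "!!s'. s' \<in> ?S ==> (case s' of (m, x) => rad {..<m} x) <= A * (case s' of (m, x) => lp {..<m} p x)"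
   "(1 - \<eta>) * A * (case s of (m, x) => lp {..<m} p x) <= (case s of (m, x) => rad {..<m} x)"
   "0 < (case s of (m, x) => lp {..<m} p x)"
  obtain m x where s: "s = (m, x)" by (cases s)
  \<comment> \<open>The extremal family may have fewer vectors than the \<open>n\<close> of the
    failing bound; from here on its own length \<open>m\<close> takes the role of
    \<open>n\<close>.\<close>
  have "type_bound Y p m A"
   unfolding type_bound_def using *(2) s *(3)[of "(_, _)"] by auto
  then show thesis using * s by (intro that[of A m x]) auto
 qed (use 0 assms bd in \<open>auto\<close>)
qed

lemma cotype_near_extremal:
 assumes "\<not> cotype_on Y p" "1 <= p" "0 < C" "0 < \<eta>"
 obtains n A x where "C <= A" "cotype_bound Y p n A" "!!i. i < n ==> x i \<in> Y"
  "(1 - \<eta>) * A * rad {..<n} x <= lp {..<n} p x" "0 < rad {..<n} x"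
proof -
 obtain n where "\<not> cotype_bound Y p n C" using assms(1) by (auto simp: cotype_on_def)
 then obtain m0 x0 where 0: "m0 <= n" "!!i. i < m0 ==> x0 i \<in> Y" "C * rad {..<m0} x0 < lp {..<m0} p x0"
  by (auto simp: cotype_bound_def not_le)
 let ?S = "{(m, x). m <= n \<and> (\<forall>i<m. x i \<in> Y)}"
 have bd: "lp {..<m} p x <= (real n powr (1 / p)) * rad {..<m} x" if "m <= n" for m and x :: "nat => 'a"
 proof -
  have "lp {..<m} p x <= real (card {..<m}) powr (1 / p) * rad {..<m} x"
   using assms by (intro lp_le norm_le_rad) (auto simp: rad_nonneg)
  also have "... <= (real n powr (1 / p)) * rad {..<m} x"
   using that assms by (intro mult_right_mono powr_mono2) (auto simp: rad_nonneg)
  finally show ?thesis .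
 qed
 show thesis
 proof (rule near_extremal[of ?S "%(m, x). rad {..<m} x" "%(m, x). lp {..<m} p x" "real n powr (1/p)" "(m0, x0)" C \<eta>])
  fix A s assume *: "C <= A" "s \<in> ?S" "!!s'. s' \<in> ?S ==> (case s' of (m, x) => lp {..<m} p x) <= A * (case s' of (m, x) => rad {..<m} x)"
   "(1 - \<eta>) * A * (case s of (m, x) => rad {..<m} x) <= (case s of (m, x) => lp {..<m} p x)"
   "0 < (case s of (m, x) => rad {..<m} x)"
  obtain m x where s: "s = (m, x)" by (cases s)
  have "cotype_bound Y p m A"
   unfolding cotype_bound_def using *(2) s *(3)[of "(_, _)"] by auto
  then show thesis using * s by (intro that[of A m x]) auto
 qed (use 0 assms bd in \<open>auto simp: rad_nonneg\<close>)
qed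

lemma sum_powr_le_powr_sum:
 fixes a :: "'i => real"
 assumes "finite I" "s \<ge> 1" "!!i. i \<in> I ==> a i \<ge> 0"
 shows "(\<Sum>i\<in>I. a i powr s) <= (\<Sum>i\<in>I. a i) powr s"
proof (cases "(\<Sum>i\<in>I. a i) = 0")
 case True
 then have "a i = 0" if "i \<in> I" for i using assms that by (simp add: sum_nonneg_eq_0_iff)
 then show ?thesis by simp
next
 case False
 define t where "t = (\<Sum>i\<in>I. a i)"
 have t: "t > 0" using False assms by (simp add: t_def sum_nonneg order.not_eq_order_implies_strict)
 have "a i powr s <= t powr s * (a i / t)" if "i \<in> I" for i
 proof -
  have "a i <= t" unfolding t_def using assms that by (intro member_le_sum) auto
  then have "(a i / t) powr s <= (a i / t) powr 1"
   using assms that t by (intro powr_mono') auto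
  then show ?thesis using t assms that by (simp add: powr_divide field_simps)
 qed
 then have "(\<Sum>i\<in>I. a i powr s) <= (\<Sum>i\<in>I. t powr s * (a i / t))" by (intro sum_mono)
 also have "... = t powr s" using t by (simp add: t_def[symmetric] flip: sum_distrib_left sum_divide_distrib)
 finally show ?thesis by (simp add: t_def)
qed

lemma lp_mono:
 assumes "p > 0" "c \<ge> 0" "!!i. i \<in> I ==> norm (y i) <= c * norm (x i)"
 shows "lp I p y <= c * lp I p x"
proof -
 have "(\<Sum>i\<in>I. norm (y i) powr p) <= (\<Sum>i\<in>I. (c * norm (x i)) powr p)"
  using assms by (intro sum_mono powr_mono2) auto
 also have "... = c powr p * (\<Sum>i\<in>I. norm (x i) powr p)"
  using assms by (simp add: powr_mult sum_distrib_left)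
 finally have "lp I p y <= (c powr p * (\<Sum>i\<in>I. norm (x i) powr p)) powr (1 / p)"
  unfolding lp_def using assms by (intro powr_mono2) (auto intro: sum_nonneg)
 also have "... = c * lp I p x"
  using assms by (simp add: powr_mult powr_powr sum_nonneg lp_def)
 finally show ?thesis .
qed

lemma sqrt_sum_eq_lp: "sqrt (\<Sum>i\<in>I. (a i)\<^sup>2) = lp I 2 (a :: 'i => real)"
proof -
 have "(\<Sum>i\<in>I. norm (a i) powr 2) = (\<Sum>i\<in>I. (a i)\<^sup>2)"
  by (intro sum.cong) auto
 then show ?thesis by (simp add: lp_def powr_half_sqrt sum_nonneg del: real_norm_def)
qed

lemma lp_antimono:
 assumes "finite I" "0 < p" "p <= q"
 shows "lp I q x <= lp I p x"
proof -
 have "(\<Sum>i\<in>I. norm (x i) powr q) = (\<Sum>i\<in>I. (norm (x i) powr p) powr (q / p))"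
  using assms by (simp add: powr_powr)
 also have "... <= (\<Sum>i\<in>I. norm (x i) powr p) powr (q / p)"
  using assms by (intro sum_powr_le_powr_sum) auto
 finally have "lp I q x <= ((\<Sum>i\<in>I. norm (x i) powr p) powr (q / p)) powr (1 / q)"
  unfolding lp_def using assms by (intro powr_mono2) (auto intro: sum_nonneg)
 also have "... = lp I p x" using assms by (simp add: powr_powr lp_def)
 finally show ?thesis .
qed

lemma lp_add_le:
 assumes "finite I" "p \<ge> 1" "!!i. i \<in> I ==> norm (x i) <= norm (y i) + norm (w i)"
 shows "lp I p x <= 2 * (lp I p y + lp I p w)"
proof -
 have "norm (x i) powr p <= 2 powr p * (norm (y i) powr p + norm (w i) powr p)" if "i \<in> I" for i
 proof -
  have "norm (x i) <= 2 * max (norm (y i)) (norm (w i))" using assms(3)[OF that] by linarith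
  then have "norm (x i) powr p <= (2 * max (norm (y i)) (norm (w i))) powr p"
   using assms by (intro powr_mono2) auto
  also have "... = 2 powr p * max (norm (y i)) (norm (w i)) powr p" by (simp add: powr_mult)
  also have "... <= 2 powr p * (norm (y i) powr p + norm (w i) powr p)"
   by (intro mult_left_mono) (auto simp: max_def)
  finally show ?thesis .
 qed
 then have "(\<Sum>i\<in>I. norm (x i) powr p) <= (\<Sum>i\<in>I. 2 powr p * (norm (y i) powr p + norm (w i) powr p))"
  by (rule sum_mono)
 also have "... = 2 powr p * (lp I p y powr p + lp I p w powr p)"
  using assms by (simp add: lp_powr sum_distrib_left sum.distrib distrib_left)
 also have "... <= 2 powr p * (lp I p y + lp I p w) powr p"
  using sum_powr_le_powr_sum[of "{0, 1::nat}" p "%i. if i = 0 then lp I p y else lp I p w"] assms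
  by (intro mult_left_mono) auto
 also have "... = (2 * (lp I p y + lp I p w)) powr p" by (rule powr_mult[symmetric]) 
 finally have "lp I p x <= ((2 * (lp I p y + lp I p w)) powr p) powr (1 / p)"
  unfolding lp_def[of I p x] using assms by (intro powr_mono2) (auto intro: sum_nonneg)
 then show ?thesis using assms by (simp add: powr_powr)
qed

section \<open>Failing exponents on subspaces of finite codimension\<close>

lemma kernel_projection:
 fixes f :: "'a::real_normed_vector \<Rightarrow>\<^sub>L real"
 assumes Z: "subspace Z" and f: "\<not> (\<forall>x\<in>Z. blinfun_apply f x = 0)"
 obtains z where "z \<in> Z" "!!x. x \<in> Z ==> x - blinfun_apply f x *\<^sub>R z \<in> Z \<inter> {x. blinfun_apply f x = 0}"
  "!!x. norm (x - blinfun_apply f x *\<^sub>R z) <= (1 + norm f * norm z) * norm x"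
proof -
 obtain z0 where z0: "z0 \<in> Z" "blinfun_apply f z0 ~= 0" using f by blast
 define z where "z = inverse (blinfun_apply f z0) *\<^sub>R z0"
 have z: "z \<in> Z" "blinfun_apply f z = 1"
  using z0 Z by (auto simp: z_def subspace_scale blinfun.scaleR_right)
 show ?thesis
 proof (rule that[OF z(1)])
  fix x assume "x \<in> Z"
  then show "x - blinfun_apply f x *\<^sub>R z \<in> Z \<inter> {x. blinfun_apply f x = 0}"
   using z Z by (auto simp: subspace_diff subspace_scale blinfun.diff_right blinfun.scaleR_right)
 next
  fix x
  have "norm (x - blinfun_apply f x *\<^sub>R z) <= norm x + \<bar>blinfun_apply f x\<bar> * norm z"
   by (rule order_trans[OF norm_triangle_ineq4]) simp
  also have "... <= norm x + (norm f * norm x) * norm z"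
   using norm_blinfun[of f x] by (intro add_left_mono mult_right_mono) auto
  finally show "norm (x - blinfun_apply f x *\<^sub>R z) <= (1 + norm f * norm z) * norm x"
   by (simp add: algebra_simps)
 qed
qed

text \<open>The part in the kernel is covered by the hypothesis. The rank one part has scalar
  coefficients, which satisfy a type 2 bound by \<open>rad_real_le\<close>, and
  \<open>p <= 2\<close> allows passing from the 2-sum to the p-sum.\<close>

lemma type_on_kernel:
 fixes f :: "'a::real_normed_vector \<Rightarrow>\<^sub>L real"
 assumes Z: "subspace Z" and p: "1 <= p" "p <= 2"
  and ty: "type_on (Z \<inter> {x. blinfun_apply f x = 0}) p"
 shows "type_on Z p"
proof (cases "\<forall>x\<in>Z. blinfun_apply f x = 0")
 case True
 then have "Z \<inter> {x. blinfun_apply f x = 0} = Z" by auto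
 then show ?thesis using ty by simp
next
 case False
 obtain z where z: "z \<in> Z" "!!x. x \<in> Z ==> x - blinfun_apply f x *\<^sub>R z \<in> Z \<inter> {x. blinfun_apply f x = 0}"
  "!!x. norm (x - blinfun_apply f x *\<^sub>R z) <= (1 + norm f * norm z) * norm x"
  using kernel_projection[OF Z False] by blast
 obtain C where C: "!!n. type_bound (Z \<inter> {x. blinfun_apply f x = 0}) p n C"
  using ty by (auto simp: type_on_def)
 define D where "D = \<bar>C\<bar> * (1 + norm f * norm z) + norm z * norm f"
 have "rad {..<m} x <= D * lp {..<m} p x" if x: "\<forall>i<m. x i \<in> Z" for m and x :: "nat => 'a"
 proof -
  let ?y = "%i. x i - blinfun_apply f (x i) *\<^sub>R z"
  have 1: "rad {..<m} ?y <= \<bar>C\<bar> * ((1 + norm f * norm z) * lp {..<m} p x)"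
  proof -
   have "rad {..<m} ?y <= C * lp {..<m} p ?y" by (rule type_boundD[OF C[of m]]) (use z(2) x in auto)
   also have "... <= \<bar>C\<bar> * lp {..<m} p ?y" by (intro mult_right_mono) auto
   also have "... <= \<bar>C\<bar> * ((1 + norm f * norm z) * lp {..<m} p x)"
    using z(3) p by (intro mult_left_mono lp_mono) auto
   finally show ?thesis .
  qed
  have "rad {..<m} (%i. blinfun_apply f (x i)) <= lp {..<m} 2 (%i. blinfun_apply f (x i))"
   using rad_real_le[of "{..<m}"] by (simp add: sqrt_sum_eq_lp)
  also have "... <= lp {..<m} p (%i. blinfun_apply f (x i))"
   using p by (intro lp_antimono) auto
  also have "... <= norm f * lp {..<m} p x"
   using p norm_blinfun[of f] by (intro lp_mono) auto
  finally have 2: "norm z * rad {..<m} (%i. blinfun_apply f (x i)) <= norm z * (norm f * lp {..<m} p x)"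
   by (intro mult_left_mono) auto
  have 3: "rad {..<m} (%i. blinfun_apply f (x i) *\<^sub>R z) <= norm z * rad {..<m} (%i. blinfun_apply f (x i))"
   by (rule rad_bounded_linear[of _ "%c. c *\<^sub>R z"]) (auto intro: linearI simp: scaleR_left_distrib)
  have "rad {..<m} x = rad {..<m} (%i. ?y i + blinfun_apply f (x i) *\<^sub>R z)" by simp
  also have "... <= rad {..<m} ?y + rad {..<m} (%i. blinfun_apply f (x i) *\<^sub>R z)"
   by (rule rad_triangle) simp
  also have "... <= D * lp {..<m} p x" using 1 2 3 by (simp add: D_def algebra_simps)
  finally show ?thesis .
 qed
 then show ?thesis by (auto simp: type_on_def type_bound_def)
qed

text \<open>As for type, with Khinchine's inequality for the scalar coefficients of the rank one
  part and \<open>2 <= p\<close>.\<close>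

lemma cotype_on_kernel:
 fixes f :: "'a::real_normed_vector \<Rightarrow>\<^sub>L real"
 assumes Z: "subspace Z" and p: "2 <= p"
  and ty: "cotype_on (Z \<inter> {x. blinfun_apply f x = 0}) p"
 shows "cotype_on Z p"
proof (cases "\<forall>x\<in>Z. blinfun_apply f x = 0")
 case True
 then have "Z \<inter> {x. blinfun_apply f x = 0} = Z" by auto
 then show ?thesis using ty by simp
next
 case False
 obtain z where z: "z \<in> Z" "!!x. x \<in> Z ==> x - blinfun_apply f x *\<^sub>R z \<in> Z \<inter> {x. blinfun_apply f x = 0}"
  "!!x. norm (x - blinfun_apply f x *\<^sub>R z) <= (1 + norm f * norm z) * norm x"
  using kernel_projection[OF Z False] by blast
 obtain C where C: "!!n. cotype_bound (Z \<inter> {x. blinfun_apply f x = 0}) p n C"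
  using ty by (auto simp: cotype_on_def)
 define D where "D = 2 * (\<bar>C\<bar> * (1 + norm f * norm z) + norm z * (2 * norm f))"
 have "lp {..<m} p x <= D * rad {..<m} x" if x: "\<forall>i<m. x i \<in> Z" for m and x :: "nat => 'a"
 proof -
  let ?y = "%i. x i - blinfun_apply f (x i) *\<^sub>R z"
  let ?w = "%i. blinfun_apply f (x i) *\<^sub>R z"
  have 1: "lp {..<m} p ?y <= \<bar>C\<bar> * ((1 + norm f * norm z) * rad {..<m} x)"
  proof -
   have "lp {..<m} p ?y <= C * rad {..<m} ?y" by (rule cotype_boundD[OF C[of m]]) (use z(2) x in auto)
   also have "... <= \<bar>C\<bar> * rad {..<m} ?y" by (intro mult_right_mono) (auto simp: rad_nonneg)
   also have "... <= \<bar>C\<bar> * ((1 + norm f * norm z) * rad {..<m} x)"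
    using z(3)
    by (intro mult_left_mono rad_bounded_linear[of _ "%v. v - blinfun_apply f v *\<^sub>R z"])
      (auto intro!: linearI simp: blinfun.add_right blinfun.scaleR_right algebra_simps)
   finally show ?thesis .
  qed
  have "lp {..<m} p (%i. blinfun_apply f (x i)) <= lp {..<m} 2 (%i. blinfun_apply f (x i))"
   using p by (intro lp_antimono) auto
  also have "... <= 2 * rad {..<m} (%i. blinfun_apply f (x i))"
   using khinchine_L1[of "{..<m}"] by (simp add: sqrt_sum_eq_lp)
  also have "... <= 2 * (norm f * rad {..<m} x)"
   by (intro mult_left_mono rad_bounded_linear[of _ "blinfun_apply f"])
     (use norm_blinfun[of f] in \<open>auto intro!: linearI simp: blinfun.add_right blinfun.scaleR_right\<close>)
  finally have "norm z * lp {..<m} p (%i. blinfun_apply f (x i)) <= norm z * (2 * (norm f * rad {..<m} x))"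
   by (intro mult_left_mono) auto
  moreover have "lp {..<m} p ?w <= norm z * lp {..<m} p (%i. blinfun_apply f (x i))"
   using p by (intro lp_mono) auto
  ultimately have 2: "lp {..<m} p ?w <= norm z * (2 * (norm f * rad {..<m} x))" by linarith
  have "lp {..<m} p x <= 2 * (lp {..<m} p ?y + lp {..<m} p ?w)"
   proof (rule lp_add_le)
   show "norm (x i) <= norm (?y i) + norm (?w i)" for i
    using norm_triangle_ineq[of "?y i" "?w i"] by simp
  qed (use p in auto)
  also have "... <= D * rad {..<m} x" using 1 2 by (simp add: D_def algebra_simps)
  finally show ?thesis .
 qed
 then show ?thesis by (auto simp: cotype_on_def cotype_bound_def)
qed

definition common_kernel :: "('a::real_normed_vector \<Rightarrow>\<^sub>L real) set => 'a set" where
 "common_kernel \<Phi> = {x. \<forall>f\<in>\<Phi>. blinfun_apply f x = 0}"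

lemma subspace_common_kernel: "subspace (common_kernel \<Phi>)"
 by (auto simp: common_kernel_def subspace_def blinfun.add_right blinfun.scaleR_right blinfun.zero_right)

lemma common_kernel_insert: "common_kernel (insert f \<Phi>) = common_kernel \<Phi> \<inter> {x. blinfun_apply f x = 0}"
 by (auto simp: common_kernel_def)

text \<open>Used contrapositively: an exponent failing on the whole space fails on the common kernel
  of any finite set of functionals, so a new level can be built inside the kernel of everything
  chosen before.\<close>

lemma type_on_common_kernel:
 fixes \<Phi> :: "('a::real_normed_vector \<Rightarrow>\<^sub>L real) set"
 assumes "finite \<Phi>" "1 <= p" "p <= 2" "type_on (common_kernel \<Phi>) p"
 shows "type_on (UNIV :: 'a set) p"
 using assms
proof (induction \<Phi> rule: finite_induct)
 case empty then show ?case by (simp add: common_kernel_def)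
next
 case (insert f \<Phi>)
 then show ?case
  by (metis common_kernel_insert subspace_common_kernel type_on_kernel)
qed

lemma cotype_on_common_kernel:
 fixes \<Phi> :: "('a::real_normed_vector \<Rightarrow>\<^sub>L real) set"
 assumes "finite \<Phi>" "2 <= p" "cotype_on (common_kernel \<Phi>) p"
 shows "cotype_on (UNIV :: 'a set) p"
 using assms
proof (induction \<Phi> rule: finite_induct)
 case empty then show ?case by (simp add: common_kernel_def)
next
 case (insert f \<Phi>)
 then show ?case
  by (metis common_kernel_insert subspace_common_kernel cotype_on_kernel)
qed

section \<open>Homogeneous sets\<close>

text \<open>A finite and approximate form of a spreading model. The error is additive; it turns into
  a factor once the norms involved have a lower bound.\<close>

definition hom_set :: "(nat => 'a::real_normed_vector) => nat => real => nat set => bool" where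
 "hom_set u l \<delta> H \<longleftrightarrow> (\<forall>ks ks' a. strict_mono_on {..<l} ks \<and> strict_mono_on {..<l} ks' \<and>
   ks ` {..<l} \<subseteq> H \<and> ks' ` {..<l} \<subseteq> H \<and> (\<forall>i<l. \<bar>a i\<bar> <= 1) -->
   norm (\<Sum>i<l. a i *\<^sub>R u (ks i)) <= norm (\<Sum>i<l. a i *\<^sub>R u (ks' i)) + \<delta>)"

lemma strict_mono_on_enum:
 fixes ks :: "nat => nat"
 assumes "strict_mono_on {..<l} ks" "i < l"
 shows "sorted_list_of_set (ks ` {..<l}) ! i = ks i"
proof -
 have "sorted_wrt (<) (map ks [0..<l])"
  using assms by (auto simp: sorted_wrt_iff_nth_less strict_mono_on_def)
 then have "sorted_list_of_set (set (map ks [0..<l])) = map ks [0..<l]"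
  by (intro sorted_list_of_set.idem_if_sorted_distinct) (auto simp: strict_sorted_iff)
 then show ?thesis using assms by (simp add: atLeast0LessThan[symmetric])
qed

text \<open>Ramsey's theorem carried over to an arbitrary finite set of colours and an arbitrary
  finite index set. \<open>N\<close> is chosen before the index set and the colouring, which later
  makes the size of the unarranged remainder independent of the vectors.\<close>

lemma ramsey_finite_colours:
 fixes col :: "nat set => 'c"
 assumes "finite K"
 obtains N where "!!I (col :: nat set => 'c). finite I ==> N <= card I ==>
   (!!S. S \<subseteq> I ==> card S = l ==> finite S ==> col S \<in> K) ==>
   \<exists>H\<subseteq>I. card H = L \<and> (\<forall>S S'. S \<subseteq> H \<and> S' \<subseteq> H \<and> card S = l \<and> card S' = l \<and> finite S \<and> finite S' --> col S = col S')"
proof -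
 obtain e where e: "bij_betw e K {..<card K}"
  using ex_bij_betw_finite_nat[OF assms] by (auto simp: atLeast0LessThan)
 obtain N :: nat where N: "partn_lst {..<N} (replicate (card K) L) l"
  using ramsey_full by blast
 show ?thesis
 proof (rule that[of N])
  fix I and col :: "nat set => 'c"
  assume I: "finite I" "N <= card I" and col: "!!S. S \<subseteq> I ==> card S = l ==> finite S ==> col S \<in> K"
  obtain h where h: "bij_betw h {..<card I} I"
   using ex_bij_betw_nat_finite[OF I(1)] by (auto simp: atLeast0LessThan)
  have injh: "inj_on h {..<N}" using h I by (auto simp: bij_betw_def intro: inj_on_subset)
  have hI: "h ` {..<N} \<subseteq> I" using h I by (auto simp: bij_betw_def)
  define f where "f S = e (col (h ` S))" for S
  have "f \<in> nsets {..<N} l \<rightarrow> {..<length (replicate (card K) L)}"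
  proof
   fix S assume S: "S \<in> nsets {..<N} l"
   then have "card (h ` S) = l" using injh by (auto simp: nsets_def card_image inj_on_subset)
   then have "col (h ` S) \<in> K" using S hI by (intro col) (auto simp: nsets_def)
   then show "f S \<in> {..<length (replicate (card K) L)}" using e by (auto simp: f_def bij_betw_def)
  qed
  then obtain i where "i < card K" "monochromatic {..<N} (replicate (card K) L ! i) l f i"
   using N unfolding partn_lst_def by fastforce
  then obtain H where H: "H \<in> nsets {..<N} L" "f ` nsets H l \<subseteq> {i}"
   by (auto simp: monochromatic_def)
  have cardH: "card (h ` H) = L" using H injh by (auto simp: nsets_def card_image inj_on_subset)
  have eqi: "e (col S) = i" if S: "S \<subseteq> h ` H" "card S = l" "finite S" for S
  proof -
   define S' where "S' = {x\<in>H. h x \<in> S}"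
   have S': "h ` S' = S" "S' \<subseteq> H" using S by (auto simp: S'_def)
   have "S' \<subseteq> {..<N}" using S' H by (auto simp: nsets_def)
   then have "inj_on h S'" using injh inj_on_subset by blast
   then have "card S' = l" using S' S card_image by metis
   moreover have "finite S'" by (rule finite_subset[OF S'(2)]) (use H in \<open>auto simp: nsets_def\<close>)
   ultimately have "S' \<in> nsets H l" using S' by (simp add: nsets_def)
   then have "f S' = i" using H(2) by blast
   then show ?thesis by (simp add: f_def S')
  qed
  have "H \<subseteq> {..<N}" using H by (simp add: nsets_def)
  then have HI: "h ` H \<subseteq> I" using hI by blast
  have "col S = col S'" if "S \<subseteq> h ` H" "S' \<subseteq> h ` H" "card S = l" "card S' = l" "finite S" "finite S'" for S S'
  proof -
   have "e (col S) = e (col S')"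
    by (simp only: eqi[OF that(1,3,5)] eqi[OF that(2,4,6)])
   moreover have "col S \<in> K" "col S' \<in> K" using that HI by (auto intro!: col)
   ultimately show ?thesis using e by (auto simp: bij_betw_def inj_on_def)
  qed
  then show "\<exists>H\<subseteq>I. card H = L \<and> (\<forall>S S'. S \<subseteq> H \<and> S' \<subseteq> H \<and> card S = l \<and> card S' = l \<and> finite S \<and> finite S' --> col S = col S')"
   using HI cardH by (intro exI[of _ "h ` H"]) blast
 qed
qed

lemma norm_sum_scaled_le:
 fixes u :: "nat => 'a::real_normed_vector"
 assumes "finite I" "!!i. i \<in> I ==> norm (u i) <= 1" "!!i. i \<in> I ==> \<bar>a i\<bar> <= c"
 shows "norm (\<Sum>i\<in>I. a i *\<^sub>R u i) <= real (card I) * c"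
proof -
 have "norm (\<Sum>i\<in>I. a i *\<^sub>R u i) <= (\<Sum>i\<in>I. c)"
 proof (rule sum_norm_le)
  fix i assume "i \<in> I"
  then have "\<bar>a i\<bar> * norm (u i) <= c * 1" using assms by (intro mult_mono) force+
  then show "norm (a i *\<^sub>R u i) <= c" by simp
 qed
 then show ?thesis by simp
qed

lemma ramsey_hom_set:
 assumes \<delta>: "\<delta> > 0"
 obtains R where "!!(u :: nat => 'a::real_normed_vector) I. finite I ==> R <= card I ==>
   (!!i. i \<in> I ==> norm (u i) <= 1) ==> \<exists>H\<subseteq>I. card H = L \<and> hom_set u l \<delta> H"
proof -
 \<comment> \<open>The mesh \<open>1 / q\<close> of the coefficient grid: rounding the coefficients
   changes a norm by at most \<open>l / q <= \<delta> / 4\<close>. A colour records all norms at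
   grid points up to \<open>\<delta> / 4\<close>, so two roundings and one colour class stay below
   \<open>\<delta>\<close>.\<close>
 define q where "q = nat \<lceil>4 * real l / \<delta>\<rceil> + 1"
 have "4 * real l / \<delta> <= real q" unfolding q_def by linarith
 moreover have q0: "real q > 0" by (simp add: q_def)
 ultimately have q: "real l / real q <= \<delta> / 4" "q > 0" using \<delta> by (simp_all add: field_simps)
 define G where "G = {..<l} \<rightarrow>\<^sub>E (%j. real_of_int j / real q) ` {- int q..int q}"
 define B where "B = nat \<lfloor>4 * real l / \<delta>\<rfloor>"
 define K where "K = G \<rightarrow>\<^sub>E {..B}"
 define val where "val u S g = norm (\<Sum>i<l. g i *\<^sub>R u (sorted_list_of_set S ! i))"
  for u :: "nat => 'a" and S and g :: "nat => real"
 define col where "col u S = restrict (%g. nat \<lfloor>4 * val u S g / \<delta>\<rfloor>) G" for u :: "nat => 'a" and S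
 have "finite G" by (simp add: G_def finite_PiE)
 then have "finite K" by (simp add: K_def finite_PiE)
 then obtain N where N: "!!I (col :: nat set => (nat => real) => nat). finite I ==> N <= card I ==>
   (!!S. S \<subseteq> I ==> card S = l ==> finite S ==> col S \<in> K) ==>
   \<exists>H\<subseteq>I. card H = L \<and> (\<forall>S S'. S \<subseteq> H \<and> S' \<subseteq> H \<and> card S = l \<and> card S' = l \<and> finite S \<and> finite S' --> col S = col S')"
  using ramsey_finite_colours[of K l L] by blast
 have G1: "\<bar>g i\<bar> <= 1" if "g \<in> G" "i < l" for g i
 proof -
  have "g i \<in> (%j. real_of_int j / real q) ` {- int q..int q}"
   using that unfolding G_def by (intro PiE_mem[of g "{..<l}"]) auto
  then obtain j where "g i = real_of_int j / real q" "j \<in> {- int q..int q}" by blast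
  moreover from this have "\<bar>real_of_int j\<bar> <= real q" by (simp add: abs_le_iff)
  ultimately show ?thesis using q by simp
 qed
 show ?thesis
 proof (rule that[of N])
  fix u :: "nat => 'a" and I assume I: "finite I" "N <= card I" and u: "!!i. i \<in> I ==> norm (u i) <= 1"
  have "col u S \<in> K" if S: "S \<subseteq> I" "card S = l" "finite S" for S
  proof -
   have "nat \<lfloor>4 * val u S g / \<delta>\<rfloor> <= B" if g: "g \<in> G" for g
   proof -
    have "sorted_list_of_set S ! i \<in> I" if "i < l" for i
    proof -
     have "sorted_list_of_set S ! i \<in> set (sorted_list_of_set S)"
      using S that by (intro nth_mem) simp
     then show ?thesis using S by auto
    qed
    then have "val u S g <= real (card {..<l}) * 1"
     unfolding val_def using u G1[OF g] by (intro norm_sum_scaled_le) auto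
    then have "4 * val u S g / \<delta> <= 4 * real l / \<delta>" using \<delta> by (simp add: divide_right_mono)
    then show ?thesis unfolding B_def by (intro nat_mono floor_mono)
   qed
   then show ?thesis by (auto simp: col_def K_def)
  qed
  then obtain H where H: "H \<subseteq> I" "card H = L"
   "!!S S'. S \<subseteq> H ==> S' \<subseteq> H ==> card S = l ==> card S' = l ==> finite S ==> finite S' ==> col u S = col u S'"
   using N[OF I, of "col u"] by blast
  have "norm (\<Sum>i<l. a i *\<^sub>R u (ks i)) <= norm (\<Sum>i<l. a i *\<^sub>R u (ks' i)) + \<delta>"
   if ks: "strict_mono_on {..<l} ks" "strict_mono_on {..<l} ks'" "ks ` {..<l} \<subseteq> H" "ks' ` {..<l} \<subseteq> H"
    and a: "\<forall>i<l. \<bar>a i\<bar> <= 1" for ks ks' a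
  proof -
   define g where "g = restrict (%i. real_of_int \<lfloor>a i * real q\<rfloor> / real q) {..<l}"
   have gG: "g \<in> G"
   proof -
    have "\<lfloor>a i * real q\<rfloor> \<in> {- int q..int q}" if "i < l" for i
    proof -
     have "\<bar>a i * real q\<bar> <= 1 * real q" unfolding abs_mult using a that by (intro mult_mono) auto
     then have "- real q <= a i * real q" "a i * real q <= real q" by linarith+
     then show ?thesis by (simp add: le_floor_iff floor_le_iff)
    qed
    then show ?thesis by (auto simp: G_def g_def)
   qed
   have ag: "\<bar>a i - g i\<bar> <= 1 / real q" if "i < l" for i
   proof -
    have "\<bar>a i * real q - real_of_int \<lfloor>a i * real q\<rfloor>\<bar> <= 1" by linarith
    then have "\<bar>a i * real q - real_of_int \<lfloor>a i * real q\<rfloor>\<bar> / real q <= 1 / real q"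
     by (intro divide_right_mono) auto
    moreover have "a i - g i = (a i * real q - real_of_int \<lfloor>a i * real q\<rfloor>) / real q"
     using q that by (simp add: g_def field_simps)
    ultimately show ?thesis by simp
   qed
   have approx: "\<bar>norm (\<Sum>i<l. a i *\<^sub>R u (k i)) - norm (\<Sum>i<l. g i *\<^sub>R u (k i))\<bar> <= \<delta> / 4"
    if "k ` {..<l} \<subseteq> H" for k
   proof -
    have "\<bar>norm (\<Sum>i<l. a i *\<^sub>R u (k i)) - norm (\<Sum>i<l. g i *\<^sub>R u (k i))\<bar>
      <= norm ((\<Sum>i<l. a i *\<^sub>R u (k i)) - (\<Sum>i<l. g i *\<^sub>R u (k i)))"
     by (rule norm_triangle_ineq3)
    also have "... = norm (\<Sum>i<l. (a i - g i) *\<^sub>R u (k i))"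
     by (simp add: sum_subtractf scaleR_left_diff_distrib)
    also have "... <= real (card {..<l}) * (1 / real q)"
     using ag that u H(1) by (intro norm_sum_scaled_le) auto
    also have "... <= \<delta> / 4" using q by simp
    finally show ?thesis .
   qed
   have val_eq: "val u (k ` {..<l}) g = norm (\<Sum>i<l. g i *\<^sub>R u (k i))" if "strict_mono_on {..<l} k" for k
    unfolding val_def using strict_mono_on_enum[OF that] by simp
   have card: "card (k ` {..<l}) = l" if "strict_mono_on {..<l} k" for k :: "nat => nat"
    using strict_mono_on_imp_inj_on[OF that] by (simp add: card_image)
   have "col u (ks ` {..<l}) = col u (ks' ` {..<l})" using ks card by (intro H(3)) auto
   then have "nat \<lfloor>4 * val u (ks ` {..<l}) g / \<delta>\<rfloor> = nat \<lfloor>4 * val u (ks' ` {..<l}) g / \<delta>\<rfloor>"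
    unfolding col_def using gG by (metis (mono_tags, lifting) restrict_apply')
   moreover have "0 <= 4 * val u S g / \<delta>" for S using \<delta> by (simp add: val_def)
   ultimately have "\<lfloor>4 * val u (ks ` {..<l}) g / \<delta>\<rfloor> = \<lfloor>4 * val u (ks' ` {..<l}) g / \<delta>\<rfloor>"
    by (metis eq_nat_nat_iff zero_le_floor)
   then have "4 * val u (ks ` {..<l}) g / \<delta> <= 4 * val u (ks' ` {..<l}) g / \<delta> + 1" by linarith
   then have "val u (ks ` {..<l}) g <= val u (ks' ` {..<l}) g + \<delta> / 4" using \<delta> by (simp add: field_simps)
   then show ?thesis
    using approx[OF ks(3)] approx[OF ks(4)] val_eq[OF ks(1)] val_eq[OF ks(2)] by linarith
  qed
  then show "\<exists>H\<subseteq>I. card H = L \<and> hom_set u l \<delta> H"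
   using H(1,2) by (intro exI[of _ H]) (simp add: hom_set_def)
 qed
qed

lemma finite_enumeration:
 fixes H :: "nat set"
 assumes "finite H"
 obtains h where "strict_mono_on {..<card H} h" "h ` {..<card H} = H"
proof (rule that[of "%i. sorted_list_of_set H ! i"])
 have "sorted_wrt (<) (sorted_list_of_set H)"
  by (simp add: strict_sorted_iff)
 then show "strict_mono_on {..<card H} (%i. sorted_list_of_set H ! i)"
  unfolding strict_mono_on_def by (auto intro: sorted_wrt_nth_less)
 have "(%i. sorted_list_of_set H ! i) ` {..<length (sorted_list_of_set H)} = set (sorted_list_of_set H)"
  by (auto simp: set_conv_nth)
 then show "(%i. sorted_list_of_set H ! i) ` {..<card H} = H" using assms by simp
qed

text \<open>A tuple of length \<open>m <= l\<close> is padded with zero coefficients at the last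
  elements of \<open>H\<close>; giving up the last \<open>l\<close> elements leaves room for
  this.\<close>

lemma hom_set_initial:
 assumes "finite H" "card H = N + l" "hom_set u l \<delta> H"
 obtains H0 where "H0 \<subseteq> H" "card H0 = N" "!!m. m <= l ==> hom_set u m \<delta> H0"
proof -
 obtain h where h: "strict_mono_on {..<N + l} h" "h ` {..<N + l} = H"
  using finite_enumeration[OF assms(1)] assms(2) by metis
 have inj: "inj_on h {..<N + l}" using h(1) by (rule strict_mono_on_imp_inj_on)
 show ?thesis
 proof (rule that[of "h ` {..<N}"])
  show "h ` {..<N} \<subseteq> H" using h by force
  show "card (h ` {..<N}) = N" using inj by (simp add: card_image inj_on_subset[OF inj])
  fix m assume m: "m <= l"
  define ext where "ext k i = (if i < m then k i else h (N + i))" for k :: "nat => nat" and i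
  have ext: "strict_mono_on {..<l} (ext k)" "ext k ` {..<l} \<subseteq> H"
   if k: "strict_mono_on {..<m} k" "k ` {..<m} \<subseteq> h ` {..<N}" for k
  proof -
   show "strict_mono_on {..<l} (ext k)"
   proof (rule strict_mono_onI)
    fix i j assume ij: "i \<in> {..<l}" "j \<in> {..<l}" "i < j"
    consider "j < m" | "i < m" "m <= j" | "m <= i" by linarith
    then show "ext k i < ext k j"
    proof cases
     case 1 then show ?thesis using k(1) ij by (auto simp: ext_def strict_mono_on_def)
    next
     case 2
     then obtain r where "r < N" "k i = h r" using k(2) by auto
     moreover have "h r < h (N + j)" using h(1) \<open>r < N\<close> ij by (auto simp: strict_mono_on_def)
     ultimately show ?thesis using 2 by (simp add: ext_def)
    next
     case 3 then show ?thesis using h(1) ij by (auto simp: ext_def strict_mono_on_def)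
    qed
   qed
   show "ext k ` {..<l} \<subseteq> H"
   proof clarify
    fix i assume "i < l"
    show "ext k i \<in> H"
    proof (cases "i < m")
     case True
     then have "k i \<in> h ` {..<N}" using k(2) by blast
     then show ?thesis using True h(2) by (auto simp: ext_def)
    next
     case False
     then show ?thesis using \<open>i < l\<close> h(2) by (auto simp: ext_def)
    qed
   qed
  qed
  show "hom_set u m \<delta> (h ` {..<N})"
   unfolding hom_set_def
  proof clarify
   fix ks ks' :: "nat => nat" and a :: "nat => real"
   assume k: "strict_mono_on {..<m} ks" "strict_mono_on {..<m} ks'" "ks ` {..<m} \<subseteq> h ` {..<N}"
    "ks' ` {..<m} \<subseteq> h ` {..<N}" and a: "\<forall>i<m. \<bar>a i\<bar> <= 1"
   have sum: "(\<Sum>i<l. (if i < m then a i else 0) *\<^sub>R u (ext k i)) = (\<Sum>i<m. a i *\<^sub>R u (k i))" for k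
    using m by (intro sum.mono_neutral_cong_right) (auto simp: ext_def)
   have "norm (\<Sum>i<l. (if i < m then a i else 0) *\<^sub>R u (ext ks i))
     <= norm (\<Sum>i<l. (if i < m then a i else 0) *\<^sub>R u (ext ks' i)) + \<delta>"
    by (rule assms(3)[unfolded hom_set_def, rule_format])
      (simp add: ext[OF k(1,3)] ext[OF k(2,4)] a)
   then show "norm (\<Sum>i<m. a i *\<^sub>R u (ks i)) <= norm (\<Sum>i<m. a i *\<^sub>R u (ks' i)) + \<delta>"
    by (simp only: sum)
  qed
 qed
qed

lemma ramsey_hom_upto:
 assumes \<delta>: "\<delta> > 0"
 obtains R where "!!(u :: nat => 'a::real_normed_vector) I. finite I ==> R <= card I ==>
   (!!i. i \<in> I ==> norm (u i) <= 1) ==> \<exists>H\<subseteq>I. card H = L \<and> (\<forall>m\<le>l. hom_set u m \<delta> H)"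
proof -
 obtain R where R: "!!(u :: nat => 'a) I. finite I ==> R <= card I ==>
   (!!i. i \<in> I ==> norm (u i) <= 1) ==> \<exists>H\<subseteq>I. card H = L + l \<and> hom_set u l \<delta> H"
  using ramsey_hom_set[OF \<delta>, where ?'a = 'a] by blast
 show ?thesis
 proof (rule that[of R])
  fix u :: "nat => 'a" and I assume I: "finite I" "R <= card I" "!!i. i \<in> I ==> norm (u i) <= 1"
  obtain H where H: "H \<subseteq> I" "card H = L + l" "hom_set u l \<delta> H"
   using R[OF I(1,2), of u] I(3) by blast
  have "finite H" using H(1) I(1) by (rule finite_subset)
  then obtain H0 where "H0 \<subseteq> H" "card H0 = L" "!!m. m <= l ==> hom_set u m \<delta> H0"
   using hom_set_initial[OF _ H(2,3)] by metis
  then show "\<exists>H\<subseteq>I. card H = L \<and> (\<forall>m\<le>l. hom_set u m \<delta> H)"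
   using H(1) by (intro exI[of _ H0]) auto
 qed
qed

section \<open>Splitting a finite family into homogeneous blocks\<close>

lemma exhaust_disjoint:
 assumes "finite I" "!!H. P H ==> H ~= {}"
 shows "\<exists>\<H>. finite \<H> \<and> disjoint \<H> \<and> \<Union>\<H> \<subseteq> I \<and> (\<forall>H\<in>\<H>. P H) \<and> (\<forall>H. H \<subseteq> I - \<Union>\<H> --> \<not> P H)"
 using assms(1)
 proof (induction "card I" arbitrary: I rule: less_induct)
  case less
  show ?case
  proof (cases "\<exists>H\<subseteq>I. P H")
   case True
   then obtain H where H: "H \<subseteq> I" "P H" by blast
   have "I - H \<subset> I" using H(1) assms(2)[OF H(2)] by blast
   then have "card (I - H) < card I" using less.prems by (simp add: psubset_card_mono)
   then obtain \<H> where \<H>: "finite \<H>" "disjoint \<H>" "\<Union>\<H> \<subseteq> I - H" "\<forall>H\<in>\<H>. P H"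
    "\<forall>H'. H' \<subseteq> I - H - \<Union>\<H> --> \<not> P H'"
    using less.hyps[of "I - H"] less.prems by auto
   have "disjoint (insert H \<H>)"
    using \<H>(2,3) by (auto simp: pairwise_insert disjnt_def)
   moreover have "I - \<Union>(insert H \<H>) = I - H - \<Union>\<H>" by auto
   ultimately show ?thesis using \<H> H by (intro exI[of _ "insert H \<H>"]) auto
  qed (intro exI[of _ "{}"], auto)
qed

lemma sum_half_powers_le:
 fixes \<kappa> :: "'i => nat"
 assumes "finite W" "!!c. card {i\<in>W. \<kappa> i = c} <= R"
 shows "(\<Sum>i\<in>W. (1/2 :: real) ^ \<kappa> i) <= 2 * real R"
proof -
 have "(\<Sum>i\<in>W. (1/2 :: real) ^ \<kappa> i) = (\<Sum>c\<in>\<kappa> ` W. \<Sum>i\<in>{i\<in>W. \<kappa> i = c}. (1/2) ^ \<kappa> i)"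
  using assms by (intro sum.group[symmetric]) auto
 also have "... = (\<Sum>c\<in>\<kappa> ` W. real (card {i\<in>W. \<kappa> i = c}) * (1/2) ^ c)"
  by (intro sum.cong refl) simp
 also have "... <= (\<Sum>c\<in>\<kappa> ` W. real R * (1/2) ^ c)"
  using assms by (intro sum_mono mult_right_mono) auto
 also have "... = real R * (\<Sum>c\<in>\<kappa> ` W. (1/2) ^ c)" by (simp add: sum_distrib_left)
 also have "... <= real R * (\<Sum>c. (1/2) ^ c)"
  using assms by (intro mult_left_mono sum_le_suminf summable_geometric) auto
 also have "(\<Sum>c. (1/2 :: real) ^ c) = 2" using suminf_geometric[of "1/2 :: real"] by simp
 finally show ?thesis by simp
qed

lemma dyadic_class:
 fixes r m :: real
 assumes "0 < r" "r <= m"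
 obtains c :: nat where "r <= m * (1/2) ^ c" "m * (1/2) ^ c < 2 * r"
proof -
 obtain n where n: "m / r < 2 ^ n" using real_arch_pow[of 2 "m / r"] by auto
 define c where "c = (LEAST n. m / r < 2 ^ Suc n)"
 have ex: "m / r < 2 ^ Suc n" using n by (meson less_le_trans one_le_numeral power_increasing le_SucI order_refl)
 have c1: "m / r < 2 ^ Suc c" unfolding c_def using ex by (rule LeastI)
 have c2: "2 ^ c <= m / r"
 proof (cases c)
  case 0 then show ?thesis using assms by simp
 next
  case (Suc d)
  then have "\<not> m / r < 2 ^ Suc d" unfolding c_def by (metis lessI not_less_Least)
  then show ?thesis using Suc by simp
 qed
 show ?thesis using c1 c2 assms by (intro that[of c]) (auto simp: field_simps power_one_over)
qed

text \<open>A block consists of \<open>L\<close> vectors of one dyadic norm class and is homogeneous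
  after rescaling. The remainder \<open>W\<close> has at most a Ramsey number \<open>R\<close> of
  vectors in each class, so its norms sum to at most \<open>2 * R * m\<close>. Since
  \<open>R\<close> does not depend on \<open>n\<close> and \<open>x\<close>, this is negligible once
  the type or cotype constant is large.\<close>

definition block_decomp ::
 "nat => (nat => 'a::real_normed_vector) => nat => nat => real => nat => real => (nat => nat) => nat set set => nat set => bool" where
 "block_decomp n x L l \<delta> R m \<kappa> \<H> W \<longleftrightarrow>
   0 < m \<and> (\<exists>i<n. norm (x i) = m) \<and>
   finite \<H> \<and> disjoint \<H> \<and> \<Union>\<H> \<union> W = {i. i < n \<and> x i ~= 0} \<and> \<Union>\<H> \<inter> W = {} \<and>
   (\<forall>i<n. norm (x i) <= m * (1/2) ^ \<kappa> i \<and> (x i ~= 0 --> m * (1/2) ^ \<kappa> i < 2 * norm (x i))) \<and>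
   (\<forall>H\<in>\<H>. card H = L \<and> (\<exists>c. \<forall>i\<in>H. \<kappa> i = c) \<and> (\<forall>j\<le>l. hom_set (%i. (2 ^ \<kappa> i / m) *\<^sub>R x i) j \<delta> H)) \<and>
   (\<Sum>i\<in>W. (1/2 :: real) ^ \<kappa> i) <= 2 * real R"

lemma block_decomp_exists:
 assumes "\<delta> > 0" "L > 0"
 obtains R where "!!n (x :: nat => 'a::real_normed_vector). (\<exists>i<n. x i ~= 0) ==>
  \<exists>m \<kappa> \<H> W. block_decomp n x L l \<delta> R m \<kappa> \<H> W"
proof -
 obtain R where R: "!!(u :: nat => 'a) I. finite I ==> R <= card I ==>
   (!!i. i \<in> I ==> norm (u i) <= 1) ==> \<exists>H\<subseteq>I. card H = L \<and> (\<forall>j\<le>l. hom_set u j \<delta> H)"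
  using ramsey_hom_upto[OF assms(1), where ?'a = 'a] by blast
 show ?thesis
 proof (rule that[of R])
  fix n and x :: "nat => 'a" assume ne: "\<exists>i<n. x i ~= 0"
  define m where "m = Max ((%i. norm (x i)) ` {..<n})"
  have "n > 0" using ne by auto
  then have "m \<in> (%i. norm (x i)) ` {..<n}" unfolding m_def by (intro Max_in) auto
  then have m1: "\<exists>i<n. norm (x i) = m" by auto
  have m2: "norm (x i) <= m" if "i < n" for i unfolding m_def using that by (intro Max_ge) auto
  have m0: "m > 0" using ne m2 by (metis zero_less_norm_iff less_le_trans)
  have "\<exists>c. norm (x i) <= m * (1/2) ^ c \<and> (x i ~= 0 --> m * (1/2) ^ c < 2 * norm (x i))" if "i < n" for i
  proof (cases "x i = 0")
   case True then show ?thesis using m0 by auto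
  next
   case False then show ?thesis using dyadic_class[of "norm (x i)" m] m2[OF that] by auto
  qed
  then obtain \<kappa> where \<kappa>: "!!i. i < n ==> norm (x i) <= m * (1/2) ^ \<kappa> i \<and> (x i ~= 0 --> m * (1/2) ^ \<kappa> i < 2 * norm (x i))"
   by metis
  define u where "u i = (2 ^ \<kappa> i / m) *\<^sub>R x i" for i
  have u: "norm (u i) <= 1" if "i < n" for i
   using \<kappa>[OF that] m0 by (simp add: u_def field_simps power_one_over)
  define P where "P H \<longleftrightarrow> card H = L \<and> (\<exists>c. \<forall>i\<in>H. \<kappa> i = c) \<and> (\<forall>j\<le>l. hom_set u j \<delta> H)" for H
  define I where "I = {i. i < n \<and> x i ~= 0}"
  have "finite I" by (simp add: I_def)
  moreover have "P H ==> H ~= {}" for H using assms by (auto simp: P_def)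
  ultimately obtain \<H> where \<H>: "finite \<H>" "disjoint \<H>" "\<Union>\<H> \<subseteq> I" "!!H. H \<in> \<H> ==> P H"
   "!!H. H \<subseteq> I - \<Union>\<H> ==> \<not> P H"
   using exhaust_disjoint[of I P] by metis
  define W where "W = I - \<Union>\<H>"
  \<comment> \<open>Maximality: a class with more than \<open>R\<close> remaining vectors would
    contain a further block.\<close>
  have "card {i\<in>W. \<kappa> i = c} <= R" for c
  proof (rule ccontr)
   assume "\<not> ?thesis"
   then have le: "R <= card {i\<in>W. \<kappa> i = c}" by simp
   have fin: "finite {i\<in>W. \<kappa> i = c}" using \<open>finite I\<close> by (simp add: W_def)
   obtain H where "H \<subseteq> {i\<in>W. \<kappa> i = c}" "card H = L" "\<forall>j\<le>l. hom_set u j \<delta> H"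
    using R[OF fin le, of u] u by (force simp: W_def I_def)
   moreover from this have "\<forall>i\<in>H. \<kappa> i = c" by auto
   ultimately have "H \<subseteq> W" "P H" by (auto simp: P_def)
   then show False using \<H>(5) by (simp add: W_def)
  qed
  then have "(\<Sum>i\<in>W. (1/2 :: real) ^ \<kappa> i) <= 2 * real R"
   using \<open>finite I\<close> by (intro sum_half_powers_le) (auto simp: W_def)
  then have "block_decomp n x L l \<delta> R m \<kappa> \<H> W"
   unfolding block_decomp_def using m0 m1 \<H> \<kappa>
   by (auto simp: W_def I_def P_def u_def[abs_def])
  then show "\<exists>m \<kappa> \<H> W. block_decomp n x L l \<delta> R m \<kappa> \<H> W" by blast
 qed
qed

section \<open>Spreading sequences\<close>

lemma sum_lessThan_double: "(\<Sum>i<2 * m. f i) = (\<Sum>s<m. f (2 * s) + f (2 * s + 1 :: nat) :: 'a::comm_monoid_add)"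
 by (induction m) (auto simp: add_ac)

definition dominates :: "nat => (nat => 'a::real_normed_vector) => (nat => 'a) => real => bool" where
 "dominates m v w \<delta> \<longleftrightarrow> (\<forall>a. (\<forall>s<m. \<bar>a s\<bar> <= (1 :: real)) -->
   norm (\<Sum>s<m. a s *\<^sub>R v s) <= norm (\<Sum>s<m. a s *\<^sub>R w s) + \<delta>)"

text \<open>\<open>m\<close> successive pairs form one increasing tuple of length
  \<open>2 * m\<close>, with coefficients \<open>a s\<close> and \<open>- a s\<close>.\<close>

lemma hom_set_pairs:
 fixes u :: "nat => 'a::real_normed_vector" and h p q p' q' :: "nat => nat"
 assumes H: "hom_set u (2 * m) \<delta> H"
  and h: "strict_mono_on {..<N} h" "h ` {..<N} \<subseteq> H"
  and p: "!!s. s < m ==> p s < q s" "!!s. s < m ==> q s < N" "!!s t. s < t ==> t < m ==> q s < p t"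
  and p': "!!s. s < m ==> p' s < q' s" "!!s. s < m ==> q' s < N" "!!s t. s < t ==> t < m ==> q' s < p' t"
 shows "dominates m (%s. u (h (p s)) - u (h (q s))) (%s. u (h (p' s)) - u (h (q' s))) \<delta>"
 unfolding dominates_def
proof (intro allI impI)
 fix a :: "nat => real" assume a: "\<forall>s<m. \<bar>a s\<bar> <= 1"
 define b where "b i = (if even i then a (i div 2) else - a (i div 2))" for i
 define k where "k p q i = (if even i then h (p (i div 2)) else h (q (i div 2)))" for p q :: "nat => nat" and i
 have b: "\<forall>i<2 * m. \<bar>b i\<bar> <= 1" using a by (auto simp: b_def)
 have k: "strict_mono_on {..<2 * m} (k p q)" "k p q ` {..<2 * m} \<subseteq> H"
  if pq: "!!s. s < m ==> p s < q s" "!!s. s < m ==> q s < N" "!!s t. s < t ==> t < m ==> q s < p t" for p q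
 proof -
  define r where "r i = (if even i then p (i div 2) else q (i div 2))" for i
  have kr: "k p q i = h (r i)" for i by (simp add: k_def r_def)
  have rN: "r i < N" if "i < 2 * m" for i
  proof -
   have "i div 2 < m" using that by simp
   then show ?thesis using pq(1)[of "i div 2"] pq(2)[of "i div 2"] by (simp add: r_def)
  qed
  have rr: "r i < r j" if "i < j" "j < 2 * m" for i j
  proof (cases "i div 2 = j div 2")
   case True
   then have "even i" "odd j" using that by presburger+
   then show ?thesis using True pq(1)[of "j div 2"] that by (simp add: r_def)
  next
   case False
   then have "i div 2 < j div 2" "j div 2 < m" using that by auto
   then have "q (i div 2) < p (j div 2)" "p (i div 2) < q (i div 2)" "p (j div 2) < q (j div 2)"
    using pq by auto
   then show ?thesis by (simp add: r_def)
  qed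
  show "strict_mono_on {..<2 * m} (k p q)"
   using h(1) rN rr by (auto simp: strict_mono_on_def kr)
  show "k p q ` {..<2 * m} \<subseteq> H" using h(2) rN by (auto simp: kr)
 qed
 have sum: "(\<Sum>i<2 * m. b i *\<^sub>R u (k p q i)) = (\<Sum>s<m. a s *\<^sub>R (u (h (p s)) - u (h (q s))))" for p q
  by (simp add: sum_lessThan_double b_def k_def scaleR_diff_right)
 have "norm (\<Sum>i<2 * m. b i *\<^sub>R u (k p q i)) <= norm (\<Sum>i<2 * m. b i *\<^sub>R u (k p' q' i)) + \<delta>"
  by (rule H[unfolded hom_set_def, rule_format]) (use k[of p q, OF p] k[of p' q', OF p'] b in auto)
 then show "norm (\<Sum>s<m. a s *\<^sub>R (u (h (p s)) - u (h (q s)))) <= norm (\<Sum>s<m. a s *\<^sub>R (u (h (p' s)) - u (h (q' s)))) + \<delta>"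
  by (simp only: sum)
qed

text \<open>Replacing the terms outside \<open>F\<close> by consecutive differences and averaging over all their
 positions makes these terms telescope.\<close>

lemma differences_unconditional:
 fixes u :: "nat => 'a::real_normed_vector" and h :: "nat => nat"
 assumes H: "hom_set u (2 * M) \<delta> H" and K: "K > 0"
  and h: "strict_mono_on {..<M * Suc K} h" "h ` {..<M * Suc K} \<subseteq> H"
  and u: "!!i. i \<in> H ==> norm (u i) <= 1"
  and a: "!!s. s < M ==> \<bar>a s\<bar> <= 1" and F: "F \<subseteq> {..<M}"
 defines "d \<equiv> %s. u (h (s * Suc K)) - u (h (s * Suc K + 1))"
 shows "norm (\<Sum>s\<in>F. a s *\<^sub>R d s) <= norm (\<Sum>s<M. a s *\<^sub>R d s) + (\<delta> + 2 * real M / real K)"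
proof -
 have bound: "s * Suc K + j < M * Suc K" if "s < M" "j <= K" for s j
 proof -
  have "s * Suc K + j < Suc s * Suc K" using that by simp
  also have "... <= M * Suc K" using that by (intro mult_le_mono1) simp
  finally show ?thesis .
 qed
 have step: "s * Suc K + j < t * Suc K" if "s < t" "j <= K" for s t j
 proof -
  have "s * Suc K + j < Suc s * Suc K" using that by simp
  also have "... <= t * Suc K" using that by (intro mult_le_mono1) simp
  finally show ?thesis .
 qed
 define v where "v \<tau> = (\<Sum>s\<in>F. a s *\<^sub>R d s) +
   (\<Sum>s\<in>{..<M} - F. a s *\<^sub>R (u (h (s * Suc K + \<tau>)) - u (h (s * Suc K + Suc \<tau>))))" for \<tau>
 have v: "norm (v \<tau>) <= norm (\<Sum>s<M. a s *\<^sub>R d s) + \<delta>" if \<tau>: "\<tau> < K" for \<tau>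
 proof -
  define p where "p s = (if s \<in> F then s * Suc K else s * Suc K + \<tau>)" for s
  have dom: "dominates M (%s. u (h (p s)) - u (h (p s + 1))) (%s. u (h (s * Suc K)) - u (h (s * Suc K + 1))) \<delta>"
  proof (rule hom_set_pairs[OF H h])
   fix s t assume "s < t" "t < M"
   have "s * Suc K + \<tau> + 1 < t * Suc K" "s * Suc K + 1 < t * Suc K"
    using step[OF \<open>s < t\<close>, of "\<tau> + 1"] step[OF \<open>s < t\<close>, of 1] \<tau> K by auto
   then show "p s + 1 < p t" "s * Suc K + 1 < t * Suc K" by (auto simp: p_def)
  qed (use bound \<tau> K in \<open>auto simp: p_def intro: bound[of _ "Suc _", simplified] bound[of _ 1, simplified]\<close>)
  have eq: "(\<Sum>s<M. a s *\<^sub>R (u (h (p s)) - u (h (p s + 1)))) = v \<tau>"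
  proof -
   have "(\<Sum>s<M. a s *\<^sub>R (u (h (p s)) - u (h (p s + 1)))) =
     (\<Sum>s\<in>F. a s *\<^sub>R (u (h (p s)) - u (h (p s + 1)))) + (\<Sum>s\<in>{..<M} - F. a s *\<^sub>R (u (h (p s)) - u (h (p s + 1))))"
    using F by (simp add: sum.subset_diff add.commute)
   then show ?thesis by (simp add: v_def p_def d_def)
  qed
  have "norm (\<Sum>s<M. a s *\<^sub>R (u (h (p s)) - u (h (p s + 1)))) <= norm (\<Sum>s<M. a s *\<^sub>R d s) + \<delta>"
   unfolding d_def by (rule dom[unfolded dominates_def, rule_format]) (use a in auto)
  then show ?thesis unfolding eq .
 qed
 \<comment> \<open>What is left by the telescoping: two vectors of norm at most 1 for each
   \<open>s\<close>, hence at most \<open>2 * M\<close> in norm, and small after division by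
   \<open>K\<close>.\<close>
 define w where "w = (\<Sum>s\<in>{..<M} - F. a s *\<^sub>R (u (h (s * Suc K)) - u (h (s * Suc K + K))))"
 have "(\<Sum>\<tau><K. v \<tau>) = real K *\<^sub>R (\<Sum>s\<in>F. a s *\<^sub>R d s) + w"
 proof -
  have "(\<Sum>\<tau><K. v \<tau>) = real K *\<^sub>R (\<Sum>s\<in>F. a s *\<^sub>R d s) +
    (\<Sum>s\<in>{..<M} - F. a s *\<^sub>R (\<Sum>\<tau><K. u (h (s * Suc K + \<tau>)) - u (h (s * Suc K + Suc \<tau>))))"
   unfolding v_def sum.distrib scaleR_sum_right
   by (subst sum.swap[of _ "{..<M} - F"]) (simp add: sum_constant_scaleR scaleR_sum_right)
  also have "(%s. a s *\<^sub>R (\<Sum>\<tau><K. u (h (s * Suc K + \<tau>)) - u (h (s * Suc K + Suc \<tau>)))) =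
    (%s. a s *\<^sub>R (u (h (s * Suc K)) - u (h (s * Suc K + K))))"
  proof
   fix s
   show "a s *\<^sub>R (\<Sum>\<tau><K. u (h (s * Suc K + \<tau>)) - u (h (s * Suc K + Suc \<tau>))) =
    a s *\<^sub>R (u (h (s * Suc K)) - u (h (s * Suc K + K)))"
    by (simp only: sum_lessThan_telescope'[of "%\<tau>. u (h (s * Suc K + \<tau>))" K] add_0_right)
  qed
  finally show ?thesis by (simp add: w_def)
 qed
 moreover have "norm (\<Sum>\<tau><K. v \<tau>) <= real K * (norm (\<Sum>s<M. a s *\<^sub>R d s) + \<delta>)"
  using sum_norm_le[of "{..<K}" v "%_. norm (\<Sum>s<M. a s *\<^sub>R d s) + \<delta>"] v by simp
 moreover have "norm w <= 2 * real M"
 proof -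
  have "norm w <= (\<Sum>s\<in>{..<M} - F. 2)"
   unfolding w_def
  proof (rule sum_norm_le)
   fix s assume s: "s \<in> {..<M} - F"
   have "h (s * Suc K) \<in> H" "h (s * Suc K + K) \<in> H"
    using bound[of s 0] bound[of s K] s h(2) by auto
   then have "norm (u (h (s * Suc K)) - u (h (s * Suc K + K))) <= 1 + 1"
    by (intro norm_triangle_le_diff add_mono u)
   then show "norm (a s *\<^sub>R (u (h (s * Suc K)) - u (h (s * Suc K + K)))) <= 2"
    using a[of s] s mult_mono[of "\<bar>a s\<bar>" 1 _ 2] by force
  qed
  also have "... <= 2 * real M" using card_mono[of "{..<M}" "{..<M} - F"] by simp
  finally show ?thesis .
 qed
 ultimately have "norm (real K *\<^sub>R (\<Sum>s\<in>F. a s *\<^sub>R d s)) <= real K * (norm (\<Sum>s<M. a s *\<^sub>R d s) + \<delta>) + 2 * real M"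
  using norm_triangle_ineq4[of "\<Sum>\<tau><K. v \<tau>" w] by simp
 then show ?thesis using K by (simp add: field_simps)
qed

text \<open>Suppression unconditionality and invariance under order preserving changes of position,
  both with constant 2. Together they make sums with constant coefficients depend, up to a constant,
  only on the number of terms.\<close>

definition spreading :: "nat => (nat => 'a::real_normed_vector) => bool" where
 "spreading M e \<longleftrightarrow>
   (\<forall>a F. F \<subseteq> {..<M} --> norm (\<Sum>s\<in>F. a s *\<^sub>R e s) <= 2 * norm (\<Sum>s<M. a s *\<^sub>R e s)) \<and>
   (\<forall>(m :: nat) (i :: nat => nat) j a. strict_mono_on {..<m} i \<and> strict_mono_on {..<m} j \<and> i ` {..<m} \<subseteq> {..<M} \<and> j ` {..<m} \<subseteq> {..<M} -->
    norm (\<Sum>s<m. a s *\<^sub>R e (i s)) <= 2 * norm (\<Sum>s<m. a s *\<^sub>R e (j s)))"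

lemma scale_to_unit_sup:
 fixes a :: "nat => real"
 assumes "finite S" "\<exists>s\<in>S. a s ~= 0"
 obtains c s0 where "c > 0" "s0 \<in> S" "\<bar>c * a s0\<bar> = 1" "!!s. s \<in> S ==> \<bar>c * a s\<bar> <= 1"
proof -
 define m where "m = Max ((%s. \<bar>a s\<bar>) ` S)"
 have "m \<in> (%s. \<bar>a s\<bar>) ` S" unfolding m_def using assms by (intro Max_in) auto
 then obtain s0 where s0: "s0 \<in> S" "\<bar>a s0\<bar> = m" by auto
 have m: "\<bar>a s\<bar> <= m" if "s \<in> S" for s unfolding m_def using assms that by (intro Max_ge) auto
 have "m > 0" using assms(2) m by force
 then show ?thesis using s0 m by (intro that[of "1 / m" s0]) (auto simp: abs_mult)
qed

text \<open>If the largest coefficient has modulus 1, unconditionality up to the additive error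
  bounds the norm below by 3/4 of \<open>norm (d 0)\<close>. Against this an additive error of an
  eighth of \<open>norm (d 0)\<close> costs less than a factor 2.\<close>

lemma spreading_of_hom_set:
 fixes u :: "nat => 'a::real_normed_vector" and h :: "nat => nat"
 assumes H: "!!j. j <= 2 * M ==> hom_set u j \<delta> H" and K: "K > 0" and M: "M > 0"
  and h: "strict_mono_on {..<M * Suc K} h" "h ` {..<M * Suc K} \<subseteq> H"
  and u: "!!i. i \<in> H ==> norm (u i) <= 1"
 defines "d \<equiv> %s. u (h (s * Suc K)) - u (h (s * Suc K + 1))"
 assumes small: "\<delta> + 2 * real M / real K <= norm (d 0) / 8" and nz: "d 0 ~= 0" and \<delta>: "0 <= \<delta>"
 shows "spreading M d"
proof -
 define c where "c = norm (d 0)"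
 have c: "c > 0" using nz by (simp add: c_def)
 define \<delta>' where "\<delta>' = \<delta> + 2 * real M / real K"
 have \<delta>': "\<delta> <= \<delta>'" "\<delta>' <= c / 8" using small by (auto simp: \<delta>'_def c_def)
 have unc: "norm (\<Sum>s\<in>F. a s *\<^sub>R d s) <= norm (\<Sum>s<M. a s *\<^sub>R d s) + \<delta>'"
  if "!!s. s < M ==> \<bar>a s\<bar> <= 1" "F \<subseteq> {..<M}" for a F
  using differences_unconditional[OF H K h u that] by (simp add: \<delta>'_def d_def)
 have pos: "s * Suc K + 1 < M * Suc K" if "s < M" for s
 proof -
  have "s * Suc K + 1 < Suc s * Suc K" using K by simp
  also have "... <= M * Suc K" using that by (intro mult_le_mono1) simp
  finally show ?thesis .
 qed
 have spr: "dominates m (%s. d (i s)) (%s. d (j s)) \<delta>"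
  if ij: "strict_mono_on {..<m} i" "strict_mono_on {..<m} j" "i ` {..<m} \<subseteq> {..<M}" "j ` {..<m} \<subseteq> {..<M}" for m :: nat and i j
 proof -
  have le: "m <= M"
   using card_inj_on_le[OF strict_mono_on_imp_inj_on[OF ij(1)] ij(3)] by simp
  have gap: "k s * Suc K + 1 < k t * Suc K" if "strict_mono_on {..<m} k" "s < t" "t < m" for k :: "nat => nat" and s t
  proof -
   have "k s < k t" using that by (auto simp: strict_mono_on_def)
   then have "Suc (k s) * Suc K <= k t * Suc K" by (intro mult_le_mono1) simp
   then show ?thesis using K by simp
  qed
  show ?thesis
   unfolding d_def
   by (rule hom_set_pairs[OF H h]) (use le pos gap[OF ij(1)] gap[OF ij(2)] ij in \<open>auto\<close>)
 qed
 have low1: "3 / 4 * c <= norm (\<Sum>s<M. a s *\<^sub>R d s)"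
  if a: "!!s. s < M ==> \<bar>a s\<bar> <= 1" "s0 < M" "\<bar>a s0\<bar> = 1" for a s0
 proof -
  have "dominates 1 (%s. d ((%_. 0) s)) (%s. d ((%_. s0) s)) \<delta>"
   using a(2) by (intro spr) (auto simp: strict_mono_on_def)
  then have "c <= norm (d s0) + \<delta>" unfolding dominates_def c_def
   by (elim allE[of _ "%_. 1"]) simp
  moreover have "norm (d s0) <= norm (\<Sum>s<M. a s *\<^sub>R d s) + \<delta>'"
   using unc[of a "{s0}"] a by simp
  ultimately show ?thesis using \<delta>' by linarith
 qed
 have unc2: "norm (\<Sum>s\<in>F. a s *\<^sub>R d s) <= 2 * norm (\<Sum>s<M. a s *\<^sub>R d s)" if F: "F \<subseteq> {..<M}" for a F
 proof (cases "\<exists>s\<in>{..<M}. a s ~= 0")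
  case False
  then have "(\<Sum>s\<in>F. a s *\<^sub>R d s) = 0" using F by (intro sum.neutral) auto
  then show ?thesis by simp
 next
  case True
  then obtain r s0 where r: "r > 0" "s0 \<in> {..<M}" "\<bar>r * a s0\<bar> = 1" "!!s. s \<in> {..<M} ==> \<bar>r * a s\<bar> <= 1"
   using scale_to_unit_sup[of "{..<M}" a] by blast
  have "norm (\<Sum>s\<in>F. (r * a s) *\<^sub>R d s) <= 2 * norm (\<Sum>s<M. (r * a s) *\<^sub>R d s)"
   using unc[of "%s. r * a s" F] low1[of "%s. r * a s" s0] r F \<delta>' c by force
  also have "(\<Sum>s<M. (r * a s) *\<^sub>R d s) = r *\<^sub>R (\<Sum>s<M. a s *\<^sub>R d s)"
   by (simp add: scaleR_sum_right)
  also have "(\<Sum>s\<in>F. (r * a s) *\<^sub>R d s) = r *\<^sub>R (\<Sum>s\<in>F. a s *\<^sub>R d s)"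
   by (simp add: scaleR_sum_right)
  finally show ?thesis using r by simp
 qed
 have spr2: "norm (\<Sum>s<m. a s *\<^sub>R d (i s)) <= 2 * norm (\<Sum>s<m. a s *\<^sub>R d (j s))"
  if ij: "strict_mono_on {..<m} i" "strict_mono_on {..<m} j" "i ` {..<m} \<subseteq> {..<M}" "j ` {..<m} \<subseteq> {..<M}" for m :: nat and i j a
 proof (cases "\<exists>s\<in>{..<m}. a s ~= 0")
  case False
  then have "(\<Sum>s<m. a s *\<^sub>R d (i s)) = 0" by (intro sum.neutral) auto
  then show ?thesis by simp
 next
  case True
  then obtain r s0 where r: "r > 0" "s0 \<in> {..<m}" "\<bar>r * a s0\<bar> = 1" "!!s. s \<in> {..<m} ==> \<bar>r * a s\<bar> <= 1"
   using scale_to_unit_sup[of "{..<m}" a] by blast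
  have inj: "inj_on j {..<m}" using ij(2) by (rule strict_mono_on_imp_inj_on)
  define b where "b t = (if t \<in> j ` {..<m} then r * a (the_inv_into {..<m} j t) else 0)" for t
  have bj: "b (j s) = r * a s" if "s < m" for s
   using that inj by (simp add: b_def the_inv_into_f_f)
  have "(\<Sum>t<M. b t *\<^sub>R d t) = (\<Sum>t\<in>j ` {..<m}. b t *\<^sub>R d t)"
   using ij(4) by (intro sum.mono_neutral_right) (auto simp: b_def)
  also have "... = (\<Sum>s<m. (r * a s) *\<^sub>R d (j s))"
   using inj by (simp add: sum.reindex bj)
  finally have eq: "(\<Sum>t<M. b t *\<^sub>R d t) = (\<Sum>s<m. (r * a s) *\<^sub>R d (j s))" .
  have "\<bar>b t\<bar> <= 1" for t
  proof (cases "t \<in> j ` {..<m}")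
   case True
   then obtain x where "x < m" "t = j x" by auto
   then show ?thesis using bj[of x] r(4)[of x] by simp
  qed (simp add: b_def)
  then have "3 / 4 * c <= norm (\<Sum>s<m. (r * a s) *\<^sub>R d (j s))"
   using low1[of b "j s0"] r(2,3) bj ij(4) unfolding eq by auto
  moreover have "norm (\<Sum>s<m. (r * a s) *\<^sub>R d (i s)) <= norm (\<Sum>s<m. (r * a s) *\<^sub>R d (j s)) + \<delta>"
   using spr[OF ij] r(4) by (auto simp: dominates_def)
  ultimately have "norm (\<Sum>s<m. (r * a s) *\<^sub>R d (i s)) <= 2 * norm (\<Sum>s<m. (r * a s) *\<^sub>R d (j s))"
   using \<delta>' c by linarith
  also have "(\<Sum>s<m. (r * a s) *\<^sub>R d (j s)) = r *\<^sub>R (\<Sum>s<m. a s *\<^sub>R d (j s))"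
   by (simp add: scaleR_sum_right)
  also have "(\<Sum>s<m. (r * a s) *\<^sub>R d (i s)) = r *\<^sub>R (\<Sum>s<m. a s *\<^sub>R d (i s))"
   by (simp add: scaleR_sum_right)
  finally show ?thesis using r by simp
 qed
 show ?thesis unfolding spreading_def
  by (intro conjI allI impI; (elim conjE)?) (assumption | rule unc2 spr2)+
qed

lemma spreading_scale: "spreading M e ==> spreading M (%s. c *\<^sub>R e s)"
proof -
 assume e: "spreading M e"
 have *: "(\<Sum>s\<in>F. a s *\<^sub>R c *\<^sub>R f s) = c *\<^sub>R (\<Sum>s\<in>F. a s *\<^sub>R f s)" for F :: "nat set" and f :: "nat => 'a" and a
  by (simp add: scaleR_sum_right mult.commute)
 have "\<bar>c\<bar> * x <= 2 * (\<bar>c\<bar> * y)" if "x <= 2 * y" for x y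
  using mult_left_mono[OF that, of "\<bar>c\<bar>"] by simp
 with e show ?thesis unfolding spreading_def * norm_scaleR by simp
qed

text \<open>Coefficients in the interval from -1 to 1 are convex combinations of signs, one
  coordinate at a time; \<open>v\<close> carries the coordinates already treated.\<close>

lemma norm_sum_contract:
 fixes x :: "'i => 'a::real_normed_vector"
 assumes "finite I" "!!\<sigma>. (!!i. i \<in> I ==> \<sigma> i = 1 \<or> \<sigma> i = (-1 :: real)) ==> norm (v + (\<Sum>i\<in>I. \<sigma> i *\<^sub>R x i)) <= B"
  and "!!i. i \<in> I ==> \<bar>\<theta> i\<bar> <= 1"
 shows "norm (v + (\<Sum>i\<in>I. \<theta> i *\<^sub>R x i)) <= B"
 using assms
proof (induction I arbitrary: v rule: finite_induct)
 case (insert j I)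
 have *: "norm (v + s *\<^sub>R x j + (\<Sum>i\<in>I. \<theta> i *\<^sub>R x i)) <= B" if s: "s = 1 \<or> s = -1" for s
 proof (rule insert.IH)
  fix \<sigma> assume \<sigma>: "!!i. i \<in> I ==> \<sigma> i = 1 \<or> \<sigma> i = (-1 :: real)"
  have eq: "(\<Sum>i\<in>I. (if i = j then s else \<sigma> i) *\<^sub>R x i) = (\<Sum>i\<in>I. \<sigma> i *\<^sub>R x i)"
   using insert.hyps by (intro sum.cong) auto
  have "norm (v + (\<Sum>i\<in>insert j I. (if i = j then s else \<sigma> i) *\<^sub>R x i)) <= B"
   by (rule insert.prems(1)) (use \<sigma> s in auto)
  then show "norm (v + s *\<^sub>R x j + (\<Sum>i\<in>I. \<sigma> i *\<^sub>R x i)) <= B"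
   using insert.hyps by (simp add: eq add.assoc)
 qed (use insert.prems in auto)
 define w where "w = (\<Sum>i\<in>I. \<theta> i *\<^sub>R x i)"
 define t where "t = (1 + \<theta> j) / 2"
 have t: "0 <= t" "t <= 1" using insert.prems(2)[of j] by (auto simp: t_def)
 have "v + (\<Sum>i\<in>insert j I. \<theta> i *\<^sub>R x i) = t *\<^sub>R (v + x j + w) + (1 - t) *\<^sub>R (v - x j + w)"
 proof -
  have "t *\<^sub>R (v + x j + w) + (1 - t) *\<^sub>R (v - x j + w) = (t + (1 - t)) *\<^sub>R (v + w) + (t - (1 - t)) *\<^sub>R x j"
   unfolding scaleR_add_left scaleR_left_diff_distrib scaleR_add_right scaleR_diff_right by simp
  then show ?thesis using insert.hyps by (simp add: w_def[symmetric] t_def add_ac)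
 qed
 also have "norm ... <= t * norm (v + x j + w) + (1 - t) * norm (v - x j + w)"
  using t by (intro order_trans[OF norm_triangle_ineq]) simp
 also have "... <= t * B + (1 - t) * B"
  using *[of 1] *[of "-1"] t by (intro add_mono mult_left_mono) (auto simp: w_def)
 finally show ?case by (simp add: algebra_simps)
qed simp

section \<open>The fundamental function of a spreading sequence\<close>

definition flat :: "(nat => 'a::real_normed_vector) => nat => real" where
 "flat e f = norm (\<Sum>i<f. e i)"

lemma spreading_restrict:
 assumes "spreading M e" "F \<subseteq> {..<M}"
 shows "norm (\<Sum>s\<in>F. a s *\<^sub>R e s) <= 2 * norm (\<Sum>s<M. a s *\<^sub>R e s)"
proof -
 note * = assms(1)[unfolded spreading_def, THEN conjunct1]
 show ?thesis by (rule mp[OF spec[OF spec[OF *, of a], of F] assms(2)])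
qed

lemma spreading_shift:
 fixes i j :: "nat => nat"
 assumes "spreading M e" "strict_mono_on {..<m} i" "strict_mono_on {..<m} j" "i ` {..<m} \<subseteq> {..<M}" "j ` {..<m} \<subseteq> {..<M}"
 shows "norm (\<Sum>s<m. a s *\<^sub>R e (i s)) <= 2 * norm (\<Sum>s<m. a s *\<^sub>R e (j s))"
proof -
 note * = assms(1)[unfolded spreading_def, THEN conjunct2]
 show ?thesis
  by (rule mp[OF spec[OF spec[OF spec[OF spec[OF *, of m], of i], of j], of a]]) (intro conjI assms(2-))
qed

text \<open>For signs, the positive and the negative indices each cost a factor 2 by restriction;
  convexity extends this to multipliers of modulus at most 1.\<close>

lemma spreading_signs:
 assumes e: "spreading M e" and \<theta>: "!!i. i < M ==> \<bar>\<theta> i\<bar> <= 1"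
 shows "norm (\<Sum>i<M. (\<theta> i * a i) *\<^sub>R e i) <= 4 * norm (\<Sum>i<M. a i *\<^sub>R e i)"
proof -
 have "norm (0 + (\<Sum>i<M. \<theta> i *\<^sub>R (a i *\<^sub>R e i))) <= 4 * norm (\<Sum>i<M. a i *\<^sub>R e i)"
 proof (rule norm_sum_contract)
  fix \<sigma> assume \<sigma>: "!!i. i \<in> {..<M} ==> \<sigma> i = 1 \<or> \<sigma> i = (-1 :: real)"
  let ?F = "{i. i < M \<and> \<sigma> i = 1}"
  let ?x = "%i. a i *\<^sub>R e i"
  have "(\<Sum>i<M. \<sigma> i *\<^sub>R ?x i) = (\<Sum>i\<in>?F. \<sigma> i *\<^sub>R ?x i) + (\<Sum>i\<in>{..<M} - ?F. \<sigma> i *\<^sub>R ?x i)"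
   by (subst sum.subset_diff[of ?F]) (auto simp: add.commute)
  also have "... = (\<Sum>i\<in>?F. ?x i) - (\<Sum>i\<in>{..<M} - ?F. ?x i)"
  proof -
   have "(\<Sum>i\<in>{..<M} - ?F. \<sigma> i *\<^sub>R ?x i) = (\<Sum>i\<in>{..<M} - ?F. - ?x i)"
    using \<sigma> by (intro sum.cong) force+
   moreover have "(\<Sum>i\<in>?F. \<sigma> i *\<^sub>R ?x i) = (\<Sum>i\<in>?F. ?x i)" by (intro sum.cong) auto
   ultimately show ?thesis by (simp add: sum_negf)
  qed
  also have "norm ... <= norm (\<Sum>i\<in>?F. ?x i) + norm (\<Sum>i\<in>{..<M} - ?F. ?x i)"
   by (rule norm_triangle_ineq4)
  also have "... <= 2 * norm (\<Sum>i<M. a i *\<^sub>R e i) + 2 * norm (\<Sum>i<M. a i *\<^sub>R e i)"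
   by (intro add_mono spreading_restrict[OF e]) auto
  finally show "norm (0 + (\<Sum>i<M. \<sigma> i *\<^sub>R ?x i)) <= 4 * norm (\<Sum>i<M. a i *\<^sub>R e i)" by simp
 qed (use \<theta> in auto)
 then show ?thesis by simp
qed

lemma spreading_enum:
 fixes F :: "nat set"
 assumes e: "spreading M e" and F: "F \<subseteq> {..<M}"
 obtains j where "strict_mono_on {..<card F} j" "bij_betw j {..<card F} F"
  "\<forall>b. norm (\<Sum>s<card F. b s *\<^sub>R e (j s)) <= 2 * norm (\<Sum>s<card F. b s *\<^sub>R e s)"
  "\<forall>b. norm (\<Sum>s<card F. b s *\<^sub>R e s) <= 2 * norm (\<Sum>s<card F. b s *\<^sub>R e (j s))"
proof -
 have fF: "finite F" using F by (rule finite_subset) simp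
 obtain j where j: "strict_mono_on {..<card F} j" "j ` {..<card F} = F" using finite_enumeration[OF fF] .
 have cF: "card F <= M" using card_mono[OF _ F] by simp
 have id: "strict_mono_on {..<card F} (%s. s)" "(%s. s) ` {..<card F} \<subseteq> {..<M}"
  using cF by (auto simp: strict_mono_on_def)
 have jM: "j ` {..<card F} \<subseteq> {..<M}" using j(2) F by simp
 show ?thesis
 proof (rule that[of j])
  show "bij_betw j {..<card F} F" using j strict_mono_on_imp_inj_on by (auto simp: bij_betw_def)
  show "\<forall>b. norm (\<Sum>s<card F. b s *\<^sub>R e (j s)) <= 2 * norm (\<Sum>s<card F. b s *\<^sub>R e s)"
   by (intro allI spreading_shift[OF e j(1) id(1) jM id(2)])
  show "\<forall>b. norm (\<Sum>s<card F. b s *\<^sub>R e s) <= 2 * norm (\<Sum>s<card F. b s *\<^sub>R e (j s))"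
   by (intro allI spreading_shift[OF e id(1) j(1) id(2) jM])
 qed (rule j(1))
qed

lemma flat_set:
 assumes e: "spreading M e" and F: "F \<subseteq> {..<M}"
 shows "norm (\<Sum>i\<in>F. e i) <= 2 * flat e (card F)" "flat e (card F) <= 2 * norm (\<Sum>i\<in>F. e i)"
proof -
 obtain j where j0: "strict_mono_on {..<card F} j" and j: "bij_betw j {..<card F} F"
  "\<forall>b. norm (\<Sum>s<card F. b s *\<^sub>R e (j s)) <= 2 * norm (\<Sum>s<card F. b s *\<^sub>R e s)"
  "\<forall>b. norm (\<Sum>s<card F. b s *\<^sub>R e s) <= 2 * norm (\<Sum>s<card F. b s *\<^sub>R e (j s))"
  by (rule spreading_enum[OF e F]) (rule that)
 have "(\<Sum>s<card F. e (j s)) = (\<Sum>i\<in>F. e i)" using j(1) by (rule sum.reindex_bij_betw)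
 then show "norm (\<Sum>i\<in>F. e i) <= 2 * flat e (card F)" "flat e (card F) <= 2 * norm (\<Sum>i\<in>F. e i)"
  using j(2)[rule_format, of "%_. 1"] j(3)[rule_format, of "%_. 1"] by (simp_all add: flat_def)
qed

lemma flat_mono:
 assumes e: "spreading M e" and "f <= g" "g <= M"
 shows "flat e f <= 2 * flat e g"
proof -
 have "norm (\<Sum>s\<in>{..<f}. (if s < g then 1 else 0) *\<^sub>R e s) <= 2 * norm (\<Sum>s<M. (if s < g then 1 else 0) *\<^sub>R e s)"
  using assms by (intro spreading_restrict[OF e]) auto
 also have "(\<Sum>s<M. (if s < g then 1 else 0) *\<^sub>R e s) = (\<Sum>s<g. e s)"
  using assms by (intro sum.mono_neutral_cong_right) auto
 also have "(\<Sum>s\<in>{..<f}. (if s < g then 1 else 0) *\<^sub>R e s) = (\<Sum>s<f. e s)"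
  using assms by (intro sum.cong) auto
 finally show ?thesis by (simp add: flat_def)
qed

text \<open>Averaging the cyclic shifts of a coefficient sequence produces constant coefficients.\<close>

lemma flat_dual:
 assumes e: "spreading M e" and F: "F \<subseteq> {..<M}"
 shows "(\<Sum>i\<in>F. \<bar>a i\<bar>) * flat e (card F) <= 64 * real (card F) * norm (\<Sum>i<M. a i *\<^sub>R e i)"
proof -
 define f where "f = card F"
 have fF: "finite F" using F by (rule finite_subset) simp
 have fM: "f <= M" using card_mono[OF _ F] by (simp add: f_def)
 obtain j where j': "strict_mono_on {..<card F} j" "bij_betw j {..<card F} F"
  "\<forall>b. norm (\<Sum>s<card F. b s *\<^sub>R e (j s)) <= 2 * norm (\<Sum>s<card F. b s *\<^sub>R e s)"
  "\<forall>b. norm (\<Sum>s<card F. b s *\<^sub>R e s) <= 2 * norm (\<Sum>s<card F. b s *\<^sub>R e (j s))"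
  by (rule spreading_enum[OF e F]) (rule that)
 note j1 = j'(2)[folded f_def] and j3 = j'(4)[folded f_def]
 define b where "b s = \<bar>a (j s)\<bar>" for s
 define v where "v = (\<Sum>s<f. b s *\<^sub>R e s)"
 have "norm v <= 2 * norm (\<Sum>s<f. b s *\<^sub>R e (j s))" unfolding v_def by (rule j3[rule_format])
 also have "(\<Sum>s<f. b s *\<^sub>R e (j s)) = (\<Sum>i\<in>F. \<bar>a i\<bar> *\<^sub>R e i)"
  unfolding b_def using j1 by (rule sum.reindex_bij_betw)
 also have "... = (\<Sum>i<M. ((if i \<in> F then sgn (a i) else 0) * a i) *\<^sub>R e i)"
  using F by (intro sum.mono_neutral_cong_left) (auto simp: abs_sgn mult.commute)
 also have "2 * norm ... <= 2 * (4 * norm (\<Sum>i<M. a i *\<^sub>R e i))"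
  by (intro mult_left_mono spreading_signs[OF e]) (auto simp: abs_sgn_eq)
 finally have v: "norm v <= 8 * norm (\<Sum>i<M. a i *\<^sub>R e i)" by simp
 have vF: "norm (\<Sum>s\<in>G. b s *\<^sub>R e s) <= 2 * norm v" if "G \<subseteq> {..<f}" for G
 proof -
  have "norm (\<Sum>s\<in>G. (if s < f then b s else 0) *\<^sub>R e s) <= 2 * norm (\<Sum>s<M. (if s < f then b s else 0) *\<^sub>R e s)"
   using that fM by (intro spreading_restrict[OF e]) auto
  also have "(\<Sum>s<M. (if s < f then b s else 0) *\<^sub>R e s) = v"
   unfolding v_def using fM by (intro sum.mono_neutral_cong_right) auto
  also have "(\<Sum>s\<in>G. (if s < f then b s else 0) *\<^sub>R e s) = (\<Sum>s\<in>G. b s *\<^sub>R e s)"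
   using that by (intro sum.cong) auto
  finally show ?thesis .
 qed
 have move: "norm (\<Sum>s<m. b (s + p) *\<^sub>R e (s + q)) <= 4 * norm v" if "m + p <= f" "m + q <= f" for m p q
 proof -
  have "norm (\<Sum>s<m. b (s + p) *\<^sub>R e (s + q)) <= 2 * norm (\<Sum>s<m. b (s + p) *\<^sub>R e (s + p))"
   using that fM by (intro spreading_shift[OF e]) (auto simp: strict_mono_on_def)
  also have "(\<Sum>s<m. b (s + p) *\<^sub>R e (s + p)) = (\<Sum>s\<in>{p..<p + m}. b s *\<^sub>R e s)"
   using sum.shift_bounds_nat_ivl[of "%s. b s *\<^sub>R e s" 0 p m] by (simp add: atLeast0LessThan add.commute)
  also have "2 * norm ... <= 2 * (2 * norm v)"
   using that by (intro mult_left_mono vF) auto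
  finally show ?thesis by simp
 qed
 \<comment> \<open>The coefficients rotated by \<open>\<tau>\<close>. Cut where the rotation wraps
   around, this is two shifted parts of \<open>v\<close>, each of norm at most
   \<open>4 * norm v\<close>: a factor 2 for the shift and 2 for the restriction. With the factor 8
   in the bound of \<open>v\<close> this gives 64.\<close>
 define w where "w \<tau> = (\<Sum>s<f. b ((s + \<tau>) mod f) *\<^sub>R e s)" for \<tau>
 have w: "norm (w \<tau>) <= 8 * norm v" if \<tau>: "\<tau> < f" for \<tau>
 proof -
  have "w \<tau> = (\<Sum>s<f - \<tau>. b ((s + \<tau>) mod f) *\<^sub>R e s) + (\<Sum>s\<in>{f - \<tau>..<f}. b ((s + \<tau>) mod f) *\<^sub>R e s)"
   unfolding w_def using sum.atLeastLessThan_concat[of 0 "f - \<tau>" f "%s. b ((s + \<tau>) mod f) *\<^sub>R e s"]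
   by (simp add: atLeast0LessThan)
  also have "(\<Sum>s<f - \<tau>. b ((s + \<tau>) mod f) *\<^sub>R e s) = (\<Sum>s<f - \<tau>. b (s + \<tau>) *\<^sub>R e (s + 0))"
   by (intro sum.cong) auto
  also have "(\<Sum>s\<in>{f - \<tau>..<f}. b ((s + \<tau>) mod f) *\<^sub>R e s) = (\<Sum>s<\<tau>. b (s + 0) *\<^sub>R e (s + (f - \<tau>)))"
  proof -
   have "(\<Sum>s\<in>{0 + (f - \<tau>)..<\<tau> + (f - \<tau>)}. b ((s + \<tau>) mod f) *\<^sub>R e s) =
     (\<Sum>s\<in>{0..<\<tau>}. b ((s + (f - \<tau>) + \<tau>) mod f) *\<^sub>R e (s + (f - \<tau>)))"
    by (rule sum.shift_bounds_nat_ivl)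
   also have "... = (\<Sum>s\<in>{0..<\<tau>}. b (s + 0) *\<^sub>R e (s + (f - \<tau>)))"
    using \<tau> by (intro sum.cong) (auto simp: add.assoc)
   finally show ?thesis using \<tau> by (simp add: atLeast0LessThan)
  qed
  also have "norm ((\<Sum>s<f - \<tau>. b (s + \<tau>) *\<^sub>R e (s + 0)) + (\<Sum>s<\<tau>. b (s + 0) *\<^sub>R e (s + (f - \<tau>)))) <= 4 * norm v + 4 * norm v"
   using \<tau> by (intro norm_triangle_le add_mono move) auto
  finally show ?thesis by simp
 qed
 have rot: "(\<Sum>\<tau><f. b ((s + \<tau>) mod f)) = (\<Sum>\<tau><f. b \<tau>)" if s: "s \<in> {..<f}" for s
 proof -
  have "bij_betw (%\<tau>. (s + \<tau>) mod f) {..<f} {..<f}"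
  proof (rule bij_betwI[where g = "%\<tau>. (\<tau> + (f - s)) mod f"])
   show "((s + \<tau>) mod f + (f - s)) mod f = \<tau>" if "\<tau> \<in> {..<f}" for \<tau>
   proof -
    have "((s + \<tau>) mod f + (f - s)) mod f = (s + \<tau> + (f - s)) mod f" by (rule mod_add_left_eq)
    also have "s + \<tau> + (f - s) = \<tau> + f" using s by simp
    finally show ?thesis using that by simp
   qed
   show "(s + (\<tau> + (f - s)) mod f) mod f = \<tau>" if "\<tau> \<in> {..<f}" for \<tau>
   proof -
    have "(s + (\<tau> + (f - s)) mod f) mod f = (s + (\<tau> + (f - s))) mod f" by (rule mod_add_right_eq)
    also have "s + (\<tau> + (f - s)) = \<tau> + f" using s by simp
    finally show ?thesis using that by simp
   qed
  qed (use s in auto)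
  then show ?thesis by (rule sum.reindex_bij_betw)
 qed
 have "(\<Sum>\<tau><f. w \<tau>) = (\<Sum>s<f. (\<Sum>\<tau><f. b ((s + \<tau>) mod f)) *\<^sub>R e s)"
  unfolding w_def by (subst sum.swap) (simp add: scaleR_sum_left)
 also have "... = (\<Sum>s<f. (\<Sum>\<tau><f. b \<tau>) *\<^sub>R e s)"
  using rot by simp
 finally have "(\<Sum>\<tau><f. b \<tau>) * flat e f = norm (\<Sum>\<tau><f. w \<tau>)"
  by (simp add: flat_def b_def sum_nonneg flip: scaleR_sum_right)
 also have "... <= real f * (8 * norm v)"
  using sum_norm_le[of "{..<f}" w "%_. 8 * norm v"] w by simp
 also have "... <= real f * (8 * (8 * norm (\<Sum>i<M. a i *\<^sub>R e i)))"
  using v by (intro mult_left_mono) auto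
 also have "(\<Sum>\<tau><f. b \<tau>) = (\<Sum>i\<in>F. \<bar>a i\<bar>)"
  unfolding b_def using j1 by (rule sum.reindex_bij_betw)
 finally show ?thesis by (simp add: f_def)
qed

section \<open>Convexity inequalities for powers\<close>

lemma powr_tangent:
 fixes t \<alpha> :: real
 assumes "0 <= t" "0 < \<alpha>" "\<alpha> <= 1"
 shows "t powr \<alpha> <= \<alpha> * t + (1 - \<alpha>)"
proof (cases "t = 0")
 case True then show ?thesis using assms by simp
next
 case False
 have "exp ((1 - \<alpha>) *\<^sub>R 0 + \<alpha> *\<^sub>R ln t) <= (1 - \<alpha>) * exp 0 + \<alpha> * exp (ln t)"
  using assms by (intro convex_onD[OF exp_convex]) auto
 then show ?thesis using False assms by (simp add: powr_def algebra_simps)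
qed

text \<open>Jensen's inequality for a concave power, from the tangent at the mean
  \<open>S\<close>.\<close>

lemma sign_avg_powr_le:
 assumes "finite I" "0 < \<alpha>" "\<alpha> <= 1" "!!\<xi>. \<xi> \<in> signs I ==> 0 <= f \<xi>"
 shows "sign_avg I (%\<xi>. f \<xi> powr \<alpha>) <= sign_avg I f powr \<alpha>"
proof (cases "sign_avg I f = 0")
 case True
 then have "sum f (signs I) = 0" by (simp add: sign_avg_def)
 then have "f \<xi> = 0" if "\<xi> \<in> signs I" for \<xi>
  using assms that by (subst (asm) sum_nonneg_eq_0_iff) auto
 then show ?thesis by (simp add: sign_avg_def)
next
 case False
 define S where "S = sign_avg I f"
 have S: "S > 0" using False sign_avg_nonneg[of I f] assms by (simp add: S_def order.not_eq_order_implies_strict)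
 have "f \<xi> powr \<alpha> <= S powr \<alpha> * (\<alpha> / S) * f \<xi> + S powr \<alpha> * (1 - \<alpha>)" if "\<xi> \<in> signs I" for \<xi>
 proof -
  have "(f \<xi> / S) powr \<alpha> <= \<alpha> * (f \<xi> / S) + (1 - \<alpha>)"
   using assms that S by (intro powr_tangent) auto
  then have "S powr \<alpha> * (f \<xi> / S) powr \<alpha> <= S powr \<alpha> * (\<alpha> * (f \<xi> / S) + (1 - \<alpha>))"
   by (intro mult_left_mono) auto
  moreover have "S powr \<alpha> * (f \<xi> / S) powr \<alpha> = f \<xi> powr \<alpha>"
   using S by (simp flip: powr_mult)
  ultimately show ?thesis by (simp add: algebra_simps)
 qed
 then have "sign_avg I (%\<xi>. f \<xi> powr \<alpha>) <= sign_avg I (%\<xi>. S powr \<alpha> * (\<alpha> / S) * f \<xi> + S powr \<alpha> * (1 - \<alpha>))"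
  using assms by (intro sign_avg_mono) auto
 also have "... = S powr \<alpha>"
  by (subst sign_avg_add, subst sign_avg_cmult, subst sign_avg_const)
    (use S assms in \<open>auto simp: S_def[symmetric] algebra_simps\<close>)
 finally show ?thesis by (simp add: S_def)
qed

text \<open>The sharp constant matters: for pair sums it leads to the factor
  \<open>2 powr (1 - 2 / p)\<close>, which is below 1 for \<open>p < 2\<close>, whereas the crude
  \<open>2 powr p\<close> would give \<open>2 powr (1 - 1 / p)\<close>, which is never below
  1.\<close>

lemma powr_add_le:
 fixes a b p :: real
 assumes "0 <= a" "0 <= b" "1 <= p"
 shows "(a + b) powr p <= 2 powr (p - 1) * (a powr p + b powr p)"
proof -
 define s where "s = (a powr p + b powr p) / 2"
 have "x <= s powr (1/p) * ((1/p) * (x powr p / s) + (1 - 1/p))" if "0 <= x" "s > 0" for x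
 proof -
  have "(x powr p / s) powr (1/p) <= (1/p) * (x powr p / s) + (1 - 1/p)"
   using that assms by (intro powr_tangent) auto
  then have "s powr (1/p) * (x powr p / s) powr (1/p) <= s powr (1/p) * ((1/p) * (x powr p / s) + (1 - 1/p))"
   by (intro mult_left_mono) auto
  moreover have "s powr (1/p) * (x powr p / s) powr (1/p) = x"
   using that assms by (simp add: powr_powr flip: powr_mult)
  ultimately show ?thesis by simp
 qed note tangent = this
 show ?thesis
 proof (cases "s > 0")
  case False
  then have "a powr p + b powr p <= 0" by (simp add: s_def)
  then have "a powr p = 0" "b powr p = 0"
   using powr_ge_zero[of a p] powr_ge_zero[of b p] by linarith+
  then show ?thesis by simp
 next
  case True
  have "a + b <= s powr (1/p) * ((1/p) * (a powr p / s) + (1 - 1/p)) + s powr (1/p) * ((1/p) * (b powr p / s) + (1 - 1/p))"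
   using True assms by (intro add_mono tangent) auto
  also have "... = s powr (1/p) * ((1/p) * ((a powr p + b powr p) / s) + 2 * (1 - 1/p))"
   by (simp add: algebra_simps add_divide_distrib)
  also have "(a powr p + b powr p) / s = 2"
  proof -
   have "a powr p + b powr p = 2 * s" by (simp add: s_def)
   then show ?thesis using True by simp
  qed
  also have "s powr (1/p) * ((1/p) * 2 + 2 * (1 - 1/p)) = 2 * s powr (1/p)"
   using assms by (simp add: field_simps)
  finally have "(a + b) powr p <= (2 * s powr (1/p)) powr p"
   using assms by (intro powr_mono2) auto
  also have "... = 2 powr p * s" using True assms by (simp add: powr_mult powr_powr)
  also have "... = 2 powr (p - 1) * (a powr p + b powr p)"
   by (simp add: s_def powr_diff)
  finally show ?thesis .
 qed
qed

text \<open>Minkowski's integral inequality: the norm of an average is at most the average of the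
  norms.\<close>

lemma lp_avg_le:
 fixes y :: "'e => 'j => real"
 assumes r: "r \<ge> 1" and fin: "finite I" "finite J" and y: "!!\<xi> j. 0 <= f \<xi> j"
 shows "(\<Sum>j\<in>J. sign_avg I (%\<xi>. f \<xi> j) powr r) powr (1 / r) <= sign_avg I (%\<xi>. (\<Sum>j\<in>J. f \<xi> j powr r) powr (1 / r))"
proof -
 define m where "m j = sign_avg I (%\<xi>. f \<xi> j)" for j
 have m: "m j \<ge> 0" for j unfolding m_def using y by (intro sign_avg_nonneg) auto
 define B where "B = (\<Sum>j\<in>J. m j powr r) powr (1 / r)"
 define N where "N \<xi> = (\<Sum>j\<in>J. f \<xi> j powr r) powr (1 / r)" for \<xi>
 have N0: "N \<xi> \<ge> 0" for \<xi> by (simp add: N_def)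
 have Br: "B powr r = (\<Sum>j\<in>J. m j powr r)" using r by (simp add: B_def powr_powr sum_nonneg)
 have Nr: "N \<xi> powr r = (\<Sum>j\<in>J. f \<xi> j powr r)" for \<xi> using r by (simp add: N_def powr_powr sum_nonneg)
 show ?thesis
 proof (cases "B = 0")
  case True then show ?thesis using N0 sign_avg_nonneg[of I N] by (simp add: B_def m_def N_def[abs_def])
 next
  case False
  then have B: "B > 0" by (simp add: B_def order.not_eq_order_implies_strict)
  \<comment> \<open>Hoelder's inequality against the weights \<open>m j powr (r - 1)\<close>, proved
    term by term from the tangent bound after normalising both sides.\<close>
  have holder: "(\<Sum>j\<in>J. m j powr (r - 1) * f \<xi> j) <= B powr (r - 1) * N \<xi>" for \<xi>
  proof (cases "N \<xi> = 0")
   case True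
   then have "(\<Sum>j\<in>J. f \<xi> j powr r) = 0" using Nr[of \<xi>] r by simp
   then have "f \<xi> j = 0" if "j \<in> J" for j
    using that fin by (subst (asm) sum_nonneg_eq_0_iff) auto
   then show ?thesis using True by simp
  next
   case False
   then have N: "N \<xi> > 0" using N0[of \<xi>] by linarith
   have "m j powr (r - 1) * f \<xi> j <= B powr (r - 1) * N \<xi> * ((1 / r) * (f \<xi> j powr r / N \<xi> powr r) + (1 - 1/r) * (m j powr r / B powr r))"
    (is "_ <= _ * ?R") for j
   proof (cases "m j = 0")
    case True
    then show ?thesis using r N y by (cases "r = 1") (auto simp: powr_0 divide_simps)
   next
    case False
    then have mj: "m j > 0" using m[of j] by linarith
    define a where "a = f \<xi> j powr r / N \<xi> powr r"
    define b where "b = m j powr r / B powr r"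
    have ab: "a \<ge> 0" "b > 0" using mj B by (auto simp: a_def b_def)
    have "(a / b) powr (1/r) <= (1/r) * (a / b) + (1 - 1/r)"
     using ab r by (intro powr_tangent) auto
    then have "b * (a / b) powr (1/r) <= b * ((1/r) * (a / b) + (1 - 1/r))"
     using ab by (intro mult_left_mono) auto
    also have "... = ?R" using ab by (simp add: a_def[symmetric] b_def[symmetric] field_simps)
    also have "b * (a / b) powr (1/r) = a powr (1/r) * (b * b powr (- (1/r)))"
     using ab by (simp add: powr_divide powr_minus field_simps)
    also have "b * b powr (- (1/r)) = b powr (1 - 1/r)"
     using ab by (simp add: powr_diff powr_minus field_simps)
    also have "a powr (1/r) = f \<xi> j / N \<xi>"
     using N y r by (simp add: a_def powr_divide powr_powr)
    also have "b powr (1 - 1/r) = m j powr (r - 1) / B powr (r - 1)"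
     using mj B r by (simp add: b_def powr_divide powr_powr algebra_simps)
    finally show ?thesis using N B by (simp add: field_simps)
   qed
   then have "(\<Sum>j\<in>J. m j powr (r - 1) * f \<xi> j) <=
    (\<Sum>j\<in>J. B powr (r - 1) * N \<xi> * ((1 / r) * (f \<xi> j powr r / N \<xi> powr r) + (1 - 1/r) * (m j powr r / B powr r)))"
    by (intro sum_mono)
   also have "... = B powr (r - 1) * N \<xi> * ((1 / r) * (N \<xi> powr r / N \<xi> powr r) + (1 - 1/r) * (B powr r / B powr r))"
    by (simp only: sum_distrib_left[symmetric] sum.distrib sum_divide_distrib[symmetric] Br Nr)
   also have "... = B powr (r - 1) * N \<xi>" using B N by simp
   finally show ?thesis .
  qed
  have "B powr (r - 1) * B = B powr r" using B by (simp add: powr_diff)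
  also have "... = (\<Sum>j\<in>J. m j powr (r - 1) * m j)"
   unfolding Br using m r by (intro sum.cong refl) (auto simp: powr_diff less_eq_real_def)
  also have "... = sign_avg I (%\<xi>. \<Sum>j\<in>J. m j powr (r - 1) * f \<xi> j)"
   by (simp add: sign_avg_sum sign_avg_cmult m_def)
  also have "... <= sign_avg I (%\<xi>. B powr (r - 1) * N \<xi>)"
   using holder fin by (intro sign_avg_mono) auto
  also have "... = B powr (r - 1) * sign_avg I N" by (rule sign_avg_cmult)
  finally have "B <= sign_avg I N" using B by simp
  then show ?thesis by (simp add: B_def m_def N_def[abs_def])
 qed
qed

section \<open>Extracting spreading sequences from a failing exponent\<close>

lemma block_index:
 assumes "block_decomp n x L l \<delta> R m \<kappa> \<H> W"
 obtains \<phi> where "inj_on \<phi> (\<H> \<times> {..<L})" "\<phi> ` (\<H> \<times> {..<L}) = \<Union>\<H>"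
  "!!H. H \<in> \<H> ==> strict_mono_on {..<L} (%s. \<phi> (H, s))"
  "!!H. H \<in> \<H> ==> (%s. \<phi> (H, s)) ` {..<L} = H"
proof -
 have L: "card H = L" if "H \<in> \<H>" for H using assms that by (simp add: block_decomp_def)
 have fin: "finite H" if "H \<in> \<H>" for H
 proof (rule finite_subset)
  show "H \<subseteq> {..<n}" using assms that by (auto simp: block_decomp_def)
 qed simp
 have "\<exists>h. strict_mono_on {..<L} h \<and> h ` {..<L} = H" if "H \<in> \<H>" for H
  using finite_enumeration[OF fin[OF that]] L[OF that] by metis
 then obtain h where h: "!!H. H \<in> \<H> ==> strict_mono_on {..<L} (h H)" "!!H. H \<in> \<H> ==> h H ` {..<L} = H"
  by metis
 have inj: "inj_on (%(H, s). h H s) (\<H> \<times> {..<L})"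
 proof (rule inj_onI, clarify)
  fix H s H' s' assume *: "H \<in> \<H>" "s < L" "H' \<in> \<H>" "s' < L" "h H s = h H' s'"
  have "h H s \<in> H" "h H' s' \<in> H'" using h(2) * by blast+
  moreover have "disjoint \<H>" using assms by (simp add: block_decomp_def)
  ultimately have "H = H'" using * by (metis disjoint_iff disjointD)
  then show "H = H' \<and> s = s'"
   using * strict_mono_on_imp_inj_on[OF h(1)[OF *(1)]] by (auto simp: inj_on_def)
 qed
 show ?thesis
 proof (rule that[of "%(H, s). h H s"])
  have "(%(H, s). h H s) ` (\<H> \<times> {..<L}) = (\<Union>H\<in>\<H>. h H ` {..<L})" by fast
  then show "(%(H, s). h H s) ` (\<H> \<times> {..<L}) = \<Union>\<H>" using h(2) by simp
 qed (use inj h in auto)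
qed

lemma group_preimage:
 assumes "H \<in> \<H>" "t < (N :: nat)" "k > 0"
 shows "{q \<in> \<H> \<times> {..<k * N}. (fst q, snd q div k) = (H, t)} = (%r. (H, t * k + r)) ` {..<k}"
proof (intro set_eqI iffI)
 fix q assume q: "q \<in> {q \<in> \<H> \<times> {..<k * N}. (fst q, snd q div k) = (H, t)}"
 then have "q = (H, t * k + snd q mod k)"
  using div_mult_mod_eq[of "snd q" k] by (auto simp: prod_eq_iff)
 then show "q \<in> (%r. (H, t * k + r)) ` {..<k}" using assms by (metis image_eqI lessThan_iff mod_less_divisor)
next
 fix q assume "q \<in> (%r. (H, t * k + r)) ` {..<k}"
 then obtain r where r: "q = (H, t * k + r)" "r < k" by auto
 have "t * k + r < Suc t * k" using r by simp
 also have "... <= N * k" using assms by (intro mult_le_mono1) simp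
 finally show "q \<in> {q \<in> \<H> \<times> {..<k * N}. (fst q, snd q div k) = (H, t)}"
  using r assms by (simp add: mult.commute)
qed

text \<open>Restricting to the indices of sign -1 is half the sum of the family and a copy with
  changed signs; both have the same average.\<close>

lemma rad_half_le:
 assumes "finite Q" "!!q. q \<in> Q ==> \<theta> q = 1 \<or> \<theta> q = (-1 :: real)"
 shows "rad Q (%q. if \<theta> q = -1 then d q else 0) <= rad Q d"
proof -
 have "rad Q (%q. if \<theta> q = -1 then d q else 0) = rad Q (%q. (1/2) *\<^sub>R d q + (1/2) *\<^sub>R ((- \<theta> q) *\<^sub>R d q))"
 proof (rule rad_cong)
  fix q assume "q \<in> Q"
  then show "(if \<theta> q = -1 then d q else 0) = (1/2) *\<^sub>R d q + (1/2) *\<^sub>R ((- \<theta> q) *\<^sub>R d q)"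
   using assms(2)[of q] scaleR_half_double[of "d q"] by (auto simp flip: scaleR_add_right)
 qed
 also have "... <= rad Q (%q. (1/2) *\<^sub>R d q) + rad Q (%q. (1/2) *\<^sub>R ((- \<theta> q) *\<^sub>R d q))"
  using assms by (intro rad_triangle)
 also have "... <= (1/2) * rad Q d + (1/2) * rad Q (%q. (- \<theta> q) *\<^sub>R d q)"
  using assms by (intro add_mono rad_bounded_linear) (auto intro!: linearI simp: scaleR_add_right)
 also have "rad Q (%q. (- \<theta> q) *\<^sub>R d q) = rad Q d"
  unfolding rad_def using assms by (intro lin_avg_flip) force+
 finally show ?thesis by simp
qed

text \<open>For \<open>p < 2\<close> the sums \<open>x + y\<close> of the pairs cannot account for the type constant, since each of
 them occurs only for half of the signs; hence the differences do.\<close>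

lemma rad_differences_ge:
 fixes x :: "nat => 'a::real_normed_vector"
 assumes ty: "type_bound Y p n A" and p: "1 <= p" and A: "A \<ge> 0"
  and Q: "finite Q" "inj_on a Q" "inj_on b Q" "a ` Q \<inter> b ` Q = {}" "card Q <= n"
  and Y: "subspace Y" "!!q. q \<in> Q ==> x (a q) \<in> Y" "!!q. q \<in> Q ==> x (b q) \<in> Y"
 shows "rad (a ` Q \<union> b ` Q) x <= A * (2 powr (1 - 2 / p) * lp (a ` Q \<union> b ` Q) p x) + rad Q (%q. x (a q) - x (b q))"
proof -
 define d where "d q = x (a q) - x (b q)" for q
 define s where "s q = x (a q) + x (b q)" for q
 define I where "I = a ` Q \<union> b ` Q"
 \<comment> \<open>For fixed relative signs the pairs with \<open>\<theta> q = 1\<close> enter as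
   sums and the others as differences. The type bound is spent on the sums only; on average over
   \<open>\<theta>\<close> half of them are present.\<close>
 have one: "rad Q (%q. x (a q) + \<theta> q *\<^sub>R x (b q)) <= A * (\<Sum>q\<in>Q. (1 + \<theta> q) / 2 * norm (s q) powr p) powr (1 / p) + rad Q d"
  if \<theta>: "\<theta> \<in> signs Q" for \<theta>
 proof -
  have \<theta>q: "\<theta> q = 1 \<or> \<theta> q = -1" if "q \<in> Q" for q using \<theta> that by (rule signs_cases)
  have "rad Q (%q. x (a q) + \<theta> q *\<^sub>R x (b q)) = rad Q (%q. (if \<theta> q = 1 then s q else 0) + (if \<theta> q = -1 then d q else 0))"
   using \<theta>q by (intro rad_cong) (force simp: s_def d_def)
  also have "... <= rad Q (%q. if \<theta> q = 1 then s q else 0) + rad Q (%q. if \<theta> q = -1 then d q else 0)"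
   using Q by (intro rad_triangle)
  also have "... <= A * lp Q p (%q. if \<theta> q = 1 then s q else 0) + rad Q d"
   using Q Y \<theta>q by (intro add_mono rad_half_le type_boundD[OF ty]) (auto simp: s_def subspace_add subspace_0)
  also have "lp Q p (%q. if \<theta> q = 1 then s q else 0) = (\<Sum>q\<in>Q. (1 + \<theta> q) / 2 * norm (s q) powr p) powr (1 / p)"
   unfolding lp_def by (intro arg_cong2[of _ _ _ _ "(powr)"] refl sum.cong) (use \<theta>q in force)
  finally show ?thesis .
 qed
 have avg: "sign_avg Q (%\<theta>. \<Sum>q\<in>Q. (1 + \<theta> q) / 2 * norm (s q) powr p) = (\<Sum>q\<in>Q. norm (s q) powr p) / 2"
 proof -
  have z: "sign_avg Q (%\<theta>. \<theta> q) = 0" if "q \<in> Q" for q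
  proof -
   have "sign_avg (insert q (Q - {q})) (%\<theta>. \<theta> q) = 0"
    using Q by (subst sign_avg_insert) auto
   then show ?thesis using that by (simp add: insert_absorb)
  qed
  have "sign_avg Q (%\<theta>. (1 + \<theta> q) / 2 * norm (s q) powr p) = norm (s q) powr p / 2" if "q \<in> Q" for q
  proof -
   have "sign_avg Q (%\<theta>. (1 + \<theta> q) / 2 * norm (s q) powr p) =
     sign_avg Q (%\<theta>. norm (s q) powr p / 2 + norm (s q) powr p / 2 * \<theta> q)"
    by (intro sign_avg_cong) (simp add: field_simps)
   also have "... = norm (s q) powr p / 2"
    using Q z[OF that] by (simp only: sign_avg_add sign_avg_cmult sign_avg_const)
   finally show ?thesis .
  qed
  then have "(\<Sum>q\<in>Q. sign_avg Q (%\<theta>. (1 + \<theta> q) / 2 * norm (s q) powr p)) = (\<Sum>q\<in>Q. norm (s q) powr p / 2)"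
   by (rule sum.cong[OF refl])
  then show ?thesis unfolding sign_avg_sum sum_divide_distrib .
 qed
 have key: "((\<Sum>q\<in>Q. norm (s q) powr p) / 2) powr (1 / p) <= 2 powr (1 - 2 / p) * lp I p x"
 proof -
  have "norm (s q) powr p <= 2 powr (p - 1) * (norm (x (a q)) powr p + norm (x (b q)) powr p)" for q
  proof -
   have "norm (s q) powr p <= (norm (x (a q)) + norm (x (b q))) powr p"
    unfolding s_def using p by (intro powr_mono2 norm_triangle_ineq) auto
   also have "... <= 2 powr (p - 1) * (norm (x (a q)) powr p + norm (x (b q)) powr p)"
    using p by (intro powr_add_le) auto
   finally show ?thesis .
  qed
  then have "(\<Sum>q\<in>Q. norm (s q) powr p) <= (\<Sum>q\<in>Q. 2 powr (p - 1) * (norm (x (a q)) powr p + norm (x (b q)) powr p))"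
   by (intro sum_mono)
  also have "... = 2 powr (p - 1) * (\<Sum>i\<in>I. norm (x i) powr p)"
   using Q by (simp add: I_def sum.union_disjoint sum.reindex sum.distrib flip: sum_distrib_left)
  also have "... = 2 powr (p - 1) * lp I p x powr p" using p by (simp add: lp_powr)
  finally have "(\<Sum>q\<in>Q. norm (s q) powr p) / 2 <= 2 powr (p - 2) * lp I p x powr p"
   by (simp add: powr_diff)
  then have "((\<Sum>q\<in>Q. norm (s q) powr p) / 2) powr (1 / p) <= (2 powr (p - 2) * lp I p x powr p) powr (1 / p)"
   using p by (intro powr_mono2) (auto intro!: sum_nonneg)
  also have "... = 2 powr (1 - 2 / p) * lp I p x"
   using p by (simp add: powr_mult powr_powr diff_divide_distrib)
  finally show ?thesis .
 qed
 have "rad I x = sign_avg Q (%\<theta>. rad Q (%q. x (a q) + \<theta> q *\<^sub>R x (b q)))"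
  unfolding rad_def I_def using Q by (intro lin_avg_pairs)
 also have "... <= sign_avg Q (%\<theta>. A * (\<Sum>q\<in>Q. (1 + \<theta> q) / 2 * norm (s q) powr p) powr (1 / p) + rad Q d)"
  using one Q by (intro sign_avg_mono)
 also have "... = A * sign_avg Q (%\<theta>. (\<Sum>q\<in>Q. (1 + \<theta> q) / 2 * norm (s q) powr p) powr (1 / p)) + rad Q d"
  using Q by (simp only: sign_avg_add sign_avg_cmult sign_avg_const)
 also have "... <= A * ((\<Sum>q\<in>Q. norm (s q) powr p) / 2) powr (1 / p) + rad Q d"
  unfolding avg[symmetric] using Q p A
  by (intro add_right_mono mult_left_mono sign_avg_powr_le) (auto intro!: sum_nonneg mult_nonneg_nonneg dest: signs_cases)
 also have "... <= A * (2 powr (1 - 2 / p) * lp I p x) + rad Q d"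
  using key A by (intro add_right_mono mult_left_mono)
 finally show ?thesis by (simp add: I_def d_def[abs_def])
qed

lemma exists_group_ge:
 fixes f h :: "'j => real"
 assumes "finite J" "(\<Sum>j\<in>J. f j) <= (\<Sum>j\<in>J. h j)" "J ~= {}"
 obtains j where "j \<in> J" "f j <= h j"
 using assms by (metis linorder_not_le sum_strict_mono)

lemma spreading_normalize:
 assumes d: "spreading M d" and nz: "d 0 ~= 0"
 defines "e \<equiv> %s. (1 / norm (d 0)) *\<^sub>R d s"
 shows "spreading M e" "norm (e 0) = 1" "flat e k = flat d k / norm (d 0)"
proof -
 show "spreading M e" unfolding e_def using d by (rule spreading_scale)
 show "norm (e 0) = 1" using nz by (simp add: e_def)
 have "(\<Sum>i<k. e i) = (1 / norm (d 0)) *\<^sub>R (\<Sum>i<k. d i)" by (simp add: e_def scaleR_sum_right)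
 then show "flat e k = flat d k / norm (d 0)" by (simp add: flat_def)
qed

lemma spreading_signs_flat:
 assumes d: "spreading M d" and "k <= M" "!!i. i < k ==> \<xi> i = 1 \<or> \<xi> i = (-1 :: real)"
 shows "norm (\<Sum>i<k. \<xi> i *\<^sub>R d i) <= 4 * flat d k" "flat d k <= 4 * norm (\<Sum>i<k. \<xi> i *\<^sub>R d i)"
proof -
 have ext: "(\<Sum>i<M. (if i < k then f i else 0) *\<^sub>R d i) = (\<Sum>i<k. f i *\<^sub>R d i)" for f :: "nat => real"
  using assms by (intro sum.mono_neutral_cong_right) auto
 have ab: "\<bar>if i < k then \<xi> i else 0\<bar> <= 1" for i using assms(3)[of i] by auto
 have "norm (\<Sum>i<M. ((if i < k then \<xi> i else 0) * (if i < k then 1 else 0)) *\<^sub>R d i)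
   <= 4 * norm (\<Sum>i<M. (if i < k then 1 else 0) *\<^sub>R d i)"
  by (intro spreading_signs[OF d] ab)
 also have "(\<Sum>i<M. ((if i < k then \<xi> i else 0) * (if i < k then 1 else 0)) *\<^sub>R d i) = (\<Sum>i<M. (if i < k then \<xi> i else 0) *\<^sub>R d i)"
  by (intro sum.cong) auto
 finally show "norm (\<Sum>i<k. \<xi> i *\<^sub>R d i) <= 4 * flat d k" by (simp only: ext flat_def scaleR_one)
 have "norm (\<Sum>i<M. ((if i < k then \<xi> i else 0) * (if i < k then \<xi> i else 0)) *\<^sub>R d i)
   <= 4 * norm (\<Sum>i<M. (if i < k then \<xi> i else 0) *\<^sub>R d i)"
  by (intro spreading_signs[OF d] ab)
 also have "(\<Sum>i<M. ((if i < k then \<xi> i else 0) * (if i < k then \<xi> i else 0)) *\<^sub>R d i) = (\<Sum>i<M. (if i < k then 1 else 0) *\<^sub>R d i)"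
  using assms(3) by (intro sum.cong) (auto, fastforce)
 finally show "flat d k <= 4 * norm (\<Sum>i<k. \<xi> i *\<^sub>R d i)" by (simp only: ext flat_def scaleR_one)
qed

text \<open>Near-extremality makes the differences inside the blocks carry at least
  \<open>c * A * lp {..<n} p x\<close> of the average. Grouped into signed sums of \<open>k\<close>
  differences they are at most \<open>n\<close> vectors, so the bound with the same \<open>A\<close>
  applies to the group sums and the uncontrolled constant \<open>A\<close> cancels. Hence some group
  has norm at least \<open>c\<close> times the p-sum of its vectors, that is, of order
  \<open>k powr (1 / p)\<close> relative to their common size. Homogeneity carries this over to
  widely separated differences, which are spreading.\<close>

lemma type_extract:
 assumes Y: "subspace Y" and nt: "\<not> type_on Y p" and p: "1 <= p" "p < 2" and k: "0 < k" "k <= M"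
 obtains e :: "nat => 'a::real_normed_vector" where "spreading M e" "!!i. i < M ==> e i \<in> Y" "norm (e 0) = 1"
  "(1 - 2 powr (1 - 2 / p)) / 64 * real k powr (1 / p) <= flat e k"
proof -
 define c where "c = (1 - 2 powr (1 - 2 / p)) / 2"
 have "2 powr (1 - 2 / p) < 2 powr 0" using p by (intro powr_less_mono) (auto simp: field_simps)
 then have c: "0 < c" "c <= 1/2" by (auto simp: c_def)
 \<comment> \<open>The lower bound for the norm of one rescaled difference: \<open>k\<close> of them
   have to produce a norm of at least \<open>c / 2\<close>, and half of the resulting
   \<open>2 * \<beta>\<close> is given to the homogeneity errors.\<close>
 define \<beta> where "\<beta> = c / (4 * real k)"
 have \<beta>: "\<beta> > 0" "\<beta> <= c / 4" using c k by (auto simp: \<beta>_def field_simps)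
 define \<delta> where "\<delta> = \<beta> / 32"
 have \<delta>: "\<delta> > 0" using \<beta> by (simp add: \<delta>_def)
 define K where "K = nat \<lceil>64 * real M / \<beta>\<rceil> + 1"
 have K: "K > 0" by (simp add: K_def)
 have "64 * real M / \<beta> <= real K" unfolding K_def by linarith
 then have K2: "2 * real M / real K <= \<beta> / 32" using \<beta> K by (simp add: field_simps)
 define N where "N = M * Suc K"
 \<comment> \<open>A block holds \<open>N\<close> groups of \<open>k\<close> pairs. \<open>N\<close>
   itself leaves room for \<open>M\<close> differences at distance \<open>Suc K\<close>.\<close>
 define L where "L = 2 * (k * N)"
 have N: "N > 0" "k * N \<ge> N" "N <= L" using k by (auto simp: N_def L_def)
 have L: "L > 0" using N by simp
 obtain R where R: "!!n (x :: nat => 'a). (\<exists>i<n. x i ~= 0) ==>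
  \<exists>m \<kappa> \<H> W. block_decomp n x L (2 * M) \<delta> R m \<kappa> \<H> W"
  using block_decomp_exists[OF \<delta> L, where ?'a = 'a] by blast
 \<comment> \<open>One \<open>\<eta>\<close> is lost to near-extremality and one to the remainder
   \<open>W\<close>; then \<open>1 - 2 * \<eta> - 2 powr (1 - 2 / p)\<close> is exactly
   \<open>c\<close>.\<close>
 define \<eta> where "\<eta> = c / 2"
 have \<eta>: "\<eta> > 0" using c by (simp add: \<eta>_def)
 define C where "C = 2 * real R / \<eta> + 1"
 have "C > 0" using \<eta> by (simp add: C_def add_nonneg_pos)
 then obtain n A x where A: "C <= A" and ty: "type_bound Y p n A" and xY: "!!i. i < n ==> x i \<in> Y"
  and ext: "(1 - \<eta>) * A * lp {..<n} p x <= rad {..<n} x" and pos: "0 < lp {..<n} p x"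
  using type_near_extremal[OF nt p(1) _ \<eta>] by metis
 have A0: "A > 0" and RA: "2 * real R <= \<eta> * A"
 proof -
  show "A > 0" using A \<open>C > 0\<close> by simp
  have "2 * real R = \<eta> * (2 * real R / \<eta>)" using \<eta> by simp
  also have "... <= \<eta> * A" using A \<eta> by (intro mult_left_mono) (auto simp: C_def)
  finally show "2 * real R <= \<eta> * A" .
 qed
 have "\<exists>i<n. x i ~= 0"
 proof (rule ccontr)
  assume "\<not> ?thesis"
  then have "lp {..<n} p x = 0" by (simp add: lp_def)
  then show False using pos by simp
 qed
 then obtain m \<kappa> \<H> W where bd: "block_decomp n x L (2 * M) \<delta> R m \<kappa> \<H> W" using R by blast
 have m0: "m > 0" and finH: "finite \<H>" and cover: "\<Union>\<H> \<union> W = {i. i < n \<and> x i ~= 0}" "\<Union>\<H> \<inter> W = {}"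
  and \<kappa>: "!!i. i < n ==> norm (x i) <= m * (1/2) ^ \<kappa> i"
   "!!i. i < n ==> x i ~= 0 ==> m * (1/2) ^ \<kappa> i < 2 * norm (x i)"
  and HH: "!!H. H \<in> \<H> ==> (\<exists>c. \<forall>i\<in>H. \<kappa> i = c)"
   "!!H j. H \<in> \<H> ==> j <= 2 * M ==> hom_set (%i. (2 ^ \<kappa> i / m) *\<^sub>R x i) j \<delta> H"
  and W: "(\<Sum>i\<in>W. (1/2 :: real) ^ \<kappa> i) <= 2 * real R"
  and mx: "\<exists>i<n. norm (x i) = m"
  using bd by (auto simp: block_decomp_def)
 define I where "I = \<Union>\<H>"
 have I: "I \<subseteq> {..<n}" "W \<subseteq> {..<n}" using cover by (auto simp: I_def)
 have fin: "finite I" "finite W" using I finite_subset by blast+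
 have mlp: "m <= lp {..<n} p x" using mx norm_le_lp[of "{..<n}" _ p x] p by force
 have radI: "(1 - 2 * \<eta>) * A * lp {..<n} p x <= rad I x"
 proof -
  have eqn: "{..<n} = I \<union> ({..<n} - I)" using I by auto
  have "rad {..<n} x <= rad I x + (\<Sum>i\<in>{..<n} - I. norm (x i))"
   using rad_union_le[of I "{..<n} - I" x] fin eqn by auto
  also have "(\<Sum>i\<in>{..<n} - I. norm (x i)) = (\<Sum>i\<in>W. norm (x i))"
   using cover I by (intro sum.mono_neutral_right) (auto simp: I_def)
  also have "... <= (\<Sum>i\<in>W. m * (1/2) ^ \<kappa> i)" using \<kappa>(1) I by (intro sum_mono) auto
  also have "... <= m * (2 * real R)" using W m0 by (simp flip: sum_distrib_left)
  also have "... <= lp {..<n} p x * (\<eta> * A)" by (rule mult_mono[OF mlp RA]) simp_all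
  finally show ?thesis using ext by (simp add: algebra_simps)
 qed
 obtain \<phi> where \<phi>: "inj_on \<phi> (\<H> \<times> {..<L})" "\<phi> ` (\<H> \<times> {..<L}) = I"
  "!!H. H \<in> \<H> ==> strict_mono_on {..<L} (%s. \<phi> (H, s))"
  "!!H. H \<in> \<H> ==> (%s. \<phi> (H, s)) ` {..<L} = H"
  using block_index[OF bd] unfolding I_def by blast
 define Q where "Q = \<H> \<times> {..<k * N}"
 define a where "a q = \<phi> (fst q, 2 * snd q)" for q
 define b where "b q = \<phi> (fst q, 2 * snd q + 1)" for q
 have finQ: "finite Q" using finH by (simp add: Q_def)
 have inQ: "(fst q, 2 * snd q) \<in> \<H> \<times> {..<L}" "(fst q, 2 * snd q + 1) \<in> \<H> \<times> {..<L}" if "q \<in> Q" for q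
  using that by (auto simp: Q_def L_def)
 have inja: "inj_on a Q"
 proof (rule inj_onI)
  fix q q' assume "q \<in> Q" "q' \<in> Q" "a q = a q'"
  then have "(fst q, 2 * snd q) = (fst q', 2 * snd q')"
   using inj_onD[OF \<phi>(1)] inQ unfolding a_def by blast
  then show "q = q'" by (simp add: prod_eq_iff)
 qed
 have injb: "inj_on b Q"
 proof (rule inj_onI)
  fix q q' assume "q \<in> Q" "q' \<in> Q" "b q = b q'"
  then have "(fst q, 2 * snd q + 1) = (fst q', 2 * snd q' + 1)"
   using inj_onD[OF \<phi>(1)] inQ unfolding b_def by blast
  then show "q = q'" by (simp add: prod_eq_iff)
 qed
 have disj: "a ` Q \<inter> b ` Q = {}"
 proof (rule ccontr)
  assume "\<not> ?thesis"
  then obtain q q' where "q \<in> Q" "q' \<in> Q" "a q = b q'" by blast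
  then have "(fst q, 2 * snd q) = (fst q', 2 * snd q' + 1)"
   using inj_onD[OF \<phi>(1)] inQ unfolding a_def b_def by blast
  then show False by simp presburger
 qed
 have Iab: "I = a ` Q \<union> b ` Q"
 proof
  show "a ` Q \<union> b ` Q \<subseteq> I" using inQ \<phi>(2) unfolding a_def b_def by blast
  show "I \<subseteq> a ` Q \<union> b ` Q"
  proof
   fix i assume "i \<in> I"
   then obtain H s where s: "H \<in> \<H>" "s < L" "i = \<phi> (H, s)" unfolding \<phi>(2)[symmetric] by auto
   have "(H, s div 2) \<in> Q" using s by (auto simp: Q_def L_def)
   moreover have "i = a (H, s div 2) \<or> i = b (H, s div 2)"
    unfolding a_def b_def using s(3) by (cases "even s") auto
   ultimately show "i \<in> a ` Q \<union> b ` Q" by blast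
  qed
 qed
 have abI: "a q \<in> I" "b q \<in> I" if "q \<in> Q" for q using that Iab by auto
 have xab: "x (a q) \<in> Y" "x (b q) \<in> Y" if "q \<in> Q" for q
 proof -
  have "a q < n" "b q < n" using abI[OF that] I by auto
  then show "x (a q) \<in> Y" "x (b q) \<in> Y" using xY by auto
 qed
 have cardQ: "card Q <= n"
  using card_inj_on_le[OF inja, of "{..<n}"] Iab I by auto
 define d where "d q = x (a q) - x (b q)" for q
 have radQ: "c * A * lp {..<n} p x <= rad Q d"
 proof -
  have "rad I x <= A * (2 powr (1 - 2 / p) * lp I p x) + rad Q d"
   unfolding Iab d_def using A0 p finQ inja injb disj cardQ Y xab
   by (intro rad_differences_ge[OF ty]) auto
  also have "... <= A * (2 powr (1 - 2 / p) * lp {..<n} p x) + rad Q d"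
  proof -
   have "lp I p x <= lp {..<n} p x"
    unfolding lp_def using p I by (intro powr_mono2 sum_mono2) (auto intro: sum_nonneg)
   then show ?thesis using A0 by (intro add_right_mono mult_left_mono) auto
  qed
  finally have "((1 - 2 * \<eta>) - 2 powr (1 - 2 / p)) * A * lp {..<n} p x <= rad Q d"
   using radI by (simp add: algebra_simps)
  also have "(1 - 2 * \<eta>) - 2 powr (1 - 2 / p) = c" by (simp add: \<eta>_def c_def field_simps)
  finally show ?thesis .
 qed
 define J where "J = \<H> \<times> {..<N}"
 define g where "g q = (fst q, snd q div k)" for q :: "nat set \<times> nat"
 have finJ: "finite J" using finH by (simp add: J_def)
 have gQ: "g ` Q \<subseteq> J"
  using k by (auto simp: g_def Q_def J_def less_mult_imp_div_less mult.commute)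
 define V where "V \<xi> j = (\<Sum>q\<in>{q\<in>Q. g q = j}. \<xi> q *\<^sub>R d q)" for \<xi> :: "nat set \<times> nat => real" and j
 have "rad Q d = sign_avg Q (%\<xi>. rad J (V \<xi>))"
  unfolding rad_def V_def[abs_def] by (rule lin_avg_group[OF finQ finJ gQ])
 then obtain \<xi> where \<xi>: "\<xi> \<in> signs Q" "rad Q d <= rad J (V \<xi>)"
  using sign_avg_exists_ge[OF finQ] by metis
 have "card J <= card Q" using N by (simp add: J_def Q_def card_cartesian_product)
 then have "rad J (V \<xi>) <= A * lp J p (V \<xi>)"
  using finJ cardQ xab Y
  by (intro type_boundD[OF ty]) (auto simp: V_def d_def intro!: subspace_sum subspace_scale subspace_diff)
 then have "A * (c * lp {..<n} p x) <= A * lp J p (V \<xi>)" using \<xi>(2) radQ by (simp add: mult_ac)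
 then have low: "c * lp {..<n} p x <= lp J p (V \<xi>)" using A0 by simp
 have sums: "(\<Sum>j\<in>J. c powr p * (\<Sum>q\<in>{q\<in>Q. g q = j}. norm (x (a q)) powr p)) <= (\<Sum>j\<in>J. norm (V \<xi> j) powr p)"
 proof -
  have "(\<Sum>j\<in>J. c powr p * (\<Sum>q\<in>{q\<in>Q. g q = j}. norm (x (a q)) powr p)) = c powr p * (\<Sum>q\<in>Q. norm (x (a q)) powr p)"
   using sum.group[OF finQ finJ gQ, of "%q. norm (x (a q)) powr p"] by (simp flip: sum_distrib_left)
  also have "(\<Sum>q\<in>Q. norm (x (a q)) powr p) = (\<Sum>i\<in>a ` Q. norm (x i) powr p)"
   using inja by (simp add: sum.reindex)
  also have "c powr p * ... <= c powr p * (\<Sum>i<n. norm (x i) powr p)"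
   using Iab I by (intro mult_left_mono sum_mono2) auto
  also have "... = (c * lp {..<n} p x) powr p" using p by (simp add: powr_mult lp_powr)
  also have "... <= lp J p (V \<xi>) powr p" using low c p by (intro powr_mono2) auto
  also have "... = (\<Sum>j\<in>J. norm (V \<xi> j) powr p)" using p by (simp add: lp_powr)
  finally show ?thesis .
 qed
 have "J ~= {}"
 proof
  assume "J = {}"
  then have "lp J p (V \<xi>) = 0" by (simp add: lp_def)
  moreover have "0 < c * lp {..<n} p x" using c pos by simp
  ultimately show False using low by simp
 qed
 then obtain j where j: "j \<in> J" "c powr p * (\<Sum>q\<in>{q\<in>Q. g q = j}. norm (x (a q)) powr p) <= norm (V \<xi> j) powr p"
  using exists_group_ge[OF finJ sums] by blast
 obtain H t where Ht: "j = (H, t)" "H \<in> \<H>" "t < N" using j(1) by (auto simp: J_def)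
 define h where "h s = \<phi> (H, s)" for s
 have h: "strict_mono_on {..<L} h" "h ` {..<L} = H" using \<phi>(3,4)[OF Ht(2)] by (auto simp: h_def[abs_def])
 obtain c0 where c0: "!!i. i \<in> H ==> \<kappa> i = c0" using HH(1)[OF Ht(2)] by blast
 define \<mu> where "\<mu> = m * (1/2) ^ c0"
 have \<mu>: "\<mu> > 0" using m0 by (simp add: \<mu>_def)
 define u where "u i = (2 ^ \<kappa> i / m) *\<^sub>R x i" for i
 have HI: "H \<subseteq> I" using Ht by (auto simp: I_def)
 have Hx: "i < n" "x i ~= 0" if "i \<in> H" for i using HI that cover by (auto simp: I_def)
 have xu: "x i = \<mu> *\<^sub>R u i" if "i \<in> H" for i
  using c0[OF that] m0 by (simp add: u_def \<mu>_def power_one_over)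
 have u1: "norm (u i) <= 1" if "i \<in> H" for i
  using \<kappa>(1)[OF Hx(1)[OF that]] xu[OF that] c0[OF that] \<mu> by (simp add: \<mu>_def[symmetric])
 have x2: "\<mu> / 2 <= norm (x i)" if "i \<in> H" for i
  using \<kappa>(2)[OF Hx[OF that]] c0[OF that] by (simp add: \<mu>_def[symmetric])
 have hom: "hom_set u l \<delta> H" if "l <= 2 * M" for l
  using HH(2)[OF Ht(2) that] by (simp add: u_def[abs_def])
 have pre: "{q\<in>Q. g q = j} = (%r. (H, t * k + r)) ` {..<k}"
  unfolding Q_def g_def Ht(1) using Ht k by (intro group_preimage)
 have injr: "inj_on (%r. (H, t * k + r)) {..<k}" by (auto simp: inj_on_def)
 have tk: "2 * (t * k + r) + 1 < L" if "r < k" for r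
 proof -
  have "t * k + r < Suc t * k" using that by simp
  also have "... <= N * k" using Ht by (intro mult_le_mono1) simp
  finally show ?thesis by (simp add: L_def mult.commute)
 qed
 define \<sigma> where "\<sigma> r = \<xi> (H, t * k + r)" for r
 have \<sigma>: "\<sigma> r = 1 \<or> \<sigma> r = -1" if "r < k" for r
  unfolding \<sigma>_def using \<xi>(1) by (rule signs_cases) (use pre that in blast)
 define v where "v r = u (h (2 * (t * k + r))) - u (h (2 * (t * k + r) + 1))" for r
 have Vj: "V \<xi> j = \<mu> *\<^sub>R (\<Sum>r<k. \<sigma> r *\<^sub>R v r)"
 proof -
  have "V \<xi> j = (\<Sum>r<k. \<sigma> r *\<^sub>R d (H, t * k + r))"
   unfolding V_def pre using injr by (simp add: sum.reindex \<sigma>_def)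
  also have "... = (\<Sum>r<k. \<mu> *\<^sub>R (\<sigma> r *\<^sub>R v r))"
  proof (rule sum.cong[OF refl])
   fix r assume "r \<in> {..<k}"
   then have "h (2 * (t * k + r)) \<in> H" "h (2 * (t * k + r) + 1) \<in> H"
    using tk[of r] h(2) by auto
   then have "d (H, t * k + r) = \<mu> *\<^sub>R v r"
    by (simp add: d_def a_def b_def v_def xu scaleR_diff_right flip: h_def)
   then show "\<sigma> r *\<^sub>R d (H, t * k + r) = \<mu> *\<^sub>R (\<sigma> r *\<^sub>R v r)" by (simp add: mult.commute)
  qed
  finally show ?thesis by (simp add: scaleR_sum_right)
 qed
 have lowv: "c / 2 * real k powr (1 / p) <= norm (\<Sum>r<k. \<sigma> r *\<^sub>R v r)"
 proof -
  have "real k * (\<mu> / 2) powr p = (\<Sum>q\<in>{q\<in>Q. g q = j}. (\<mu> / 2) powr p)"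
   unfolding pre using injr by (simp add: card_image)
  also have "... <= (\<Sum>q\<in>{q\<in>Q. g q = j}. norm (x (a q)) powr p)"
  proof (intro sum_mono powr_mono2)
   fix q assume "q \<in> {q\<in>Q. g q = j}"
   then obtain r where "q = (H, t * k + r)" "r < k" unfolding pre by auto
   then have "a q \<in> H" using tk[of r] h(2) by (auto simp: a_def simp flip: h_def)
   then show "\<mu> / 2 <= norm (x (a q))" by (rule x2)
  qed (use p \<mu> in auto)
  finally have "c powr p * (real k * (\<mu> / 2) powr p) <= c powr p * (\<Sum>q\<in>{q\<in>Q. g q = j}. norm (x (a q)) powr p)"
   by (intro mult_left_mono) auto
  then have "c powr p * (real k * (\<mu> / 2) powr p) <= norm (V \<xi> j) powr p" using j(2) by linarith
  moreover have "c powr p * (real k * (\<mu> / 2) powr p) = (c * real k powr (1 / p) * (\<mu> / 2)) powr p"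
   unfolding powr_mult powr_powr using p by simp
  ultimately have "((c * real k powr (1 / p) * (\<mu> / 2)) powr p) powr (1/p) <= (norm (V \<xi> j) powr p) powr (1/p)"
   using p by (intro powr_mono2[of "1/p"]) auto
  then have "c * real k powr (1 / p) * (\<mu> / 2) <= norm (V \<xi> j)" using p c \<mu> by (simp add: powr_powr)
  also have "... = \<mu> * norm (\<Sum>r<k. \<sigma> r *\<^sub>R v r)" unfolding Vj using \<mu> by simp
  finally have "\<mu> * (c / 2 * real k powr (1 / p)) <= \<mu> * norm (\<Sum>r<k. \<sigma> r *\<^sub>R v r)" by (simp add: mult_ac)
  then show ?thesis using \<mu> by simp
 qed
 \<comment> \<open>Differences of neighbours at positions \<open>Suc K\<close> apart. They are
   comparable with the consecutive pairs of the selected group by \<open>hom_set_pairs\<close>, and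
   only the gaps make them unconditional.\<close>
 define e0 where "e0 s = u (h (s * Suc K)) - u (h (s * Suc K + 1))" for s
 have step: "s * Suc K + 1 < N" if "s < M" for s
 proof -
  have "s * Suc K + 1 < Suc s * Suc K" using K by simp
  also have "... <= N" unfolding N_def using that by (intro mult_le_mono1) simp
  finally show ?thesis .
 qed
 have gap: "s * Suc K + 1 < r * Suc K" if "s < r" for s r
 proof -
  have "s * Suc K + 1 < Suc s * Suc K" using K by simp
  also have "... <= r * Suc K" using that by (intro mult_le_mono1) simp
  finally show ?thesis .
 qed
 have hsub: "h ` {..<L} \<subseteq> H" using h(2) by simp
 have "dominates k (%r. v r) (%s. e0 s) \<delta>"
  unfolding v_def e0_def
 proof (rule hom_set_pairs[OF _ h(1) hsub])
  show "hom_set u (2 * k) \<delta> H" using k by (intro hom) simp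
 qed (use tk step gap k N(3) in \<open>auto intro: less_le_trans order_less_trans\<close>)
 then have d1: "norm (\<Sum>r<k. \<sigma> r *\<^sub>R v r) <= norm (\<Sum>r<k. \<sigma> r *\<^sub>R e0 r) + \<delta>"
  using \<sigma> unfolding dominates_def by force
 have d0: "norm (e0 s) <= norm (e0 0) + \<delta>" if "s < k" for s
 proof -
  have "dominates 1 (%r. u (h (s * Suc K)) - u (h (s * Suc K + 1))) (%r. u (h (0 * Suc K)) - u (h (0 * Suc K + 1))) \<delta>"
  proof (rule hom_set_pairs[OF _ h(1) hsub])
   show "hom_set u (2 * 1) \<delta> H" using k by (intro hom) simp
   show "s * Suc K + 1 < L" "0 * Suc K + 1 < L" using step[of s] step[of 0] that k N(3) by auto
  qed auto
  then show ?thesis unfolding dominates_def e0_def by (elim allE[of _ "%_. 1"]) simp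
 qed
 have k1: "1 <= real k powr (1 / p)" using k p by (intro ge_one_powr_ge_zero) auto
 have d00: "\<beta> <= norm (e0 0)"
 proof -
  have "norm (\<Sum>r<k. \<sigma> r *\<^sub>R e0 r) <= (\<Sum>r<k. norm (e0 0) + \<delta>)"
  proof (rule sum_norm_le)
   fix r assume "r \<in> {..<k}"
   then show "norm (\<sigma> r *\<^sub>R e0 r) <= norm (e0 0) + \<delta>" using \<sigma>[of r] d0[of r] by auto
  qed
  then have "norm (\<Sum>r<k. \<sigma> r *\<^sub>R e0 r) <= real k * (norm (e0 0) + \<delta>)" by simp
  moreover have "c / 2 * 1 <= c / 2 * real k powr (1 / p)" by (rule mult_left_mono[OF k1]) (use c in simp)
  ultimately have "c / 2 <= real k * (norm (e0 0) + \<delta>) + \<delta>"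
   using lowv d1 by linarith
  moreover have "\<delta> <= real k * \<delta>" using k \<delta> by simp
  ultimately have "c / 2 <= real k * (norm (e0 0) + 2 * \<delta>)" by (simp add: algebra_simps)
  moreover have "c / 2 = real k * (2 * \<beta>)" using k by (simp add: \<beta>_def)
  ultimately have "2 * \<beta> <= norm (e0 0) + 2 * \<delta>" using k by simp
  then show ?thesis using \<beta> by (simp add: \<delta>_def)
 qed
 have spr: "spreading M e0"
  unfolding e0_def
 proof (rule spreading_of_hom_set[OF hom K])
  show "strict_mono_on {..<M * Suc K} h" using h(1) N(3) unfolding N_def by (auto simp: strict_mono_on_def)
  show "h ` {..<M * Suc K} \<subseteq> H" using h(2) N(3) unfolding N_def by force
  show "\<delta> + 2 * real M / real K <= norm (u (h (0 * Suc K)) - u (h (0 * Suc K + 1))) / 8"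
   using d00 K2 \<beta>(1) unfolding \<delta>_def e0_def by linarith
  show "u (h (0 * Suc K)) - u (h (0 * Suc K + 1)) ~= 0" using d00 \<beta> by (auto simp: e0_def)
 qed (use k \<delta> u1 in auto)
 define e where "e s = (1 / norm (e0 0)) *\<^sub>R e0 s" for s
 have e00: "e0 0 ~= 0" using d00 \<beta> by auto
 note e = spreading_normalize[OF spr e00, folded e_def]
 have hH: "h (s * Suc K) \<in> H" "h (s * Suc K + 1) \<in> H" if "s < M" for s
  using step[OF that] N(3) h(2) by auto
 show thesis
 proof (rule that[of e])
  show "e i \<in> Y" if "i < M" for i
  proof -
   have "u r \<in> Y" if "r \<in> H" for r using Hx(1)[OF that] xY Y by (simp add: u_def subspace_scale)
   then show ?thesis using hH[OF that] Y by (simp add: e_def e0_def subspace_scale subspace_diff)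
  qed
  have "norm (e0 0) <= 1 + 1"
   unfolding e0_def using hH[of 0] k by (intro norm_triangle_le_diff add_mono u1) auto
  then have "flat e0 k / 2 <= flat e k"
   unfolding e(3) using e00 by (intro divide_left_mono) (auto simp: flat_def)
  moreover have "norm (\<Sum>r<k. \<sigma> r *\<^sub>R e0 r) <= 4 * flat e0 k"
   using spr k \<sigma> by (intro spreading_signs_flat) auto
  moreover have "\<delta> <= c / 4 * real k powr (1 / p)"
  proof -
   have "c / 4 * 1 <= c / 4 * real k powr (1 / p)" by (rule mult_left_mono[OF k1]) (use c in simp)
   then show ?thesis using \<beta> c unfolding \<delta>_def by linarith
  qed
  ultimately have "c / 32 * real k powr (1 / p) <= flat e k" using lowv d1 by linarith
  then show "(1 - 2 powr (1 - 2 / p)) / 64 * real k powr (1 / p) <= flat e k"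
   by (simp add: c_def)
 qed (use e in auto)
qed

lemma khinchine_L1_subset:
 fixes a :: "'i => real"
 assumes "finite Q" "P \<subseteq> Q"
 shows "sqrt (\<Sum>q\<in>P. (a q)\<^sup>2) <= 2 * sign_avg Q (%\<xi>. \<bar>\<Sum>q\<in>P. \<xi> q * a q\<bar>)"
proof -
 have "sqrt (\<Sum>q\<in>Q. (if q \<in> P then a q else 0)\<^sup>2) <= 2 * rad Q (%q. if q \<in> P then a q else 0)"
  using assms(1) by (rule khinchine_L1)
 also have "(\<Sum>q\<in>Q. (if q \<in> P then a q else 0)\<^sup>2) = (\<Sum>q\<in>P. (a q)\<^sup>2)"
  using assms by (intro sum.mono_neutral_cong_right) auto
 also have "rad Q (%q. if q \<in> P then a q else 0) = sign_avg Q (%\<xi>. \<bar>\<Sum>q\<in>P. \<xi> q * a q\<bar>)"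
 proof -
  have "(\<Sum>q\<in>Q. \<xi> q *\<^sub>R (if q \<in> P then a q else 0)) = (\<Sum>q\<in>P. \<xi> q * a q)" for \<xi>
   using assms by (intro sum.mono_neutral_cong_right) auto
  then show ?thesis by (simp add: rad_def lin_avg_def)
 qed
 finally show ?thesis .
qed

text \<open>The cotype bound estimates group sums from above, again with cancellation of
  \<open>A\<close>, so here the vectors themselves are grouped. Since the bound is averaged over
  signs, Minkowski's inequality is used to find one group that is small on average. Passing to
  differences keeps an upper estimate, but it has to be excluded that they nearly vanish; this is
  where \<open>k powr (1 / 2)\<close> has to be much larger than
  \<open>k powr (1 / r)\<close>.\<close>

lemma cotype_extract:
 assumes Y: "subspace Y" and nt: "\<not> cotype_on Y r" and r: "2 < r"
  and k: "0 < k" "k <= M" and klarge: "64 < real k powr (1 / 2 - 1 / r)"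
 obtains e :: "nat => 'a::real_normed_vector" where "spreading M e" "!!i. i < M ==> e i \<in> Y" "norm (e 0) = 1"
  "flat e k <= 320 * real k powr (1 / r)"
proof -
 define \<delta> :: real where "\<delta> = 1 / 256"
 have \<delta>: "\<delta> > 0" by (simp add: \<delta>_def)
 define K where "K = 512 * M"
 have K: "K > 0" using k by (simp add: K_def)
 have K2: "2 * real M / real K <= 1 / 256" using k by (simp add: K_def)
 define N where "N = M * Suc K"
 define L where "L = k * N"
 have N: "N > 0" "N <= L" using k by (auto simp: N_def L_def)
 have L: "L > 0" using N by simp
 obtain R where R: "!!n (x :: nat => 'a). (\<exists>i<n. x i ~= 0) ==>
  \<exists>m \<kappa> \<H> W. block_decomp n x L (2 * M) \<delta> R m \<kappa> \<H> W"
  using block_decomp_exists[OF \<delta> L, where ?'a = 'a] by blast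
 \<comment> \<open>Makes \<open>(A / 2) powr r\<close> at least \<open>4 * R\<close>, so the
   remainder contributes at most half of \<open>\<Lambda> powr r\<close>. Near-extremality up to a
   factor 2 is enough here, because no sharp constant is compared.\<close>
 define C where "C = 2 * (4 * real R + 1)"
 have "C > 0" by (simp add: C_def)
 then obtain n A x where A: "C <= A" and ty: "cotype_bound Y r n A" and xY: "!!i. i < n ==> x i \<in> Y"
  and ext: "(1 - 1 / 2) * A * rad {..<n} x <= lp {..<n} r x" and pos: "0 < rad {..<n} x"
  using cotype_near_extremal[OF nt, of C "1/2"] r by (metis half_gt_zero_iff less_eq_real_def less_trans one_less_numeral_iff semiring_norm(76) zero_less_one)
 have A0: "A > 0" using A \<open>C > 0\<close> by simp
 define \<Lambda> where "\<Lambda> = lp {..<n} r x"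
 have ext': "A * rad {..<n} x <= 2 * \<Lambda>" using ext by (simp add: \<Lambda>_def)
 have \<Lambda>0: "\<Lambda> > 0" using ext' A0 pos by (metis mult_pos_pos less_le_trans zero_less_mult_pos zero_less_numeral)
 have "\<exists>i<n. x i ~= 0"
 proof (rule ccontr)
  assume "\<not> ?thesis"
  then have "lp {..<n} r x = 0" by (simp add: lp_def)
  then show False using \<Lambda>0 by (simp add: \<Lambda>_def)
 qed
 then obtain m \<kappa> \<H> W where bd: "block_decomp n x L (2 * M) \<delta> R m \<kappa> \<H> W" using R by blast
 have m0: "m > 0" and finH: "finite \<H>" and cover: "\<Union>\<H> \<union> W = {i. i < n \<and> x i ~= 0}" "\<Union>\<H> \<inter> W = {}"
  and \<kappa>: "!!i. i < n ==> norm (x i) <= m * (1/2) ^ \<kappa> i"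
   "!!i. i < n ==> x i ~= 0 ==> m * (1/2) ^ \<kappa> i < 2 * norm (x i)"
  and HH: "!!H. H \<in> \<H> ==> (\<exists>c. \<forall>i\<in>H. \<kappa> i = c)"
   "!!H j. H \<in> \<H> ==> j <= 2 * M ==> hom_set (%i. (2 ^ \<kappa> i / m) *\<^sub>R x i) j \<delta> H"
  and W: "(\<Sum>i\<in>W. (1/2 :: real) ^ \<kappa> i) <= 2 * real R"
  and mx: "\<exists>i<n. norm (x i) = m"
  using bd by (auto simp: block_decomp_def)
 define I where "I = \<Union>\<H>"
 have I: "I \<subseteq> {..<n}" "W \<subseteq> {..<n}" using cover by (auto simp: I_def)
 have fin: "finite I" "finite W" using I finite_subset by blast+
 have sumI: "\<Lambda> powr r <= 2 * (\<Sum>i\<in>I. norm (x i) powr r)"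
 proof -
  have "\<Lambda> powr r = (\<Sum>i<n. norm (x i) powr r)" unfolding \<Lambda>_def using r by (simp add: lp_powr)
  also have "... = (\<Sum>i\<in>I \<union> W. norm (x i) powr r)"
   using cover I by (intro sum.mono_neutral_right) (auto simp: I_def)
  also have "... = (\<Sum>i\<in>I. norm (x i) powr r) + (\<Sum>i\<in>W. norm (x i) powr r)"
   using cover fin by (intro sum.union_disjoint) (auto simp: I_def)
  also have "(\<Sum>i\<in>W. norm (x i) powr r) <= \<Lambda> powr r / 2"
  proof -
   have "norm (x i) powr r <= m powr r * (1/2) ^ \<kappa> i" if "i \<in> W" for i
   proof -
    have "norm (x i) powr r <= (m * (1/2) ^ \<kappa> i) powr r"
     using \<kappa>(1)[of i] I that r by (intro powr_mono2) auto
    also have "... = m powr r * ((1/2) ^ \<kappa> i) powr r" by (rule powr_mult)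
    also have "((1/2 :: real) ^ \<kappa> i) powr r <= ((1/2) ^ \<kappa> i) powr 1"
     using r by (intro powr_mono') (auto simp: power_le_one)
    finally show ?thesis by (simp add: mult_left_mono)
   qed
   then have "(\<Sum>i\<in>W. norm (x i) powr r) <= m powr r * (\<Sum>i\<in>W. (1/2) ^ \<kappa> i)"
    unfolding sum_distrib_left by (rule sum_mono)
   also have "... <= m powr r * (2 * real R)" using W by (intro mult_left_mono) auto
   also have "... <= (2 * \<Lambda> / A) powr r * (2 * real R)"
   proof -
    have "m <= rad {..<n} x" using mx norm_le_rad[of "{..<n}"] by force
    also have "... <= 2 * \<Lambda> / A" using ext' A0 by (simp add: field_simps)
    finally show ?thesis using m0 r by (intro mult_right_mono powr_mono2) auto
   qed
   also have "(2 * \<Lambda> / A) powr r = \<Lambda> powr r / (A / 2) powr r"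
    using A0 \<Lambda>0 by (simp add: powr_divide powr_mult)
   also have "\<Lambda> powr r / (A / 2) powr r * (2 * real R) <= \<Lambda> powr r / 2"
   proof -
    have A2: "4 * real R + 1 <= A / 2" using A by (simp add: C_def)
    have "(A / 2) powr 1 <= (A / 2) powr r" using A2 r by (intro powr_mono) auto
    then have "4 * real R <= (A / 2) powr r" using A2 A0 by simp
    then have "\<Lambda> powr r * (4 * real R) <= \<Lambda> powr r * (A / 2) powr r" by (intro mult_left_mono) auto
    then show ?thesis using A0 by (simp add: field_simps)
   qed
   finally show ?thesis .
  qed
  finally show ?thesis by simp
 qed
 obtain \<phi> where \<phi>: "inj_on \<phi> (\<H> \<times> {..<L})" "\<phi> ` (\<H> \<times> {..<L}) = I"
  "!!H. H \<in> \<H> ==> strict_mono_on {..<L} (%s. \<phi> (H, s))"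
  "!!H. H \<in> \<H> ==> (%s. \<phi> (H, s)) ` {..<L} = H"
  using block_index[OF bd] unfolding I_def by blast
 define Q where "Q = \<H> \<times> {..<k * N}"
 have QL: "Q = \<H> \<times> {..<L}" by (simp add: Q_def L_def)
 have finQ: "finite Q" using finH by (simp add: Q_def)
 have inj: "inj_on \<phi> Q" and im: "\<phi> ` Q = I" using \<phi>(1,2) by (simp_all add: QL)
 have \<phi>n: "\<phi> q < n" if "q \<in> Q" for q using that im I by auto
 have cardQ: "card Q <= n"
  using card_inj_on_le[OF inj, of "{..<n}"] im I by auto
 define J where "J = \<H> \<times> {..<N}"
 define g where "g q = (fst q, snd q div k)" for q :: "nat set \<times> nat"
 have finJ: "finite J" using finH by (simp add: J_def)
 have gQ: "g ` Q \<subseteq> J"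
  using k by (auto simp: g_def Q_def J_def less_mult_imp_div_less mult.commute)
 have cardJ: "card J <= n"
 proof -
  have "card J <= card Q" using k by (simp add: J_def Q_def card_cartesian_product)
  then show ?thesis using cardQ by simp
 qed
 define V where "V \<xi> j = (\<Sum>q\<in>{q\<in>Q. g q = j}. \<xi> q *\<^sub>R x (\<phi> q))" for \<xi> :: "nat set \<times> nat => real" and j
 define M' where "M' j = sign_avg Q (%\<xi>. norm (V \<xi> j))" for j
 have VY: "V \<xi> j \<in> Y" for \<xi> j
  unfolding V_def using Y xY \<phi>n by (auto intro!: subspace_sum subspace_scale)
 have avg: "sign_avg Q (%\<xi>. lp J r (V \<xi>)) <= 2 * \<Lambda>"
 proof -
  have "sign_avg Q (%\<xi>. lp J r (V \<xi>)) <= sign_avg Q (%\<xi>. A * rad J (V \<xi>))"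
   using finQ finJ cardJ VY by (intro sign_avg_mono cotype_boundD[OF ty]) auto
  also have "... = A * sign_avg Q (%\<xi>. rad J (V \<xi>))" by (rule sign_avg_cmult)
  also have "sign_avg Q (%\<xi>. rad J (V \<xi>)) = rad Q (%q. x (\<phi> q))"
   unfolding rad_def V_def[abs_def] by (rule lin_avg_group[OF finQ finJ gQ, symmetric])
  also have "... = rad I x" using rad_reindex[OF finQ inj, of x] im by simp
  also have "A * rad I x <= A * rad {..<n} x" using A0 I by (intro mult_left_mono rad_mono) auto
  finally show ?thesis using ext' by simp
 qed
 have "(\<Sum>j\<in>J. M' j powr r) powr (1 / r) <= sign_avg Q (%\<xi>. (\<Sum>j\<in>J. norm (V \<xi> j) powr r) powr (1 / r))"
  unfolding M'_def using r finQ finJ by (intro lp_avg_le) auto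
 also have "... <= 2 * \<Lambda>" using avg by (simp add: lp_def)
 finally have "((\<Sum>j\<in>J. M' j powr r) powr (1 / r)) powr r <= (2 * \<Lambda>) powr r"
  using r by (intro powr_mono2) auto
 then have "(\<Sum>j\<in>J. M' j powr r) <= 2 powr r * \<Lambda> powr r"
  using r by (simp add: powr_powr powr_mult sum_nonneg)
 also have "... <= 2 powr r * (2 * (\<Sum>i\<in>I. norm (x i) powr r))"
  using sumI by (intro mult_left_mono) auto
 also have "(\<Sum>i\<in>I. norm (x i) powr r) = (\<Sum>q\<in>Q. norm (x (\<phi> q)) powr r)"
  using inj by (simp add: im[symmetric] sum.reindex)
 also have "... = (\<Sum>j\<in>J. \<Sum>q\<in>{q\<in>Q. g q = j}. norm (x (\<phi> q)) powr r)"
  by (rule sum.group[OF finQ finJ gQ, symmetric])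
 finally have sums: "(\<Sum>j\<in>J. M' j powr r) <= (\<Sum>j\<in>J. 2 powr r * 2 * (\<Sum>q\<in>{q\<in>Q. g q = j}. norm (x (\<phi> q)) powr r))"
  by (simp add: sum_distrib_left mult.assoc)
 have "J ~= {}"
 proof
  assume "J = {}"
  then have "I = {}" using N by (auto simp: J_def I_def)
  then show False using sumI \<Lambda>0 by simp
 qed
 then obtain j where j: "j \<in> J" "M' j powr r <= 2 powr r * 2 * (\<Sum>q\<in>{q\<in>Q. g q = j}. norm (x (\<phi> q)) powr r)"
  using exists_group_ge[OF finJ sums] by blast
 obtain H t where Ht: "j = (H, t)" "H \<in> \<H>" "t < N" using j(1) by (auto simp: J_def)
 define h where "h s = \<phi> (H, s)" for s
 have h: "strict_mono_on {..<L} h" "h ` {..<L} = H" using \<phi>(3,4)[OF Ht(2)] by (auto simp: h_def[abs_def])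
 obtain c0 where c0: "!!i. i \<in> H ==> \<kappa> i = c0" using HH(1)[OF Ht(2)] by blast
 define \<mu> where "\<mu> = m * (1/2) ^ c0"
 have \<mu>: "\<mu> > 0" using m0 by (simp add: \<mu>_def)
 define u where "u i = (2 ^ \<kappa> i / m) *\<^sub>R x i" for i
 have HI: "H \<subseteq> I" using Ht by (auto simp: I_def)
 have Hx: "i < n" "x i ~= 0" if "i \<in> H" for i using HI that cover by (auto simp: I_def)
 have xu: "x i = \<mu> *\<^sub>R u i" if "i \<in> H" for i
  using c0[OF that] m0 by (simp add: u_def \<mu>_def power_one_over)
 have u1: "norm (u i) <= 1" if "i \<in> H" for i
  using \<kappa>(1)[OF Hx(1)[OF that]] xu[OF that] c0[OF that] \<mu> by (simp add: \<mu>_def[symmetric])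
 have u2: "1 / 2 <= norm (u i)" if "i \<in> H" for i
  using \<kappa>(2)[OF Hx[OF that]] xu[OF that] c0[OF that] \<mu> by (simp add: \<mu>_def[symmetric])
 have hom: "hom_set u l \<delta> H" if "l <= 2 * M" for l
  using HH(2)[OF Ht(2) that] by (simp add: u_def[abs_def])
 have pre: "{q\<in>Q. g q = j} = (%s. (H, t * k + s)) ` {..<k}"
  unfolding Q_def g_def Ht(1) using Ht k by (intro group_preimage)
 have injr: "inj_on (%s. (H, t * k + s)) {..<k}" by (auto simp: inj_on_def)
 have tk: "t * k + s < L" if "s < k" for s
 proof -
  have "t * k + s < Suc t * k" using that by simp
  also have "... <= N * k" using Ht by (intro mult_le_mono1) simp
  finally show ?thesis by (simp add: L_def mult.commute)
 qed
 have Vj: "V \<xi> j = \<mu> *\<^sub>R (\<Sum>s<k. \<xi> (H, t * k + s) *\<^sub>R u (h (t * k + s)))" for \<xi>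
 proof -
  have "V \<xi> j = (\<Sum>s<k. \<xi> (H, t * k + s) *\<^sub>R x (\<phi> (H, t * k + s)))"
   unfolding V_def pre using injr by (simp add: sum.reindex)
  also have "... = (\<Sum>s<k. \<mu> *\<^sub>R (\<xi> (H, t * k + s) *\<^sub>R u (h (t * k + s))))"
  proof (rule sum.cong[OF refl])
   fix s assume "s \<in> {..<k}"
   then have "h (t * k + s) \<in> H" using tk[of s] h(2) by auto
   then show "\<xi> (H, t * k + s) *\<^sub>R x (\<phi> (H, t * k + s)) = \<mu> *\<^sub>R (\<xi> (H, t * k + s) *\<^sub>R u (h (t * k + s)))"
    using xu[of "h (t * k + s)"] by (simp add: h_def mult.commute)
  qed
  finally show ?thesis by (simp add: scaleR_sum_right)
 qed
 have upM: "M' j <= \<mu> * (4 * real k powr (1 / r))"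
 proof -
  have "(\<Sum>q\<in>{q\<in>Q. g q = j}. norm (x (\<phi> q)) powr r) <= (\<Sum>q\<in>{q\<in>Q. g q = j}. \<mu> powr r)"
  proof (intro sum_mono powr_mono2)
   fix q assume "q \<in> {q\<in>Q. g q = j}"
   then obtain s where "q = (H, t * k + s)" "s < k" unfolding pre by auto
   then have "\<phi> q \<in> H" using tk[of s] h(2) by (auto simp flip: h_def)
   then show "norm (x (\<phi> q)) <= \<mu>" using \<kappa>(1)[OF Hx(1)] c0 by (simp add: \<mu>_def)
  qed (use r in auto)
  also have "... = real k * \<mu> powr r" unfolding pre using injr by (simp add: card_image)
  finally have "M' j powr r <= 2 powr r * 2 * (real k * \<mu> powr r)"
   using j(2) by (meson mult_left_mono order_trans powr_ge_zero mult_nonneg_nonneg zero_le_numeral)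
  also have "... <= 2 powr r * 2 powr r * (real k * \<mu> powr r)"
   using powr_mono[of 1 r 2] r by (intro mult_right_mono mult_left_mono) auto
  also have "... = (\<mu> * (4 * real k powr (1 / r))) powr r"
  proof -
   have four: "(4 :: real) powr r = 2 powr r * 2 powr r" using powr_mult[of 2 2 r] by simp
   show ?thesis unfolding powr_mult powr_powr using r by (simp add: four)
  qed
  finally have "(M' j powr r) powr (1 / r) <= ((\<mu> * (4 * real k powr (1 / r))) powr r) powr (1 / r)"
   using r by (intro powr_mono2[of "1/r"]) auto
  moreover have "M' j \<ge> 0" unfolding M'_def by (intro sign_avg_nonneg) auto
  ultimately show ?thesis using r \<mu> by (simp add: powr_powr)
 qed
 define e0 where "e0 s = u (h (s * Suc K)) - u (h (s * Suc K + 1))" for s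
 have step: "s * Suc K + 1 < N" if "s < M" for s
 proof -
  have "s * Suc K + 1 < Suc s * Suc K" using K by simp
  also have "... <= N" unfolding N_def using that by (intro mult_le_mono1) simp
  finally show ?thesis .
 qed
 have gap: "s * Suc K + 1 < r * Suc K" if "s < r" for s r
 proof -
  have "s * Suc K + 1 < Suc s * Suc K" using K by simp
  also have "... <= r * Suc K" using that by (intro mult_le_mono1) simp
  finally show ?thesis .
 qed
 have hsub: "h ` {..<L} \<subseteq> H" using h(2) by simp
 have hH: "h s \<in> H" if "s < L" for s using that h(2) by auto
 have L1: "1 < L" using step[of 0] k N(2) by simp
 text \<open>If all the vectors of the block were close to each other, their signed sums would be of
  order at least \<open>sqrt k\<close> on average by Khinchine's inequality.\<close>
 have d00: "1 / 8 <= norm (e0 0)"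
 proof (rule ccontr)
  assume neg: "\<not> ?thesis"
  obtain f :: "'a \<Rightarrow>\<^sub>L real" where f: "blinfun_apply f (u (h 0)) = norm (u (h 0))" "norm f <= 1"
   by (rule norming_functional)
  have fle: "\<bar>blinfun_apply f v\<bar> <= norm v" for v
   using norm_blinfun[of f v] mult_right_mono[OF f(2), of "norm v"] by simp
  have close: "norm (u (h 0) - u (h s)) <= 1 / 4" if "s < L" for s
  proof (cases "s = 0")
   case False
   have "dominates 1 (%r. u (h 0) - u (h s)) (%r. u (h (0 * Suc K)) - u (h (0 * Suc K + 1))) \<delta>"
   proof (rule hom_set_pairs[OF _ h(1) hsub])
    show "hom_set u (2 * 1) \<delta> H" using k by (intro hom) simp
   qed (use False that L1 in auto)
   then have "norm (u (h 0) - u (h s)) <= norm (e0 0) + \<delta>"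
    unfolding dominates_def e0_def by (elim allE[of _ "%_. 1"]) simp
   then show ?thesis using neg by (simp add: \<delta>_def)
  qed simp
  have flow: "1 / 4 <= blinfun_apply f (u (h s))" if "s < L" for s
  proof -
   have "blinfun_apply f (u (h 0)) - blinfun_apply f (u (h s)) <= 1 / 4"
    using fle[of "u (h 0) - u (h s)"] close[OF that] by (simp add: blinfun.diff_right)
   then show ?thesis using f(1) u2[OF hH[OF L]] by simp
  qed
  have "sqrt (real k) * (\<mu> / 4) <= sqrt (\<Sum>q\<in>{q\<in>Q. g q = j}. (blinfun_apply f (x (\<phi> q)))\<^sup>2)"
  proof -
   have "real k * (\<mu> / 4)\<^sup>2 = (\<Sum>q\<in>{q\<in>Q. g q = j}. (\<mu> / 4)\<^sup>2)"
    unfolding pre using injr by (simp add: card_image)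
   also have "... <= (\<Sum>q\<in>{q\<in>Q. g q = j}. (blinfun_apply f (x (\<phi> q)))\<^sup>2)"
   proof (intro sum_mono power_mono)
    fix q assume "q \<in> {q\<in>Q. g q = j}"
    then obtain s where s: "q = (H, t * k + s)" "s < k" unfolding pre by auto
    have "x (\<phi> q) = \<mu> *\<^sub>R u (h (t * k + s))" using xu[OF hH[OF tk[OF s(2)]]] s(1) by (simp add: h_def)
    moreover have "\<mu> * (1 / 4) <= \<mu> * blinfun_apply f (u (h (t * k + s)))"
     using flow[OF tk[OF s(2)]] \<mu> by (intro mult_left_mono) auto
    ultimately show "\<mu> / 4 <= blinfun_apply f (x (\<phi> q))" by (simp add: blinfun.scaleR_right)
   qed (use \<mu> in auto)
   finally have "sqrt (real k * (\<mu> / 4)\<^sup>2) <= sqrt (\<Sum>q\<in>{q\<in>Q. g q = j}. (blinfun_apply f (x (\<phi> q)))\<^sup>2)"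
    by (rule real_sqrt_le_mono)
   then show ?thesis using \<mu> by (simp add: real_sqrt_mult)
  qed
  also have "... <= 2 * sign_avg Q (%\<xi>. \<bar>\<Sum>q\<in>{q\<in>Q. g q = j}. \<xi> q * blinfun_apply f (x (\<phi> q))\<bar>)"
   using finQ by (intro khinchine_L1_subset) auto
  also have "... <= 2 * M' j"
   unfolding M'_def
  proof (intro mult_left_mono sign_avg_mono finQ)
   fix \<xi>
   have "blinfun_apply f (V \<xi> j) = (\<Sum>q\<in>{q\<in>Q. g q = j}. \<xi> q * blinfun_apply f (x (\<phi> q)))"
    by (simp add: V_def blinfun.sum_right blinfun.scaleR_right)
   then show "\<bar>\<Sum>q\<in>{q\<in>Q. g q = j}. \<xi> q * blinfun_apply f (x (\<phi> q))\<bar> <= norm (V \<xi> j)"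
    using fle[of "V \<xi> j"] by simp
  qed simp
  also have "... <= 2 * (\<mu> * (4 * real k powr (1 / r)))" using upM by simp
  finally have "\<mu> * sqrt (real k) <= \<mu> * (32 * real k powr (1 / r))" by (simp add: mult_ac)
  then have "real k powr (1 / 2) <= 32 * real k powr (1 / r)" using \<mu> by (simp add: powr_half_sqrt)
  then have "real k powr (1 / 2) / real k powr (1 / r) <= 32" using k by (simp add: divide_le_eq)
  then have "real k powr (1 / 2 - 1 / r) <= 32" by (simp only: powr_diff)
  then show False using klarge by simp
 qed
 obtain \<xi> where \<xi>0: "\<xi> \<in> signs Q" "norm (V \<xi> j) <= M' j"
  unfolding M'_def by (rule sign_avg_exists_le[OF finQ])
 have \<xi>: "\<xi> \<in> signs Q" "norm (V \<xi> j) <= \<mu> * (4 * real k powr (1 / r))"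
  using \<xi>0 upM by auto
 define \<sigma> where "\<sigma> s = \<xi> (H, t * k + s)" for s
 have \<sigma>: "\<sigma> s = 1 \<or> \<sigma> s = -1" if "s < k" for s
  unfolding \<sigma>_def using \<xi>(1) by (rule signs_cases) (use pre that in blast)
 have Vs: "norm (\<Sum>s<k. \<sigma> s *\<^sub>R u (h (t * k + s))) <= 4 * real k powr (1 / r)"
  using \<xi>(2) \<mu> unfolding Vj \<sigma>_def by simp
 have shift: "norm (\<Sum>s<k. \<sigma> s *\<^sub>R u (h (s * Suc K + a))) <= 4 * real k powr (1 / r) + \<delta>" if "a <= 1" for a
 proof -
  have hk: "hom_set u k \<delta> H" using k by (intro hom) simp
  have "norm (\<Sum>s<k. \<sigma> s *\<^sub>R u (h (s * Suc K + a))) <= norm (\<Sum>s<k. \<sigma> s *\<^sub>R u (h (t * k + s))) + \<delta>"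
  proof (rule hk[unfolded hom_set_def, rule_format], intro conjI allI impI)
   have "s * Suc K + a < L" if "s < k" for s
    using step[of s] that k N(2) \<open>a <= 1\<close> by linarith
   moreover have "s * Suc K + a < s' * Suc K + a" if "s < s'" for s s'
    using gap[OF that] by linarith
   ultimately show "strict_mono_on {..<k} (%s. h (s * Suc K + a))" "(%s. h (s * Suc K + a)) ` {..<k} \<subseteq> H"
    using h(1) hH by (auto simp: strict_mono_on_def)
   show "strict_mono_on {..<k} (%s. h (t * k + s))" "(%s. h (t * k + s)) ` {..<k} \<subseteq> H"
    using h(1) hH tk by (auto simp: strict_mono_on_def)
  qed (use \<sigma> in force)
  then show ?thesis using Vs by simp
 qed
 have k1: "1 <= real k powr (1 / r)" using k r by (intro ge_one_powr_ge_zero) auto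
 have up0: "norm (\<Sum>s<k. \<sigma> s *\<^sub>R e0 s) <= 10 * real k powr (1 / r)"
 proof -
  have "(\<Sum>s<k. \<sigma> s *\<^sub>R e0 s) = (\<Sum>s<k. \<sigma> s *\<^sub>R u (h (s * Suc K + 0))) - (\<Sum>s<k. \<sigma> s *\<^sub>R u (h (s * Suc K + 1)))"
   by (simp add: e0_def scaleR_diff_right sum_subtractf)
  also have "norm ... <= (4 * real k powr (1 / r) + \<delta>) + (4 * real k powr (1 / r) + \<delta>)"
   by (intro norm_triangle_le_diff add_mono shift) auto
  also have "... <= 10 * real k powr (1 / r)" using k1 by (simp add: \<delta>_def)
  finally show ?thesis .
 qed
 have spr: "spreading M e0"
  unfolding e0_def
 proof (rule spreading_of_hom_set[OF hom K])
  show "strict_mono_on {..<M * Suc K} h" using h(1) N(2) unfolding N_def by (auto simp: strict_mono_on_def)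
  show "h ` {..<M * Suc K} \<subseteq> H" using hH N(2) unfolding N_def by auto
  show "\<delta> + 2 * real M / real K <= norm (u (h (0 * Suc K)) - u (h (0 * Suc K + 1))) / 8"
   using d00 K2 unfolding \<delta>_def e0_def by linarith
  show "u (h (0 * Suc K)) - u (h (0 * Suc K + 1)) ~= 0" using d00 by (auto simp: e0_def)
 qed (use k \<delta> u1 in auto)
 define e where "e s = (1 / norm (e0 0)) *\<^sub>R e0 s" for s
 have e00: "e0 0 ~= 0" using d00 by auto
 note e = spreading_normalize[OF spr e00, folded e_def]
 show thesis
 proof (rule that[of e])
  show "e i \<in> Y" if "i < M" for i
  proof -
   have "u s \<in> Y" if "s \<in> H" for s using Hx(1)[OF that] xY Y by (simp add: u_def subspace_scale)
   moreover have "h (i * Suc K) \<in> H" "h (i * Suc K + 1) \<in> H" using step[OF that] N(2) by (auto intro!: hH)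
   ultimately show ?thesis using Y by (simp add: e_def e0_def subspace_scale subspace_diff)
  qed
  have "flat e0 k <= 4 * norm (\<Sum>s<k. \<sigma> s *\<^sub>R e0 s)"
   using spr k \<sigma> by (intro spreading_signs_flat) auto
  then have "flat e0 k <= 40 * real k powr (1 / r)" using up0 by simp
  then have "flat e k <= 40 * real k powr (1 / r) / (1 / 8)"
   unfolding e(3) using d00 by (intro frac_le) auto
  then show "flat e k <= 320 * real k powr (1 / r)" by simp
 qed (use e in auto)
qed

section \<open>Growth of the fundamental function at the scale of one level\<close>

lemma spreading_le:
 assumes e: "spreading M' e" and le: "M <= M'"
 shows "spreading M e"
 unfolding spreading_def
proof (intro conjI allI impI; (elim conjE)?)
 fix a and F :: "nat set" assume F: "F \<subseteq> {..<M}"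
 have "norm (\<Sum>s\<in>F. (if s < M then a s else 0) *\<^sub>R e s) <= 2 * norm (\<Sum>s<M'. (if s < M then a s else 0) *\<^sub>R e s)"
  using F le by (intro spreading_restrict[OF e]) auto
 also have "(\<Sum>s<M'. (if s < M then a s else 0) *\<^sub>R e s) = (\<Sum>s<M. a s *\<^sub>R e s)"
  using le by (intro sum.mono_neutral_cong_right) auto
 also have "(\<Sum>s\<in>F. (if s < M then a s else 0) *\<^sub>R e s) = (\<Sum>s\<in>F. a s *\<^sub>R e s)"
  using F by (intro sum.cong) auto
 finally show "norm (\<Sum>s\<in>F. a s *\<^sub>R e s) <= 2 * norm (\<Sum>s<M. a s *\<^sub>R e s)" .
next
 fix m :: nat and i j :: "nat => nat" and a
 assume "strict_mono_on {..<m} i" "strict_mono_on {..<m} j" "i ` {..<m} \<subseteq> {..<M}" "j ` {..<m} \<subseteq> {..<M}"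
 then show "norm (\<Sum>s<m. a s *\<^sub>R e (i s)) <= 2 * norm (\<Sum>s<m. a s *\<^sub>R e (j s))"
  using le by (intro spreading_shift[OF e]) auto
qed

lemma spreading_norms:
 assumes e: "spreading M e" and "norm (e 0) = 1" "i < M"
 shows "norm (e i) <= 2" "1 / 2 <= norm (e i)"
proof -
 have "norm (\<Sum>s<(1::nat). 1 *\<^sub>R e ((%_. i) s)) <= 2 * norm (\<Sum>s<(1::nat). 1 *\<^sub>R e ((%_. 0) s))"
  using assms by (intro spreading_shift[OF e]) (auto simp: strict_mono_on_def)
 then show "norm (e i) <= 2" using assms by simp
 have "norm (\<Sum>s<(1::nat). 1 *\<^sub>R e ((%_. 0) s)) <= 2 * norm (\<Sum>s<(1::nat). 1 *\<^sub>R e ((%_. i) s))"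
  using assms by (intro spreading_shift[OF e]) (auto simp: strict_mono_on_def)
 then show "1 / 2 <= norm (e i)" using assms by simp
qed

lemma rad_flat:
 assumes e: "spreading M e" and "N <= M"
 shows "rad {..<N} e <= 4 * flat e N" "flat e N <= 4 * rad {..<N} e"
proof -
 have s: "\<xi> i = 1 \<or> \<xi> i = -1" if "\<xi> \<in> signs {..<N}" "i < N" for \<xi> i
  using that by (intro signs_cases[of \<xi> "{..<N}"]) auto
 have "rad {..<N} e <= sign_avg {..<N} (%_. 4 * flat e N)"
  unfolding rad_def lin_avg_def using s by (intro sign_avg_mono spreading_signs_flat(1)[OF e assms(2)]) auto
 then show "rad {..<N} e <= 4 * flat e N" by simp
 have "sign_avg {..<N} (%_. flat e N) <= sign_avg {..<N} (%\<xi>. 4 * norm (\<Sum>i<N. \<xi> i *\<^sub>R e i))"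
  using s by (intro sign_avg_mono spreading_signs_flat(2)[OF e assms(2)]) auto
 then show "flat e N <= 4 * rad {..<N} e" by (simp add: rad_def lin_avg_def sign_avg_cmult)
qed

lemma flat_upper_of_type:
 fixes e :: "nat => 'a::real_normed_vector"
 assumes ty: "!!n. type_bound (UNIV :: 'a set) p n C" and p: "1 <= p"
  and e: "spreading M e" "norm (e 0) = 1" and N: "N <= M"
 shows "flat e N <= 8 * \<bar>C\<bar> * real N powr (1 / p)"
proof -
 have "flat e N <= 4 * rad {..<N} e" using rad_flat[OF e(1) N] by simp
 also have "rad {..<N} e <= C * lp {..<N} p e" by (rule type_boundD[OF ty[of N]]) auto
 also have "C * lp {..<N} p e <= \<bar>C\<bar> * lp {..<N} p e" by (intro mult_right_mono) auto
 also have "lp {..<N} p e <= real (card {..<N}) powr (1 / p) * 2"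
  using p spreading_norms(1)[OF e] N by (intro lp_le) auto
 finally show ?thesis by (simp add: mult_left_mono)
qed

lemma flat_lower_of_cotype:
 fixes e :: "nat => 'a::real_normed_vector"
 assumes ty: "!!n. cotype_bound (UNIV :: 'a set) q n C" and q: "1 <= q"
  and e: "spreading M e" "norm (e 0) = 1" and N: "N <= M"
 shows "real N powr (1 / q) <= 8 * \<bar>C\<bar> * flat e N"
proof -
 have "real N * (1 / 2) powr q = (\<Sum>i<N. (1 / 2) powr q)" by simp
 also have "... <= (\<Sum>i<N. norm (e i) powr q)"
  using q spreading_norms(2)[OF e] N by (intro sum_mono powr_mono2) auto
 finally have "(real N * (1 / 2) powr q) powr (1 / q) <= lp {..<N} q e"
  unfolding lp_def using q by (intro powr_mono2) auto
 also have "(real N * (1 / 2) powr q) powr (1 / q) = real N powr (1 / q) / 2"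
  using q unfolding powr_mult powr_powr by simp
 finally have 1: "real N powr (1 / q) / 2 <= lp {..<N} q e" .
 have 2: "lp {..<N} q e <= C * rad {..<N} e" by (rule cotype_boundD[OF ty[of N]]) auto
 have 3: "C * rad {..<N} e <= \<bar>C\<bar> * rad {..<N} e" by (intro mult_right_mono) (auto simp: rad_nonneg)
 have 4: "\<bar>C\<bar> * rad {..<N} e <= \<bar>C\<bar> * (4 * flat e N)"
  using rad_flat[OF e(1) N] by (intro mult_left_mono) auto
 show ?thesis using 1 2 3 4 by linarith
qed

text \<open>32 disjoint axes of \<open>2 * axis_size n\<close> positions have to fit below
  \<open>n - 2\<close>. Subtracting 3 makes the axes of level \<open>n + 1\<close> fit there as
  well, since they are also used for lines on level \<open>n\<close>.\<close>

definition axis_size :: "nat => nat" where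
 "axis_size n = (n - 3) div 64"

text \<open>Over the last \<open>2 * axis_size n\<close> doublings before
  \<open>2 ^ (n - 2)\<close>, the length of a sum over all positions of a level but two, the
  fundamental function grows at least with the power \<open>1 / 2 + \<delta>\<close>, up to
  \<open>C\<close>.\<close>

definition type_rates :: "real => real => nat => (nat => 'a::real_normed_vector) => bool" where
 "type_rates C \<delta> n e \<longleftrightarrow>
   2 powr (2 * real (axis_size n) * (1 / 2 + \<delta>)) * flat e (2 ^ (n - 2 - 2 * axis_size n)) <= C * flat e (2 ^ (n - 2))"

text \<open>The growth beyond \<open>2 ^ (2 * h)\<close> stays below the square root. The exponent
  \<open>4 * h + 2\<close> instead of \<open>4 * h\<close> absorbs that the axis sizes of
  neighbouring levels may differ by one.\<close>

definition cotype_rates :: "real => real => nat => (nat => 'a::real_normed_vector) => bool" where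
 "cotype_rates C \<delta> n e \<longleftrightarrow>
   flat e (2 ^ (4 * axis_size n + 2)) <= C * 2 powr (2 * real (axis_size n) * (1 / 2 - \<delta>)) * flat e (2 ^ (2 * axis_size n))"

text \<open>\<open>p\<close> and \<open>q\<close> enclose the type index closely. Their discrepancy
  accumulates over all of the roughly \<open>64 * h\<close> doublings of a level, but the gain over
  the square root only over \<open>2 * h\<close> of them; this is the factor 32.\<close>

lemma type_exponents:
 assumes "type_index TYPE('a::real_normed_vector) ~= 2"
 obtains p q \<delta> where "has_type TYPE('a) p" "1 <= q" "q < 2" "\<not> type_on (UNIV :: 'a set) q"
  "\<delta> > 0" "1 / 2 + \<delta> + 32 * (1 / p - 1 / q) <= 1 / q" "1 / q <= 1 / p"
proof -
 define S where "S = {p. has_type TYPE('a) p}"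
 have S12: "1 <= p" "p <= 2" if "p \<in> S" for p using that by (auto simp: S_def has_type_def)
 have one: "1 \<in> S"
  unfolding S_def has_type_iff type_on_def type_bound_def mem_Collect_eq
  by (auto intro!: exI[of _ 1] order_trans[OF rad_le_sum] simp: lp_def sum_nonneg)
 have bdd: "bdd_above S" using S12 by (intro bdd_aboveI[of _ 2]) auto
 define s where "s = Sup S"
 have s1: "1 <= s" "s <= 2"
  using one bdd S12 by (auto simp: s_def intro!: cSup_upper cSup_least)
 have "s < 2"
 proof (rule ccontr)
  assume "\<not> ?thesis"
  then have "s = 2" using s1 by simp
  have "type_index TYPE('a) = 2"
  proof (rule antisym)
   show "type_index TYPE('a) <= 2" unfolding type_index_def using S12 by (intro SUP_least) (auto simp: S_def)
   show "2 <= type_index TYPE('a)"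
   proof (rule dense_le)
    fix y :: ereal assume "y < 2"
    show "y <= type_index TYPE('a)"
    proof (cases y)
     case (real r)
     then have "r < Sup S" using \<open>y < 2\<close> \<open>s = 2\<close> by (simp add: s_def)
     then obtain p where "p \<in> S" "r < p" using less_cSup_iff[of S r] one bdd by blast
     then have "y <= ereal p" "ereal p <= type_index TYPE('a)"
      using real by (auto simp: type_index_def S_def intro: SUP_upper)
     then show ?thesis by (rule order_trans)
    qed (use \<open>y < 2\<close> in auto)
   qed
  qed
  then show False using assms by simp
 qed
 define \<theta> where "\<theta> = 1 / s - 1 / 2"
 have \<theta>: "0 < \<theta>" "\<theta> <= 1 / 2" using s1 \<open>s < 2\<close> by (auto simp: \<theta>_def field_simps)
 \<comment> \<open>With \<open>1 / s = 1 / 2 + 256 * \<xi>\<close> the left side of the required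
   inequality exceeds 1/2 by at most \<open>65 * \<xi>\<close>, and \<open>1 / q\<close> exceeds it
   by \<open>255 * \<xi>\<close>.\<close>
 define \<xi> where "\<xi> = \<theta> / 256"
 have \<xi>: "\<xi> > 0" using \<theta> by (simp add: \<xi>_def)
 have "1 / s = 1 / 2 + \<theta>" by (simp add: \<theta>_def)
 then have sinv: "1 / s = 1 / 2 + 256 * \<xi>" by (simp add: \<xi>_def)
 define q where "q = 1 / (1 / s - \<xi>)"
 have q: "1 / q = 1 / s - \<xi>" by (simp add: q_def)
 have qpos: "0 < 1 / s - \<xi>" "1 / s - \<xi> < 1 / s" "1 / 2 < 1 / s - \<xi>" using sinv \<xi> by auto
 have "s < q" using qpos s1 by (auto simp: q_def field_simps)
 have "q < 2" using qpos by (simp add: q_def field_simps)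
 have "q \<notin> S" using \<open>s < q\<close> bdd cSup_upper[of q S] by (auto simp: s_def)
 have "1 / (1 / s + \<xi>) < s"
  using divide_strict_left_mono[of "1 / s" "1 / s + \<xi>" 1] s1 \<xi> by (simp add: add_pos_pos)
 then obtain p where p: "p \<in> S" "1 / (1 / s + \<xi>) < p" using less_cSup_iff[of S] one bdd by (auto simp: s_def)
 have "1 / p <= 1 / s + \<xi>"
 proof -
  have "0 < 1 / (1 / s + \<xi>)" using s1 \<xi> by (simp add: add_pos_pos)
  then have "1 / p <= 1 / (1 / (1 / s + \<xi>))" using p(2) S12(1)[OF p(1)] by (intro divide_left_mono) (auto intro!: divide_pos_pos)
  then show ?thesis by simp
 qed
 moreover have "1 / s <= 1 / p"
  using p(1) bdd S12[OF p(1)] cSup_upper[of p S] by (intro divide_left_mono) (auto simp: s_def)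
 ultimately have pq: "1 / p - 1 / q <= 2 * \<xi>" "1 / q <= 1 / p"
  using q \<xi> by simp_all
 have "32 * (1 / p - 1 / q) <= 32 * (2 * \<xi>)" using pq(1) by (intro mult_left_mono) auto
 then have pq': "1 / 2 + \<xi> + 32 * (1 / p - 1 / q) <= 1 / q" using q sinv \<xi> by simp
 show thesis
 proof (rule that[of p q \<xi>])
  show "\<not> type_on (UNIV :: 'a set) q"
   using \<open>q \<notin> S\<close> \<open>s < q\<close> \<open>q < 2\<close> s1 by (auto simp: S_def has_type_iff)
  show "has_type TYPE('a) p" using p by (simp add: S_def)
 qed (use \<open>q < 2\<close> \<open>s < q\<close> s1 pq pq' \<xi> in auto)
qed

text \<open>An upper growth exponent \<open>1 / r\<close> over \<open>4 * h\<close> doublings is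
  compared with a lower exponent \<open>\<kappa>\<close> over \<open>2 * h\<close>, hence
  \<open>2 / r - \<kappa>\<close>. The value \<open>\<kappa> = 0\<close> stands for cotype
  infinity.\<close>

lemma cotype_exponents:
 assumes "cotype_index TYPE('a::real_normed_vector) ~= 2"
 obtains r \<kappa> \<delta> where "2 < r" "\<not> cotype_on (UNIV :: 'a set) r" "\<delta> > 0" "2 / r - \<kappa> <= 1 / 2 - \<delta>"
  "\<kappa> = 0 \<or> (\<kappa> > 0 \<and> has_cotype TYPE('a) (1 / \<kappa>))"
proof -
 define S where "S = {p. has_cotype TYPE('a) p}"
 have S2: "2 <= p" if "p \<in> S" for p using that by (auto simp: S_def has_cotype_def)
 show thesis
 proof (cases "S = {}")
  case True
  \<comment> \<open>Without any finite cotype every exponent fails; 8 is chosen because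
    \<open>2 / 8 = 1 / 2 - 1 / 4\<close>.\<close>
  then have "8 \<notin> S" by auto
  then show thesis by (intro that[of 8 "1/4" 0]) (auto simp: S_def has_cotype_iff)
 next
  case False
  have bdd: "bdd_below S" using S2 by (intro bdd_belowI[of _ 2]) auto
  define s where "s = Inf S"
  have s2: "2 <= s" using False S2 by (auto simp: s_def intro!: cInf_greatest)
  have "2 < s"
  proof (rule ccontr)
   assume "\<not> ?thesis"
   then have "s = 2" using s2 by simp
   have "cotype_index TYPE('a) = 2"
   proof (rule antisym)
    show "2 <= cotype_index TYPE('a)" unfolding cotype_index_def using S2 by (intro INF_greatest) (auto simp: S_def)
    show "cotype_index TYPE('a) <= 2"
    proof (rule dense_ge)
     fix y :: ereal assume "2 < y"
     show "cotype_index TYPE('a) <= y"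
     proof (cases y)
      case (real r)
      then have "Inf S < r" using \<open>2 < y\<close> \<open>s = 2\<close> by (simp add: s_def)
      then obtain p where "p \<in> S" "p < r" using cInf_less_iff[of S r] False bdd by blast
      then have "cotype_index TYPE('a) <= ereal p" "ereal p <= y"
       using real by (auto simp: cotype_index_def S_def intro: INF_lower)
      then show ?thesis by (rule order_trans)
     qed (use \<open>2 < y\<close> in auto)
    qed
   qed
   then show False using assms by simp
  qed
  define \<theta> where "\<theta> = 1 / 2 - 1 / s"
  define \<xi> where "\<xi> = \<theta> / 6"
  have "1 / s < 1 / 2" using \<open>2 < s\<close> by (simp add: field_simps)
  then have \<xi>: "\<xi> > 0" by (simp add: \<xi>_def \<theta>_def)
  have "1 / s = 1 / 2 - \<theta>" by (simp add: \<theta>_def)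
  then have sinv: "1 / s = 1 / 2 - 6 * \<xi>" by (simp add: \<xi>_def)
  define r where "r = 1 / (1 / s + \<xi>)"
  have r: "1 / r = 1 / s + \<xi>" by (simp add: r_def)
  have rpos: "0 < 1 / s + \<xi>" using s2 \<xi> by (simp add: add_pos_pos)
  have "1 / s + \<xi> < 1 / 2" using sinv \<xi> by simp
  then have "2 < r" using rpos by (simp add: r_def field_simps)
  have "r < s" using s2 \<xi> rpos by (simp add: r_def field_simps)
  then have "r \<notin> S" using bdd cInf_lower[of r S] by (auto simp: s_def)
  obtain q where q: "q \<in> S" "1 / s - \<xi> <= 1 / q"
  proof (cases "1 / s - \<xi> <= 0")
   case True
   obtain q where "q \<in> S" using False by blast
   moreover from this have "0 <= 1 / q" using S2[of q] by simp
   ultimately show thesis using True by (intro that[of q]) linarith+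
  next
   case F: False
   then have "s < 1 / (1 / s - \<xi>)" using s2 \<xi> by (simp add: field_simps)
   then obtain q where q: "q \<in> S" "q < 1 / (1 / s - \<xi>)" using cInf_less_iff[of S] False bdd by (auto simp: s_def)
   then have "1 / (1 / (1 / s - \<xi>)) <= 1 / q" using F S2[OF q(1)] by (intro divide_left_mono) auto
   then show thesis using q that by simp
  qed
  show thesis
  proof (rule that[of r "3 * \<xi>" "1 / q"])
   show "\<not> cotype_on (UNIV :: 'a set) r" using \<open>r \<notin> S\<close> \<open>2 < r\<close> by (auto simp: S_def has_cotype_iff)
   show "2 / r - 1 / q <= 1 / 2 - 3 * \<xi>" using r q(2) sinv by (simp add: field_simps) 
   show "1 / q = 0 \<or> (1 / q > 0 \<and> has_cotype TYPE('a) (1 / (1 / q)))"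
    using q S2[OF q(1)] by (auto simp: S_def)
  qed (use \<open>2 < r\<close> \<xi> in auto)
 qed
qed

lemma axis_size_bounds: "64 * axis_size n <= n - 3" "n - 3 <= 64 * axis_size n + 63"
 unfolding axis_size_def by auto

definition spread_everywhere :: "(nat => (nat => 'a::real_normed_vector) => bool) => bool" where
 "spread_everywhere rate \<longleftrightarrow> (\<forall>\<Phi> n. finite \<Phi> --> 2 <= n --> (\<exists>e. spreading (2 ^ (n + 2)) e \<and>
   (\<forall>i<2 ^ (n + 2). e i \<in> common_kernel \<Phi>) \<and> norm (e 0) = 1 \<and> rate n e))"

lemma spread_everywhere_mono:
 "spread_everywhere r ==> (!!n e. r n e ==> r' n e) ==> spread_everywhere r'"
 unfolding spread_everywhere_def by meson

text \<open>The upper bound from type \<open>p\<close> at \<open>2 ^ (n - 2 - 2 * h)\<close> is set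
  against the lower bound from the failing \<open>q\<close> at \<open>2 ^ (n - 2)\<close>. The
  excess \<open>65 * g\<close> of the exponents does not depend on \<open>n\<close> and goes into
  \<open>C\<close>.\<close>

lemma type_structures:
 assumes "type_index TYPE('a::real_normed_vector) ~= 2"
 obtains C \<delta> where "C > 0" "\<delta> > 0"
  "spread_everywhere (type_rates C \<delta> :: nat => (nat => 'a) => bool)"
proof -
 obtain p q \<delta> where p: "has_type TYPE('a) p" and q: "1 <= q" "q < 2" "\<not> type_on (UNIV :: 'a set) q"
  and \<delta>: "\<delta> > 0" "1 / 2 + \<delta> + 32 * (1 / p - 1 / q) <= 1 / q" "1 / q <= 1 / p"
  using type_exponents[OF assms] by metis
 obtain B where B: "!!n. type_bound (UNIV :: 'a set) p n B" and p1: "1 <= p"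
  using p by (auto simp: has_type_iff type_on_def)
 define c where "c = (1 - 2 powr (1 - 2 / q)) / 64"
 have "2 powr (1 - 2 / q) < 2 powr 0" using q by (intro powr_less_mono) (auto simp: field_simps)
 then have c: "c > 0" by (simp add: c_def)
 define g where "g = 1 / p - 1 / q"
 have g: "g \<ge> 0" using \<delta> by (simp add: g_def)
 define C where "C = 8 * (\<bar>B\<bar> + 1) * 2 powr (65 * g) / c"
 have C: "C > 0" using c by (simp add: C_def)
 have main: "\<exists>e :: nat => 'a. spreading (2 ^ (n + 2)) e \<and>
   (\<forall>i<2 ^ (n + 2). e i \<in> common_kernel \<Phi>) \<and> norm (e 0) = 1 \<and> type_rates C \<delta> n e"
  if \<Phi>: "finite \<Phi>" and n: "2 <= n" for \<Phi> :: "('a \<Rightarrow>\<^sub>L real) set" and n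
 proof -
  have nt: "\<not> type_on (common_kernel \<Phi>) q"
   using type_on_common_kernel[OF \<Phi>, of q] q by auto
  have "(2::nat) ^ (n - 2) <= 2 ^ (n + 2)" by (intro power_increasing) auto
  then obtain e :: "nat => 'a" where e: "spreading (2 ^ (n + 2)) e" "!!i. i < 2 ^ (n + 2) ==> e i \<in> common_kernel \<Phi>"
   "norm (e 0) = 1" "c * real (2 ^ (n - 2)) powr (1 / q) <= flat e (2 ^ (n - 2))"
   using type_extract[OF subspace_common_kernel nt q(1,2), of "2 ^ (n - 2)" "2 ^ (n + 2)"] unfolding c_def by auto
  define h where "h = axis_size n"
  have h: "2 * h <= n - 2" "n - 2 <= 64 * h + 64" using axis_size_bounds[of n] n by (auto simp: h_def)
  have "flat e (2 ^ (n - 2 - 2 * h)) <= 8 * \<bar>B\<bar> * real (2 ^ (n - 2 - 2 * h)) powr (1 / p)"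
  proof (rule flat_upper_of_type[OF B p1 e(1,3)])
   show "(2::nat) ^ (n - 2 - 2 * h) <= 2 ^ (n + 2)" by (intro power_increasing) auto
  qed
  also have "... <= 8 * (\<bar>B\<bar> + 1) * real (2 ^ (n - 2 - 2 * h)) powr (1 / p)"
   by (intro mult_right_mono) auto
  also have "real (2 ^ (n - 2 - 2 * h)) powr (1 / p) = 2 powr ((real (n - 2) - 2 * real h) / p)"
  proof -
   have "real (2 ^ (n - 2 - 2 * h)) = 2 powr real (n - 2 - 2 * h)" by (simp add: powr_realpow)
   also have "real (n - 2 - 2 * h) = real (n - 2) - 2 * real h" using h by simp
   finally show ?thesis by (simp add: powr_powr)
  qed
  finally have 1: "flat e (2 ^ (n - 2 - 2 * h)) <= 8 * (\<bar>B\<bar> + 1) * 2 powr ((real (n - 2) - 2 * real h) / p)" .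
  have expo: "2 * real h * (1 / 2 + \<delta>) + (real (n - 2) - 2 * real h) / p <= 65 * g + real (n - 2) / q"
  proof -
   have "2 * real h * (1 / 2 + \<delta>) <= 2 * real h * (1 / q - 32 * g)"
    using \<delta>(2) by (intro mult_left_mono) (auto simp: g_def)
   moreover have "(real (n - 2) - 2 * real h) / p = (real (n - 2) - 2 * real h) * g + (real (n - 2) - 2 * real h) / q"
    by (simp add: g_def algebra_simps diff_divide_distrib)
   moreover have "(real (n - 2) - 2 * real h) * g <= (64 * real h + 65) * g"
    using h g by (intro mult_right_mono) auto
   ultimately show ?thesis by (simp add: algebra_simps diff_divide_distrib)
  qed
  have "2 powr (2 * real h * (1 / 2 + \<delta>)) * flat e (2 ^ (n - 2 - 2 * h))
    <= 2 powr (2 * real h * (1 / 2 + \<delta>)) * (8 * (\<bar>B\<bar> + 1) * 2 powr ((real (n - 2) - 2 * real h) / p))"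
   using 1 by (intro mult_left_mono) auto
  also have "... = 8 * (\<bar>B\<bar> + 1) * 2 powr (2 * real h * (1 / 2 + \<delta>) + (real (n - 2) - 2 * real h) / p)"
   by (simp add: powr_add)
  also have "... <= 8 * (\<bar>B\<bar> + 1) * 2 powr (65 * g + real (n - 2) / q)"
   using expo by (intro mult_left_mono powr_mono) auto
  also have "... = C * (c * real (2 ^ (n - 2)) powr (1 / q))"
  proof -
   have "real (2 ^ (n - 2)) = 2 powr real (n - 2)" by (simp add: powr_realpow)
   then have "real (2 ^ (n - 2)) powr (1 / q) = 2 powr (real (n - 2) / q)" by (simp add: powr_powr)
   then show ?thesis using c by (simp add: C_def powr_add)
  qed
  also have "... <= C * flat e (2 ^ (n - 2))" using e(4) C by (intro mult_left_mono) auto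
  finally have "type_rates C \<delta> n e" by (simp add: type_rates_def h_def)
  then show ?thesis using e by blast
 qed
 show thesis by (rule that[OF C \<delta>(1)]) (use main in \<open>auto simp: spread_everywhere_def\<close>)
qed

lemma cotype_structures:
 assumes "cotype_index TYPE('a::real_normed_vector) ~= 2"
 obtains C \<delta> where "C > 0" "\<delta> > 0"
  "spread_everywhere (cotype_rates C \<delta> :: nat => (nat => 'a) => bool)"
proof -
 obtain r \<kappa> \<delta> where r: "2 < r" "\<not> cotype_on (UNIV :: 'a set) r" and \<delta>: "\<delta> > 0" "2 / r - \<kappa> <= 1 / 2 - \<delta>"
  and \<kappa>: "\<kappa> = 0 \<or> (\<kappa> > 0 \<and> has_cotype TYPE('a) (1 / \<kappa>))"
  using cotype_exponents[OF assms] by metis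
 obtain D where D: "D > 0" "!!(e :: nat => 'a) M N. spreading M e ==> norm (e 0) = 1 ==> N <= M ==> 0 < N ==> real N powr \<kappa> <= D * flat e N"
 proof (cases "\<kappa> = 0")
  case True
  have "real N powr \<kappa> <= 2 * flat e N" if "spreading M e" "norm (e 0) = 1" "N <= M" "0 < N" for e :: "nat => 'a" and M N
   using flat_mono[OF that(1), of 1 N] that True by (simp add: flat_def)
  then show thesis by (intro that[of 2]) auto
 next
  case False
  then have k: "\<kappa> > 0" "has_cotype TYPE('a) (1 / \<kappa>)" using \<kappa> by auto
  then obtain B where B: "!!n. cotype_bound (UNIV :: 'a set) (1 / \<kappa>) n B" and "2 <= 1 / \<kappa>"
   by (auto simp: has_cotype_iff cotype_on_def)
  have "real N powr \<kappa> <= 8 * (\<bar>B\<bar> + 1) * flat e N" if "spreading M e" "norm (e 0) = 1" "N <= M" for e :: "nat => 'a" and M N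
  proof -
   have "real N powr (1 / (1 / \<kappa>)) <= 8 * \<bar>B\<bar> * flat e N"
    using B that \<open>2 <= 1 / \<kappa>\<close> by (intro flat_lower_of_cotype) auto
   also have "... <= 8 * (\<bar>B\<bar> + 1) * flat e N" by (intro mult_right_mono) (auto simp: flat_def)
   finally show ?thesis by simp
  qed
  then show thesis by (intro that[of "8 * (\<bar>B\<bar> + 1)"]) auto
 qed
 define \<alpha> where "\<alpha> = 1 / 2 - 1 / r"
 have \<alpha>: "\<alpha> > 0" using r by (simp add: \<alpha>_def field_simps)
 \<comment> \<open>\<open>cotype_extract\<close> needs a large number of terms. Multiplying the
   number by the constant \<open>k0\<close> ensures this on early levels too and only affects
   \<open>C\<close>.\<close>
 obtain k0 :: nat where k0: "64 powr (1 / \<alpha>) < real k0" using reals_Archimedean2 by blast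
 have k01: "1 <= real k0" using k0 ge_one_powr_ge_zero[of 64 "1 / \<alpha>"] \<alpha> by simp
 define C where "C = 640 * real k0 powr (1 / r) * 4 powr (1 / r) * D"
 have C: "C > 0" using D k01 by (simp add: C_def)
 have main: "\<exists>e :: nat => 'a. spreading (2 ^ (n + 2)) e \<and>
   (\<forall>i<2 ^ (n + 2). e i \<in> common_kernel \<Phi>) \<and> norm (e 0) = 1 \<and> cotype_rates C \<delta> n e"
  if \<Phi>: "finite \<Phi>" and n: "2 <= n" for \<Phi> :: "('a \<Rightarrow>\<^sub>L real) set" and n
 proof -
  have nt: "\<not> cotype_on (common_kernel \<Phi>) r"
   using cotype_on_common_kernel[OF \<Phi>, of r] r by auto
  define h where "h = axis_size n"
  have h: "4 * h <= n" using axis_size_bounds[of n] by (auto simp: h_def)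
  define k :: nat where "k = 2 ^ (4 * h + 2)"
  define k' where "k' = k * k0"
  define M where "M = (2 ^ (n + 2) * k0 :: nat)"
  have k: "0 < k'" "k' <= M" "k <= k'" "k <= 2 ^ (n + 2)" "2 ^ (n + 2) <= M"
   using k01 h by (auto simp: k_def k'_def M_def intro!: mult_le_mono1 power_increasing)
  have "64 = (64 powr (1 / \<alpha>)) powr \<alpha>" using \<alpha> by (simp add: powr_powr)
  also have "... < real k0 powr \<alpha>" using k0 \<alpha> by (intro powr_less_mono2) auto
  also have "... <= real k' powr \<alpha>"
  proof -
   have "1 * k0 <= k'" unfolding k'_def by (intro mult_le_mono1) (simp add: k_def)
   then show ?thesis using \<alpha> by (intro powr_mono2) auto
  qed
  finally have big: "64 < real k' powr (1 / 2 - 1 / r)" by (simp add: \<alpha>_def)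
  obtain e :: "nat => 'a" where e: "spreading M e" "!!i. i < M ==> e i \<in> common_kernel \<Phi>"
   "norm (e 0) = 1" "flat e k' <= 320 * real k' powr (1 / r)"
   using cotype_extract[OF subspace_common_kernel nt r(1) k(1,2) big] by metis
  have "flat e k <= 2 * flat e k'" using flat_mono[OF e(1) k(3,2)] .
  also have "... <= 640 * real k' powr (1 / r)" using e(4) by simp
  finally have f1: "flat e k <= 640 * real k' powr (1 / r)" .
  have "real k' = real k0 * (4 * 2 powr (4 * real h))"
   by (simp add: k'_def k_def powr_realpow[symmetric] power_add flip: powr_realpow)
  then have f2: "real k' powr (1 / r) = real k0 powr (1 / r) * 4 powr (1 / r) * 2 powr (4 * real h / r)"
   by (simp only: powr_mult powr_powr) simp
  have "2 powr (4 * real h / r) <= 2 powr (2 * real h * (1 / 2 - \<delta>) + 2 * real h * \<kappa>)"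
  proof -
   have "2 * real h * (2 / r - \<kappa>) <= 2 * real h * (1 / 2 - \<delta>)" using \<delta>(2) by (intro mult_left_mono) auto
   then show ?thesis by (intro powr_mono) (auto simp: algebra_simps)
  qed
  also have "... = 2 powr (2 * real h * (1 / 2 - \<delta>)) * real (2 ^ (2 * h)) powr \<kappa>"
  proof -
   have "real (2 ^ (2 * h)) = 2 powr (2 * real h)" by (simp flip: powr_realpow)
   then show ?thesis by (simp add: powr_add powr_powr)
  qed
  also have "... <= 2 powr (2 * real h * (1 / 2 - \<delta>)) * (D * flat e (2 ^ (2 * h)))"
  proof (intro mult_left_mono D(2)[OF e(1,3)])
   have "(2::nat) ^ (2 * h) <= 2 ^ (n + 2)" using h by (intro power_increasing) auto
   then show "2 ^ (2 * h) <= M" using k(5) by linarith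
  qed auto
  finally have f3: "2 powr (4 * real h / r) <= 2 powr (2 * real h * (1 / 2 - \<delta>)) * (D * flat e (2 ^ (2 * h)))" .
  have "flat e k <= 640 * (real k0 powr (1 / r) * 4 powr (1 / r) * (2 powr (2 * real h * (1 / 2 - \<delta>)) * (D * flat e (2 ^ (2 * h)))))"
   using f1 mult_left_mono[OF f3, of "640 * (real k0 powr (1 / r) * 4 powr (1 / r))"] unfolding f2
   by (simp add: mult.assoc)
  then have "flat e k <= C * 2 powr (2 * real h * (1 / 2 - \<delta>)) * flat e (2 ^ (2 * h))"
   by (simp add: C_def mult_ac)
  then have "cotype_rates C \<delta> n e" by (simp add: cotype_rates_def h_def k_def)
  moreover have "spreading (2 ^ (n + 2)) e" using e(1) k(5) by (rule spreading_le)
  moreover have "\<forall>i<2 ^ (n + 2). e i \<in> common_kernel \<Phi>" using e(2) k(5) by auto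
  ultimately show ?thesis using e(3) by blast
 qed
 show thesis by (rule that[OF C \<delta>(1)]) (use main in \<open>auto simp: spread_everywhere_def\<close>)
qed

section \<open>Finite-dimensional decompositions\<close>

lemma compact_coefficient_box:
 fixes B :: "'a::real_normed_vector set"
 assumes "finite B"
 shows "compact {\<Sum>b\<in>B. a b *\<^sub>R b | a. \<forall>b\<in>B. \<bar>a b\<bar> <= K}"
 using assms
proof (induction B rule: finite_induct)
 case (insert b B)
 let ?S = "{\<Sum>b\<in>B. a b *\<^sub>R b | a. \<forall>b\<in>B. \<bar>a b\<bar> <= K}"
 have "{\<Sum>c\<in>insert b B. a c *\<^sub>R c | a. \<forall>c\<in>insert b B. \<bar>a c\<bar> <= K} = (%(c, x). c *\<^sub>R b + x) ` ({-K..K} \<times> ?S)"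
 proof (intro set_eqI iffI)
  fix x assume "x \<in> {\<Sum>c\<in>insert b B. a c *\<^sub>R c | a. \<forall>c\<in>insert b B. \<bar>a c\<bar> <= K}"
  then obtain a where a: "x = (\<Sum>c\<in>insert b B. a c *\<^sub>R c)" "\<forall>c\<in>insert b B. \<bar>a c\<bar> <= K" by blast
  then have "x = (%(c, x). c *\<^sub>R b + x) (a b, \<Sum>c\<in>B. a c *\<^sub>R c)" using insert.hyps by simp
  moreover have "(a b, \<Sum>c\<in>B. a c *\<^sub>R c) \<in> {-K..K} \<times> ?S" using a(2) by (auto simp: abs_le_iff)
  ultimately show "x \<in> (%(c, x). c *\<^sub>R b + x) ` ({-K..K} \<times> ?S)" by blast
 next
  fix x assume "x \<in> (%(c, x). c *\<^sub>R b + x) ` ({-K..K} \<times> ?S)"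
  then obtain c a where a: "x = c *\<^sub>R b + (\<Sum>c\<in>B. a c *\<^sub>R c)" "\<bar>c\<bar> <= K" "\<forall>c\<in>B. \<bar>a c\<bar> <= K"
   by (auto simp: abs_le_iff)
  have "(\<Sum>d\<in>B. (a(b := c)) d *\<^sub>R d) = (\<Sum>d\<in>B. a d *\<^sub>R d)"
   using insert.hyps by (intro sum.cong) auto
  then have "x = (\<Sum>d\<in>insert b B. (a(b := c)) d *\<^sub>R d)"
   using a(1) insert.hyps by simp
  moreover have "\<forall>d\<in>insert b B. \<bar>(a(b := c)) d\<bar> <= K" using a by auto
  ultimately show "x \<in> {\<Sum>c\<in>insert b B. a c *\<^sub>R c | a. \<forall>c\<in>insert b B. \<bar>a c\<bar> <= K}" by blast
 qed
 moreover have "compact ((%(c, x). c *\<^sub>R b + x) ` ({-K..K} \<times> ?S))"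
  by (intro compact_continuous_image compact_Times insert.IH compact_Icc)
    (auto simp: case_prod_beta intro!: continuous_intros)
 ultimately show ?case by simp
qed simp

text \<open>On the compact set of combinations with \<open>a b = 1\<close> and all coefficients at
  most 1 in modulus the norm attains its minimum, which is positive by independence. Dividing by the
  largest coefficient reduces to this case.\<close>

lemma independent_coefficient_bound:
 fixes B :: "'a::real_normed_vector set"
 assumes fin: "finite B" and ind: "independent B"
 obtains K where "K > 0" "!!a b. b \<in> B ==> \<bar>a b\<bar> <= K * norm (\<Sum>c\<in>B. a c *\<^sub>R c)"
proof -
 have "\<exists>\<delta>>0. \<forall>a. (\<forall>c\<in>B. \<bar>a c\<bar> <= 1) --> a b = 1 --> \<delta> <= norm (\<Sum>c\<in>B. a c *\<^sub>R c)" if b: "b \<in> B" for b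
 proof -
  let ?S = "{\<Sum>c\<in>B - {b}. a c *\<^sub>R c | a. \<forall>c\<in>B - {b}. \<bar>a c\<bar> <= 1}"
  have cpt: "compact ((%x. b + x) ` ?S)"
   using fin by (intro compact_translation compact_coefficient_box) auto
  have "(\<Sum>c\<in>B - {b}. (%_. 0) c *\<^sub>R c) \<in> ?S"
   unfolding mem_Collect_eq by (intro exI[of _ "%_. 0"]) auto
  then have ne: "(%x. b + x) ` ?S ~= {}" by blast
  obtain x where x: "x \<in> (%x. b + x) ` ?S" "\<forall>y\<in>(%x. b + x) ` ?S. norm x <= norm y"
   using continuous_attains_inf[OF cpt ne continuous_on_norm_id] by blast
  have split: "(\<Sum>c\<in>B. a c *\<^sub>R c) = b + (\<Sum>c\<in>B - {b}. a c *\<^sub>R c)" if "a b = 1" for a :: "'a => real"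
   using fin b that by (simp add: sum.remove)
  have "x ~= 0"
  proof
   assume "x = 0"
   then obtain a where a: "0 = b + (\<Sum>c\<in>B - {b}. a c *\<^sub>R c)" using x(1) by auto
   have "(\<Sum>c\<in>B. (a(b := 1)) c *\<^sub>R c) = b + (\<Sum>c\<in>B - {b}. (a(b := 1)) c *\<^sub>R c)" by (rule split) simp
   also have "(\<Sum>c\<in>B - {b}. (a(b := 1)) c *\<^sub>R c) = (\<Sum>c\<in>B - {b}. a c *\<^sub>R c)" by (intro sum.cong) auto
   finally have "(\<Sum>c\<in>B. (a(b := 1)) c *\<^sub>R c) = 0" using a by simp
   then have "(a(b := 1)) b = 0" using independentD[OF ind fin order_refl] b by blast
   then show False by simp
  qed
  moreover have "norm x <= norm (\<Sum>c\<in>B. a c *\<^sub>R c)" if a: "\<forall>c\<in>B. \<bar>a c\<bar> <= 1" "a b = 1" for a :: "'a => real"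
  proof -
   have "(\<Sum>c\<in>B - {b}. a c *\<^sub>R c) \<in> ?S" using a by blast
   then show ?thesis unfolding split[of a, OF a(2)] using x(2) by blast
  qed
  ultimately show ?thesis by (intro exI[of _ "norm x"]) auto
 qed
 then obtain \<delta> where \<delta>: "!!b. b \<in> B ==> \<delta> b > 0"
  "!!b a. b \<in> B ==> \<forall>c\<in>B. \<bar>a c\<bar> <= 1 ==> a b = 1 ==> \<delta> b <= norm (\<Sum>c\<in>B. a c *\<^sub>R c)"
  by metis
 define K where "K = (\<Sum>b\<in>B. 1 / \<delta> b) + 1"
 have K: "1 / \<delta> b <= K" if "b \<in> B" for b
 proof -
  have "1 / \<delta> b <= (\<Sum>b\<in>B. 1 / \<delta> b)" using fin that \<delta>(1) by (intro member_le_sum) (auto simp: less_imp_le)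
  then show ?thesis by (simp add: K_def)
 qed
 have K0: "K > 0" unfolding K_def using \<delta>(1) by (intro add_nonneg_pos sum_nonneg) (auto simp: less_imp_le)
 show ?thesis
 proof (rule that[OF K0])
  fix a :: "'a => real" and b assume b: "b \<in> B"
  define m where "m = Max ((%c. \<bar>a c\<bar>) ` B)"
  have "m \<in> (%c. \<bar>a c\<bar>) ` B" unfolding m_def using fin b by (intro Max_in) auto
  then obtain s where s: "s \<in> B" "\<bar>a s\<bar> = m" by auto
  have m: "\<bar>a c\<bar> <= m" if "c \<in> B" for c unfolding m_def using fin that by (intro Max_ge) auto
  show "\<bar>a b\<bar> <= K * norm (\<Sum>c\<in>B. a c *\<^sub>R c)"
  proof (cases "m = 0")
   case True
   then have "a b = 0" using m[OF b] by simp
   then show ?thesis using K0 by simp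
  next
   case False
   then have m0: "m > 0" using s by linarith
   have nz: "a s ~= 0" using s m0 by auto
   have "\<delta> s <= norm (\<Sum>c\<in>B. (a c / a s) *\<^sub>R c)"
    using s m m0 nz by (intro \<delta>(2)) auto
   also have "(\<Sum>c\<in>B. (a c / a s) *\<^sub>R c) = (1 / a s) *\<^sub>R (\<Sum>c\<in>B. a c *\<^sub>R c)"
    by (simp add: scaleR_sum_right)
   finally have "m * \<delta> s <= norm (\<Sum>c\<in>B. a c *\<^sub>R c)" using s m0 by (simp add: field_simps)
   then have "m <= (1 / \<delta> s) * norm (\<Sum>c\<in>B. a c *\<^sub>R c)" using \<delta>(1)[OF s(1)] by (simp add: field_simps)
   also have "... <= K * norm (\<Sum>c\<in>B. a c *\<^sub>R c)" using K[OF s(1)] by (intro mult_right_mono) auto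
   finally show ?thesis using m[OF b] by linarith
  qed
 qed
qed

lemma compact_span_cball:
 fixes B :: "'a::real_normed_vector set"
 assumes "finite B"
 shows "compact (span B \<inter> cball 0 r)"
proof -
 obtain C where C: "C \<subseteq> B" "independent C" "B \<subseteq> span C"
  using maximal_independent_subset[of B] by blast
 have fin: "finite C" using C(1) assms by (rule finite_subset)
 have sp: "span B = span C" using C span_mono span_minimal by (metis span_span subset_antisym)
 obtain K where K: "K > 0" "!!a b. b \<in> C ==> \<bar>a b\<bar> <= K * norm (\<Sum>c\<in>C. a c *\<^sub>R c)"
  using independent_coefficient_bound[OF fin C(2)] by blast
 let ?S = "{\<Sum>b\<in>C. a b *\<^sub>R b | a. \<forall>b\<in>C. \<bar>a b\<bar> <= K * r}"
 have "span B \<inter> cball 0 r = ?S \<inter> cball 0 r"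
 proof (intro set_eqI iffI)
  fix x assume x: "x \<in> span B \<inter> cball 0 r"
  then obtain a where a: "x = (\<Sum>b\<in>C. a b *\<^sub>R b)" unfolding sp span_finite[OF fin] by auto
  have "\<bar>a b\<bar> <= K * r" if "b \<in> C" for b
  proof -
   have "\<bar>a b\<bar> <= K * norm x" using K(2)[OF that] a by simp
   also have "... <= K * r" using x K(1) by (intro mult_left_mono) auto
   finally show ?thesis .
  qed
  then show "x \<in> ?S \<inter> cball 0 r" using x a by blast
 next
  fix x assume "x \<in> ?S \<inter> cball 0 r"
  then show "x \<in> span B \<inter> cball 0 r" unfolding sp span_finite[OF fin] by auto
 qed
 then show ?thesis using compact_coefficient_box[OF fin] by (simp add: compact_Int_closed)
qed

text \<open>Take norming functionals of a 1/4-net of the compact unit ball: at a unit vector one of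
  them is at least 3/4 - 1/4.\<close>

lemma norming_set:
 fixes B :: "'a::real_normed_vector set"
 assumes "finite B"
 obtains \<Psi> :: "('a \<Rightarrow>\<^sub>L real) set" where "finite \<Psi>" "!!f. f \<in> \<Psi> ==> norm f <= 1"
  "!!v. v \<in> span B ==> \<exists>f\<in>\<Psi>. norm v <= 2 * blinfun_apply f v"
proof -
 let ?S = "span B \<inter> cball 0 1"
 have "?S \<subseteq> (\<Union>w\<in>?S. ball w (1/4))" by force
 then obtain N where N: "N \<subseteq> ?S" "finite N" "?S \<subseteq> (\<Union>w\<in>N. ball w (1/4))"
  using compactE_image[OF compact_span_cball[OF assms], of ?S "%w. ball w (1/4)"] by auto
 have "\<exists>f :: 'a \<Rightarrow>\<^sub>L real. blinfun_apply f w = norm w \<and> norm f <= 1" for w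
  using norming_functional[of w] by blast
 then obtain F :: "'a => 'a \<Rightarrow>\<^sub>L real" where F: "!!w. blinfun_apply (F w) w = norm w" "!!w. norm (F w) <= 1"
  by metis
 show ?thesis
 proof (rule that[of "F ` N"])
  fix v assume v: "v \<in> span B"
  show "\<exists>f\<in>F ` N. norm v <= 2 * blinfun_apply f v"
  proof (cases "v = 0")
   case True
   have "0 \<in> ?S" by (simp add: span_zero)
   then have "N ~= {}" using N(3) by auto
   then show ?thesis using True by (auto simp: blinfun.zero_right)
  next
   case False
   define u where "u = (1 / norm v) *\<^sub>R v"
   have u: "norm u = 1" "v = norm v *\<^sub>R u" using False by (auto simp: u_def)
   have "u \<in> ?S" using v u(1) by (auto simp: u_def intro: span_scale)
   then obtain w where w: "w \<in> N" "norm (w - u) < 1 / 4" using N(3) by (auto simp: dist_norm)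
   have "blinfun_apply (F w) (w - u) <= 1 / 4"
   proof -
    have "\<bar>blinfun_apply (F w) (w - u)\<bar> <= norm (F w) * norm (w - u)"
     using norm_blinfun[of "F w" "w - u"] by simp
    also have "... <= 1 * norm (w - u)" using F(2) by (intro mult_right_mono) auto
    finally show ?thesis using w(2) by simp
   qed
   moreover have "3 / 4 <= norm w" using w(2) u(1) norm_triangle_ineq2[of u "u - w"] norm_minus_commute[of u w] by simp
   ultimately have "1 / 2 <= blinfun_apply (F w) u" using F(1)[of w] by (simp add: blinfun.diff_right)
   then have "norm v * (1 / 2) <= norm v * blinfun_apply (F w) u" by (intro mult_left_mono) auto
   also have "... = blinfun_apply (F w) v" by (subst (2) u(2)) (simp add: blinfun.scaleR_right)
   finally show ?thesis using w(1) by (intro bexI[of _ "F w"]) auto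
  qed
 qed (use N F in auto)
qed

text \<open>\<open>flat_dual\<close> for one-element sets bounds the coordinates on the span, and
  they extend by Hahn-Banach.\<close>

lemma spreading_coordinates:
 fixes e :: "nat => 'a::real_normed_vector"
 assumes e: "spreading M e" "norm (e 0) = 1"
 obtains E :: "nat => 'a \<Rightarrow>\<^sub>L real" where "!!i j. i < M ==> j < M ==> blinfun_apply (E i) (e j) = (if i = j then 1 else 0)"
proof -
 have "\<exists>f :: 'a \<Rightarrow>\<^sub>L real. \<forall>j<M. blinfun_apply f (e j) = (if i = j then 1 else 0)" if i: "i < M" for i
 proof -
  define G where "G = (%a. (\<Sum>j<M. a j *\<^sub>R e j, a i :: real)) ` UNIV"
  have G: "(x, r) \<in> G \<longleftrightarrow> (\<exists>a. x = (\<Sum>j<M. a j *\<^sub>R e j) \<and> r = a i)" for x r by (auto simp: G_def)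
  obtain f :: "'a \<Rightarrow>\<^sub>L real" where f: "!!x r. (x, r) \<in> G ==> blinfun_apply f x = r"
  proof (rule hahn_banach_graph[of G 64])
   show "(x + y, r + s) \<in> G" if "(x, r) \<in> G" "(y, s) \<in> G" for x r y s
   proof -
    obtain a b where "x = (\<Sum>j<M. a j *\<^sub>R e j)" "r = a i" "y = (\<Sum>j<M. b j *\<^sub>R e j)" "s = b i"
     using \<open>(x, r) \<in> G\<close> \<open>(y, s) \<in> G\<close> unfolding G by blast
    then show ?thesis unfolding G
     by (intro exI[of _ "%j. a j + b j"]) (simp add: scaleR_add_left sum.distrib)
   qed
   show "(c *\<^sub>R x, c * r) \<in> G" if xr: "(x, r) \<in> G" for c x r
   proof -
    obtain a where "x = (\<Sum>j<M. a j *\<^sub>R e j)" "r = a i" using xr unfolding G by blast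
    then show ?thesis unfolding G
     by (intro exI[of _ "%j. c * a j"]) (simp add: scaleR_sum_right)
   qed
   show "\<bar>r\<bar> <= 64 * norm x" if xr: "(x, r) \<in> G" for x r
   proof -
    obtain a where a: "x = (\<Sum>j<M. a j *\<^sub>R e j)" "r = a i" using xr unfolding G by blast
    show ?thesis using flat_dual[OF e(1), of "{i}" a] i a e(2) by (simp add: flat_def)
   qed
  qed (auto simp: G_def)
  have "blinfun_apply f (e j) = (if i = j then 1 else 0)" if "j < M" for j
  proof (rule f)
   have "e j = (\<Sum>k<M. (if k = j then 1 else 0) *\<^sub>R e k)" using that by (simp add: if_distrib[of "%c. c *\<^sub>R _"] cong: if_cong)
   then show "(e j, if i = j then 1 else 0) \<in> G" unfolding G by (intro exI[of _ "%k. if k = j then 1 else 0"]) simp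
  qed
  then show ?thesis by blast
 qed
 then obtain E :: "nat => 'a \<Rightarrow>\<^sub>L real" where "!!i j. i < M ==> j < M ==> blinfun_apply (E i) (e j) = (if i = j then 1 else 0)"
  by metis
 then show thesis by (rule that)
qed

text \<open>\<open>\<Psi>\<close> collects what the next level has to annihilate: the coordinates
  constructed so far and a norming set for the span constructed so far.\<close>

definition fdd_stage :: "(nat => (nat => 'a) => bool) => nat => (nat => nat => 'a::real_normed_vector) =>
  (nat => nat => 'a \<Rightarrow>\<^sub>L real) => ('a \<Rightarrow>\<^sub>L real) set => bool" where
 "fdd_stage good N e D \<Psi> \<longleftrightarrow> finite \<Psi> \<and>
   (\<forall>n\<in>{2..<N}. good n (e n)) \<and>
   (\<forall>n\<in>{2..<N}. \<forall>m\<in>{2..<N}. \<forall>i<2 ^ (n + 2). \<forall>j<2 ^ (m + 2).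
    blinfun_apply (D n i) (e m j) = (if n = m \<and> i = j then 1 else 0)) \<and>
   (\<forall>n\<in>{2..<N}. \<forall>i<2 ^ (n + 2). D n i \<in> \<Psi>) \<and>
   (\<forall>v\<in>span {e n i | n i. n \<in> {2..<N} \<and> i < 2 ^ (n + 2)}. \<exists>f\<in>\<Psi>. norm f <= 1 \<and> norm v <= 2 * blinfun_apply f v)"

lemma fdd_step:
 fixes good :: "nat => (nat => 'a::real_normed_vector) => bool"
 assumes ex: "!!\<Phi> n. finite \<Phi> ==> 2 <= n ==> \<exists>e :: nat => 'a. (\<forall>i<2 ^ (n + 2). e i \<in> common_kernel \<Phi>) \<and> good n e"
  and spr: "!!n e. good n e ==> spreading (2 ^ (n + 2)) e \<and> norm (e 0) = 1"
  and st: "fdd_stage good N e D \<Psi>" and N: "2 <= N"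
 shows "\<exists>e' D' \<Psi>'. fdd_stage good (Suc N) e' D' \<Psi>' \<and> (\<forall>n<N. e' n = e n \<and> D' n = D n) \<and> \<Psi> \<subseteq> \<Psi>' \<and>
  (\<forall>i<2 ^ (N + 2). e' N i \<in> common_kernel \<Psi>)"
proof -
 have fin: "finite \<Psi>" and good: "!!n. n \<in> {2..<N} ==> good n (e n)"
  and bi: "!!n m i j. n \<in> {2..<N} ==> m \<in> {2..<N} ==> i < 2 ^ (n + 2) ==> j < 2 ^ (m + 2) ==>
    blinfun_apply (D n i) (e m j) = (if n = m \<and> i = j then 1 else 0)"
  and D\<Psi>: "!!n i. n \<in> {2..<N} ==> i < 2 ^ (n + 2) ==> D n i \<in> \<Psi>"
  using st by (auto simp: fdd_stage_def)
 obtain x where x: "!!i. i < 2 ^ (N + 2) ==> x i \<in> common_kernel \<Psi>" "good N x"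
  using ex[OF fin N] by blast
 obtain E :: "nat => 'a \<Rightarrow>\<^sub>L real" where E: "!!i j. i < 2 ^ (N + 2) ==> j < 2 ^ (N + 2) ==> blinfun_apply (E i) (x j) = (if i = j then 1 else 0)"
  using spreading_coordinates[of "2 ^ (N + 2)" x] spr[OF x(2)] by blast
 \<comment> \<open>The new coordinates are corrected so as to vanish on the earlier levels. The
   correction does not disturb them on the new level, where the old coordinates are zero.\<close>
 define C where "C i = E i - (\<Sum>m\<in>{2..<N}. \<Sum>j<2 ^ (m + 2). blinfun_apply (E i) (e m j) *\<^sub>R D m j)" for i
 define e' where "e' = e(N := x)"
 define D' where "D' = D(N := C)"
 have C_apply: "blinfun_apply (C i) v = blinfun_apply (E i) v - (\<Sum>m\<in>{2..<N}. \<Sum>j<2 ^ (m + 2). blinfun_apply (E i) (e m j) * blinfun_apply (D m j) v)" for i v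
  by (simp add: C_def blinfun.diff_left blinfun.sum_left blinfun.scaleR_left)
 have Dx: "blinfun_apply (D m j) (x k) = 0" if "m \<in> {2..<N}" "j < 2 ^ (m + 2)" "k < 2 ^ (N + 2)" for m j k
  using x(1)[OF that(3)] D\<Psi>[OF that(1,2)] by (auto simp: common_kernel_def)
 have Cx: "blinfun_apply (C i) (x k) = (if i = k then 1 else 0)" if "i < 2 ^ (N + 2)" "k < 2 ^ (N + 2)" for i k
  using E[OF that] Dx that by (simp add: C_apply)
 have Ce: "blinfun_apply (C i) (e m j) = 0" if "m \<in> {2..<N}" "j < 2 ^ (m + 2)" for i m j
 proof -
  have "(\<Sum>m'\<in>{2..<N}. \<Sum>j'<2 ^ (m' + 2). blinfun_apply (E i) (e m' j') * blinfun_apply (D m' j') (e m j)) =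
    (\<Sum>m'\<in>{2..<N}. if m' = m then blinfun_apply (E i) (e m j) else 0)"
  proof (rule sum.cong[OF refl])
   fix m' assume m': "m' \<in> {2..<N}"
   have "(\<Sum>j'<2 ^ (m' + 2). blinfun_apply (E i) (e m' j') * blinfun_apply (D m' j') (e m j)) =
     (\<Sum>j'<2 ^ (m' + 2). if m' = m \<and> j' = j then blinfun_apply (E i) (e m j) else 0)"
    using bi m' that by (intro sum.cong) auto
   also have "... = (if m' = m then blinfun_apply (E i) (e m j) else 0)" using that(2) by auto
   finally show "(\<Sum>j'<2 ^ (m' + 2). blinfun_apply (E i) (e m' j') * blinfun_apply (D m' j') (e m j)) =
    (if m' = m then blinfun_apply (E i) (e m j) else 0)" .
  qed
  also have "... = blinfun_apply (E i) (e m j)" using that(1) by simp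
  finally show ?thesis by (simp add: C_apply)
 qed
 let ?B = "{e' n i | n i. n \<in> {2..<Suc N} \<and> i < 2 ^ (n + 2)}"
 have "?B \<subseteq> (%(n, i). e' n i) ` (SIGMA n:{2..<Suc N}. {..<2 ^ (n + 2)})" by force
 then have "finite ?B" by (rule finite_subset) simp
 then obtain F :: "('a \<Rightarrow>\<^sub>L real) set" where F: "finite F" "!!f. f \<in> F ==> norm f <= 1"
  "!!v. v \<in> span ?B ==> \<exists>f\<in>F. norm v <= 2 * blinfun_apply f v"
  using norming_set[of ?B] by blast
 define \<Psi>' where "\<Psi>' = \<Psi> \<union> C ` {..<2 ^ (N + 2)} \<union> F"
 have "fdd_stage good (Suc N) e' D' \<Psi>'"
  unfolding fdd_stage_def
 proof (intro conjI ballI allI impI)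
  show "finite \<Psi>'" using fin F by (simp add: \<Psi>'_def)
  show "good n (e' n)" if "n \<in> {2..<Suc N}" for n using good[of n] x(2) that by (cases "n = N") (auto simp: e'_def)
  show "blinfun_apply (D' n i) (e' m j) = (if n = m \<and> i = j then 1 else 0)"
   if nm: "n \<in> {2..<Suc N}" "m \<in> {2..<Suc N}" "i < 2 ^ (n + 2)" "j < 2 ^ (m + 2)" for n m i j
  proof -
   consider "n \<in> {2..<N}" "m \<in> {2..<N}" | "n \<in> {2..<N}" "m = N" | "n = N" "m \<in> {2..<N}" | "n = N" "m = N"
    using nm(1,2) by force
   then show ?thesis
   proof cases
    case 1 then show ?thesis using bi[OF 1 nm(3,4)] by (simp add: e'_def D'_def)
   next
    case 2 then show ?thesis using Dx[OF 2(1) nm(3)] nm(4) by (simp add: e'_def D'_def)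
   next
    case 3 then show ?thesis using Ce[OF 3(2) nm(4)] by (simp add: e'_def D'_def)
   next
    case 4 then show ?thesis using Cx[of i j] nm(3,4) by (simp add: e'_def D'_def)
   qed
  qed
  show "D' n i \<in> \<Psi>'" if "n \<in> {2..<Suc N}" "i < 2 ^ (n + 2)" for n i
   using that D\<Psi>[of n i] by (cases "n = N") (auto simp: D'_def \<Psi>'_def)
  show "\<exists>f\<in>\<Psi>'. norm f <= 1 \<and> norm v <= 2 * blinfun_apply f v" if "v \<in> span ?B" for v
   using F(3)[OF that] F(2) unfolding \<Psi>'_def by blast
 qed
 moreover have "\<forall>n<N. e' n = e n \<and> D' n = D n" by (simp add: e'_def D'_def)
 moreover have "\<forall>i<2 ^ (N + 2). e' N i \<in> common_kernel \<Psi>" using x by (simp add: e'_def)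
 ultimately show ?thesis by (intro exI[of _ e'] exI[of _ D'] exI[of _ \<Psi>']) (auto simp: \<Psi>'_def)
qed

text \<open>The spaces of all later levels lie in the kernel of functionals that are norming for the
 span of the earlier levels, so that the partial sum projections are bounded by \<open>2\<close>.\<close>

lemma fdd_exists:
 fixes good :: "nat => (nat => 'a::real_normed_vector) => bool"
 assumes ex: "!!\<Phi> n. finite \<Phi> ==> 2 <= n ==> \<exists>e :: nat => 'a. (\<forall>i<2 ^ (n + 2). e i \<in> common_kernel \<Phi>) \<and> good n e"
  and spr: "!!n e. good n e ==> spreading (2 ^ (n + 2)) e \<and> norm (e 0) = 1"
 obtains e D where "!!n. 2 <= n ==> good n (e n)"
  "!!n m i j. 2 <= n ==> 2 <= m ==> i < 2 ^ (n + 2) ==> j < 2 ^ (m + 2) ==>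
    blinfun_apply (D n i) (e m j) = (if n = m \<and> i = j then 1 else 0)"
  "!!n v. 2 <= n ==> v \<in> closure (span {e m i | m i. 2 <= m \<and> i < 2 ^ (m + 2)}) ==>
    norm (\<Sum>i<2 ^ (n + 2). blinfun_apply (D n i) v *\<^sub>R e n i) <= 4 * norm v"
proof -
 let ?P = "%k (e, D, \<Psi>). fdd_stage good (k + 2) e D \<Psi>"
 let ?Q = "%k (e, D, \<Psi>) (e', D', \<Psi>'). (\<forall>n<k + 2. e' n = e n \<and> D' n = D n) \<and> \<Psi> \<subseteq> \<Psi>' \<and>
  (\<forall>i<2 ^ (k + 2 + 2). e' (k + 2) i \<in> common_kernel \<Psi>)"
 have "\<exists>s. \<forall>k. ?P k (s k) \<and> ?Q k (s k) (s (Suc k))"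
 proof (rule dependent_nat_choice)
  obtain f :: "'a \<Rightarrow>\<^sub>L real" where "norm f <= 1" using norming_functional[of "0 :: 'a"] by blast
  then have "?P 0 (undefined, undefined, {f})"
   by (auto simp: fdd_stage_def blinfun.zero_right)
  then show "\<exists>s. ?P 0 s" by blast
 next
  fix s k assume "?P k s"
  then obtain e D \<Psi> where "s = (e, D, \<Psi>)" "fdd_stage good (k + 2) e D \<Psi>" by (cases s) auto
  then show "\<exists>s'. ?P (Suc k) s' \<and> ?Q k s s'"
   using fdd_step[OF ex spr, of "k + 2" e D \<Psi>] by auto
 qed
 then obtain s where s': "\<forall>k. ?P k (s k) \<and> ?Q k (s k) (s (Suc k))" by (rule exE)
 have s: "?P k (s k)" "?Q k (s k) (s (Suc k))" for k
  by (rule spec[OF s', THEN conjunct1]) (rule spec[OF s', THEN conjunct2])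
 define es where "es k = fst (s k)" for k
 define Ds where "Ds k = fst (snd (s k))" for k
 define Fs where "Fs k = snd (snd (s k))" for k
 have sk: "s k = (es k, Ds k, Fs k)" for k by (simp add: es_def Ds_def Fs_def)
 have st: "fdd_stage good (k + 2) (es k) (Ds k) (Fs k)" for k using s(1)[of k] by (simp add: sk)
 have step: "n < k + 2 ==> es (Suc k) n = es k n \<and> Ds (Suc k) n = Ds k n" "Fs k \<subseteq> Fs (Suc k)"
  "i < 2 ^ (k + 2 + 2) ==> es (Suc k) (k + 2) i \<in> common_kernel (Fs k)" for k n i
  using s(2)[of k] by (auto simp: sk)
 have mono: "k <= l ==> n < k + 2 ==> es l n = es k n \<and> Ds l n = Ds k n" for k l n
  by (induction l rule: dec_induct) (use step(1) in auto)
 have Fmono: "k <= l ==> Fs k \<subseteq> Fs l" for k l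
  by (induction l rule: dec_induct) (use step(2) in auto)
 define e where "e n = es (n - 1) n" for n
 define D where "D n = Ds (n - 1) n" for n
 have es_e: "es k n = e n" "Ds k n = D n" if "2 <= n" "n < k + 2" for k n
  using mono[of "n - 1" k n] that by (auto simp: e_def D_def)
 have good: "good n (e n)" if "2 <= n" for n
  using st[of "n - 1"] that by (auto simp: fdd_stage_def e_def)
 have bi: "blinfun_apply (D n i) (e m j) = (if n = m \<and> i = j then 1 else 0)"
  if "2 <= n" "2 <= m" "i < 2 ^ (n + 2)" "j < 2 ^ (m + 2)" for n m i j
 proof -
  have "blinfun_apply (Ds (n + m) n i) (es (n + m) m j) = (if n = m \<and> i = j then 1 else 0)"
   using st[of "n + m"] that unfolding fdd_stage_def by auto
  then show ?thesis using es_e[of n "n + m"] es_e[of m "n + m"] that by simp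
 qed
 have ker: "e m i \<in> common_kernel (Fs k)" if "k + 2 <= m" "i < 2 ^ (m + 2)" for k m i
 proof -
  define l where "l = m - 2"
  have l: "m = l + 2" "k <= l" using that(1) by (auto simp: l_def)
  then have "e m i \<in> common_kernel (Fs l)" using step(3)[of i l] that(2) by (simp add: e_def)
  then show ?thesis using Fmono[OF l(2)] by (auto simp: common_kernel_def)
 qed
 let ?W = "{e m i | m i. 2 <= m \<and> i < 2 ^ (m + 2)}"
 define P where "P n v = (\<Sum>i<2 ^ (n + 2). blinfun_apply (D n i) v *\<^sub>R e n i)" for n v
 have Plin: "P n (v + w) = P n v + P n w" "P n (c *\<^sub>R v) = c *\<^sub>R P n v" "P n 0 = 0" for n v w c
  by (auto simp: P_def blinfun.add_right blinfun.scaleR_right blinfun.zero_right scaleR_add_left sum.distrib scaleR_sum_right)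
 have Pe: "P n (e m j) = (if n = m then e m j else 0)" if "2 <= n" "2 <= m" "j < 2 ^ (m + 2)" for n m j
 proof -
  have "P n (e m j) = (\<Sum>i<2 ^ (n + 2). if n = m \<and> i = j then e m j else 0)"
   unfolding P_def using bi that by (intro sum.cong) auto
  then show ?thesis using that(3) by auto
 qed
 have rep: "\<exists>N. \<forall>N'\<ge>N. v = (\<Sum>n\<in>{2..<N'}. P n v)" if "v \<in> span ?W" for v
  using that
 proof (induction rule: span_induct_alt)
  case base
  then show ?case by (simp add: Plin)
 next
  case (step c x y)
  then obtain m j where mj: "x = e m j" "2 <= m" "j < 2 ^ (m + 2)" by blast
  obtain N where N: "!!N'. N' \<ge> N ==> y = (\<Sum>n\<in>{2..<N'}. P n y)" using step by blast
  have "c *\<^sub>R x + y = (\<Sum>n\<in>{2..<N'}. P n (c *\<^sub>R x + y))" if "N' \<ge> max N (Suc m)" for N'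
  proof -
   have "(\<Sum>n\<in>{2..<N'}. P n x) = (\<Sum>n\<in>{2..<N'}. if n = m then x else 0)"
    using mj by (intro sum.cong) (auto simp: Pe)
   also have "... = x" using that mj by simp
   finally have "(\<Sum>n\<in>{2..<N'}. c *\<^sub>R P n x) = c *\<^sub>R x" by (simp flip: scaleR_sum_right)
   then show ?thesis using N[of N'] that by (simp add: Plin sum.distrib)
  qed
  then show ?case by blast
 qed
 have partial: "norm (\<Sum>n\<in>{2..<k + 2}. P n v) <= 2 * norm v" if v: "v \<in> span ?W" for k v
 proof -
  obtain N where N: "!!N'. N' \<ge> N ==> v = (\<Sum>n\<in>{2..<N'}. P n v)" using rep[OF v] by blast
  define S where "S = (\<Sum>n\<in>{2..<k + 2}. P n v)"
  define T where "T = (\<Sum>n\<in>{k + 2..<N + k + 2}. P n v)"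
  have vST: "v = S + T"
   unfolding S_def T_def using N[of "N + k + 2"] sum.atLeastLessThan_concat[of 2 "k + 2" "N + k + 2" "%n. P n v"] by simp
  have "S \<in> span {es k n i | n i. n \<in> {2..<k + 2} \<and> i < 2 ^ (n + 2)}"
   unfolding S_def P_def
  proof (intro span_sum span_scale span_base)
   fix n i :: nat assume ni: "n \<in> {2..<k + 2}" "i \<in> {..<2 ^ (n + 2)}"
   have "es k n = e n" using ni(1) by (intro es_e(1)) auto
   then show "e n i \<in> {es k n i | n i. n \<in> {2..<k + 2} \<and> i < 2 ^ (n + 2)}"
    using ni by (intro CollectI exI[of _ n] exI[of _ i]) simp
  qed
  then obtain f where f: "f \<in> Fs k" "norm f <= 1" "norm S <= 2 * blinfun_apply f S"
   using st[of k] unfolding fdd_stage_def by blast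
  have fz: "blinfun_apply f (e n i) = 0" if "k + 2 <= n" "i < 2 ^ (n + 2)" for n i
   using ker[OF that] f(1) unfolding common_kernel_def by blast
  have "blinfun_apply f T = 0"
   unfolding T_def P_def blinfun.sum_right blinfun.scaleR_right
   by (intro sum.neutral ballI) (simp only: fz atLeastLessThan_iff lessThan_iff scaleR_zero_right)
  then have "norm S <= 2 * blinfun_apply f v" using f(3) by (simp add: vST blinfun.add_right)
  also have "blinfun_apply f v <= 1 * norm v"
   using norm_blinfun[of f v] mult_right_mono[OF f(2), of "norm v"] by simp
  finally show ?thesis by (simp add: S_def)
 qed
 have bound: "norm (P n v) <= 4 * norm v" if "v \<in> span ?W" "2 <= n" for n v
 proof -
  define k where "k = n - 2"
  have k: "n = k + 2" using \<open>2 <= n\<close> by (simp add: k_def)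
  have "P n v = (\<Sum>n\<in>{2..<Suc k + 2}. P n v) - (\<Sum>n\<in>{2..<k + 2}. P n v)" by (simp add: k)
  also have "norm ... <= 2 * norm v + 2 * norm v"
   by (intro norm_triangle_le_diff add_mono partial that)
  finally show ?thesis by simp
 qed
 have "norm (P n v) <= 4 * norm v" if v: "v \<in> closure (span ?W)" and n: "2 <= n" for n v
 proof -
  obtain x where x: "!!k. x k \<in> span ?W" "x \<longlonglongrightarrow> v" using v unfolding closure_sequential by blast
  have "(%k. norm (P n (x k))) \<longlonglongrightarrow> norm (P n v)"
   unfolding P_def using x(2) by (intro tendsto_intros)
  moreover have "(%k. 4 * norm (x k)) \<longlonglongrightarrow> 4 * norm v" using x(2) by (intro tendsto_intros)
  ultimately show ?thesis by (rule LIMSEQ_le) (use bound[OF x(1) n] in auto)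
 qed
 then show thesis using that[of e D] good bi unfolding P_def by blast
qed

section \<open>Characters and bent functions\<close>

text \<open>The Walsh character \<open>(- 1) ^ card (a \<inter> b)\<close> for finite
  \<open>a\<close>. As a product over \<open>a\<close> it is visibly multiplicative in
  \<open>a\<close> and can be summed by \<open>sum_Pow_prod\<close>.\<close>

definition chi :: "nat set => nat set => real" where
 "chi a b = (\<Prod>p\<in>a. if p \<in> b then - 1 else 1)"

lemma chi_commute:
 assumes "finite a" "finite b" shows "chi a b = chi b a"
proof -
 have "chi a b = (- 1) ^ card (a \<inter> b)" if "finite a" for a b
 proof -
  have "chi a b = (\<Prod>p\<in>a \<inter> b. - 1)" unfolding chi_def
   using that by (intro prod.mono_neutral_cong_right) auto
  then show ?thesis by simp
 qed
 from this[OF assms(1), of b] this[OF assms(2), of a] show ?thesis by (simp add: Int_commute)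
qed

lemma chi_abs [simp]: "\<bar>chi a b\<bar> = 1"
proof -
 have "\<bar>chi a b\<bar> = (\<Prod>p\<in>a. \<bar>if p \<in> b then - 1 else 1 :: real\<bar>)" unfolding chi_def by (rule abs_prod)
 also have "... = 1" by (intro prod.neutral) auto
 finally show ?thesis .
qed

lemma chi_square [simp]: "chi a b * chi a b = 1"
 using abs_mult_self_eq[of "chi a b"] by simp

lemma chi_Un: "finite a ==> finite b ==> a \<inter> b = {} ==> chi (a \<union> b) i = chi a i * chi b i"
 by (simp add: chi_def prod.union_disjoint)

lemma sum_Pow_insert:
 fixes f :: "'b set => 'a::comm_monoid_add"
 assumes "finite P" "p \<notin> P"
 shows "(\<Sum>s\<in>Pow (insert p P). f s) = (\<Sum>s\<in>Pow P. f s + f (insert p s))"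
proof -
 have "inj_on (insert p) (Pow P)"
  using assms(2) by (intro inj_onI) (metis Diff_insert_absorb PowD subset_iff)
 then have "sum f (insert p ` Pow P) = (\<Sum>s\<in>Pow P. f (insert p s))" by (simp add: sum.reindex)
 moreover have "sum f (Pow P \<union> insert p ` Pow P) = sum f (Pow P) + sum f (insert p ` Pow P)"
  using assms by (intro sum.union_disjoint) auto
 ultimately show ?thesis by (simp add: Pow_insert sum.distrib)
qed

lemma sum_Pow_prod:
 fixes f :: "'b => real"
 assumes "finite P" shows "(\<Sum>s\<in>Pow P. \<Prod>p\<in>s. f p) = (\<Prod>p\<in>P. 1 + f p)"
 using assms
proof (induction P rule: finite_induct)
 case (insert p P)
 have "(\<Sum>s\<in>Pow (insert p P). \<Prod>p\<in>s. f p) = (\<Sum>s\<in>Pow P. (\<Prod>p\<in>s. f p) + (\<Prod>p\<in>insert p s. f p))"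
  using insert.hyps by (rule sum_Pow_insert)
 also have "... = (\<Sum>s\<in>Pow P. (1 + f p) * (\<Prod>p\<in>s. f p))"
 proof (rule sum.cong[OF refl])
  fix s assume "s \<in> Pow P"
  then have "p \<notin> s" "finite s" using insert.hyps finite_subset by auto
  then show "(\<Prod>p\<in>s. f p) + (\<Prod>p\<in>insert p s. f p) = (1 + f p) * (\<Prod>p\<in>s. f p)" by (simp add: algebra_simps)
 qed
 finally show ?case using insert by (simp flip: sum_distrib_left)
qed simp

lemma chi_orthogonal:
 assumes "finite P" "s \<subseteq> P" "s' \<subseteq> P"
 shows "(\<Sum>a\<in>Pow P. chi a s * chi a s') = (if s = s' then 2 ^ card P else 0)"
proof -
 let ?f = "%p. (if p \<in> s then - 1 else 1) * (if p \<in> s' then - 1 else 1) :: real"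
 have "(\<Sum>a\<in>Pow P. chi a s * chi a s') = (\<Sum>a\<in>Pow P. \<Prod>p\<in>a. ?f p)"
  by (simp add: chi_def prod.distrib)
 also have "... = (\<Prod>p\<in>P. 1 + ?f p)" using assms(1) by (rule sum_Pow_prod)
 also have "... = (if s = s' then 2 ^ card P else 0)"
 proof (cases "s = s'")
  case True
  then have "(\<Prod>p\<in>P. 1 + ?f p) = (\<Prod>p\<in>P. 2)" by (intro prod.cong) auto
  then show ?thesis using True by simp
 next
  case False
  then obtain p where "p \<in> P" "(p \<in> s) ~= (p \<in> s')" using assms by blast
  then show ?thesis using False assms(1) by (auto intro!: prod_zero bexI[of _ p])
 qed
 finally show ?thesis .
qed

text \<open>The quadratic character on pairs of positions; all its Fourier coefficients have the same
 absolute value.\<close>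

definition bent :: "nat set => nat set => real" where
 "bent Q s = (\<Prod>q\<in>Q. if q \<in> s \<and> Suc q \<in> s then - 1 else 1)"

lemma bent_abs [simp]: "\<bar>bent Q s\<bar> = 1"
proof -
 have "\<bar>bent Q s\<bar> = (\<Prod>q\<in>Q. \<bar>if q \<in> s \<and> Suc q \<in> s then - 1 else 1 :: real\<bar>)" unfolding bent_def by (rule abs_prod)
 also have "... = 1" by (intro prod.neutral) auto
 finally show ?thesis .
qed

lemma bent_square [simp]: "bent Q s * bent Q s = 1"
 using abs_mult_self_eq[of "bent Q s"] by simp

text \<open>The sum factorises over the pairs of \<open>q\<close> and \<open>Suc q\<close>, which
  are disjoint because \<open>q\<close> is even. For signs every factor
  \<open>1 + f q + f (Suc q) - f q * f (Suc q)\<close> is 2 or -2.\<close>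

lemma bent_sum:
 fixes f :: "nat => real"
 assumes "finite Q" "!!q. q \<in> Q ==> even q" "!!p. f p = 1 \<or> f p = - 1"
 shows "\<bar>\<Sum>s\<in>Pow (Q \<union> Suc ` Q). bent Q s * (\<Prod>p\<in>s. f p)\<bar> = 2 ^ card Q"
 using assms(1,2)
proof (induction Q rule: finite_induct)
 case empty
 then show ?case by (simp add: bent_def)
next
 case (insert q Q)
 let ?P = "Q \<union> Suc ` Q"
 have fin: "finite ?P" using insert.hyps by simp
 have ev: "even q" "!!r. r \<in> Q ==> even r" using insert.prems by auto
 have q: "q \<notin> ?P" using insert.hyps ev by auto
 have q2: "Suc q \<notin> ?P"
 proof
  assume "Suc q \<in> ?P"
  then have "Suc q \<in> Q \<or> q \<in> Q" by auto
  then show False using ev(1) ev(2)[of "Suc q"] insert.hyps by auto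
 qed
 have P: "insert q Q \<union> Suc ` insert q Q = insert q (insert (Suc q) ?P)" by auto
 have q1: "q \<notin> insert (Suc q) ?P" using q by simp
 have b: "bent (insert q Q) s = bent Q s" "bent (insert q Q) (insert (Suc q) s) = bent Q s"
  "bent (insert q Q) (insert q s) = bent Q s" "bent (insert q Q) (insert q (insert (Suc q) s)) = - bent Q s"
  if s: "s \<in> Pow ?P" for s
 proof -
  have n: "q \<notin> s" "Suc q \<notin> s" using s q q2 by auto
  have *: "bent Q (insert q s) = bent Q s" "bent Q (insert (Suc q) s) = bent Q s"
   "bent Q (insert q (insert (Suc q) s)) = bent Q s"
   unfolding bent_def using insert.hyps q q2 ev by (auto intro!: prod.cong)
  have ins: "bent (insert q Q) r = (if q \<in> r \<and> Suc q \<in> r then - 1 else 1) * bent Q r" for r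
   using insert.hyps by (simp add: bent_def)
  show "bent (insert q Q) s = bent Q s" "bent (insert q Q) (insert (Suc q) s) = bent Q s"
   "bent (insert q Q) (insert q s) = bent Q s" "bent (insert q Q) (insert q (insert (Suc q) s)) = - bent Q s"
   unfolding ins using n * by simp_all
 qed
 have "(\<Sum>s\<in>Pow (insert q (insert (Suc q) ?P)). bent (insert q Q) s * (\<Prod>p\<in>s. f p)) =
   (\<Sum>s\<in>Pow ?P. (1 + f q + f (Suc q) - f q * f (Suc q)) * (bent Q s * (\<Prod>p\<in>s. f p)))"
  unfolding sum_Pow_insert[OF finite.insertI[OF fin] q1] sum_Pow_insert[OF fin q2]
 proof (rule sum.cong[OF refl])
  fix s assume s: "s \<in> Pow ?P"
  then have n: "q \<notin> s" "Suc q \<notin> s" "finite s" using q q2 fin finite_subset by auto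
  show "bent (insert q Q) s * (\<Prod>p\<in>s. f p) + bent (insert q Q) (insert q s) * (\<Prod>p\<in>insert q s. f p) +
    (bent (insert q Q) (insert (Suc q) s) * (\<Prod>p\<in>insert (Suc q) s. f p) +
     bent (insert q Q) (insert q (insert (Suc q) s)) * (\<Prod>p\<in>insert q (insert (Suc q) s). f p)) =
    (1 + f q + f (Suc q) - f q * f (Suc q)) * (bent Q s * (\<Prod>p\<in>s. f p))"
   unfolding b[OF s] using n by (simp add: algebra_simps)
 qed
 also have "... = (1 + f q + f (Suc q) - f q * f (Suc q)) * (\<Sum>s\<in>Pow ?P. bent Q s * (\<Prod>p\<in>s. f p))"
  by (simp add: sum_distrib_left)
 finally have "\<bar>\<Sum>s\<in>Pow (insert q Q \<union> Suc ` insert q Q). bent (insert q Q) s * (\<Prod>p\<in>s. f p)\<bar> =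
   \<bar>1 + f q + f (Suc q) - f q * f (Suc q)\<bar> * 2 ^ card Q"
  using insert.IH ev(2) unfolding P by (simp add: abs_mult)
 also have "\<bar>1 + f q + f (Suc q) - f q * f (Suc q)\<bar> = 2" using assms(3)[of q] assms(3)[of "Suc q"] by auto
 finally show ?case using insert.hyps by simp
qed

text \<open>The stride 64 interleaves 32 classes with two adjacent positions per period. An axis
  thus consists of \<open>h\<close> pairs, the form required by the bent function.\<close>

definition axis_even :: "nat => nat => nat set" where
 "axis_even h c = (%u. 64 * u + 2 * c) ` {..<h}"

definition axis :: "nat => nat => nat set" where
 "axis h c = axis_even h c \<union> Suc ` axis_even h c"

lemma axis_props:
 assumes "c < 32"
 shows "finite (axis_even h c)" "\<forall>q\<in>axis_even h c. even q" "card (axis_even h c) = h"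
  "finite (axis h c)" "card (axis h c) = 2 * h" "axis h c \<subseteq> {..<64 * h}"
  "c' < 32 ==> c ~= c' ==> axis h c \<inter> axis h' c' = {}"
proof -
 show 1: "finite (axis_even h c)" "finite (axis h c)" by (simp_all add: axis_even_def axis_def)
 show ev: "\<forall>q\<in>axis_even h c. even q" by (auto simp: axis_even_def)
 show card: "card (axis_even h c) = h" unfolding axis_even_def by (subst card_image) (auto simp: inj_on_def)
 have "axis_even h c \<inter> Suc ` axis_even h c = {}"
 proof (rule ccontr)
  assume "axis_even h c \<inter> Suc ` axis_even h c ~= {}"
  then obtain q where "q \<in> axis_even h c" "Suc q \<in> axis_even h c" by auto
  then have "even q" "even (Suc q)" using ev by blast+
  then show False by simp
 qed
 then show "card (axis h c) = 2 * h"
  unfolding axis_def using 1 card by (subst card_Un_disjoint) (auto simp: card_image)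
 have mod: "p mod 64 div 2 = c \<and> p div 64 < h" if pc: "p \<in> axis h c" "c < 32" for p h c
 proof -
  obtain u where u: "u < h" "p = 64 * u + 2 * c \<or> p = 64 * u + 2 * c + 1"
   using pc(1) unfolding axis_def axis_even_def by fastforce
  then show ?thesis using pc(2) by (elim disjE) simp_all
 qed
 show "axis h c \<subseteq> {..<64 * h}"
 proof
  fix p assume "p \<in> axis h c"
  then have "p div 64 < h" using mod assms by blast
  then show "p \<in> {..<64 * h}" by simp
 qed
 show "axis h c \<inter> axis h' c' = {}" if "c' < 32" "c ~= c'"
  using mod[of _ h c] mod[of _ h' c'] assms that by blast
qed

text \<open>An axis has \<open>2 * h\<close> positions, so this is the square root of the number of
  summands, for every twist by characters.\<close>

lemma bent_axis:
 assumes "c < 32"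
 shows "\<bar>\<Sum>s\<in>Pow (axis h c). bent (axis_even h c) s * chi s a * chi s i\<bar> = 2 ^ h"
proof -
 have "\<bar>\<Sum>s\<in>Pow (axis h c). bent (axis_even h c) s * (\<Prod>p\<in>s. (if p \<in> a then - 1 else 1) * (if p \<in> i then - 1 else 1))\<bar> = 2 ^ card (axis_even h c)"
  unfolding axis_def using axis_props(1,2)[OF assms, of h] by (intro bent_sum) auto
 then show ?thesis using axis_props(3)[OF assms, of h] by (simp add: chi_def prod.distrib mult.assoc)
qed

text \<open>All points of the line expand over one and the same coset of \<open>V\<close>, so the
  coefficients add up to Fourier coefficients of \<open>\<sigma>\<close>. The target space is
  arbitrary in order to cover both vectors and values of functionals.\<close>

lemma sum_line_inside:
 fixes g :: "nat set => 'v::real_vector"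
 assumes "P \<subseteq> V" "finite V" "finite w"
 shows "(\<Sum>s\<in>Pow P. \<sigma> s *\<^sub>R (\<Sum>i\<in>Pow V. chi (w - P \<union> s) i *\<^sub>R g (w - P \<union> s - V \<union> i))) =
  (\<Sum>v\<in>(%i. w - V \<union> i) ` Pow V. (chi (w - P) (v \<inter> V) * (\<Sum>s\<in>Pow P. \<sigma> s * chi s (v \<inter> V))) *\<^sub>R g v)"
proof -
 have finP: "finite P" using assms finite_subset by blast
 have "(\<Sum>s\<in>Pow P. \<sigma> s *\<^sub>R (\<Sum>i\<in>Pow V. chi (w - P \<union> s) i *\<^sub>R g (w - P \<union> s - V \<union> i))) =
   (\<Sum>s\<in>Pow P. \<Sum>i\<in>Pow V. (chi (w - P) i * (\<sigma> s * chi s i)) *\<^sub>R g (w - V \<union> i))"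
  unfolding scaleR_sum_right
 proof (intro sum.cong refl)
  fix s i assume si: "s \<in> Pow P" "i \<in> Pow V"
  have "w - P \<union> s - V \<union> i = w - V \<union> i" using si assms(1) by blast
  moreover have "chi (w - P \<union> s) i = chi (w - P) i * chi s i"
   using si assms finP finite_subset by (intro chi_Un) auto
  ultimately show "\<sigma> s *\<^sub>R chi (w - P \<union> s) i *\<^sub>R g (w - P \<union> s - V \<union> i) = (chi (w - P) i * (\<sigma> s * chi s i)) *\<^sub>R g (w - V \<union> i)"
   by (simp add: mult_ac)
 qed
 also have "... = (\<Sum>i\<in>Pow V. \<Sum>s\<in>Pow P. (chi (w - P) i * (\<sigma> s * chi s i)) *\<^sub>R g (w - V \<union> i))" by (rule sum.swap)
 also have "... = (\<Sum>i\<in>Pow V. (chi (w - P) i * (\<Sum>s\<in>Pow P. \<sigma> s * chi s i)) *\<^sub>R g (w - V \<union> i))"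
  by (simp add: scaleR_sum_left sum_distrib_left)
 also have "... = (\<Sum>v\<in>(%i. w - V \<union> i) ` Pow V. (chi (w - P) (v \<inter> V) * (\<Sum>s\<in>Pow P. \<sigma> s * chi s (v \<inter> V))) *\<^sub>R g v)"
 proof (rule sum.reindex_bij_witness[of _ "%v. v \<inter> V" "%i. w - V \<union> i"])
  fix i assume i: "i \<in> Pow V"
  show e: "(w - V \<union> i) \<inter> V = i" using i by blast
  show "w - V \<union> i \<in> (%i. w - V \<union> i) ` Pow V" using i by blast
  show "(chi (w - P) ((w - V \<union> i) \<inter> V) * (\<Sum>s\<in>Pow P. \<sigma> s * chi s ((w - V \<union> i) \<inter> V))) *\<^sub>R g (w - V \<union> i) =
    (chi (w - P) i * (\<Sum>s\<in>Pow P. \<sigma> s * chi s i)) *\<^sub>R g (w - V \<union> i)" unfolding e ..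
 next
  fix v assume "v \<in> (%i. w - V \<union> i) ` Pow V"
  then obtain i where "i \<in> Pow V" "v = w - V \<union> i" by blast
  then show "w - V \<union> (v \<inter> V) = v" "v \<inter> V \<in> Pow V" by blast+
 qed
 finally show ?thesis .
qed

text \<open>The points of the line expand over disjoint cosets. Nothing cancels: the coefficients
  keep their modulus and the number of terms is multiplied by \<open>2 ^ card P\<close>.\<close>

lemma sum_line_outside:
 fixes g :: "nat set => 'v::real_vector"
 assumes "P \<inter> V = {}"
 shows "(\<Sum>s\<in>Pow P. \<sigma> s *\<^sub>R (\<Sum>i\<in>Pow V. chi (w - P \<union> s) i *\<^sub>R g (w - P \<union> s - V \<union> i))) =
  (\<Sum>v\<in>(%r. w - (P \<union> V) \<union> r) ` Pow (P \<union> V). (\<sigma> (v \<inter> P) * chi (w - P \<union> (v \<inter> P)) (v \<inter> V)) *\<^sub>R g v)"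
 unfolding scaleR_sum_right sum.cartesian_product
proof (rule sum.reindex_bij_witness[of _ "%v. (v \<inter> P, v \<inter> V)" "%(s, i). w - (P \<union> V) \<union> (s \<union> i)"])
 fix y assume "y \<in> Pow P \<times> Pow V"
 then obtain s i where y: "y = (s, i)" and si: "s \<subseteq> P" "i \<subseteq> V" by (cases y) auto
 have e: "(w - (P \<union> V) \<union> (s \<union> i)) \<inter> P = s" "(w - (P \<union> V) \<union> (s \<union> i)) \<inter> V = i" using si assms by blast+
 show "((case y of (s, i) => w - (P \<union> V) \<union> (s \<union> i)) \<inter> P, (case y of (s, i) => w - (P \<union> V) \<union> (s \<union> i)) \<inter> V) = y"
  unfolding y prod.case e ..
 show "(case y of (s, i) => w - (P \<union> V) \<union> (s \<union> i)) \<in> (%r. w - (P \<union> V) \<union> r) ` Pow (P \<union> V)"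
  unfolding y prod.case using si by (intro imageI) blast
 have "w - P \<union> s - V \<union> i = w - (P \<union> V) \<union> (s \<union> i)" using si assms by blast
 then show "(\<sigma> ((case y of (s, i) => w - (P \<union> V) \<union> (s \<union> i)) \<inter> P) *
    chi (w - P \<union> ((case y of (s, i) => w - (P \<union> V) \<union> (s \<union> i)) \<inter> P)) ((case y of (s, i) => w - (P \<union> V) \<union> (s \<union> i)) \<inter> V)) *\<^sub>R
    g (case y of (s, i) => w - (P \<union> V) \<union> (s \<union> i)) =
   (case y of (s, i) => \<sigma> s *\<^sub>R chi (w - P \<union> s) i *\<^sub>R g (w - P \<union> s - V \<union> i))"
  unfolding y prod.case e by simp
next
 fix v assume "v \<in> (%r. w - (P \<union> V) \<union> r) ` Pow (P \<union> V)"
 then obtain r where "r \<subseteq> P \<union> V" "v = w - (P \<union> V) \<union> r" by blast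
 then show "(case (v \<inter> P, v \<inter> V) of (s, i) => w - (P \<union> V) \<union> (s \<union> i)) = v" "(v \<inter> P, v \<inter> V) \<in> Pow P \<times> Pow V" by auto
qed

lemma card_translates: "finite V ==> card ((%i. w - V \<union> i) ` Pow V) = 2 ^ card V"
 by (subst card_image) (auto simp: inj_on_def card_Pow)

section \<open>Szankowski's construction\<close>

text \<open>The enumeration may be arbitrary, because a level enters only through estimates by the
  size of the coefficients and the number of terms.\<close>

definition idx :: "nat => nat set \<times> bool \<times> bool => nat" where
 "idx n = (SOME f. bij_betw f (Pow {..<n} \<times> UNIV) {..<2 ^ (n + 2)})"

lemma idx: "bij_betw (idx n) (Pow {..<n} \<times> UNIV) {..<2 ^ (n + 2)}"
proof -
 have "card (Pow {..<n} \<times> (UNIV :: (bool \<times> bool) set)) = card {..<2 ^ (n + 2) :: nat}"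
  by (simp add: card_cartesian_product card_Pow power_add flip: UNIV_Times_UNIV)
 then have "\<exists>f. bij_betw f (Pow {..<n} \<times> (UNIV :: (bool \<times> bool) set)) {..<2 ^ (n + 2) :: nat}"
  by (intro finite_same_card_bij) auto
 then show ?thesis unfolding idx_def by (rule someI_ex)
qed

definition string_type :: "nat => nat set => bool \<times> bool => nat" where
 "string_type n w \<nu> = of_bool (n - 1 \<in> w) + 2 * of_bool (n - 2 \<in> w) + 4 * of_bool (fst \<nu>) + 8 * of_bool (snd \<nu>)"

text \<open>The class of \<open>w\<close> records its last two bits, the copy bits and the parity of the level. This is
 what distinguishes \<open>w\<close> from the indices of the terms that remain in \<open>Y\<close> below.\<close>

definition axis_class :: "nat => nat set => bool \<times> bool => nat" where
 "axis_class n w \<nu> = 2 * string_type n w \<nu> + n mod 2"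

definition own_axis :: "nat => nat set => bool \<times> bool => nat set" where
 "own_axis n w \<nu> = axis (axis_size n) (axis_class n w \<nu>)"

lemma string_type_less: "string_type n w \<nu> < 16"
 by (auto simp: string_type_def of_bool_def)

lemma axis_class_less: "axis_class n w \<nu> < 32"
 using string_type_less[of n w \<nu>] by (auto simp: axis_class_def)

lemma string_type_eq_iff:
 "string_type n w \<nu> = string_type n w' \<nu>' \<longleftrightarrow> (n - 1 \<in> w \<longleftrightarrow> n - 1 \<in> w') \<and> (n - 2 \<in> w \<longleftrightarrow> n - 2 \<in> w') \<and> \<nu> = \<nu>'"
 by (cases \<nu>; cases \<nu>') (auto simp: string_type_def of_bool_def split: if_splits)

lemma axis_size_less: "64 * axis_size n <= n - 2" "64 * axis_size (Suc n) <= n - 2"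
 unfolding axis_size_def by auto

lemma own_axis_subset: "own_axis n w \<nu> \<subseteq> {..<n - 2}"
 unfolding own_axis_def using axis_props(6)[OF axis_class_less, of "axis_size n" n w \<nu>] axis_size_less(1)[of n] by auto

text \<open>Type and cotype share one development: \<open>ty\<close> selects the growth rate that is
  available and, through \<open>U\<close>, the positions over which vectors are averaged.\<close>

locale szankowski =
 fixes e :: "nat => nat => 'a::real_normed_vector" and D :: "nat => nat => 'a \<Rightarrow>\<^sub>L real"
  and C \<delta> :: real and ty :: bool
 assumes spr: "!!n. 2 <= n ==> spreading (2 ^ (n + 2)) (e n)" "!!n. 2 <= n ==> norm (e n 0) = 1"
  and rates: "!!n. 2 <= n ==> if ty then type_rates C \<delta> n (e n) else cotype_rates C \<delta> n (e n)"
  and biorth: "!!n m i j. 2 <= n ==> 2 <= m ==> i < 2 ^ (n + 2) ==> j < 2 ^ (m + 2) ==>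
    blinfun_apply (D n i) (e m j) = (if n = m \<and> i = j then 1 else 0)"
  and proj: "!!n v. 2 <= n ==> v \<in> closure (span {e m i | m i. 2 <= m \<and> i < 2 ^ (m + 2)}) ==>
    norm (\<Sum>i<2 ^ (n + 2). blinfun_apply (D n i) v *\<^sub>R e n i) <= 4 * norm v"
  and C: "C > 0" and \<delta>: "0 < \<delta>" "\<delta> <= 1 / 2"
begin

definition W :: "'a set" where
 "W = closure (span {e m i | m i. 2 <= m \<and> i < 2 ^ (m + 2)})"

definition lam :: "nat => nat => real" where "lam n f = flat (e n) f"

definition d :: "nat => nat set => bool \<times> bool => 'a" where "d n w \<nu> = e n (idx n (w, \<nu>))"

definition ds :: "nat => nat set => bool \<times> bool => 'a \<Rightarrow>\<^sub>L real" where "ds n w \<nu> = D n (idx n (w, \<nu>))"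

lemma idx_less: "w \<subseteq> {..<n} ==> idx n (w, \<nu>) < 2 ^ (n + 2)"
 using bij_betwE[OF idx[of n]] by fastforce

lemma ds_d:
 assumes "2 <= n" "2 <= m" "w \<subseteq> {..<n}" "w' \<subseteq> {..<m}"
 shows "blinfun_apply (ds n w \<nu>) (d m w' \<nu>') = (if n = m \<and> w = w' \<and> \<nu> = \<nu>' then 1 else 0)"
proof -
 have "idx n (w, \<nu>) = idx n (w', \<nu>') \<longleftrightarrow> (w, \<nu>) = (w', \<nu>')" if "n = m"
  using bij_betw_imp_inj_on[OF idx[of n]] assms that by (intro inj_on_eq_iff) auto
 then show ?thesis
  unfolding ds_def d_def using biorth[OF assms(1,2) idx_less[OF assms(3)] idx_less[OF assms(4)]] by auto
qed

text \<open>A factor 4 replaces the coefficients by the constant \<open>B\<close>, a factor 2 the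
  index set by an initial segment.\<close>

lemma d_upper:
 assumes n: "2 <= n" and F: "F \<subseteq> Pow {..<n}" and c: "!!w. w \<in> F ==> \<bar>c w\<bar> <= B"
 shows "norm (\<Sum>w\<in>F. c w *\<^sub>R d n w \<nu>) <= B * (8 * lam n (card F))"
proof (cases "F = {}")
 case True then show ?thesis by (simp add: lam_def flat_def)
next
 case False
 have B: "B \<ge> 0" using c False by force
 define f where "f w = idx n (w, \<nu>)" for w
 have inj: "inj_on f F"
 proof (rule inj_onI)
  fix w w' assume w: "w \<in> F" "w' \<in> F" "f w = f w'"
  have "(w, \<nu>) = (w', \<nu>)"
   using w F unfolding f_def by (intro inj_onD[OF bij_betw_imp_inj_on[OF idx[of n]]]) auto
  then show "w = w'" by simp
 qed
 have "f w < 2 ^ (n + 2)" if "w \<in> F" for w unfolding f_def using F that by (intro idx_less) auto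
 then have sub: "f ` F \<subseteq> {..<2 ^ (n + 2)}" by (intro image_subsetI) simp
 define a where "a i = (if i \<in> f ` F then c (the_inv_into F f i) else 0)" for i
 have af: "a (f w) = c w" if "w \<in> F" for w using that inj by (simp add: a_def the_inv_into_f_f)
 have aB: "\<bar>a i\<bar> <= B" for i
 proof (cases "i \<in> f ` F")
  case True
  then obtain w where "w \<in> F" "i = f w" by blast
  then show ?thesis using af c by simp
 qed (simp add: a_def B)
 have "(\<Sum>w\<in>F. c w *\<^sub>R d n w \<nu>) = (\<Sum>i\<in>f ` F. a i *\<^sub>R e n i)"
  using inj by (simp add: sum.reindex af d_def f_def[symmetric])
 also have "... = (\<Sum>i<2 ^ (n + 2). ((if B = 0 then 0 else a i / B) * (if i \<in> f ` F then B else 0)) *\<^sub>R e n i)"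
 proof (rule sum.mono_neutral_cong_left)
  show "\<forall>i\<in>{..<2 ^ (n + 2)} - f ` F. ((if B = 0 then 0 else a i / B) * (if i \<in> f ` F then B else 0)) *\<^sub>R e n i = 0"
   by simp
  show "a i *\<^sub>R e n i = ((if B = 0 then 0 else a i / B) * (if i \<in> f ` F then B else 0)) *\<^sub>R e n i"
   if "i \<in> f ` F" for i
   using that aB[of i] by (cases "B = 0") simp_all
 qed (use sub in auto)
 also have "norm ... <= 4 * norm (\<Sum>i<2 ^ (n + 2). (if i \<in> f ` F then B else 0) *\<^sub>R e n i)"
  using aB B by (intro spreading_signs[OF spr(1)[OF n]]) (auto simp: divide_le_eq)
 also have "(\<Sum>i<2 ^ (n + 2). (if i \<in> f ` F then B else 0) *\<^sub>R e n i) = B *\<^sub>R (\<Sum>i\<in>f ` F. e n i)"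
  unfolding scaleR_sum_right using sub by (intro sum.mono_neutral_cong_right) auto
 also have "4 * norm (B *\<^sub>R (\<Sum>i\<in>f ` F. e n i)) <= 4 * (B * (2 * flat (e n) (card (f ` F))))"
  using mult_left_mono[OF flat_set(1)[OF spr(1)[OF n] sub] B] B by simp
 finally show ?thesis using inj by (simp add: card_image lam_def)
qed

text \<open>\<open>flat_dual\<close> applied to the component of \<open>v\<close> on level
  \<open>n\<close>. The additional factor 4 bounds the projection onto the level, which is
  controlled on \<open>W\<close> only.\<close>

lemma ds_upper:
 assumes n: "2 <= n" and F: "F \<subseteq> Pow {..<n}" and c: "!!w. w \<in> F ==> \<bar>c w\<bar> <= B" and v: "v \<in> W" and B: "0 <= B"
 shows "\<bar>\<Sum>w\<in>F. c w * blinfun_apply (ds n w \<nu>) v\<bar> * lam n (card F) <= B * (256 * real (card F) * norm v)"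
proof -
 define f where "f w = idx n (w, \<nu>)" for w
 have inj: "inj_on f F"
 proof (rule inj_onI)
  fix w w' assume w: "w \<in> F" "w' \<in> F" "f w = f w'"
  have "(w, \<nu>) = (w', \<nu>)"
   using w F unfolding f_def by (intro inj_onD[OF bij_betw_imp_inj_on[OF idx[of n]]]) auto
  then show "w = w'" by simp
 qed
 have "f w < 2 ^ (n + 2)" if "w \<in> F" for w unfolding f_def using F that by (intro idx_less) auto
 then have sub: "f ` F \<subseteq> {..<2 ^ (n + 2)}" by (intro image_subsetI) simp
 have "\<bar>\<Sum>w\<in>F. c w * blinfun_apply (ds n w \<nu>) v\<bar> <= (\<Sum>w\<in>F. \<bar>c w * blinfun_apply (ds n w \<nu>) v\<bar>)"
  by (rule sum_abs)
 also have "... <= (\<Sum>w\<in>F. B * \<bar>blinfun_apply (ds n w \<nu>) v\<bar>)"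
  unfolding abs_mult using c by (intro sum_mono mult_right_mono) auto
 also have "... = B * (\<Sum>i\<in>f ` F. \<bar>blinfun_apply (D n i) v\<bar>)"
  unfolding ds_def f_def[symmetric] using inj by (simp add: sum.reindex sum_distrib_left)
 finally have "\<bar>\<Sum>w\<in>F. c w * blinfun_apply (ds n w \<nu>) v\<bar> * lam n (card F) <=
   B * ((\<Sum>i\<in>f ` F. \<bar>blinfun_apply (D n i) v\<bar>) * flat (e n) (card (f ` F)))"
  using inj by (simp add: card_image lam_def flat_def mult_right_mono flip: mult.assoc)
 also have "... <= B * (64 * real (card (f ` F)) * norm (\<Sum>i<2 ^ (n + 2). blinfun_apply (D n i) v *\<^sub>R e n i))"
  using B by (intro mult_left_mono flat_dual[OF spr(1)[OF n] sub])
 also have "... <= B * (64 * real (card (f ` F)) * (4 * norm v))"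
  using B proj[OF n, of v] v by (intro mult_left_mono) (auto simp: W_def)
 finally show ?thesis using inj by (simp add: card_image)
qed

lemma lam_pos:
 assumes "2 <= n" "0 < f" "f <= 2 ^ (n + 2)" shows "0 < lam n f"
proof -
 have "flat (e n) 1 <= 2 * flat (e n) f" using assms by (intro flat_mono[OF spr(1)]) auto
 moreover have "flat (e n) 1 = 1" using spr(2)[OF assms(1)] by (simp add: flat_def)
 ultimately show ?thesis by (simp add: lam_def)
qed

text \<open>The vector \<open>x n w\<close> averages over the positions in \<open>U\<close>. A signed sum of such vectors over a line
 inside \<open>U\<close> has norm of order the square root of the number of terms; over a line outside \<open>U\<close> it is
 governed by the growth of \<open>lam\<close>. With this choice the fixed gain over the square root occurs exactly
 once, for the functionals on the own axis (type) or for the vectors on the other axes (cotype).\<close>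

definition U :: "nat => nat set => bool \<times> bool => nat set" where
 "U n w \<nu> = (if ty then {..<n - 2} - own_axis n w \<nu> else own_axis n w \<nu>)"

lemma U_subset: "U n w \<nu> \<subseteq> {..<n - 2}"
 using own_axis_subset by (auto simp: U_def)

lemma finite_U [simp]: "finite (U n w \<nu>)"
 using U_subset by (rule finite_subset) simp

lemma U_cong: "(n - 1 \<in> w \<longleftrightarrow> n - 1 \<in> w') ==> (n - 2 \<in> w \<longleftrightarrow> n - 2 \<in> w') ==> U n w \<nu> = U n w' \<nu>"
 by (simp add: U_def own_axis_def axis_class_def string_type_def)

text \<open>Dividing by the norm of a flat sum of the same length keeps \<open>x\<close> bounded. In
  \<open>xs\<close> the inverse factor appears together with the number of terms, which the
  orthogonality of the characters produces.\<close>

definition x :: "nat => nat set => bool \<times> bool => 'a" where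
 "x n w \<nu> = (1 / lam n (2 ^ card (U n w \<nu>))) *\<^sub>R (\<Sum>i\<in>Pow (U n w \<nu>). chi w i *\<^sub>R d n (w - U n w \<nu> \<union> i) \<nu>)"

definition xs :: "nat => nat set => bool \<times> bool => 'a \<Rightarrow>\<^sub>L real" where
 "xs n w \<nu> = (lam n (2 ^ card (U n w \<nu>)) / 2 ^ card (U n w \<nu>)) *\<^sub>R (\<Sum>i\<in>Pow (U n w \<nu>). chi w i *\<^sub>R ds n (w - U n w \<nu> \<union> i) \<nu>)"

lemma lamU_pos: "2 <= n ==> 0 < lam n (2 ^ card (U n w \<nu>))"
proof (rule lam_pos)
 have "card (U n w \<nu>) <= n" using card_mono[OF _ U_subset[of n w \<nu>]] by simp
 then show "(2::nat) ^ card (U n w \<nu>) <= 2 ^ (n + 2)" by (intro power_increasing) auto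
qed auto

text \<open>On one coset of \<open>U\<close> this is the orthogonality of characters. Different
  cosets never meet: \<open>U\<close> is determined by the last two positions, which it does not
  contain.\<close>

lemma xs_x:
 assumes n: "2 <= n" "2 <= m" and w: "w \<subseteq> {..<n}" "w' \<subseteq> {..<m}"
 shows "blinfun_apply (xs n w \<nu>) (x m w' \<nu>') = (if n = m \<and> w = w' \<and> \<nu> = \<nu>' then 1 else 0)"
proof -
 define V where "V = U n w \<nu>"
 define V' where "V' = U m w' \<nu>'"
 have fV: "finite V" "finite V'" by (simp_all add: V_def V'_def)
 have Vn: "V \<subseteq> {..<n - 2}" "V' \<subseteq> {..<m - 2}" using U_subset by (auto simp: V_def V'_def)
 have finw: "finite w" "finite w'" using w finite_subset by auto
 have app: "blinfun_apply (xs n w \<nu>) (x m w' \<nu>') = (lam n (2 ^ card V) / 2 ^ card V) * (1 / lam m (2 ^ card V')) *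
   (\<Sum>i\<in>Pow V. \<Sum>j\<in>Pow V'. chi w i * chi w' j * blinfun_apply (ds n (w - V \<union> i) \<nu>) (d m (w' - V' \<union> j) \<nu>'))"
  by (simp add: xs_def x_def V_def[symmetric] V'_def[symmetric] blinfun.scaleR_left blinfun.sum_left blinfun.scaleR_right
    blinfun.sum_right sum_distrib_left mult_ac) (rule sum.swap)
 have dd: "blinfun_apply (ds n (w - V \<union> i) \<nu>) (d m (w' - V' \<union> j) \<nu>') =
   (if n = m \<and> w - V \<union> i = w' - V' \<union> j \<and> \<nu> = \<nu>' then 1 else 0)" if "i \<in> Pow V" "j \<in> Pow V'" for i j
  using that w Vn by (intro ds_d n) force+
 show ?thesis
 proof (cases "n = m \<and> \<nu> = \<nu>' \<and> V = V' \<and> w - V = w' - V'")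
  case False
  have ne: "\<not> (n = m \<and> w - V \<union> i = w' - V' \<union> j \<and> \<nu> = \<nu>')" if ij: "i \<in> Pow V" "j \<in> Pow V'" for i j
  proof
   assume eq: "n = m \<and> w - V \<union> i = w' - V' \<union> j \<and> \<nu> = \<nu>'"
   have last: "p \<in> w \<longleftrightarrow> p \<in> w'" if p: "p = n - 1 \<or> p = n - 2" for p
   proof -
    have "p \<notin> {..<n - 2}" using p by auto
    then have "p \<notin> V" "p \<notin> V'" "p \<notin> i" "p \<notin> j" using Vn ij eq by auto
    then show ?thesis using eq by blast
   qed
   have "U n w \<nu> = U n w' \<nu>" using last by (intro U_cong) blast+
   then have "V = V'" unfolding V_def V'_def using eq by simp
   moreover have "w - V = w' - V'" using eq ij \<open>V = V'\<close> by blast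
   ultimately show False using False eq by blast
  qed
  have "blinfun_apply (ds n (w - V \<union> i) \<nu>) (d m (w' - V' \<union> j) \<nu>') = 0" if "i \<in> Pow V" "j \<in> Pow V'" for i j
   unfolding dd[OF that] by (rule if_not_P[OF ne[OF that]])
  then have "(\<Sum>i\<in>Pow V. \<Sum>j\<in>Pow V'. chi w i * chi w' j * blinfun_apply (ds n (w - V \<union> i) \<nu>) (d m (w' - V' \<union> j) \<nu>')) = 0"
   by (intro sum.neutral ballI) (metis mult_zero_right)
  then have "blinfun_apply (xs n w \<nu>) (x m w' \<nu>') = 0" unfolding app by simp
  moreover have "\<not> (n = m \<and> w = w' \<and> \<nu> = \<nu>')" using False by (auto simp: V_def V'_def)
  ultimately show ?thesis by simp
 next
  case True
  then have nm: "n = m" "\<nu> = \<nu>'" "V' = V" "w' - V = w - V" by auto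
  have "(\<Sum>i\<in>Pow V. \<Sum>j\<in>Pow V'. chi w i * chi w' j * blinfun_apply (ds n (w - V \<union> i) \<nu>) (d m (w' - V' \<union> j) \<nu>')) =
    (\<Sum>i\<in>Pow V. \<Sum>j\<in>Pow V. if j = i then chi w i * chi w' i else 0)"
  proof (intro sum.cong refl)
   fix i j assume "i \<in> Pow V" "j \<in> Pow V"
   then have ij: "i \<in> Pow V" "j \<in> Pow V'" using nm by auto
   have "w - V \<union> i = w' - V' \<union> j \<longleftrightarrow> j = i" using ij nm by blast
   then show "chi w i * chi w' j * blinfun_apply (ds n (w - V \<union> i) \<nu>) (d m (w' - V' \<union> j) \<nu>') = (if j = i then chi w i * chi w' i else 0)"
    unfolding dd[OF ij] using nm by simp
  qed (use nm in simp)
  also have "... = (\<Sum>i\<in>Pow V. chi w i * chi w' i)" using fV by simp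
  also have "... = (\<Sum>i\<in>Pow V. chi i (w \<inter> V) * chi i (w' \<inter> V))"
  proof (rule sum.cong[OF refl])
   fix i assume i: "i \<in> Pow V"
   have fi: "finite i" using i fV finite_subset by auto
   have "chi i w = chi i (w \<inter> V)" "chi i w' = chi i (w' \<inter> V)"
    unfolding chi_def using i by (auto intro!: prod.cong)
   then show "chi w i * chi w' i = chi i (w \<inter> V) * chi i (w' \<inter> V)"
    using chi_commute[OF finw(1) fi] chi_commute[OF finw(2) fi] by simp
  qed
  also have "... = (if w \<inter> V = w' \<inter> V then 2 ^ card V else 0)"
   using fV by (intro chi_orthogonal) auto
  finally have "blinfun_apply (xs n w \<nu>) (x m w' \<nu>') = (if w \<inter> V = w' \<inter> V then 1 else 0)"
   unfolding app using nm lamU_pos[OF n(1), of w \<nu>, folded V_def] by simp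
  moreover have "w \<inter> V = w' \<inter> V \<longleftrightarrow> w = w'" using nm by blast
  ultimately show ?thesis using nm by simp
 qed
qed

lemma U_line: "P \<subseteq> {..<n - 2} ==> s \<subseteq> P ==> U n (w - P \<union> s) \<nu> = U n w \<nu>"
 by (rule U_cong) auto

lemma x_line:
 assumes "P \<subseteq> {..<n - 2}" "V = U n w \<nu>"
 shows "(\<Sum>s\<in>Pow P. \<sigma> s *\<^sub>R x n (w - P \<union> s) \<nu>) =
  (1 / lam n (2 ^ card V)) *\<^sub>R (\<Sum>s\<in>Pow P. \<sigma> s *\<^sub>R (\<Sum>i\<in>Pow V. chi (w - P \<union> s) i *\<^sub>R d n (w - P \<union> s - V \<union> i) \<nu>))"
 unfolding scaleR_sum_right
proof (rule sum.cong[OF refl])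
 fix s assume "s \<in> Pow P"
 then have "U n (w - P \<union> s) \<nu> = V" using U_line assms by auto
 then show "\<sigma> s *\<^sub>R x n (w - P \<union> s) \<nu> =
   (\<Sum>i\<in>Pow V. (1 / lam n (2 ^ card V)) *\<^sub>R \<sigma> s *\<^sub>R chi (w - P \<union> s) i *\<^sub>R d n (w - P \<union> s - V \<union> i) \<nu>)"
  by (simp add: x_def scaleR_sum_right mult_ac)
qed

lemma xs_line:
 assumes "P \<subseteq> {..<n - 2}" "V = U n w \<nu>"
 shows "(\<Sum>s\<in>Pow P. \<sigma> s * blinfun_apply (xs n (w - P \<union> s) \<nu>) v) =
  lam n (2 ^ card V) / 2 ^ card V *
   (\<Sum>s\<in>Pow P. \<sigma> s *\<^sub>R (\<Sum>i\<in>Pow V. chi (w - P \<union> s) i *\<^sub>R blinfun_apply (ds n (w - P \<union> s - V \<union> i) \<nu>) v))"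
 unfolding sum_distrib_left
proof (rule sum.cong[OF refl])
 fix s assume "s \<in> Pow P"
 then have "U n (w - P \<union> s) \<nu> = V" using U_line assms by auto
 then show "\<sigma> s * blinfun_apply (xs n (w - P \<union> s) \<nu>) v =
   lam n (2 ^ card V) / 2 ^ card V * \<sigma> s *\<^sub>R (\<Sum>i\<in>Pow V. chi (w - P \<union> s) i *\<^sub>R blinfun_apply (ds n (w - P \<union> s - V \<union> i) \<nu>) v)"
  by (simp add: xs_def blinfun.scaleR_left blinfun.sum_left sum_distrib_left mult_ac)
qed

text \<open>The summation does not enlarge the coset, so \<open>lam\<close> cancels against the
  normalisation, and \<open>2 ^ h\<close> comes from the bent function alone. This factor is the
  same for every norm.\<close>

lemma x_line_inside:
 assumes n: "2 <= n" and w: "w \<subseteq> {..<n}" and c: "c < 32" and P: "P = axis h c" "P \<subseteq> U n w \<nu>"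
 shows "norm (\<Sum>s\<in>Pow P. (bent (axis_even h c) s * chi s a) *\<^sub>R x n (w - P \<union> s) \<nu>) <= 8 * 2 ^ h"
proof -
 define V where "V = U n w \<nu>"
 have V: "V \<subseteq> {..<n - 2}" "finite V" "P \<subseteq> V" using U_subset P by (auto simp: V_def)
 have fw: "finite w" using w finite_subset by auto
 let ?F = "(%i. w - V \<union> i) ` Pow V"
 let ?c = "%v. chi (w - P) (v \<inter> V) * (\<Sum>s\<in>Pow P. bent (axis_even h c) s * chi s a * chi s (v \<inter> V))"
 have "(\<Sum>s\<in>Pow P. (bent (axis_even h c) s * chi s a) *\<^sub>R x n (w - P \<union> s) \<nu>) =
   (1 / lam n (2 ^ card V)) *\<^sub>R (\<Sum>v\<in>?F. ?c v *\<^sub>R d n v \<nu>)"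
  unfolding x_line[OF order_trans[OF V(3,1)] V_def]
   sum_line_inside[OF V(3) V(2) fw, of "%s. bent (axis_even h c) s * chi s a" "%u. d n u \<nu>"] ..
 moreover have "norm (\<Sum>v\<in>?F. ?c v *\<^sub>R d n v \<nu>) <= 2 ^ h * (8 * lam n (card ?F))"
 proof (rule d_upper[OF n])
  show "?F \<subseteq> Pow {..<n}" using w V by force
  show "\<bar>?c v\<bar> <= 2 ^ h" for v unfolding P(1) abs_mult using bent_axis[OF c] by simp
 qed
 ultimately show ?thesis using lamU_pos[OF n, of w \<nu>] V
  by (simp add: V_def[symmetric] card_translates divide_le_eq mult_ac)
qed

text \<open>Here only the growth of \<open>lam\<close> matters: there are \<open>2 ^ card P\<close>
  times as many terms, with coefficients of modulus at most 1, under the old normalisation.\<close>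

lemma x_line_outside:
 assumes n: "2 <= n" and w: "w \<subseteq> {..<n}" and \<sigma>: "!!s. \<bar>\<sigma> s\<bar> <= 1" and P: "P \<subseteq> {..<n - 2}" "P \<inter> U n w \<nu> = {}"
 shows "norm (\<Sum>s\<in>Pow P. \<sigma> s *\<^sub>R x n (w - P \<union> s) \<nu>) <= 8 * lam n (2 ^ (card P + card (U n w \<nu>))) / lam n (2 ^ card (U n w \<nu>))"
proof -
 define V where "V = U n w \<nu>"
 have V: "V \<subseteq> {..<n - 2}" "finite V" "P \<inter> V = {}" using U_subset P by (auto simp: V_def)
 have finP: "finite P" using P(1) finite_subset by auto
 let ?F = "(%r. w - (P \<union> V) \<union> r) ` Pow (P \<union> V)"
 let ?c = "%v. \<sigma> (v \<inter> P) * chi (w - P \<union> (v \<inter> P)) (v \<inter> V)"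
 have "(\<Sum>s\<in>Pow P. \<sigma> s *\<^sub>R x n (w - P \<union> s) \<nu>) = (1 / lam n (2 ^ card V)) *\<^sub>R (\<Sum>v\<in>?F. ?c v *\<^sub>R d n v \<nu>)"
  unfolding x_line[OF P(1) V_def] sum_line_outside[OF V(3), of \<sigma> w "%u. d n u \<nu>"] ..
 moreover have "norm (\<Sum>v\<in>?F. ?c v *\<^sub>R d n v \<nu>) <= 1 * (8 * lam n (card ?F))"
 proof (rule d_upper[OF n])
  show "?F \<subseteq> Pow {..<n}" using w V P(1) by force
  show "\<bar>?c v\<bar> <= 1" for v unfolding abs_mult using \<sigma> by simp
 qed
 moreover have "card ?F = 2 ^ (card P + card V)"
  using V finP by (simp add: card_translates card_Un_disjoint)
 ultimately show ?thesis using lamU_pos[OF n, of w \<nu>]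
  by (simp add: V_def[symmetric] divide_right_mono)
qed

lemma xs_line_inside:
 assumes n: "2 <= n" and w: "w \<subseteq> {..<n}" and c: "c < 32" and P: "P = axis h c" "P \<subseteq> U n w \<nu>" and v: "v \<in> W"
 shows "\<bar>\<Sum>s\<in>Pow P. (bent (axis_even h c) s * chi s a) * blinfun_apply (xs n (w - P \<union> s) \<nu>) v\<bar> <= 256 * 2 ^ h * norm v"
proof -
 define V where "V = U n w \<nu>"
 have V: "V \<subseteq> {..<n - 2}" "finite V" "P \<subseteq> V" using U_subset P by (auto simp: V_def)
 have fw: "finite w" using w finite_subset by auto
 let ?F = "(%i. w - V \<union> i) ` Pow V"
 let ?c = "%v. chi (w - P) (v \<inter> V) * (\<Sum>s\<in>Pow P. bent (axis_even h c) s * chi s a * chi s (v \<inter> V))"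
 let ?S = "\<Sum>u\<in>?F. ?c u * blinfun_apply (ds n u \<nu>) v"
 have e: "(\<Sum>s\<in>Pow P. (bent (axis_even h c) s * chi s a) * blinfun_apply (xs n (w - P \<union> s) \<nu>) v) =
   lam n (2 ^ card V) / 2 ^ card V * ?S"
  unfolding xs_line[OF order_trans[OF V(3,1)] V_def, unfolded real_scaleR_def]
   sum_line_inside[OF V(3) V(2) fw, of "%s. bent (axis_even h c) s * chi s a" "%u. blinfun_apply (ds n u \<nu>) v", unfolded real_scaleR_def] ..
 have "\<bar>?S\<bar> * lam n (card ?F) <= 2 ^ h * (256 * real (card ?F) * norm v)"
 proof (rule ds_upper[OF n _ _ v])
  show "?F \<subseteq> Pow {..<n}" using w V by force
  show "\<bar>?c v\<bar> <= 2 ^ h" for v unfolding P(1) abs_mult using bent_axis[OF c] by simp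
 qed simp
 then show ?thesis unfolding e abs_mult using lamU_pos[OF n, of w \<nu>, folded V_def] V
  by (simp add: card_translates divide_le_eq mult_ac)
qed

lemma xs_line_outside:
 assumes n: "2 <= n" and w: "w \<subseteq> {..<n}" and \<sigma>: "!!s. \<bar>\<sigma> s\<bar> <= 1" and P: "P \<subseteq> {..<n - 2}" "P \<inter> U n w \<nu> = {}" and v: "v \<in> W"
 shows "\<bar>\<Sum>s\<in>Pow P. \<sigma> s * blinfun_apply (xs n (w - P \<union> s) \<nu>) v\<bar> * lam n (2 ^ (card P + card (U n w \<nu>))) <=
  256 * 2 ^ card P * lam n (2 ^ card (U n w \<nu>)) * norm v"
proof -
 define V where "V = U n w \<nu>"
 have V: "V \<subseteq> {..<n - 2}" "finite V" "P \<inter> V = {}" using U_subset P by (auto simp: V_def)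
 have finP: "finite P" using P(1) finite_subset by auto
 let ?F = "(%r. w - (P \<union> V) \<union> r) ` Pow (P \<union> V)"
 let ?c = "%v. \<sigma> (v \<inter> P) * chi (w - P \<union> (v \<inter> P)) (v \<inter> V)"
 let ?S = "\<Sum>u\<in>?F. ?c u * blinfun_apply (ds n u \<nu>) v"
 have e: "(\<Sum>s\<in>Pow P. \<sigma> s * blinfun_apply (xs n (w - P \<union> s) \<nu>) v) = lam n (2 ^ card V) / 2 ^ card V * ?S"
  unfolding xs_line[OF P(1) V_def, unfolded real_scaleR_def] sum_line_outside[OF V(3), of \<sigma> w "%u. blinfun_apply (ds n u \<nu>) v", unfolded real_scaleR_def] ..
 have "\<bar>?S\<bar> * lam n (card ?F) <= 1 * (256 * real (card ?F) * norm v)"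
 proof (rule ds_upper[OF n _ _ v])
  show "?F \<subseteq> Pow {..<n}" using w V P(1) by force
  show "\<bar>?c v\<bar> <= 1" for v unfolding abs_mult using \<sigma> by simp
 qed simp
 moreover have "card ?F = 2 ^ (card P + card V)"
  using V finP by (simp add: card_translates card_Un_disjoint)
 ultimately have S: "\<bar>?S\<bar> * lam n (2 ^ (card P + card V)) <= 256 * (2 ^ card P * 2 ^ card V) * norm v"
  by (simp add: power_add)
 have pos: "0 < lam n (2 ^ card V)" using lamU_pos[OF n, of w \<nu>, folded V_def] .
 have "\<bar>lam n (2 ^ card V) / 2 ^ card V * ?S\<bar> * lam n (2 ^ (card P + card V)) =
   lam n (2 ^ card V) / 2 ^ card V * (\<bar>?S\<bar> * lam n (2 ^ (card P + card V)))"
  using pos by (simp add: abs_mult)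
 also have "... <= lam n (2 ^ card V) / 2 ^ card V * (256 * (2 ^ card P * 2 ^ card V) * norm v)"
  using S pos by (intro mult_left_mono) auto
 also have "... = 256 * 2 ^ card P * lam n (2 ^ card V) * norm v" by simp
 finally show ?thesis unfolding e V_def .
qed

text \<open>The Hilbert space value \<open>2 ^ h\<close>, diminished by the factor
  \<open>2 powr (- 2 * \<delta> * real h)\<close>.\<close>

definition decay :: "nat => real" where "decay h = 2 powr (2 * real h * (1 / 2 - \<delta>))"

lemma decay_pos: "0 < decay h" by (simp add: decay_def)

definition x_bound :: "nat => real" where "x_bound h = (if ty then 8 * 2 ^ h else 32 * C * decay h)"

definition xs_bound :: "nat => real" where "xs_bound h = (if ty then 256 * C * decay h else 256 * 2 ^ h)"

text \<open>To be compared with the \<open>2 ^ (2 * h)\<close> points of a line: in either case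
  exactly one of the two factors carries the gain.\<close>

lemma bounds_product: "x_bound h * xs_bound h <= 8192 * C * (2 ^ (2 * h) * 2 powr (- 2 * \<delta> * real h))"
proof -
 have "2 ^ h * decay h = 2 powr real h * 2 powr (real h * (1 - 2 * \<delta>))"
  by (simp add: decay_def powr_realpow algebra_simps)
 also have "... = 2 powr (2 * real h) * 2 powr (- 2 * \<delta> * real h)"
  unfolding powr_add[symmetric] by (simp add: algebra_simps)
 also have "2 powr (2 * real h) = 2 ^ (2 * h)" using powr_realpow[of 2 "2 * h"] by simp
 finally have e: "2 ^ h * decay h = 2 ^ (2 * h) * 2 powr (- 2 * \<delta> * real h)" .
 have "x_bound h * xs_bound h = (if ty then 2048 else 8192) * C * (2 ^ h * decay h)"
  by (simp add: x_bound_def xs_bound_def)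
 also have "... <= 8192 * C * (2 ^ h * decay h)"
  using C decay_pos[of h] by (intro mult_right_mono) auto
 finally show ?thesis unfolding e .
qed

text \<open>For type the own axis is outside \<open>U\<close> and completes it to all
  \<open>n - 2\<close> positions; fast growth of \<open>lam\<close> makes the functionals small. For
  cotype the own axis is \<open>U\<close>, and the bent function gives \<open>2 ^ h\<close>.\<close>

lemma xs_own_bound:
 fixes \<nu> :: "bool \<times> bool"
 assumes n: "2 <= n" and w: "w \<subseteq> {..<n}" and v: "v \<in> W"
 defines "h \<equiv> axis_size n" and "c \<equiv> axis_class n w \<nu>"
 shows "\<bar>\<Sum>s\<in>Pow (axis h c). (bent (axis_even h c) s * chi s a) * blinfun_apply (xs n (w - axis h c \<union> s) \<nu>) v\<bar> <= xs_bound h * norm v"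
proof -
 define P where "P = axis h c"
 have own: "own_axis n w \<nu> = P" by (simp add: own_axis_def P_def h_def c_def)
 have c32: "c < 32" unfolding c_def by (rule axis_class_less)
 have Psub: "P \<subseteq> {..<n - 2}" using own_axis_subset own by blast
 have cardP: "card P = 2 * h" unfolding P_def by (rule axis_props(5)[OF c32])
 show ?thesis
 proof (cases ty)
  case True
  have U: "U n w \<nu> = {..<n - 2} - P" unfolding U_def using True own by simp
  have cardU: "card (U n w \<nu>) = n - 2 - 2 * h" unfolding U using Psub cardP by (subst card_Diff_subset) (auto intro: finite_subset)
  have le: "2 * h <= n - 2" using card_mono[OF _ Psub] cardP by simp
  let ?S = "\<bar>\<Sum>s\<in>Pow P. (bent (axis_even h c) s * chi s a) * blinfun_apply (xs n (w - P \<union> s) \<nu>) v\<bar>"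
  have "?S * lam n (2 ^ (card P + card (U n w \<nu>))) <= 256 * 2 ^ card P * lam n (2 ^ card (U n w \<nu>)) * norm v"
   by (rule xs_line_outside[OF n w _ Psub _ v]) (auto simp: abs_mult U)
  then have S: "?S * lam n (2 ^ (n - 2)) <= 256 * 2 ^ (2 * h) * lam n (2 ^ (n - 2 - 2 * h)) * norm v"
   using le_add_diff_inverse[OF le] by (simp add: cardP cardU)
  have t: "2 powr (2 * real h * (1 / 2 + \<delta>)) * lam n (2 ^ (n - 2 - 2 * h)) <= C * lam n (2 ^ (n - 2))"
   using rates[OF n] True by (simp add: type_rates_def lam_def h_def)
  have pp: "2 powr (2 * real h * (1 / 2 + \<delta>)) * decay h = 2 ^ (2 * h)"
   using powr_realpow[of 2 "2 * h"] unfolding decay_def powr_add[symmetric] by (simp add: algebra_simps)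
  have pos: "0 < lam n (2 ^ (n - 2))" by (intro lam_pos[OF n] power_increasing) auto
  have "2 ^ (2 * h) * lam n (2 ^ (n - 2 - 2 * h)) = decay h * (2 powr (2 * real h * (1 / 2 + \<delta>)) * lam n (2 ^ (n - 2 - 2 * h)))"
   using pp by (simp add: mult_ac)
  also have "... <= decay h * (C * lam n (2 ^ (n - 2)))" using t decay_pos[of h] by (intro mult_left_mono) auto
  finally have "256 * 2 ^ (2 * h) * lam n (2 ^ (n - 2 - 2 * h)) * norm v <= 256 * (decay h * (C * lam n (2 ^ (n - 2)))) * norm v"
   by (simp add: mult_right_mono)
  then have "?S * lam n (2 ^ (n - 2)) <= (256 * C * decay h * norm v) * lam n (2 ^ (n - 2))" using S by (simp add: mult_ac)
  then show ?thesis using pos True unfolding P_def xs_bound_def by simp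
 next
  case False
  have "U n w \<nu> = P" unfolding U_def using False own by simp
  then show ?thesis using xs_line_inside[OF n w c32 refl _ v, of h \<nu> a] False unfolding P_def xs_bound_def by simp
 qed
qed

text \<open>An axis of another class is disjoint from the own axis of \<open>u\<close>, so it lies
  inside \<open>U\<close> for type and outside for cotype. As \<open>h\<close> belongs to level
  \<open>n + 1\<close> and \<open>k\<close> to the level \<open>l\<close> of the vector, they may
  differ by one, which costs constant factors.\<close>

lemma x_other_bound:
 assumes n: "2 <= n" and l: "n <= l" "l <= n + 2" and u: "u \<subseteq> {..<l}" and c: "c < 32" "c ~= axis_class l u \<nu>"
 defines "h \<equiv> axis_size (Suc n)"
 shows "norm (\<Sum>s\<in>Pow (axis h c). (bent (axis_even h c) s * chi s a) *\<^sub>R x l (u - axis h c \<union> s) \<nu>) <= x_bound h"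
proof -
 define P where "P = axis h c"
 have Psub: "P \<subseteq> {..<l - 2}"
  using axis_props(6)[OF c(1), of h] axis_size_less(2)[of n] l unfolding P_def h_def by force
 have disj: "P \<inter> own_axis l u \<nu> = {}"
  unfolding P_def own_axis_def using c axis_class_less by (intro axis_props(7)) auto
 have l2: "2 <= l" using n l by simp
 show ?thesis
 proof (cases ty)
  case True
  have "P \<subseteq> U l u \<nu>" unfolding U_def using True Psub disj by auto
  then show ?thesis using x_line_inside[OF l2 u c(1) refl, of h \<nu> a] True unfolding P_def x_bound_def by simp
 next
  case False
  define k where "k = axis_size l"
  have U: "U l u \<nu> = own_axis l u \<nu>" unfolding U_def using False by simp
  have cards: "card P = 2 * h" "card (U l u \<nu>) = 2 * k"
   unfolding U P_def own_axis_def k_def using axis_props(5) c axis_class_less by auto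
  have hk: "h <= k + 1" "k <= h + 1" using l unfolding h_def k_def axis_size_def by auto
  have k4: "4 * k + 2 <= l + 2" using l2 unfolding k_def axis_size_def by auto
  have r: "lam l (2 ^ (4 * k + 2)) <= C * decay k * lam l (2 ^ (2 * k))"
   using rates[OF l2] False by (simp add: cotype_rates_def lam_def k_def decay_def)
  have "lam l (2 ^ (2 * h + 2 * k)) <= 2 * lam l (2 ^ (4 * k + 2))"
   unfolding lam_def
  proof (rule flat_mono[OF spr(1)[OF l2]])
   show "(2::nat) ^ (2 * h + 2 * k) <= 2 ^ (4 * k + 2)" using hk by (intro power_increasing) auto
   show "(2::nat) ^ (4 * k + 2) <= 2 ^ (l + 2)" using k4 by (intro power_increasing) auto
  qed
  then have up: "lam l (2 ^ (2 * h + 2 * k)) <= 2 * C * decay k * lam l (2 ^ (2 * k))" using r by simp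
  have "decay k <= 2 powr (2 * real (h + 1) * (1 / 2 - \<delta>))"
   unfolding decay_def using hk \<delta> by (intro powr_mono mult_right_mono) auto
  also have "... = decay h * 2 powr (1 - 2 * \<delta>)"
   unfolding decay_def powr_add[symmetric] by (simp add: algebra_simps)
  also have "... <= decay h * 2" using decay_pos[of h] \<delta> powr_mono[of "1 - 2 * \<delta>" 1 2] by (intro mult_left_mono) auto
  finally have dk: "decay k <= decay h * 2" .
  have pos: "0 < lam l (2 ^ (2 * k))" using lamU_pos[OF l2, of u \<nu>] cards by simp
  have "norm (\<Sum>s\<in>Pow P. (bent (axis_even h c) s * chi s a) *\<^sub>R x l (u - P \<union> s) \<nu>) <=
    8 * lam l (2 ^ (card P + card (U l u \<nu>))) / lam l (2 ^ card (U l u \<nu>))"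
   using disj U by (intro x_line_outside[OF l2 u _ Psub]) (auto simp: abs_mult)
  also have "... = 8 * lam l (2 ^ (2 * h + 2 * k)) / lam l (2 ^ (2 * k))" by (simp add: cards)
  also have "... <= 16 * C * decay k" using up pos by (simp add: divide_le_eq)
  also have "... <= 32 * C * decay h" using dk C by simp
  finally show ?thesis using False unfolding P_def x_bound_def by simp
 qed
qed

lemma norm_x:
 assumes n: "2 <= n" and w: "w \<subseteq> {..<n}" shows "norm (x n w \<nu>) <= 8"
proof -
 \<comment> \<open>A single vector is the sum over the line without positions.\<close>
 have "norm (\<Sum>s\<in>Pow {}. (%_. 1) s *\<^sub>R x n (w - {} \<union> s) \<nu>) <= 8 * lam n (2 ^ (card ({} :: nat set) + card (U n w \<nu>))) / lam n (2 ^ card (U n w \<nu>))"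
  by (rule x_line_outside[OF n w, where \<sigma> = "%_. 1"]) auto
 then show ?thesis using lamU_pos[OF n, of w \<nu>] by simp
qed

lemma abs_xs:
 assumes n: "2 <= n" and w: "w \<subseteq> {..<n}" and v: "v \<in> W" shows "\<bar>blinfun_apply (xs n w \<nu>) v\<bar> <= 256 * norm v"
proof -
 have "\<bar>\<Sum>s\<in>Pow {}. (%_. 1) s * blinfun_apply (xs n (w - {} \<union> s) \<nu>) v\<bar> * lam n (2 ^ (card ({} :: nat set) + card (U n w \<nu>))) <=
   256 * 2 ^ card ({} :: nat set) * lam n (2 ^ card (U n w \<nu>)) * norm v"
  by (rule xs_line_outside[OF n w _ _ _ v, where \<sigma> = "%_. 1"]) auto
 then show ?thesis using lamU_pos[OF n, of w \<nu>] by simp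
qed

end

text \<open>All points of a line have the same \<open>P\<close>, so exchanging \<open>s\<close> with
  the part of \<open>w\<close> in \<open>P w\<close> is an involution of the pairs.\<close>

lemma sum_over_lines:
 fixes f :: "nat set => real"
 assumes A: "finite A" and P: "!!w. w \<subseteq> A ==> P w \<subseteq> A"
  and line: "!!w s. w \<subseteq> A ==> s \<subseteq> P w ==> P (w - P w \<union> s) = P w" and card: "!!w. w \<subseteq> A ==> card (P w) = k"
 shows "(\<Sum>w\<in>Pow A. \<Sum>s\<in>Pow (P w). f (w - P w \<union> s)) = 2 ^ k * (\<Sum>w\<in>Pow A. f w)"
proof -
 let ?S = "Sigma (Pow A) (%w. Pow (P w))"
 let ?g = "%(w, s). (w - P w \<union> s, w \<inter> P w)"
 have fin: "finite (P w)" if "w \<subseteq> A" for w using P[OF that] A finite_subset by blast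
 have "(\<Sum>w\<in>Pow A. \<Sum>s\<in>Pow (P w). f (w - P w \<union> s)) = (\<Sum>(w, s)\<in>?S. f (w - P w \<union> s))"
  using A fin by (intro sum.Sigma) auto
 also have "... = (\<Sum>(w, s)\<in>?S. f w)"
 proof (rule sum.reindex_bij_witness[of _ ?g ?g])
  fix y assume "y \<in> ?S"
  then obtain w s where y: "y = (w, s)" and ws: "w \<subseteq> A" "s \<subseteq> P w" by auto
  have e: "P (w - P w \<union> s) = P w" using line ws .
  show "?g (?g y) = y" "?g (?g y) = y" unfolding y prod.case e using ws by auto
  show "?g y \<in> ?S" "?g y \<in> ?S" unfolding y prod.case using e ws P[OF ws(1)] by auto
  show "(case ?g y of (w, s) => f w) = (case y of (w, s) => f (w - P w \<union> s))" unfolding y prod.case ..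
 qed
 also have "... = (\<Sum>w\<in>Pow A. \<Sum>s\<in>Pow (P w). f w)"
  using A fin by (intro sum.Sigma[symmetric]) auto
 also have "... = (\<Sum>w\<in>Pow A. 2 ^ k * f w)"
  using card fin by (intro sum.cong refl) (simp add: card_Pow)
 finally show ?thesis by (simp add: sum_distrib_left)
qed

text \<open>Summing over \<open>a\<close> selects the diagonal by orthogonality, and there the bent
  signs square to 1. A diagonal sum becomes an average of forms in which both arguments are summed
  separately with signs of flat spectrum.\<close>

lemma bent_decoupling:
 fixes F :: "nat set => nat set => real"
 assumes c: "c < 32"
 shows "(\<Sum>a\<in>Pow (axis h c). \<Sum>s\<in>Pow (axis h c). \<Sum>s'\<in>Pow (axis h c).
   (bent (axis_even h c) s * chi s a) * (bent (axis_even h c) s' * chi s' a) * F s s') =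
  2 ^ (2 * h) * (\<Sum>s\<in>Pow (axis h c). F s s)"
proof -
 let ?P = "axis h c" and ?b = "bent (axis_even h c)"
 have fin: "finite ?P" using axis_props(4)[OF c] .
 have "(\<Sum>a\<in>Pow ?P. \<Sum>s\<in>Pow ?P. \<Sum>s'\<in>Pow ?P. (?b s * chi s a) * (?b s' * chi s' a) * F s s') =
   (\<Sum>s\<in>Pow ?P. \<Sum>a\<in>Pow ?P. \<Sum>s'\<in>Pow ?P. (?b s * chi s a) * (?b s' * chi s' a) * F s s')" by (rule sum.swap)
 also have "... = (\<Sum>s\<in>Pow ?P. \<Sum>s'\<in>Pow ?P. \<Sum>a\<in>Pow ?P. (?b s * chi s a) * (?b s' * chi s' a) * F s s')"
  by (intro sum.cong refl sum.swap)
 also have "... = (\<Sum>s\<in>Pow ?P. \<Sum>s'\<in>Pow ?P. if s' = s then 2 ^ (2 * h) * F s s else 0)"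
 proof (intro sum.cong refl)
  fix s s' assume s: "s \<in> Pow ?P" "s' \<in> Pow ?P"
  have "(\<Sum>a\<in>Pow ?P. (?b s * chi s a) * (?b s' * chi s' a) * F s s') = ?b s * ?b s' * F s s' * (\<Sum>a\<in>Pow ?P. chi a s * chi a s')"
   unfolding sum_distrib_left
  proof (rule sum.cong[OF refl])
   fix a assume "a \<in> Pow ?P"
   then have "finite a" "finite s" "finite s'" using s fin finite_subset by auto
   then show "(?b s * chi s a) * (?b s' * chi s' a) * F s s' = ?b s * ?b s' * F s s' * (chi a s * chi a s')"
    by (simp add: chi_commute[of a])
  qed
  also have "... = (if s' = s then 2 ^ (2 * h) * F s s else 0)"
   using chi_orthogonal[OF fin, of s s'] s axis_props(5)[OF c, of h] by auto
  finally show "(\<Sum>a\<in>Pow ?P. (?b s * chi s a) * (?b s' * chi s' a) * F s s') = (if s' = s then 2 ^ (2 * h) * F s s else 0)" .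
 qed
 also have "... = (\<Sum>s\<in>Pow ?P. 2 ^ (2 * h) * F s s)" using fin by (intro sum.cong refl) simp
 finally show ?thesis by (simp add: sum_distrib_left)
qed

text \<open>Linearity on a set, without a bound: the operators tested later are defined only on
  spans of finitely many levels.\<close>

definition lin_on :: "'a::real_vector set => ('a => 'b::real_vector) => bool" where
 "lin_on S R \<longleftrightarrow> (\<forall>x\<in>S. \<forall>y\<in>S. R (x + y) = R x + R y) \<and> (\<forall>c. \<forall>x\<in>S. R (c *\<^sub>R x) = c *\<^sub>R R x)"

lemma lin_on_0: "lin_on S R ==> subspace S ==> R 0 = 0"
 unfolding lin_on_def by (metis scaleR_zero_left subspace_0)

lemma lin_on_sum:
 assumes R: "lin_on S R" and S: "subspace S" and f: "!!i. i \<in> I ==> f i \<in> S"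
 shows "R (\<Sum>i\<in>I. c i *\<^sub>R f i) = (\<Sum>i\<in>I. c i *\<^sub>R R (f i))"
proof (cases "finite I")
 case True
 then show ?thesis using f
 proof (induction I rule: finite_induct)
  case empty then show ?case using lin_on_0[OF R S] by simp
 next
  case (insert i I)
  have "(\<Sum>i\<in>I. c i *\<^sub>R f i) \<in> S" using S insert.prems by (intro subspace_sum subspace_scale) auto
  moreover have "c i *\<^sub>R f i \<in> S" using S insert.prems by (intro subspace_scale) auto
  ultimately show ?case using insert R unfolding lin_on_def by simp
 qed
next
 case False
 then show ?thesis using lin_on_0[OF R S] by simp
qed

lemma lin_on_subset: "lin_on S R ==> T \<subseteq> S ==> lin_on T R"
 unfolding lin_on_def by blast

lemma blinfun_eq_on_closure_span:
 fixes f g :: "'a::real_normed_vector \<Rightarrow>\<^sub>L 'b::real_normed_vector"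
 assumes "!!v. v \<in> B ==> blinfun_apply f v = blinfun_apply g v" "v \<in> closure (span B)"
 shows "blinfun_apply f v = blinfun_apply g v"
proof -
 have "blinfun_apply (f - g) v = 0"
 proof (rule continuous_constant_on_closure[of "span B" "blinfun_apply (f - g)" 0, OF _ _ assms(2)])
  show "continuous_on (closure (span B)) (blinfun_apply (f - g))"
   by (intro linear_continuous_on blinfun.bounded_linear_right)
  show "blinfun_apply (f - g) x = 0" if "x \<in> span B" for x
  proof (rule linear_eq_0_on_span[OF _ _ that])
   show "linear (blinfun_apply (f - g))" by (intro bounded_linear.linear blinfun.bounded_linear_right)
   show "blinfun_apply (f - g) y = 0" if "y \<in> B" for y using assms(1)[OF that] by (simp add: blinfun.diff_left)
  qed
 qed
 then show ?thesis by (simp add: blinfun.diff_left)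
qed

section \<open>Vectors spanning the subspaces and their functionals on two levels\<close>

context szankowski
begin

text \<open>The functional biorthogonal to \<open>z n w\<close> can be computed on level \<open>n + 1\<close>, as \<open>zs\<close>, with a free
 choice of the second copy bit, and on level \<open>n + 2\<close>, as \<open>zs'\<close>, with a free choice of the first.\<close>

definition z :: "nat => nat set => bool => 'a" where
 "z n w \<xi> = (\<Sum>b\<in>UNIV. x (n + 1) w (\<xi>, b) - x (n + 1) (insert n w) (\<xi>, b)) +
  (\<Sum>a\<in>UNIV. \<Sum>c\<in>Pow {n, n + 1}. x (n + 2) (w \<union> c) (a, \<xi>))"

definition zs :: "nat => nat set => bool => bool => 'a \<Rightarrow>\<^sub>L real" where
 "zs n w \<xi> b = (1 / 2) *\<^sub>R (xs (n + 1) w (\<xi>, b) - xs (n + 1) (insert n w) (\<xi>, b))"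

definition zs' :: "nat => nat set => bool => bool => 'a \<Rightarrow>\<^sub>L real" where
 "zs' n w \<xi> a = (1 / 4) *\<^sub>R (\<Sum>c\<in>Pow {n, n + 1}. xs (n + 2) (w \<union> c) (a, \<xi>))"

definition ZZ :: "'a set" where
 "ZZ = closure (span {z m w \<xi> | m w \<xi>. 1 <= m \<and> w \<subseteq> {..<m}})"

text \<open>The levels of the two summands of \<open>z\<close> differ, so at most one of the two
  terms on the right is present.\<close>

lemma xs_z:
 assumes N: "2 <= N" "1 <= m" and w: "w \<subseteq> {..<N}" "w' \<subseteq> {..<m}"
 shows "blinfun_apply (xs N w (a, b)) (z m w' \<xi>) =
  (if N = m + 1 \<and> a = \<xi> then of_bool (w = w') - of_bool (w = insert m w') else 0) +
  (if N = m + 2 \<and> b = \<xi> \<and> w \<inter> {..<m} = w' then 1 else 0)"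
proof -
 have s: "w' \<subseteq> {..<m + 1}" "insert m w' \<subseteq> {..<m + 1}" using w(2) by auto
 have m: "2 <= m + 1" "2 <= m + 2" using N by auto
 have 1: "blinfun_apply (xs N w (a, b)) (\<Sum>b'\<in>UNIV. x (m + 1) w' (\<xi>, b') - x (m + 1) (insert m w') (\<xi>, b')) =
   (if N = m + 1 \<and> a = \<xi> then of_bool (w = w') - of_bool (w = insert m w') else 0)"
  unfolding blinfun.sum_right blinfun.diff_right xs_x[OF N(1) m(1) w(1) s(1)] xs_x[OF N(1) m(1) w(1) s(2)] UNIV_bool
  by (cases b) auto
 have "blinfun_apply (xs N w (a, b)) (\<Sum>a'\<in>UNIV. \<Sum>c\<in>Pow {m, m + 1}. x (m + 2) (w' \<union> c) (a', \<xi>)) =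
   (\<Sum>a'\<in>UNIV. \<Sum>c\<in>Pow {m, m + 1}. if a' = a \<and> c = w \<inter> {m, m + 1} then
     (if N = m + 2 \<and> b = \<xi> \<and> w \<inter> {..<m} = w' then 1 else 0) else 0)"
  unfolding blinfun.sum_right
 proof (intro sum.cong refl)
  fix a' c assume c: "c \<in> Pow {m, m + 1}"
  then have sub: "w' \<union> c \<subseteq> {..<m + 2}" using w(2) by auto
  have "w = w' \<union> c \<longleftrightarrow> c = w \<inter> {m, m + 1} \<and> w \<inter> {..<m} = w'" if "N = m + 2"
  proof
   assume e: "w = w' \<union> c"
   have "w' \<inter> {m, m + 1} = {}" using w(2) by auto
   moreover have "c \<inter> {..<m} = {}" using c by auto
   ultimately show "c = w \<inter> {m, m + 1} \<and> w \<inter> {..<m} = w'" using e c w(2) by blast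
  next
   assume e: "c = w \<inter> {m, m + 1} \<and> w \<inter> {..<m} = w'"
   have "{..<m + 2} = {..<m} \<union> {m, m + 1}" by auto
   then show "w = w' \<union> c" using e w(1) that by blast
  qed
  then show "blinfun_apply (xs N w (a, b)) (x (m + 2) (w' \<union> c) (a', \<xi>)) =
    (if a' = a \<and> c = w \<inter> {m, m + 1} then (if N = m + 2 \<and> b = \<xi> \<and> w \<inter> {..<m} = w' then 1 else 0) else 0)"
   unfolding xs_x[OF N(1) m(2) w(1) sub] by auto
 qed
 also have "... = (\<Sum>a'\<in>UNIV. if a' = a then (if N = m + 2 \<and> b = \<xi> \<and> w \<inter> {..<m} = w' then 1 else 0) else 0)"
 proof (rule sum.cong[OF refl])
  fix a' :: bool
  have "(\<Sum>c\<in>Pow {m, m + 1}. if c = w \<inter> {m, m + 1} then r else 0) = r" for r :: real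
   by (subst sum.delta) auto
  then show "(\<Sum>c\<in>Pow {m, m + 1}. if a' = a \<and> c = w \<inter> {m, m + 1} then
    (if N = m + 2 \<and> b = \<xi> \<and> w \<inter> {..<m} = w' then 1 else 0) else 0) =
    (if a' = a then (if N = m + 2 \<and> b = \<xi> \<and> w \<inter> {..<m} = w' then 1 else 0) else (0 :: real))"
   by (cases "a' = a") simp_all
 qed
 also have "... = (if N = m + 2 \<and> b = \<xi> \<and> w \<inter> {..<m} = w' then 1 else 0)" by simp
 finally show ?thesis unfolding z_def blinfun.add_right 1 by simp
qed

text \<open>For equal levels the two signs add up to 2. For \<open>n = m + 1\<close> the two
  functionals see the same value, because \<open>w\<close> and \<open>insert n w\<close> agree below
  \<open>m\<close>, and it cancels.\<close>

lemma zs_z: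
 assumes n: "1 <= n" "1 <= m" and w: "w \<subseteq> {..<n}" "w' \<subseteq> {..<m}"
 shows "blinfun_apply (zs n w \<xi> b) (z m w' \<xi>') = (if n = m \<and> w = w' \<and> \<xi> = \<xi>' then 1 else 0)"
proof -
 have s: "w \<subseteq> {..<n + 1}" "insert n w \<subseteq> {..<n + 1}" and n2: "2 <= n + 1" using w(1) n by auto
 have nw: "n \<notin> w" using w by auto
 have "insert n w \<inter> {..<m} = w \<inter> {..<m}" if "n + 1 = m + 2" using that by auto
 moreover have "insert n w = insert m w' \<longleftrightarrow> w = w'" "w ~= insert m w'" "insert n w ~= w'" if "n = m"
  using that w nw by auto
 ultimately show ?thesis
  unfolding zs_def blinfun.scaleR_left blinfun.diff_left xs_z[OF n2 n(2) s(1) w(2)] xs_z[OF n2 n(2) s(2) w(2)]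
  by (cases "n = m"; cases "\<xi> = \<xi>'"; cases "w = w'") auto
qed

lemma zs'_apply:
 assumes "w \<subseteq> {..<n}"
 shows "blinfun_apply (zs' n w \<xi> a) v = (blinfun_apply (xs (n + 2) w (a, \<xi>)) v + blinfun_apply (xs (n + 2) (w \<union> {n}) (a, \<xi>)) v +
   blinfun_apply (xs (n + 2) (w \<union> {n + 1}) (a, \<xi>)) v + blinfun_apply (xs (n + 2) (w \<union> {n, n + 1}) (a, \<xi>)) v) / 4"
proof -
 have Pow: "Pow {n, n + 1} = {{}, {n}, {n + 1}, {n, n + 1}}" by (auto simp: Pow_insert)
 show ?thesis unfolding zs'_def blinfun.scaleR_left blinfun.sum_left Pow by (simp add: doubleton_eq_iff)
qed

lemma zs'_z:
 assumes n: "1 <= n" "1 <= m" and w: "w \<subseteq> {..<n}" "w' \<subseteq> {..<m}"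
 shows "blinfun_apply (zs' n w \<xi> a) (z m w' \<xi>') = (if n = m \<and> w = w' \<and> \<xi> = \<xi>' then 1 else 0)"
proof -
 have n2: "2 <= n + 2" by simp
 have s: "w \<subseteq> {..<n + 2}" "w \<union> {n} \<subseteq> {..<n + 2}" "w \<union> {n + 1} \<subseteq> {..<n + 2}" "w \<union> {n, n + 1} \<subseteq> {..<n + 2}"
  using w(1) by auto
 have nw: "n \<notin> w" "n + 1 \<notin> w" using w by auto
 note eq = zs'_apply[OF w(1), of \<xi> a]
 consider "n + 1 = m" | "n = m" | "n ~= m" "n + 1 ~= m" by blast
 then show ?thesis
 proof cases
  \<comment> \<open>Level \<open>n + 2\<close> is now the first level of \<open>z m\<close>. Adding
    the element \<open>m = n + 1\<close> reverses the sign there, so the four contributions cancel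
    in pairs.\<close>
  case 1
  have mw: "m \<notin> w'" "n + 1 = m" using w 1 by auto
  have mm: "m \<notin> w" "m \<notin> w \<union> {n}" "n + 1 \<notin> w'" using nw mw by auto
  then have ne: "w ~= insert m w'" "w \<union> {n} ~= insert m w'" "w \<union> {n + 1} ~= w'" "w \<union> {n, n + 1} ~= w'"
   by blast+
  have e: "w \<union> {n + 1} = insert m w" "w \<union> {n, n + 1} = insert m (w \<union> {n})" using mw by auto
  have "w \<union> {n + 1} = insert m w' \<longleftrightarrow> w = w'" "w \<union> {n, n + 1} = insert m w' \<longleftrightarrow> w \<union> {n} = w'"
   unfolding e using insert_ident[of m w w'] insert_ident[of m "w \<union> {n}" w'] mm mw by blast+
  then show ?thesis
   unfolding eq xs_z[OF n2 n(2) s(1) w(2)] xs_z[OF n2 n(2) s(2) w(2)] xs_z[OF n2 n(2) s(3) w(2)] xs_z[OF n2 n(2) s(4) w(2)]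
   using 1 ne by auto
 next
  case 2
  have "w \<inter> {..<m} = w" "(w \<union> {n}) \<inter> {..<m} = w" "(w \<union> {n + 1}) \<inter> {..<m} = w" "(w \<union> {n, n + 1}) \<inter> {..<m} = w"
   using w 2 by auto
  then show ?thesis
   unfolding eq xs_z[OF n2 n(2) s(1) w(2)] xs_z[OF n2 n(2) s(2) w(2)] xs_z[OF n2 n(2) s(3) w(2)] xs_z[OF n2 n(2) s(4) w(2)]
   using 2 by auto
 next
  case 3
  then show ?thesis
   unfolding eq xs_z[OF n2 n(2) s(1) w(2)] xs_z[OF n2 n(2) s(2) w(2)] xs_z[OF n2 n(2) s(3) w(2)] xs_z[OF n2 n(2) s(4) w(2)]
   by auto
 qed
qed

text \<open>The functionals agree on the spanning vectors of \<open>ZZ\<close>, hence on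
  \<open>ZZ\<close>; outside they are different. This is why the images of operators are required to
  lie in \<open>ZZ\<close>.\<close>

lemma zs_eq:
 assumes n: "1 <= n" "w \<subseteq> {..<n}" and v: "v \<in> ZZ"
 shows "blinfun_apply (zs n w \<xi> b) v = blinfun_apply (zs n w \<xi> b') v"
  "blinfun_apply (zs' n w \<xi> a) v = blinfun_apply (zs n w \<xi> b) v"
proof -
 show "blinfun_apply (zs n w \<xi> b) v = blinfun_apply (zs n w \<xi> b') v"
 proof (rule blinfun_eq_on_closure_span[OF _ v[unfolded ZZ_def]])
  fix y assume "y \<in> {z m w \<xi> |m w \<xi>. 1 <= m \<and> w \<subseteq> {..<m}}"
  then obtain m w' \<xi>' where y: "y = z m w' \<xi>'" "1 <= m" "w' \<subseteq> {..<m}" by blast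
  show "blinfun_apply (zs n w \<xi> b) y = blinfun_apply (zs n w \<xi> b') y"
   unfolding y(1) zs_z[OF n(1) y(2) n(2) y(3)] ..
 qed
 show "blinfun_apply (zs' n w \<xi> a) v = blinfun_apply (zs n w \<xi> b) v"
 proof (rule blinfun_eq_on_closure_span[OF _ v[unfolded ZZ_def]])
  fix y assume "y \<in> {z m w \<xi> |m w \<xi>. 1 <= m \<and> w \<subseteq> {..<m}}"
  then obtain m w' \<xi>' where y: "y = z m w' \<xi>'" "1 <= m" "w' \<subseteq> {..<m}" by blast
  show "blinfun_apply (zs' n w \<xi> a) y = blinfun_apply (zs n w \<xi> b) y"
   unfolding y(1) zs_z[OF n(1) y(2) n(2) y(3)] zs'_z[OF n(1) y(2) n(2) y(3)] ..
 qed
qed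

lemma x_in_W: "2 <= n ==> w \<subseteq> {..<n} ==> x n w \<nu> \<in> span {e m i | m i. 2 <= m \<and> i < 2 ^ (m + 2)}"
proof -
 assume n: "2 <= n" and w: "w \<subseteq> {..<n}"
 have "d n (w - U n w \<nu> \<union> i) \<nu> \<in> {e m i | m i. 2 <= m \<and> i < 2 ^ (m + 2)}" if "i \<subseteq> U n w \<nu>" for i
 proof -
  have "w - U n w \<nu> \<union> i \<subseteq> {..<n}" using w that U_subset[of n w \<nu>] by force
  then show ?thesis unfolding d_def using idx_less n by blast
 qed
 then show ?thesis unfolding x_def by (intro span_scale span_sum) (auto intro: span_base)
qed

lemma z_in_span: "1 <= n ==> w \<subseteq> {..<n} ==> z n w \<xi> \<in> span {e m i | m i. 2 <= m \<and> i < 2 ^ (m + 2)}"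
 unfolding z_def by (intro span_add span_sum span_diff x_in_W) force+

lemma ZZ_subset: "ZZ \<subseteq> W"
proof -
 have "{z m w \<xi> | m w \<xi>. 1 <= m \<and> w \<subseteq> {..<m}} \<subseteq> span {e m i | m i. 2 <= m \<and> i < 2 ^ (m + 2)}"
  using z_in_span by blast
 then have "span {z m w \<xi> | m w \<xi>. 1 <= m \<and> w \<subseteq> {..<m}} \<subseteq> span {e m i | m i. 2 <= m \<and> i < 2 ^ (m + 2)}"
  by (simp add: span_minimal)
 then show ?thesis unfolding ZZ_def W_def by (rule closure_mono)
qed

lemma norm_z:
 assumes "1 <= n" "w \<subseteq> {..<n}" shows "norm (z n w \<xi>) <= 96"
proof -
 have b: "norm (x (n + 1) w \<nu>) <= 8" "norm (x (n + 1) (insert n w) \<nu>) <= 8" for \<nu>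
  using assms by (auto intro!: norm_x)
 have c: "norm (x (n + 2) (w \<union> c) \<nu>) <= 8" if "c \<in> Pow {n, n + 1}" for c \<nu> using that assms by (intro norm_x) auto
 have "norm (\<Sum>b\<in>UNIV. x (n + 1) w (\<xi>, b) - x (n + 1) (insert n w) (\<xi>, b)) <= (\<Sum>b\<in>(UNIV::bool set). 16)"
 proof (rule sum_norm_le)
  fix b
  show "norm (x (n + 1) w (\<xi>, b) - x (n + 1) (insert n w) (\<xi>, b)) <= 16"
   using norm_triangle_ineq4[of "x (n + 1) w (\<xi>, b)" "x (n + 1) (insert n w) (\<xi>, b)"] b[of "(\<xi>, b)"] by linarith
 qed
 moreover have "norm (\<Sum>a\<in>UNIV. \<Sum>c\<in>Pow {n, n + 1}. x (n + 2) (w \<union> c) (a, \<xi>)) <= (\<Sum>a\<in>(UNIV::bool set). \<Sum>c\<in>Pow {n, n + 1}. 8)"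
  using c by (intro sum_norm_le) auto
 ultimately show ?thesis unfolding z_def using norm_triangle_ineq[of "\<Sum>b\<in>UNIV. x (n + 1) w (\<xi>, b) - x (n + 1) (insert n w) (\<xi>, b)"
  "\<Sum>a\<in>UNIV. \<Sum>c\<in>Pow {n, n + 1}. x (n + 2) (w \<union> c) (a, \<xi>)"] by (simp add: card_Pow)
qed

lemma abs_zs:
 assumes "1 <= n" "w \<subseteq> {..<n}" "v \<in> W" shows "\<bar>blinfun_apply (zs n w \<xi> b) v\<bar> <= 256 * norm v"
proof -
 have "\<bar>blinfun_apply (xs (n + 1) w (\<xi>, b)) v\<bar> <= 256 * norm v"
  using assms by (intro abs_xs) auto
 moreover have "\<bar>blinfun_apply (xs (n + 1) (insert n w) (\<xi>, b)) v\<bar> <= 256 * norm v"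
  using assms by (intro abs_xs) auto
 ultimately show ?thesis by (simp add: zs_def blinfun.scaleR_left blinfun.diff_left)
qed

section \<open>Differences of consecutive traces\<close>

definition beta :: "(nat => bool) => nat => ('a => 'a) => real" where
 "beta t n R = (\<Sum>w\<in>Pow {..<n}. blinfun_apply (zs n w (t n) False) (R (z n w (t n)))) / 2 ^ n"

definition Zt :: "(nat => bool) => nat => 'a set" where
 "Zt t n = {z m w (t m) | m w. 1 <= m \<and> m <= n \<and> w \<subseteq> {..<m}}"

text \<open>The sign makes \<open>x (n + 1) w (t n, t (n - 1))\<close> occur with coefficient 1 in
  the first summand. It also occurs once in the second, so it cancels.\<close>

definition Y :: "(nat => bool) => nat => nat set => 'a" where
 "Y t n w = (if n \<in> w then - 1 else 1) *\<^sub>R z n (w \<inter> {..<n}) (t n) - z (n - 1) (w \<inter> {..<n - 1}) (t (n - 1))"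

text \<open>\<open>180224 = 22 * 8192\<close>: the number of terms in \<open>Y_line\<close> times
  the constant of \<open>bounds_product\<close>.\<close>

definition alpha :: "nat => real" where
 "alpha n = 180224 * C * 2 powr (- 2 * \<delta> * real (axis_size (n + 1)))"

lemma Y_in_span: "2 <= n ==> Y t n w \<in> span (Zt t n)"
 unfolding Y_def Zt_def by (intro span_diff span_scale span_base) force+

text \<open>Both traces are evaluated on level \<open>n + 1\<close>. With the free copy bit chosen
  as \<open>t (n - 1)\<close> in \<open>zs\<close> and as \<open>t n\<close> in \<open>zs'\<close>,
  the same functional occurs in both, whatever \<open>t\<close> is. This is the reason for having
  two copy bits.\<close>

lemma beta_diff:
 assumes n: "2 <= n" and R: "lin_on (span (Zt t n)) R" "!!y. y \<in> span (Zt t n) ==> R y \<in> ZZ"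
 shows "beta t n R - beta t (n - 1) R =
  (\<Sum>w\<in>Pow {..<n + 1}. blinfun_apply (xs (n + 1) w (t n, t (n - 1))) (R (Y t n w))) / 2 ^ (n + 1)"
proof -
 obtain m where m: "n = Suc m" "1 <= m" using n by (cases n) auto
 let ?\<nu> = "(t n, t m)"
 let ?xs = "%w v. blinfun_apply (xs (n + 1) w ?\<nu>) v"
 have zin: "z n w (t n) \<in> span (Zt t n)" if "w \<subseteq> {..<n}" for w
  unfolding Zt_def using n that by (intro span_base) force
 have zin': "z m w (t m) \<in> span (Zt t n)" if "w \<subseteq> {..<m}" for w
  unfolding Zt_def using m that by (intro span_base) force
 have RY: "?xs w (R (Y t n w)) = (if n \<in> w then - 1 else 1) * ?xs w (R (z n (w \<inter> {..<n}) (t n))) - ?xs w (R (z m (w \<inter> {..<m}) (t m)))" for w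
 proof -
  let ?c = "(if n \<in> w then - 1 else 1) :: real"
  let ?a = "z n (w \<inter> {..<n}) (t n)" and ?b = "z m (w \<inter> {..<m}) (t m)"
  have a: "?a \<in> span (Zt t n)" "?b \<in> span (Zt t n)" using zin zin' by auto
  have "Y t n w = ?c *\<^sub>R ?a + (- 1) *\<^sub>R ?b" unfolding Y_def using m by simp
  also have "R ... = R (?c *\<^sub>R ?a) + R ((- 1) *\<^sub>R ?b)"
   using R(1) a span_scale unfolding lin_on_def by blast
  also have "... = ?c *\<^sub>R R ?a + (- 1) *\<^sub>R R ?b" using R(1) a unfolding lin_on_def by metis
  finally show ?thesis by (simp only: blinfun.add_right blinfun.scaleR_right real_scaleR_def)
 qed
 have "{..<n + 1} = insert n {..<n}" by auto
 then have "(\<Sum>w\<in>Pow {..<n + 1}. (if n \<in> w then - 1 else 1) * ?xs w (R (z n (w \<inter> {..<n}) (t n)))) =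
   (\<Sum>w\<in>Pow {..<n}. (if n \<in> w then - 1 else 1) * ?xs w (R (z n (w \<inter> {..<n}) (t n))) +
    (if n \<in> insert n w then - 1 else 1) * ?xs (insert n w) (R (z n (insert n w \<inter> {..<n}) (t n))))"
  by (simp only:) (rule sum_Pow_insert; simp)
 also have "... = (\<Sum>w\<in>Pow {..<n}. 2 * blinfun_apply (zs n w (t n) False) (R (z n w (t n))))"
 proof (rule sum.cong[OF refl])
  fix w assume "w \<in> Pow {..<n}"
  then have w: "w \<subseteq> {..<n}" "n \<notin> w" "w \<inter> {..<n} = w" "insert n w \<inter> {..<n} = w" by auto
  have "blinfun_apply (zs n w (t n) False) (R (z n w (t n))) = blinfun_apply (zs n w (t n) (t m)) (R (z n w (t n)))"
   using n w R(2)[OF zin] by (intro zs_eq) auto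
  then show "(if n \<in> w then - 1 else 1) * ?xs w (R (z n (w \<inter> {..<n}) (t n))) +
    (if n \<in> insert n w then - 1 else 1) * ?xs (insert n w) (R (z n (insert n w \<inter> {..<n}) (t n))) =
    2 * blinfun_apply (zs n w (t n) False) (R (z n w (t n)))"
   using w by (simp add: zs_def blinfun.scaleR_left blinfun.diff_left)
 qed
 finally have 1: "(\<Sum>w\<in>Pow {..<n + 1}. (if n \<in> w then - 1 else 1) * ?xs w (R (z n (w \<inter> {..<n}) (t n)))) / 2 ^ (n + 1) = beta t n R"
  by (simp add: beta_def flip: sum_distrib_left)
 have set: "{..<n + 1} = insert n (insert m {..<m})" using m by auto
 have "(\<Sum>w\<in>Pow {..<n + 1}. ?xs w (R (z m (w \<inter> {..<m}) (t m)))) =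
   (\<Sum>w\<in>Pow {..<m}. (?xs w (R (z m (w \<inter> {..<m}) (t m))) + ?xs (insert n w) (R (z m (insert n w \<inter> {..<m}) (t m)))) +
    (?xs (insert m w) (R (z m (insert m w \<inter> {..<m}) (t m))) + ?xs (insert n (insert m w)) (R (z m (insert n (insert m w) \<inter> {..<m}) (t m)))))"
  unfolding set by (subst sum_Pow_insert, use m in force, use m in force, subst sum_Pow_insert) auto
 also have "... = (\<Sum>w\<in>Pow {..<m}. 4 * blinfun_apply (zs m w (t m) False) (R (z m w (t m))))"
 proof (rule sum.cong[OF refl])
  fix w assume "w \<in> Pow {..<m}"
  then have w: "w \<subseteq> {..<m}" "w \<inter> {..<m} = w" "insert n w \<inter> {..<m} = w" "insert m w \<inter> {..<m} = w"
    "insert n (insert m w) \<inter> {..<m} = w" using m by auto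
  have s: "w \<union> {m} = insert m w" "w \<union> {m + 1} = insert n w" "w \<union> {m, m + 1} = insert n (insert m w)" "m + 2 = n + 1"
   using m by auto
  have "blinfun_apply (zs' m w (t m) (t n)) (R (z m w (t m))) = blinfun_apply (zs m w (t m) False) (R (z m w (t m)))"
   using m w R(2)[OF zin'] by (intro zs_eq) auto
  then show "(?xs w (R (z m (w \<inter> {..<m}) (t m))) + ?xs (insert n w) (R (z m (insert n w \<inter> {..<m}) (t m)))) +
    (?xs (insert m w) (R (z m (insert m w \<inter> {..<m}) (t m))) + ?xs (insert n (insert m w)) (R (z m (insert n (insert m w) \<inter> {..<m}) (t m)))) =
    4 * blinfun_apply (zs m w (t m) False) (R (z m w (t m)))"
   unfolding zs'_apply[OF w(1)] s w(2-5) by simp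
 qed
 finally have 2: "(\<Sum>w\<in>Pow {..<n + 1}. ?xs w (R (z m (w \<inter> {..<m}) (t m)))) / 2 ^ (n + 1) = beta t m R"
  using m by (simp add: beta_def flip: sum_distrib_left)
 have nm: "n - 1 = m" using m by simp
 show ?thesis unfolding nm RY sum_subtractf diff_divide_distrib 1 2 ..
qed

lemma axis_class_parity: "l mod 2 ~= l' mod 2 ==> axis_class l u \<nu> ~= axis_class l' w \<nu>'"
 unfolding axis_class_def by presburger

lemma axis_class_cong:
 "axis_class n u \<nu> = axis_class n w \<nu>' \<longleftrightarrow> (n - 1 \<in> u \<longleftrightarrow> n - 1 \<in> w) \<and> (n - 2 \<in> u \<longleftrightarrow> n - 2 \<in> w) \<and> \<nu> = \<nu>'"
 unfolding axis_class_def string_type_eq_iff[symmetric] by simp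

text \<open>After the cancellation there remain 1 + 2 + 8 + 2 + 2 + 7 = 22 vectors per index, in the
  order of \<open>g1\<close> to \<open>g6\<close>. None has the class \<open>c\<close>: on levels
  \<open>n\<close> and \<open>n + 2\<close> the parity differs, and on level \<open>n + 1\<close> a
  copy bit or one of the positions \<open>n - 1\<close> and \<open>n\<close> differs.\<close>

lemma Y_line:
 fixes a :: "nat set" and t :: "nat => bool"
 assumes n: "2 <= n" and w: "w \<subseteq> {..<n + 1}"
 defines "h \<equiv> axis_size (n + 1)" and "c \<equiv> axis_class (n + 1) w (t n, t (n - 1))"
 shows "norm (\<Sum>s\<in>Pow (axis h c). (bent (axis_even h c) s * chi s a) *\<^sub>R Y t n (w - axis h c \<union> s)) <= 22 * x_bound h"
proof -
 obtain m where m: "n = Suc m" "1 <= m" using n by (cases n) auto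
 define P where "P = axis h c"
 define \<xi> \<xi>' where "\<xi> = t n" and "\<xi>' = t m"
 define sg :: real where "sg = (if n \<in> w then - 1 else 1)"
 define \<sigma> where "\<sigma> s = bent (axis_even h c) s * chi s a" for s
 define L where "L f = (\<Sum>s\<in>Pow P. \<sigma> s *\<^sub>R f s)" for f :: "nat set => 'a"
 have c32: "c < 32" unfolding c_def by (rule axis_class_less)
 have hm: "64 * h <= m" unfolding h_def axis_size_def using m by simp
 have Pm: "P \<subseteq> {..<m}" using axis_props(6)[OF c32, of h] hm unfolding P_def by force
 define u where "u = w \<inter> {..<m}"
 define v where "v = w \<inter> {..<n}"
 define q where "q = w \<inter> {m, n}"
 define wb where "wb = (if n \<in> w then w - {n} else insert n w)"
 have subs: "u \<subseteq> {..<m}" "v \<subseteq> {..<n}" "q \<subseteq> {m, n}" "wb \<subseteq> {..<n + 1}"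
  using w by (auto simp: u_def v_def q_def wb_def)
 have uq: "u \<union> q = w" using w m unfolding u_def q_def by (force simp: less_Suc_eq)
 let ?l = "%v s. v - P \<union> s"
 have T: "norm (L (%s. x l (?l v s) \<nu>)) <= x_bound h"
  if "n <= l" "l <= n + 2" "v \<subseteq> {..<l}" "c ~= axis_class l v \<nu>" for l v \<nu>
  using x_other_bound[OF n that(1,2,3) c32 that(4), of a] unfolding L_def \<sigma>_def P_def h_def by simp
 have Lsum: "norm (L (%s. \<Sum>i\<in>I. f i s)) <= real (card I) * x_bound h" if "!!i. i \<in> I ==> norm (L (f i)) <= x_bound h"
  for I :: "'i set" and f
 proof -
  have "L (%s. \<Sum>i\<in>I. f i s) = (\<Sum>i\<in>I. L (f i))" unfolding L_def scaleR_sum_right by (rule sum.swap)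
  then show ?thesis using sum_norm_bound[of I "%i. L (f i)" "x_bound h"] that by simp
 qed
 define g1 where "g1 s = x (n + 1) (?l w s) (\<xi>, \<not> \<xi>')" for s
 define g2 where "g2 s = (\<Sum>b\<in>UNIV. x (n + 1) (?l wb s) (\<xi>, b))" for s
 define g3 where "g3 s = (\<Sum>i\<in>UNIV \<times> Pow {n, n + 1}. x (n + 2) (?l (v \<union> snd i) s) (fst i, \<xi>))" for s
 define g4 where "g4 s = (\<Sum>b\<in>UNIV. x n (?l u s) (\<xi>', b))" for s
 define g5 where "g5 s = (\<Sum>b\<in>UNIV. x n (?l (insert m u) s) (\<xi>', b))" for s
 define g6 where "g6 s = (\<Sum>i\<in>UNIV \<times> Pow {m, n} - {(\<xi>, q)}. x (n + 1) (?l (u \<union> snd i) s) (fst i, \<xi>'))" for s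
 have par: "c ~= axis_class n v \<nu>" "c ~= axis_class (n + 2) v \<nu>" for v \<nu>
  unfolding c_def by (intro axis_class_parity; presburger)+
 have same: "c ~= axis_class (n + 1) v \<nu>" if "(n \<in> v) ~= (n \<in> w) \<or> (m \<in> v) ~= (m \<in> w) \<or> \<nu> ~= (\<xi>, \<xi>')" for v \<nu>
  unfolding c_def axis_class_cong using that m by (auto simp: \<xi>_def \<xi>'_def)
 have b1: "norm (L g1) <= x_bound h" unfolding g1_def by (rule T[OF _ _ w same]) auto
 have b2: "norm (L g2) <= real (card (UNIV :: bool set)) * x_bound h" unfolding g2_def
  by (intro Lsum T[OF _ _ subs(4) same]) (auto simp: wb_def)
 have b3: "norm (L g3) <= real (card ((UNIV :: bool set) \<times> Pow {n, n + 1})) * x_bound h" unfolding g3_def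
  by (intro Lsum T[OF _ _ _ par(2)]) (use subs in auto)
 have b4: "norm (L g4) <= real (card (UNIV :: bool set)) * x_bound h" unfolding g4_def
  by (intro Lsum T[OF _ _ _ par(1)]) (use subs m in auto)
 have b5: "norm (L g5) <= real (card (UNIV :: bool set)) * x_bound h" unfolding g5_def
  by (intro Lsum T[OF _ _ _ par(1)]) (use subs m in auto)
 have b6: "norm (L g6) <= real (card (UNIV \<times> Pow {m, n} - {(\<xi>, q)})) * x_bound h" unfolding g6_def
 proof (intro Lsum T)
  fix i assume i: "i \<in> UNIV \<times> Pow {m, n} - {(\<xi>, q)}"
  then show "u \<union> snd i \<subseteq> {..<n + 1}" using subs m by auto
  show "c ~= axis_class (n + 1) (u \<union> snd i) (fst i, \<xi>')"
  proof (rule same, rule ccontr)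
   assume no: "\<not> ((n \<in> u \<union> snd i) ~= (n \<in> w) \<or> (m \<in> u \<union> snd i) ~= (m \<in> w) \<or> (fst i, \<xi>') ~= (\<xi>, \<xi>'))"
   have "n \<notin> u" "m \<notin> u" using subs m by auto
   then have "snd i = q" using no i unfolding q_def by auto
   then show False using no i by (cases i) auto
  qed
 qed auto
 have card6: "card (UNIV \<times> Pow {m, n} - {(\<xi>, q)}) = 7"
  using subs m by (subst card_Diff_singleton) (auto simp: card_cartesian_product card_Pow simp flip: UNIV_Times_UNIV)
 have card3: "card ((UNIV :: bool set) \<times> Pow {n, n + 1}) = 8" by (simp add: card_cartesian_product card_Pow)
 have Ys: "Y t n (?l w s) = g1 s - g2 s + sg *\<^sub>R g3 s - g4 s + g5 s - g6 s" if s: "s \<in> Pow P" for s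
 proof -
  have sP: "s \<subseteq> P" using s by simp
  have mem: "n \<in> ?l w s \<longleftrightarrow> n \<in> w" using Pm sP m by auto
  have v': "?l w s \<inter> {..<n} = ?l v s" "?l w s \<inter> {..<m} = ?l u s" using Pm sP m unfolding v_def u_def by auto
  have un: "?l r s \<union> c = ?l (r \<union> c) s" if "c \<inter> {..<m} = {}" for r c using Pm that by blast
  have ins: "insert n (?l v s) = ?l (insert n v) s" "insert m (?l u s) = ?l (insert m u) s" using Pm m by auto
  have zn: "z n (?l v s) \<xi> = (\<Sum>b\<in>UNIV. x (n + 1) (?l v s) (\<xi>, b) - x (n + 1) (?l (insert n v) s) (\<xi>, b)) + g3 s"
  proof -
   have "(\<Sum>a\<in>UNIV. \<Sum>c\<in>Pow {n, n + 1}. x (n + 2) (?l v s \<union> c) (a, \<xi>)) = g3 s"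
    unfolding g3_def sum.cartesian_product
   proof (rule sum.cong[OF refl])
    fix i :: "bool \<times> nat set" assume "i \<in> UNIV \<times> Pow {n, n + 1}"
    then have "snd i \<inter> {..<m} = {}" using m by auto
    then show "(case i of (a, c) => x (n + 2) (?l v s \<union> c) (a, \<xi>)) = x (n + 2) (?l (v \<union> snd i) s) (fst i, \<xi>)"
     using un by (simp add: case_prod_beta)
   qed
   then show ?thesis unfolding z_def ins by simp
  qed
  have flip: "sg *\<^sub>R (\<Sum>b\<in>UNIV. x (n + 1) (?l v s) (\<xi>, b) - x (n + 1) (?l (insert n v) s) (\<xi>, b)) =
    (\<Sum>b\<in>UNIV. x (n + 1) (?l w s) (\<xi>, b)) - g2 s"
  proof (cases "n \<in> w")
   case True
   have "insert n v = w" "v = wb" using True w by (auto simp: v_def wb_def less_Suc_eq)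
   then show ?thesis using True by (simp add: sg_def g2_def sum_subtractf)
  next
   case False
   have "v = w" using False w by (auto simp: v_def less_Suc_eq)
   moreover from this have "insert n v = wb" using False by (simp add: wb_def)
   ultimately show ?thesis using False by (simp add: sg_def g2_def sum_subtractf)
  qed
  have split1: "(\<Sum>b\<in>UNIV. x (n + 1) (?l w s) (\<xi>, b)) = x (n + 1) (?l w s) (\<xi>, \<xi>') + g1 s"
   unfolding g1_def UNIV_bool by (cases \<xi>') (simp_all add: add.commute)
  have "(\<Sum>a\<in>UNIV. \<Sum>c\<in>Pow {m, m + 1}. x (m + 2) (?l u s \<union> c) (a, \<xi>')) =
    (\<Sum>i\<in>UNIV \<times> Pow {m, n}. x (n + 1) (?l (u \<union> snd i) s) (fst i, \<xi>'))"
   unfolding sum.cartesian_product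
  proof (rule sum.cong)
   fix i :: "bool \<times> nat set" assume "i \<in> UNIV \<times> Pow {m, n}"
   then have "snd i \<inter> {..<m} = {}" using m by auto
   then show "(case i of (a, c) => x (m + 2) (?l u s \<union> c) (a, \<xi>')) = x (n + 1) (?l (u \<union> snd i) s) (fst i, \<xi>')"
    using un m by (simp add: case_prod_beta)
  qed (use m in simp)
  also have "... = x (n + 1) (?l w s) (\<xi>, \<xi>') + g6 s"
   unfolding g6_def using subs uq by (subst sum.remove[of _ "(\<xi>, q)"]) auto
  finally have zm: "z m (?l u s) \<xi>' = g4 s - g5 s + (x (n + 1) (?l w s) (\<xi>, \<xi>') + g6 s)"
   unfolding z_def ins g4_def g5_def using m by (simp add: sum_subtractf)
  have "Y t n (?l w s) = sg *\<^sub>R z n (?l v s) \<xi> - z m (?l u s) \<xi>'"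
   unfolding Y_def mem v' using m v' by (simp add: sg_def \<xi>_def \<xi>'_def)
  then show ?thesis unfolding zn zm scaleR_add_right flip split1 by simp
 qed
 have "L (%s. Y t n (?l w s)) = L (%s. g1 s - g2 s + sg *\<^sub>R g3 s - g4 s + g5 s - g6 s)"
  unfolding L_def by (intro sum.cong refl) (simp only: Ys)
 also have "... = L g1 - L g2 + sg *\<^sub>R L g3 - L g4 + L g5 - L g6"
  by (simp add: L_def scaleR_add_right scaleR_diff_right sum.distrib sum_subtractf scaleR_sum_right mult.commute)
 finally have LY: "L (%s. Y t n (?l w s)) = L g1 - L g2 + sg *\<^sub>R L g3 - L g4 + L g5 - L g6" .
 have sg1: "norm (sg *\<^sub>R L g3) = norm (L g3)" by (simp add: sg_def)
 have "norm (L g1 - L g2 + sg *\<^sub>R L g3 - L g4 + L g5 - L g6) <=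
   norm (L g1) + norm (L g2) + norm (sg *\<^sub>R L g3) + norm (L g4) + norm (L g5) + norm (L g6)"
  by (intro norm_triangle_le_diff norm_triangle_le add_mono order_refl)
 also have "... <= 22 * x_bound h" using b1 b2 b3 b4 b5 b6 unfolding sg1 card3 card6 by simp
 finally show ?thesis unfolding LY[symmetric] unfolding L_def \<sigma>_def P_def .
qed

lemma x_bound_pos: "0 < x_bound h" and xs_bound_pos: "0 < xs_bound h"
 using C decay_pos[of h] by (simp_all add: x_bound_def xs_bound_def)

text \<open>\<open>F\<close> consists of the signed line sums of \<open>Y\<close>, for all lines and
  all characters, scaled into the unit ball by \<open>Y_line\<close>. It is finite and chosen before
  \<open>R\<close>, so no operator norm enters: the largest of the finitely many
  \<open>norm (R y)\<close> takes its place.\<close>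

lemma strong_enflo:
 assumes n: "2 <= n"
 obtains F where "finite F" "F \<subseteq> span (Zt t n)" "\<forall>y\<in>F. norm y <= 1"
  "\<forall>R. lin_on (span (Zt t n)) R --> (\<forall>y\<in>span (Zt t n). R y \<in> ZZ) -->
    (\<exists>y\<in>F. \<bar>beta t n R - beta t (n - 1) R\<bar> <= alpha n * norm (R y))"
proof -
 define \<nu> where "\<nu> = (t n, t (n - 1))"
 define h where "h = axis_size (n + 1)"
 define c where "c w = axis_class (n + 1) w \<nu>" for w
 define P where "P w = axis h (c w)" for w
 define \<sigma> where "\<sigma> w a s = bent (axis_even h (c w)) s * chi s a" for w a s
 define A where "A = {..<n + 1}"
 define ys where "ys w a = (\<Sum>s\<in>Pow (P w). \<sigma> w a s *\<^sub>R Y t n (w - P w \<union> s))" for w a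
 define F where "F = (%(w, a). (1 / (22 * x_bound h)) *\<^sub>R ys w a) ` (Sigma (Pow A) (%w. Pow (P w)))"
 have c32: "c w < 32" for w unfolding c_def by (rule axis_class_less)
 have own: "P w = own_axis (n + 1) w \<nu>" for w by (simp add: P_def own_axis_def h_def c_def)
 have Psub: "P w \<subseteq> {..<n - 1}" for w unfolding own using own_axis_subset[of "n + 1"] by simp
 have PA: "P w \<subseteq> A" for w using Psub[of w] by (force simp: A_def)
 have finP: "finite (P w)" for w using Psub finite_subset by blast
 have cardP: "card (P w) = 2 * h" for w unfolding P_def by (rule axis_props(5)[OF c32])
 have cl: "c (w - P w \<union> s) = c w" if "s \<subseteq> P w" for w s
 proof -
  have "p \<in> w - P w \<union> s \<longleftrightarrow> p \<in> w" if "p = n \<or> p = n - 1" for p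
   using that \<open>s \<subseteq> P w\<close> Psub[of w] by force
  then show ?thesis unfolding c_def axis_class_cong using n by simp
 qed
 have line: "P (w - P w \<union> s) = P w" if "s \<subseteq> P w" for w s using cl[OF that] by (simp add: P_def)
 have lsub: "w - P w \<union> s \<subseteq> A" if "w \<subseteq> A" "s \<subseteq> P w" for w s using that PA[of w] by blast
 have x0: "0 < x_bound h" by (rule x_bound_pos)
 have nys: "norm (ys w a) <= 22 * x_bound h" if "w \<subseteq> A" for w a
  unfolding ys_def \<sigma>_def P_def c_def h_def \<nu>_def using that n by (intro Y_line) (auto simp: A_def)
 have Yspan: "Y t n w \<in> span (Zt t n)" for w by (rule Y_in_span[OF n])
 have ysspan: "ys w a \<in> span (Zt t n)" for w a unfolding ys_def by (intro span_sum span_scale Yspan)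
 show thesis
 proof (rule that)
  show finF: "finite F" unfolding F_def using finP by (intro finite_imageI finite_SigmaI) (auto simp: A_def)
  show "F \<subseteq> span (Zt t n)" unfolding F_def using ysspan span_scale by fastforce
  show "\<forall>y\<in>F. norm y <= 1"
   using nys x0 unfolding F_def by (auto simp: divide_le_eq)
  show "\<forall>R. lin_on (span (Zt t n)) R --> (\<forall>y\<in>span (Zt t n). R y \<in> ZZ) -->
    (\<exists>y\<in>F. \<bar>beta t n R - beta t (n - 1) R\<bar> <= alpha n * norm (R y))"
  proof (intro allI impI)
   fix R assume R: "lin_on (span (Zt t n)) R" and RZ0: "\<forall>y\<in>span (Zt t n). R y \<in> ZZ"
   have RZ: "R y \<in> ZZ" if "y \<in> span (Zt t n)" for y using RZ0 that by blast
   have "F ~= {}" unfolding F_def by blast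
   then obtain y where y: "y \<in> F" "norm (R y) = Max ((%y. norm (R y)) ` F)"
    using Max_in[of "(%y. norm (R y)) ` F"] finF by fastforce
   have max: "norm (R y') <= norm (R y)" if "y' \<in> F" for y' unfolding y(2) using finF that by (intro Max_ge) auto
   define M where "M = norm (R y)"
   define f where "f w = blinfun_apply (xs (n + 1) w \<nu>) (R (Y t n w))" for w
   have Rys: "norm (R (ys w a)) <= 22 * x_bound h * M" if "w \<subseteq> A" "a \<subseteq> P w" for w a
   proof -
    have "(1 / (22 * x_bound h)) *\<^sub>R ys w a \<in> F" unfolding F_def using that by force
    from max[OF this] have "norm (R ((1 / (22 * x_bound h)) *\<^sub>R ys w a)) <= M" unfolding M_def .
    moreover have "R ((1 / (22 * x_bound h)) *\<^sub>R ys w a) = (1 / (22 * x_bound h)) *\<^sub>R R (ys w a)"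
     using R ysspan unfolding lin_on_def by blast
    ultimately show ?thesis using x0 by (simp add: divide_le_eq mult_ac)
   qed
   define Q where "Q = xs_bound h * (22 * x_bound h * M)"
   have linebound: "\<bar>\<Sum>s\<in>Pow (P w). f (w - P w \<union> s)\<bar> <= Q" if w: "w \<subseteq> A" for w
   proof -
    let ?F = "%s s'. blinfun_apply (xs (n + 1) (w - P w \<union> s) \<nu>) (R (Y t n (w - P w \<union> s')))"
    have Ra: "R (ys w a) = (\<Sum>s\<in>Pow (P w). \<sigma> w a s *\<^sub>R R (Y t n (w - P w \<union> s)))" for a
     unfolding ys_def using Yspan by (intro lin_on_sum[OF R]) (auto simp: subspace_span)
    \<comment> \<open>Decoupling: by linearity of \<open>R\<close> the inner sum over
      \<open>s'\<close> is collected into \<open>R (ys w a)\<close>, the value at a test vector up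
      to scaling.\<close>
    have "2 ^ (2 * h) * (\<Sum>s\<in>Pow (P w). ?F s s) =
      (\<Sum>a\<in>Pow (P w). \<Sum>s\<in>Pow (P w). \<Sum>s'\<in>Pow (P w). \<sigma> w a s * \<sigma> w a s' * ?F s s')"
     unfolding \<sigma>_def P_def by (rule bent_decoupling[OF c32, symmetric])
    also have "... = (\<Sum>a\<in>Pow (P w). \<Sum>s\<in>Pow (P w). \<sigma> w a s * blinfun_apply (xs (n + 1) (w - P w \<union> s) \<nu>) (R (ys w a)))"
     unfolding Ra by (intro sum.cong refl) (simp add: blinfun.sum_right blinfun.scaleR_right sum_distrib_left mult_ac)
    also have "\<bar>...\<bar> <= (\<Sum>a\<in>Pow (P w). \<bar>\<Sum>s\<in>Pow (P w). \<sigma> w a s * blinfun_apply (xs (n + 1) (w - P w \<union> s) \<nu>) (R (ys w a))\<bar>)"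
     by (rule sum_abs)
    also have "... <= (\<Sum>a\<in>Pow (P w). Q)"
    proof (rule sum_mono)
     fix a assume a: "a \<in> Pow (P w)"
     have "R (ys w a) \<in> W" using RZ[OF ysspan] ZZ_subset by blast
     then have "\<bar>\<Sum>s\<in>Pow (P w). \<sigma> w a s * blinfun_apply (xs (n + 1) (w - P w \<union> s) \<nu>) (R (ys w a))\<bar> <= xs_bound h * norm (R (ys w a))"
      unfolding \<sigma>_def P_def h_def c_def using w n by (intro xs_own_bound) (auto simp: A_def)
     also have "... <= Q" unfolding Q_def using Rys[OF w] a xs_bound_pos[of h] by (intro mult_left_mono) auto
     finally show "\<bar>\<Sum>s\<in>Pow (P w). \<sigma> w a s * blinfun_apply (xs (n + 1) (w - P w \<union> s) \<nu>) (R (ys w a))\<bar> <= Q" .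
    qed
    also have "... = 2 ^ (2 * h) * Q" using finP cardP by (simp add: card_Pow)
    finally have "2 ^ (2 * h) * \<bar>\<Sum>s\<in>Pow (P w). ?F s s\<bar> <= 2 ^ (2 * h) * Q" by (simp add: abs_mult)
    then show ?thesis unfolding f_def by simp
   qed
   have "2 ^ (2 * h) * \<bar>\<Sum>w\<in>Pow A. f w\<bar> = \<bar>\<Sum>w\<in>Pow A. \<Sum>s\<in>Pow (P w). f (w - P w \<union> s)\<bar>"
    using sum_over_lines[of A P "2 * h" f] PA line cardP by (simp add: A_def abs_mult)
   also have "... <= (\<Sum>w\<in>Pow A. \<bar>\<Sum>s\<in>Pow (P w). f (w - P w \<union> s)\<bar>)" by (rule sum_abs)
   also have "... <= (\<Sum>w\<in>Pow A. Q)" using linebound by (intro sum_mono) auto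
   also have "... = 2 ^ (n + 1) * Q" by (simp add: A_def card_Pow)
   finally have S: "2 ^ (2 * h) * \<bar>\<Sum>w\<in>Pow A. f w\<bar> <= 2 ^ (n + 1) * Q" .
   have "Q = x_bound h * xs_bound h * (22 * M)" by (simp add: Q_def)
   also have "... <= 8192 * C * (2 ^ (2 * h) * 2 powr (- 2 * \<delta> * real h)) * (22 * M)"
    using bounds_product[of h] by (intro mult_right_mono) (auto simp: M_def)
   also have "... = 2 ^ (2 * h) * (alpha n * M)" by (simp add: alpha_def h_def)
   finally have "2 ^ (n + 1) * Q <= 2 ^ (n + 1) * (2 ^ (2 * h) * (alpha n * M))" by (rule mult_left_mono) simp
   also have "... = 2 ^ (2 * h) * (2 ^ (n + 1) * (alpha n * M))" by simp
   finally have "2 ^ (2 * h) * \<bar>\<Sum>w\<in>Pow A. f w\<bar> <= 2 ^ (2 * h) * (2 ^ (n + 1) * (alpha n * M))"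
    using S by (rule order_trans[rotated])
   then have "\<bar>\<Sum>w\<in>Pow A. f w\<bar> <= 2 ^ (n + 1) * (alpha n * M)" by (subst (asm) mult_le_cancel_left_pos) auto
   then have "\<bar>(\<Sum>w\<in>Pow A. f w) / 2 ^ (n + 1)\<bar> <= alpha n * M" by (simp add: divide_le_eq mult_ac)
   moreover have "beta t n R - beta t (n - 1) R = (\<Sum>w\<in>Pow A. f w) / 2 ^ (n + 1)"
    using beta_diff[OF n R RZ] unfolding f_def A_def \<nu>_def .
   ultimately show "\<exists>y\<in>F. \<bar>beta t n R - beta t (n - 1) R\<bar> <= alpha n * norm (R y)" using y(1) unfolding M_def by auto
  qed
 qed
qed

end

section \<open>Consequences of the strengthened Enflo criterion\<close>

lemma subspace_closure:
 fixes S :: "'a::real_normed_vector set"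
 assumes "subspace S" shows "subspace (closure S)"
 unfolding subspace_def
proof (intro conjI ballI allI)
 show "0 \<in> closure S" using subspace_0[OF assms] closure_subset by blast
 fix x assume "x \<in> closure S"
 then obtain f where f: "!!n. f n \<in> S" "f \<longlonglongrightarrow> x" unfolding closure_sequential by blast
 show "x + y \<in> closure S" if y: "y \<in> closure S" for y
 proof -
  obtain g where g: "!!n. g n \<in> S" "g \<longlonglongrightarrow> y" using y unfolding closure_sequential by blast
  show ?thesis unfolding closure_sequential
   using tendsto_add[OF f(2) g(2)] subspace_add[OF assms f(1) g(1)] by (intro exI[of _ "%n. f n + g n"]) simp
 qed
 show "c *\<^sub>R x \<in> closure S" for c
  unfolding closure_sequential
  using tendsto_scaleR[OF tendsto_const f(2)] subspace_scale[OF assms f(1)] by (intro exI[of _ "%n. c *\<^sub>R f n"]) simp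
qed

lemma compact_null_finite_sets:
 fixes A :: "nat => 'a::real_normed_vector set"
 assumes fin: "!!n. finite (A n)" and null: "!!e. 0 < e ==> \<exists>N. \<forall>n\<ge>N. \<forall>a\<in>A n. norm a < e"
 shows "compact (insert 0 (\<Union>n. A n))"
proof (rule compactI)
 fix C assume C: "\<forall>c\<in>C. open c" "insert 0 (\<Union>n. A n) \<subseteq> \<Union>C"
 obtain c where c: "c \<in> C" "0 \<in> c" using C by auto
 obtain e where e: "0 < e" "ball 0 e \<subseteq> c" using c C openE by blast
 obtain N where N: "\<forall>n\<ge>N. \<forall>a\<in>A n. norm a < e" using null[OF e(1)] by blast
 have cpt: "compact (\<Union>n<N. A n)" using fin by (intro finite_imp_compact) auto
 have cov: "(\<Union>n<N. A n) \<subseteq> \<Union>C" using C(2) by blast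
 obtain D where D: "D \<subseteq> C" "finite D" "(\<Union>n<N. A n) \<subseteq> \<Union>D"
  by (rule compactE[OF cpt cov]) (use C(1) in auto)
 have "insert 0 (\<Union>n. A n) \<subseteq> \<Union>(insert c D)"
 proof
  fix a assume a: "a \<in> insert 0 (\<Union>n. A n)"
  show "a \<in> \<Union>(insert c D)"
  proof (cases "a = 0")
   case False
   then obtain n where n: "a \<in> A n" using a by blast
   show ?thesis
   proof (cases "n < N")
    case True then show ?thesis using n D(3) by blast
   next
    case False
    then have "norm a < e" using N n by (meson not_le)
    then have "a \<in> ball 0 e" by simp
    then show ?thesis using e(2) by blast
   qed
  qed (use c in simp)
 qed
 then show "\<exists>C'\<subseteq>C. finite C' \<and> insert 0 (\<Union>n. A n) \<subseteq> \<Union>C'"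
  using D c by (intro exI[of _ "insert c D"]) simp
qed

text \<open>The usual notion in the product of two Cantor spaces, in terms of cylinders:
  \<open>l\<close> bits of both sequences are prescribed, and an extension to \<open>l'\<close> bits
  already forces the pair out of \<open>A\<close>.\<close>

definition nowhere_dense :: "((nat => bool) \<times> (nat => bool)) set => bool" where
 "nowhere_dense A \<longleftrightarrow> (\<forall>t s l. \<exists>t' s' l'. l <= l' \<and> (\<forall>n<l. t' n = t n \<and> s' n = s n) \<and>
   (\<forall>t'' s''. (\<forall>n<l'. t'' n = t' n \<and> s'' n = s' n) --> (t'', s'') \<notin> A))"

definition levels_upto :: "(nat => bool => 'a) => (nat => bool) => nat => 'a set" where
 "levels_upto z t n = {z j (t m) | j m. 1 <= m \<and> m <= n \<and> j \<in> dyadic_block m}"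

definition full_space :: "(nat => bool => 'a::real_normed_vector) => 'a set" where
 "full_space z = closure (span {z j \<xi> | j m \<xi>. 1 <= m \<and> j \<in> dyadic_block m})"

definition enflo_test ::
  "(nat => bool => 'a::real_normed_vector) => (nat => bool => 'a \<Rightarrow>\<^sub>L real) => (nat => real) =>
   (nat => bool) => nat => 'a set => bool" where
 "enflo_test z z' \<alpha> t n F \<longleftrightarrow> finite F \<and> F \<subseteq> span (levels_upto z t n) \<and> (\<forall>y\<in>F. norm y <= 1) \<and>
   (\<forall>R. lin_on (span (levels_upto z t n)) R --> (\<forall>y\<in>span (levels_upto z t n). R y \<in> full_space z) -->
    (\<exists>y\<in>F. \<bar>enflo_beta z z' t n R - enflo_beta z z' t (n - 1) R\<bar> <= \<alpha> n * norm (R y)))"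

text \<open>The last assumption strengthens the Enflo criterion: only finitely many values of the operator
 are needed, and the operator only has to be defined on the first \<open>n\<close> levels. Both are essential
 below, the former for the failure of the approximation property, the latter for non-isomorphism.\<close>

locale enflo_system =
 fixes z :: "nat => bool => 'a::banach" and z' :: "nat => bool => 'a \<Rightarrow>\<^sub>L real" and \<alpha> :: "nat => real" and M :: real
 assumes bounds: "!!j \<xi>. 1 <= j ==> norm (z j \<xi>) <= M" "!!j \<xi>. 1 <= j ==> norm (z' j \<xi>) <= M"
  and biorthogonal: "!!i j \<xi> \<tau>. 1 <= i ==> 1 <= j ==> blinfun_apply (z' i \<xi>) (z j \<tau>) = (if i = j \<and> \<xi> = \<tau> then 1 else 0)"
  and alpha: "!!n. 0 < \<alpha> n" "summable \<alpha>" "summable (%n. sqrt (\<alpha> n))"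
  and enflo: "!!t n. 2 <= n ==> \<exists>F. enflo_test z z' \<alpha> t n F"
begin

abbreviation "G \<equiv> levels_upto z"
lemmas G_def = levels_upto_def[of z]
abbreviation "X \<equiv> cantor_subspace z"
abbreviation "\<beta> \<equiv> enflo_beta z z'"

lemma block_pos: "j \<in> dyadic_block m ==> 1 <= j"
 using zero_less_power[of "2 :: nat" m] unfolding dyadic_block_def by simp

lemma block_unique: "j \<in> dyadic_block m ==> j \<in> dyadic_block n ==> m = n"
proof (induction m n rule: linorder_wlog)
 case (le m n)
 show ?case
 proof (rule ccontr)
  assume "m ~= n"
  then have "(2::nat) ^ (m + 1) <= 2 ^ n" using le by (intro power_increasing) auto
  then show False using le by (auto simp: dyadic_block_def)
 qed
qed auto

lemma finite_block [simp]: "finite (dyadic_block n)" by (simp add: dyadic_block_def)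

lemma card_block [simp]: "card (dyadic_block n) = 2 ^ n" by (simp add: dyadic_block_def)

lemma M_nonneg: "0 <= M"
 using bounds(1)[of 1 True] norm_ge_zero[of "z 1 True"] by linarith

lemma abs_z': "1 <= j ==> \<bar>blinfun_apply (z' j \<xi>) v\<bar> <= M * norm v"
 using norm_blinfun[of "z' j \<xi>" v] mult_right_mono[OF bounds(2), of j "norm v" \<xi>] by auto

lemma z'_z:
 assumes "j \<in> dyadic_block n" "i \<in> dyadic_block m"
 shows "blinfun_apply (z' j \<xi>) (z i \<tau>) = (if j = i \<and> \<xi> = \<tau> then 1 else 0)"
 using biorthogonal block_pos assms by blast

lemma X_eq: "X t = closure (span (\<Union>n. G t n))"
proof -
 have "{z j (t n) | j n. 1 <= n \<and> j \<in> dyadic_block n} = (\<Union>n. G t n)" unfolding G_def by blast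
 then show ?thesis by (simp add: cantor_subspace_def)
qed

lemma G_mono: "m <= n ==> G t m \<subseteq> G t n"
 unfolding G_def using order_trans by blast

lemma span_G_subset: "span (G t n) \<subseteq> X t"
 unfolding X_eq by (intro order_trans[OF _ closure_subset] span_mono) blast

lemma subspace_X: "subspace (X t)"
 unfolding X_eq by (intro subspace_closure subspace_span)

lemma closed_X: "closed (X t)" by (simp add: X_eq)

lemma z_in_X: "1 <= n ==> j \<in> dyadic_block n ==> z j (t n) \<in> X t"
 unfolding cantor_subspace_def by (intro subsetD[OF closure_subset] span_base) blast

lemma z_in_G: "1 <= m ==> m <= n ==> j \<in> dyadic_block m ==> z j (t m) \<in> G t n"
 unfolding G_def by blast

lemma span_UN_G: "v \<in> span (\<Union>n. G t n) ==> \<exists>n. v \<in> span (G t n)"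
proof (induction rule: span_induct_alt)
 case base show ?case using span_zero by blast
next
 case (step c x y)
 then obtain m n where "x \<in> G t m" "y \<in> span (G t n)" by blast
 then have "x \<in> span (G t (max m n))" "y \<in> span (G t (max m n))"
  using G_mono[of m "max m n" t] span_mono[OF G_mono[of n "max m n" t]] span_base by auto
 then show ?case by (intro exI[of _ "max m n"] span_add span_scale)
qed

lemma finite_G: "finite (G t n)"
proof -
 have "G t n = (\<Union>m\<in>{1..n}. (%j. z j (t m)) ` dyadic_block m)" unfolding G_def by force
 then show ?thesis by simp
qed

lemma G_cong: "(!!m. 1 <= m ==> m <= n ==> t m = s m) ==> G t n = G s n"
 unfolding G_def by force

lemma X_subset_Z: "X t \<subseteq> full_space z"
 unfolding cantor_subspace_def full_space_def by (intro closure_mono span_mono) blast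

definition test_set :: "(nat => bool) => nat => 'a set" where
 "test_set t n = (SOME F. enflo_test z z' \<alpha> t n F)"

lemma test_set:
 assumes "2 <= n"
 shows "finite (test_set t n)" "test_set t n \<subseteq> span (G t n)" "y \<in> test_set t n ==> norm y <= 1"
  "lin_on (span (G t n)) R ==> (!!y. y \<in> span (G t n) ==> R y \<in> X s) ==>
    \<exists>y\<in>test_set t n. \<bar>\<beta> t n R - \<beta> t (n - 1) R\<bar> <= \<alpha> n * norm (R y)"
proof -
 have F: "enflo_test z z' \<alpha> t n (test_set t n)"
  using enflo[OF assms, of t] unfolding test_set_def by (rule someI_ex)
 note F = F[unfolded enflo_test_def]
 from F show "finite (test_set t n)" "test_set t n \<subseteq> span (G t n)" by auto
 show "norm y <= 1" if "y \<in> test_set t n" using F that by blast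
 show "\<exists>y\<in>test_set t n. \<bar>\<beta> t n R - \<beta> t (n - 1) R\<bar> <= \<alpha> n * norm (R y)"
  if R: "lin_on (span (G t n)) R" "!!y. y \<in> span (G t n) ==> R y \<in> X s"
 proof -
  have "\<forall>y\<in>span (G t n). R y \<in> full_space z"
   using R(2) X_subset_Z by blast
  then show ?thesis using F R(1) by blast
 qed
qed

lemma bounded_linear_on_lin_on: "bounded_linear_on V W T ==> lin_on V T"
 by (simp add: bounded_linear_on_def lin_on_def)

lemma norm_le_onorm_on:
 assumes "bounded_linear_on V W T" "y \<in> V" "subspace V"
 shows "norm (T y) <= onorm_on V T * norm y"
proof (cases "y = 0")
 case True
 then show ?thesis using lin_on_0[OF bounded_linear_on_lin_on] assms by auto
next
 case False
 obtain K where K: "!!x. x \<in> V ==> norm (T x) <= K * norm x" using assms(1) unfolding bounded_linear_on_def by blast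
 have "bdd_above ((%x. norm (T x) / norm x) ` V)"
 proof (rule bdd_aboveI2)
  fix x assume "x \<in> V"
  then show "norm (T x) / norm x <= \<bar>K\<bar>"
   using order_trans[OF K mult_right_mono[OF abs_ge_self norm_ge_zero]] by (cases "x = 0") (auto simp: divide_le_eq)
 qed
 then have "norm (T y) / norm y <= onorm_on V T" unfolding onorm_on_def using assms(2) by (rule cSUP_upper2[OF _ _ order_refl])
 then show ?thesis using False by (simp add: divide_le_eq)
qed

lemma onorm_on_nonneg:
 assumes "bounded_linear_on V W T" "y \<in> V" "y ~= 0" "subspace V" shows "0 <= onorm_on V T"
proof -
 have "0 <= onorm_on V T * norm y" using norm_le_onorm_on[OF assms(1,2,4)] norm_ge_zero[of "T y"] by linarith
 then show ?thesis using assms(3) by (simp add: zero_le_mult_iff)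
qed

lemma criterion:
 assumes T: "bounded_linear_on (X t) (X s) T" and n: "2 <= n"
 shows "\<bar>\<beta> t n T - \<beta> t (n - 1) T\<bar> <= \<alpha> n * onorm_on (X t) T"
proof -
 have "lin_on (span (G t n)) T" using bounded_linear_on_lin_on[OF T] span_G_subset by (rule lin_on_subset)
 moreover have "T y \<in> X s" if "y \<in> span (G t n)" for y using T that span_G_subset unfolding bounded_linear_on_def by blast
 ultimately obtain y where y: "y \<in> test_set t n" "\<bar>\<beta> t n T - \<beta> t (n - 1) T\<bar> <= \<alpha> n * norm (T y)"
  using test_set(4)[OF n] by blast
 \<comment> \<open>A nonzero vector of \<open>X t\<close> shows that the supremum defining
   \<open>onorm_on\<close> is nonnegative.\<close>
 have two: "2 \<in> dyadic_block 1" by (simp add: dyadic_block_def)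
 have "z 2 (t 1) ~= 0" using z'_z[OF two two, of "t 1" "t 1"] by auto
 then have o: "0 <= onorm_on (X t) T" using onorm_on_nonneg[OF T z_in_X[OF _ two] _ subspace_X] by simp
 have "norm (T y) <= onorm_on (X t) T * norm y"
  using y test_set(2)[OF n] span_G_subset by (intro norm_le_onorm_on[OF T _ subspace_X]) blast
 also have "... <= onorm_on (X t) T * 1" using test_set(3)[OF n y(1)] o by (rule mult_left_mono)
 finally have "\<alpha> n * norm (T y) <= \<alpha> n * onorm_on (X t) T" using alpha(1)[of n] by (simp add: mult_left_mono)
 then show ?thesis using y(2) by linarith
qed

lemma cantorized_enflo: "cantorized_enflo TYPE('a)"
proof -
 have "bounded ((%j. z j \<xi>) ` {1..}) \<and> bounded ((%j. z' j \<xi>) ` {1..})" for \<xi>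
  unfolding bounded_iff using bounds by blast
 then show ?thesis unfolding cantorized_enflo_def using biorthogonal criterion alpha(2) by blast
qed

section \<open>Failure of the approximation property\<close>

lemma z'_tendsto_zero:
 assumes v: "v \<in> X t" and "0 < \<eta>"
 obtains N where "!!n j. N <= n ==> j \<in> dyadic_block n ==> \<bar>blinfun_apply (z' j (t n)) v\<bar> <= \<eta>"
proof -
 have "0 < \<eta> / (M + 1)" using assms(2) M_nonneg by simp
 then obtain y where y: "y \<in> span (\<Union>n. G t n)" "dist y v < \<eta> / (M + 1)"
  using v unfolding X_eq closure_approachable by blast
 obtain N where N: "y \<in> span (G t N)" using span_UN_G[OF y(1)] by blast
 show thesis
 proof (rule that[of "Suc N"])
  fix n j assume nj: "Suc N <= n" "j \<in> dyadic_block n"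
  have "blinfun_apply (z' j (t n)) y = 0"
  proof (rule linear_eq_0_on_span[OF _ _ N])
   show "linear (blinfun_apply (z' j (t n)))" by (intro bounded_linear.linear blinfun.bounded_linear_right)
   fix g assume "g \<in> G t N"
   then obtain i m where g: "g = z i (t m)" "m <= N" "i \<in> dyadic_block m" unfolding G_def by blast
   then have "j ~= i" using nj block_unique[of j n m] by auto
   then show "blinfun_apply (z' j (t n)) g = 0" unfolding g(1) using z'_z[OF nj(2) g(3)] by simp
  qed
  then have "\<bar>blinfun_apply (z' j (t n)) v\<bar> = \<bar>blinfun_apply (z' j (t n)) (v - y)\<bar>" by (simp add: blinfun.diff_right)
  also have "... <= M * norm (v - y)" using nj(2) by (intro abs_z' block_pos)
  also have "... <= (M + 1) * norm (v - y)" by (intro mult_right_mono) auto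
  also have "... <= (M + 1) * (\<eta> / (M + 1))" using y(2) M_nonneg by (intro mult_left_mono) (auto simp: dist_norm norm_minus_commute)
  also have "... = \<eta>" using M_nonneg by simp
  finally show "\<bar>blinfun_apply (z' j (t n)) v\<bar> <= \<eta>" .
 qed
qed

text \<open>The functionals of level \<open>n\<close> tend to zero uniformly on each of finitely
  many vectors spanning the range, and the images of the bounded vectors \<open>z\<close> have
  bounded coefficients. So every term of the trace is small on a late level.\<close>

lemma beta_finite_rank:
 assumes T: "bounded_linear_on (X t) (X t) T" and fin: "finite_dimensional_set (T ` X t)" and \<eta>: "0 < \<eta>"
 obtains n where "1 <= n" "\<bar>\<beta> t n T\<bar> <= \<eta>"
proof -
 obtain B0 where B0: "finite B0" "T ` X t \<subseteq> span B0" using fin unfolding finite_dimensional_set_def by blast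
 obtain B where B: "B \<subseteq> T ` X t" "independent B" "T ` X t \<subseteq> span B"
  using maximal_independent_subset[of "T ` X t"] by metis
 have finB: "finite B" using independent_span_bound[OF B0(1) B(2)] B(1) B0(2) by blast
 obtain K0 where K0: "K0 > 0" "!!a b. b \<in> B ==> \<bar>a b\<bar> <= K0 * norm (\<Sum>c\<in>B. a c *\<^sub>R c)"
  using independent_coefficient_bound[OF finB B(2)] by metis
 obtain KT where KT: "!!x. x \<in> X t ==> norm (T x) <= KT * norm x" using T unfolding bounded_linear_on_def by blast
 define K where "K = K0 * \<bar>KT\<bar> * M * real (card B) + 1"
 have K: "K > 0" unfolding K_def using K0(1) M_nonneg by (intro add_nonneg_pos mult_nonneg_nonneg) auto
 have "\<exists>N. \<forall>n j. N <= n --> j \<in> dyadic_block n --> \<bar>blinfun_apply (z' j (t n)) b\<bar> <= \<eta> / K" if b: "b \<in> B" for b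
 proof -
  have "b \<in> X t" using b B(1) T unfolding bounded_linear_on_def by blast
  then show ?thesis using z'_tendsto_zero[of b t "\<eta> / K"] \<eta> K by (metis divide_pos_pos)
 qed
 then obtain N where N: "!!b n j. b \<in> B ==> N b <= n ==> j \<in> dyadic_block n ==> \<bar>blinfun_apply (z' j (t n)) b\<bar> <= \<eta> / K"
  by metis
 define n where "n = Suc (\<Sum>b\<in>B. N b)"
 have Nn: "N b <= n" if "b \<in> B" for b unfolding n_def using member_le_sum[OF that, of N] finB by simp
 have terms: "\<bar>blinfun_apply (z' j (t n)) (T (z j (t n)))\<bar> <= \<eta>" if j: "j \<in> dyadic_block n" for j
 proof -
  have zX: "z j (t n) \<in> X t" using j by (intro z_in_X) (auto simp: n_def)
  then have "T (z j (t n)) \<in> span B" using B(3) by blast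
  then obtain a where a: "T (z j (t n)) = (\<Sum>c\<in>B. a c *\<^sub>R c)" using span_finite[OF finB] by auto
  have "norm (T (z j (t n))) <= KT * norm (z j (t n))" using KT zX .
  also have "... <= \<bar>KT\<bar> * M" using bounds(1)[OF block_pos[OF j]] by (intro mult_mono) auto
  finally have nT: "norm (T (z j (t n))) <= \<bar>KT\<bar> * M" .
  have ab: "\<bar>a b\<bar> <= K0 * (\<bar>KT\<bar> * M)" if "b \<in> B" for b
   using K0(2)[OF that, of a] mult_left_mono[OF nT, of K0] K0(1) unfolding a by linarith
  have "\<bar>blinfun_apply (z' j (t n)) (T (z j (t n)))\<bar> <= (\<Sum>c\<in>B. \<bar>a c * blinfun_apply (z' j (t n)) c\<bar>)"
   unfolding a blinfun.sum_right blinfun.scaleR_right real_scaleR_def by (rule sum_abs)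
  also have "... <= (\<Sum>c\<in>B. K0 * (\<bar>KT\<bar> * M) * (\<eta> / K))"
   unfolding abs_mult using ab N Nn j K0(1) M_nonneg by (intro sum_mono mult_mono) auto
  also have "... = (K - 1) * (\<eta> / K)" unfolding K_def by simp
  also have "... <= K * (\<eta> / K)" using \<eta> K by (intro mult_right_mono) auto
  also have "... = \<eta>" using K by simp
  finally show ?thesis .
 qed
 have "\<bar>\<Sum>j\<in>dyadic_block n. blinfun_apply (z' j (t n)) (T (z j (t n)))\<bar> <= (\<Sum>j\<in>dyadic_block n. \<eta>)"
  using terms by (intro order_trans[OF sum_abs] sum_mono)
 then have "\<bar>\<beta> t n T\<bar> <= \<eta>" unfolding enflo_beta_def by (simp add: divide_le_eq mult.commute)
 then show thesis by (intro that[of n]) (auto simp: n_def)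
qed

lemma beta_diff_identity:
 assumes "1 <= n" shows "\<beta> t n (%x. T x - x) = \<beta> t n T - 1"
proof -
 have "(\<Sum>j\<in>dyadic_block n. blinfun_apply (z' j (t n)) (z j (t n))) = (\<Sum>j\<in>dyadic_block n. 1)"
  using z'_z by (intro sum.cong refl) auto
 then show ?thesis unfolding enflo_beta_def blinfun.diff_right sum_subtractf diff_divide_distrib by simp
qed

text \<open>The compact set contains the test vectors scaled by \<open>sqrt (\<alpha> n)\<close>. If
  \<open>T\<close> is close to the identity on it, the trace of \<open>T x - x\<close> changes at
  level \<open>n\<close> by at most \<open>sqrt (\<alpha> n) * e\<close>: one root makes the set
  compact, the other makes the changes summable. So the trace of \<open>T\<close> stays above 1/2 on
  all levels, which is impossible for finite rank.\<close>

lemma not_approximation_property: "\<not> approximation_property (X t)"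
proof
 assume AP: "approximation_property (X t)"
 let ?F = "test_set t"
 note F = test_set
 \<comment> \<open>Below level 2 there are no test vectors; the spanning vectors of level 1 control
   the trace where the summation starts.\<close>
 define Fn where "Fn n = (if 2 <= n then (%y. sqrt (\<alpha> n) *\<^sub>R y) ` ?F n else G t 1)" for n
 define K where "K = insert 0 (\<Union>n. Fn n)"
 have KX: "K \<subseteq> X t"
 proof -
  have "Fn n \<subseteq> X t" for n
  proof (cases "2 <= n")
   case True
   then show ?thesis unfolding Fn_def using F(2)[of n t] span_G_subset[of t n] subspace_scale[OF subspace_X]
   by (auto intro!: subspace_scale[OF subspace_X])
  next
   case False
   then show ?thesis unfolding Fn_def using span_G_subset[of t 1] span_superset[of "G t 1"] by auto
  qed
  then show ?thesis unfolding K_def using subspace_0[OF subspace_X] by blast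
 qed
 have "compact K" unfolding K_def
 proof (rule compact_null_finite_sets)
  show "finite (Fn n)" for n using F(1) finite_G by (simp add: Fn_def)
  fix \<eta> :: real assume \<eta>: "0 < \<eta>"
  have "(%n. sqrt (\<alpha> n)) \<longlonglongrightarrow> 0" using alpha(3) by (rule summable_LIMSEQ_zero)
  then obtain N where N: "!!n. n \<ge> N ==> norm (sqrt (\<alpha> n)) < \<eta>" using \<eta> by (auto simp: LIMSEQ_iff)
  have "norm a < \<eta>" if n: "n \<ge> max N 2" and a: "a \<in> Fn n" for n a
  proof -
   obtain y where y: "a = sqrt (\<alpha> n) *\<^sub>R y" "y \<in> ?F n" using a n by (auto simp: Fn_def)
   have "norm a <= norm (sqrt (\<alpha> n)) * 1" unfolding y(1) norm_scaleR real_norm_def using F(3)[OF _ y(2)] n by (intro mult_left_mono) auto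
   then show ?thesis using N[of n] n by simp
  qed
  then show "\<exists>N. \<forall>n\<ge>N. \<forall>a\<in>Fn n. norm a < \<eta>" by blast
 qed
 define S where "S = (\<Sum>n. sqrt (\<alpha> n))"
 have S: "(\<Sum>i\<in>I. sqrt (\<alpha> i)) <= S" if "finite I" for I
  unfolding S_def using that alpha by (intro sum_le_suminf) (auto intro: less_imp_le)
 have S0: "0 <= S" using S[of "{}"] by simp
 define e where "e = 1 / (2 * (M + S + 1))"
 have e: "0 < e" "e * (M + S) < 1 / 2" using M_nonneg S0 by (auto simp: e_def field_simps)
 obtain T where T: "bounded_linear_on (X t) (X t) T" "finite_dimensional_set (T ` X t)" "\<forall>x\<in>K. norm (T x - x) <= e"
  using AP \<open>compact K\<close> KX e(1) unfolding approximation_property_def by meson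
 define R where "R x = T x - x" for x
 have R: "lin_on (X t) R" "!!x. x \<in> X t ==> R x \<in> X t"
  using T(1) subspace_diff[OF subspace_X] unfolding lin_on_def R_def bounded_linear_on_def by (auto simp: scaleR_diff_right)
 have RK: "norm (R x) <= e" if "x \<in> K" for x using T(3) that unfolding R_def by blast
 have one: "\<bar>\<beta> t 1 R\<bar> <= M * e"
 proof -
  have "\<bar>blinfun_apply (z' j (t 1)) (R (z j (t 1)))\<bar> <= M * e" if j: "j \<in> dyadic_block 1" for j
  proof -
   have "z j (t 1) \<in> Fn 1" unfolding Fn_def using z_in_G[OF _ _ j, of 1 t] by simp
   then have "norm (R (z j (t 1))) <= e" by (intro RK) (auto simp: K_def)
   then have "M * norm (R (z j (t 1))) <= M * e" using M_nonneg by (rule mult_left_mono)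
   then show ?thesis using abs_z'[OF block_pos[OF j], of "t 1" "R (z j (t 1))"] by linarith
  qed
  then have "\<bar>\<Sum>j\<in>dyadic_block 1. blinfun_apply (z' j (t 1)) (R (z j (t 1)))\<bar> <= (\<Sum>j\<in>dyadic_block 1. M * e)"
   by (intro order_trans[OF sum_abs] sum_mono)
  then show ?thesis unfolding enflo_beta_def by (simp add: divide_le_eq mult.commute)
 qed
 have step: "\<bar>\<beta> t n R - \<beta> t (n - 1) R\<bar> <= sqrt (\<alpha> n) * e" if n: "2 <= n" for n
 proof -
  have "lin_on (span (G t n)) R" using R(1) span_G_subset by (rule lin_on_subset)
  moreover have "R y \<in> X t" if "y \<in> span (G t n)" for y using that R(2) span_G_subset by blast
  ultimately obtain y where y: "y \<in> ?F n" "\<bar>\<beta> t n R - \<beta> t (n - 1) R\<bar> <= \<alpha> n * norm (R y)" using F(4)[OF n, of t R t] by blast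
  have yX: "y \<in> X t" using y F(2)[OF n, of t] span_G_subset by blast
  have "sqrt (\<alpha> n) *\<^sub>R y \<in> K" using y n by (auto simp: K_def Fn_def)
  from RK[OF this] have "norm (R (sqrt (\<alpha> n) *\<^sub>R y)) <= e" .
  moreover have "R (sqrt (\<alpha> n) *\<^sub>R y) = sqrt (\<alpha> n) *\<^sub>R R y" using R(1) yX unfolding lin_on_def by blast
  ultimately have "sqrt (\<alpha> n) * norm (R y) <= e" using alpha(1)[of n] by simp
  then have "sqrt (\<alpha> n) * (sqrt (\<alpha> n) * norm (R y)) <= sqrt (\<alpha> n) * e" using alpha(1)[of n] by (intro mult_left_mono) auto
  also have "sqrt (\<alpha> n) * (sqrt (\<alpha> n) * norm (R y)) = \<alpha> n * norm (R y)" using alpha(1)[of n] by (simp flip: mult.assoc)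
  finally show ?thesis using y(2) by linarith
 qed
 have bd: "\<bar>\<beta> t n R\<bar> <= M * e + (\<Sum>i\<in>{2..n}. sqrt (\<alpha> i)) * e" if "1 <= n" for n
  using that
 proof (induction n rule: dec_induct)
  case base then show ?case using one by simp
 next
  case (step n)
  have "\<bar>\<beta> t (Suc n) R - \<beta> t n R\<bar> <= sqrt (\<alpha> (Suc n)) * e" using \<open>!!n. 2 <= n ==> \<bar>\<beta> t n R - \<beta> t (n - 1) R\<bar> <= sqrt (\<alpha> n) * e\<close>[of "Suc n"] step.hyps by simp
  moreover have "{2..Suc n} = insert (Suc n) {2..n}" using step.hyps by auto
  ultimately show ?case using step.IH by (simp add: algebra_simps)
 qed
 have all: "\<bar>\<beta> t n R\<bar> < 1 / 2" if "1 <= n" for n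
 proof -
  have "(\<Sum>i\<in>{2..n}. sqrt (\<alpha> i)) * e <= S * e" using S[of "{2..n}"] e(1) by (intro mult_right_mono) auto
  moreover have "M * e + S * e < 1 / 2" using e(2) by (simp add: algebra_simps)
  ultimately show ?thesis using bd[OF that] by linarith
 qed
 obtain n where n: "1 <= n" "\<bar>\<beta> t n T\<bar> <= 1 / 4" using beta_finite_rank[OF T(1,2), of "1 / 4"] by auto
 show False using all[OF n(1)] beta_diff_identity[OF n(1), of t T] n(2) unfolding R_def[abs_def] by linarith
qed

text \<open>Adding a finite rank operator exchanges the spanning vectors of the finitely many levels
  where the sequences differ. It is bounded on the whole space, so mapping properties and inverses
  extend from spans to closures.\<close>

lemma E0_isomorphic:
 assumes "E0 t s" shows "isomorphic_subspaces (X t) (X s)"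
proof -
 obtain N where N: "!!n. n \<ge> N ==> t n = s n" using assms unfolding E0_def by blast
 define \<Phi> where "\<Phi> t s x = x + (\<Sum>n\<in>{1..N}. \<Sum>j\<in>dyadic_block n. blinfun_apply (z' j (t n)) x *\<^sub>R (z j (s n) - z j (t n)))" for t s x
 have lin: "bounded_linear (\<Phi> t s)" for t s
  unfolding \<Phi>_def
  by (intro bounded_linear_add bounded_linear_ident bounded_linear_sum bounded_linear_compose[OF bounded_linear_scaleR_left blinfun.bounded_linear_right])
 have gen: "\<Phi> t s (z i (t m)) = z i (s m)" if m: "1 <= m" "i \<in> dyadic_block m" and N: "!!n. n \<ge> N ==> t n = s n" for t s i m
 proof -
  have "(\<Sum>n\<in>{1..N}. \<Sum>j\<in>dyadic_block n. blinfun_apply (z' j (t n)) (z i (t m)) *\<^sub>R (z j (s n) - z j (t n))) =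
    (\<Sum>n\<in>{1..N}. if n = m then z i (s m) - z i (t m) else 0)"
  proof (rule sum.cong[OF refl])
   fix n assume "n \<in> {1..N}"
   have "(\<Sum>j\<in>dyadic_block n. blinfun_apply (z' j (t n)) (z i (t m)) *\<^sub>R (z j (s n) - z j (t n))) =
     (\<Sum>j\<in>dyadic_block n. if j = i then (if n = m then z i (s m) - z i (t m) else 0) else 0)"
   proof (rule sum.cong[OF refl])
    fix j assume j: "j \<in> dyadic_block n"
    show "blinfun_apply (z' j (t n)) (z i (t m)) *\<^sub>R (z j (s n) - z j (t n)) =
      (if j = i then (if n = m then z i (s m) - z i (t m) else 0) else 0)"
     using z'_z[OF j m(2)] block_unique[OF j] m(2) by auto
   qed
   also have "... = (if n = m then z i (s m) - z i (t m) else 0)" using m(2) by simp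
   finally show "(\<Sum>j\<in>dyadic_block n. blinfun_apply (z' j (t n)) (z i (t m)) *\<^sub>R (z j (s n) - z j (t n))) =
     (if n = m then z i (s m) - z i (t m) else 0)" .
  qed
  also have "... = z i (s m) - z i (t m)" using m(1) N[of m] by (cases "m <= N") auto
  finally show ?thesis by (simp add: \<Phi>_def)
 qed
 let ?B = "%t. {z j (t n) | j n. 1 <= n \<and> j \<in> dyadic_block n}"
 have maps: "\<Phi> t s x \<in> X s" if N: "!!n. n \<ge> N ==> t n = s n" and x: "x \<in> X t" for t s x
 proof -
  have "\<Phi> t s ` ?B t \<subseteq> ?B s" using gen[OF _ _ N] by fastforce
  then have "span (\<Phi> t s ` ?B t) \<subseteq> span (?B s)" by (rule span_mono)
  then have "\<Phi> t s ` span (?B t) \<subseteq> span (?B s)" using linear_span_image[OF bounded_linear.linear[OF lin]] by simp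
  then have "closure (\<Phi> t s ` span (?B t)) \<subseteq> X s" unfolding cantor_subspace_def by (rule closure_mono)
  moreover have "\<Phi> t s x \<in> closure (\<Phi> t s ` span (?B t))"
   using closure_bounded_linear_image_subset[OF lin, of t s "span (?B t)"] x unfolding cantor_subspace_def by blast
  ultimately show ?thesis by blast
 qed
 have inv: "\<Phi> s t (\<Phi> t s x) = x" if N: "!!n. n \<ge> N ==> t n = s n" and x: "x \<in> X t" for t s x
 proof -
  have comp: "bounded_linear (%x. \<Phi> s t (\<Phi> t s x))" using lin lin by (rule bounded_linear_compose)
  have "blinfun_apply (Blinfun (%x. \<Phi> s t (\<Phi> t s x))) x = blinfun_apply (Blinfun (%x. x)) x"
  proof (rule blinfun_eq_on_closure_span[OF _ x[unfolded cantor_subspace_def]])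
   fix v assume "v \<in> ?B t"
   then obtain j n where v: "v = z j (t n)" "1 <= n" "j \<in> dyadic_block n" by blast
   have "\<Phi> t s v = z j (s n)" unfolding v(1) using v N by (intro gen) auto
   moreover have "\<Phi> s t (z j (s n)) = v" unfolding v(1) using v N by (intro gen) auto
   ultimately show "blinfun_apply (Blinfun (%x. \<Phi> s t (\<Phi> t s x))) v = blinfun_apply (Blinfun (%x. x)) v"
    by (simp add: bounded_linear_Blinfun_apply[OF comp] bounded_linear_Blinfun_apply[OF bounded_linear_ident])
  qed
  then show ?thesis by (simp add: bounded_linear_Blinfun_apply[OF comp] bounded_linear_Blinfun_apply[OF bounded_linear_ident])
 qed
 have bl: "bounded_linear_on (X t) (X s) (\<Phi> t s)" if N: "!!n. n \<ge> N ==> t n = s n" for t s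
 proof -
  obtain K where "!!x. norm (\<Phi> t s x) <= norm x * K" using bounded_linear.bounded[OF lin] by blast
  then have "\<forall>x\<in>X t. norm (\<Phi> t s x) <= K * norm x" by (simp add: mult.commute)
  then show ?thesis unfolding bounded_linear_on_def
   using maps[OF N] bounded_linear.linear[OF lin[of t s]] by (auto simp: linear_add linear_scale)
 qed
 have N': "!!n. n \<ge> N ==> s n = t n" using N by simp
 show ?thesis unfolding isomorphic_subspaces_def
  using bl[of t s, OF N] bl[of s t, OF N'] inv[of t s, OF N] inv[of s t, OF N'] by blast
qed

section \<open>The subspaces as points of the Effros Borel space\<close>

lemma X_in_SB: "X t \<in> SB"
proof -
 have "\<not> finite_dimensional_set (X t)"
 proof
  assume "finite_dimensional_set (X t)"
  then obtain B where B: "finite B" "X t \<subseteq> span B" unfolding finite_dimensional_set_def by blast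
  define n where "n = Suc (card B)"
  define f where "f j = z j (t n)" for j
  have dual: "blinfun_apply (z' j (t n)) (f i) = (if j = i then 1 else 0)" if "j \<in> dyadic_block n" "i \<in> dyadic_block n" for i j
   using z'_z[OF that] by (simp add: f_def)
  have inj: "inj_on f (dyadic_block n)"
  proof (rule inj_onI)
   fix i j assume ij: "i \<in> dyadic_block n" "j \<in> dyadic_block n" "f i = f j"
   then show "i = j" using dual[OF ij(1,1)] dual[OF ij(1,2)] by (auto split: if_splits)
  qed
  have "independent (f ` dyadic_block n)"
  proof
   assume "dependent (f ` dyadic_block n)"
   then obtain u v where u: "v \<in> f ` dyadic_block n" "u v ~= 0" "(\<Sum>v\<in>f ` dyadic_block n. u v *\<^sub>R v) = 0"
    unfolding dependent_finite[OF finite_imageI[OF finite_block]] by blast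
   then obtain j where j: "j \<in> dyadic_block n" "v = f j" by blast
   have "0 = blinfun_apply (z' j (t n)) (\<Sum>i\<in>dyadic_block n. u (f i) *\<^sub>R f i)"
    using u(3) inj by (simp add: sum.reindex blinfun.zero_right)
   also have "... = (\<Sum>i\<in>dyadic_block n. if i = j then u (f j) else 0)"
    unfolding blinfun.sum_right blinfun.scaleR_right using dual[OF j(1)] by (intro sum.cong refl) auto
   also have "... = u v" using j by simp
   finally show False using u(2) by simp
  qed
  moreover have "f ` dyadic_block n \<subseteq> span B" using B(2) z_in_X[of n _ t] unfolding f_def n_def by auto
  ultimately have "card (f ` dyadic_block n) <= card B" using independent_span_bound[OF B(1)] by blast
  then have "2 ^ n <= card B" using inj by (simp add: card_image)
  then show False using less_exp[of n] unfolding n_def by simp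
 qed
 then show ?thesis unfolding SB_def using subspace_X closed_X by blast
qed

text \<open>An open set met by the closure is met by the span, at a vector that depends on finitely
  many bits. So the preimages of the generating sets are even open.\<close>

lemma X_measurable:
 fixes \<psi> :: "(nat => bool) => nat => bool"
 assumes \<psi>: "!!N t t'. (!!n. n < N ==> t n = t' n) ==> (!!n. n < N ==> \<psi> t n = \<psi> t' n)"
 shows "(%t. X (\<psi> t)) \<in> borel \<rightarrow>\<^sub>M (effros_borel :: 'a set measure)"
 unfolding effros_borel_def
proof (rule measurable_measure_of)
 show "(%t. X (\<psi> t)) \<in> space borel \<rightarrow> SB" using X_in_SB by simp
 fix y assume "y \<in> {{F \<in> SB. F \<inter> U ~= {}} | U. open (U :: 'a set)}"
 then obtain U where U: "y = {F \<in> SB. F \<inter> U ~= {}}" "open U" by blast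
 have "open {t. X (\<psi> t) \<inter> U ~= {}}"
 proof (subst open_subopen, rule ballI)
  fix t assume "t \<in> {t. X (\<psi> t) \<inter> U ~= {}}"
  then have "U \<inter> closure (span (\<Union>n. G (\<psi> t) n)) ~= {}" unfolding X_eq by blast
  then have "U \<inter> span (\<Union>n. G (\<psi> t) n) ~= {}" using open_Int_closure_eq_empty[OF U(2)] by blast
  then obtain v where v: "v \<in> U" "v \<in> span (\<Union>n. G (\<psi> t) n)" by blast
  obtain N where N: "v \<in> span (G (\<psi> t) N)" using span_UN_G[OF v(2)] by blast
  define V where "V = (\<Inter>n\<in>{..<Suc N}. (%t :: nat => bool. t n) -` {t n :: bool})"
  have "open V" unfolding V_def
   by (intro open_INT ballI open_vimage open_discrete continuous_on_product_coordinates) simp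
  moreover have "t \<in> V" by (simp add: V_def)
  moreover have "V \<subseteq> {t. X (\<psi> t) \<inter> U ~= {}}"
  proof
   fix t' assume t': "t' \<in> V"
   have "\<psi> t' n = \<psi> t n" if "n < Suc N" for n using t' that by (intro \<psi>[of "Suc N"]) (auto simp: V_def)
   then have "G (\<psi> t') N = G (\<psi> t) N" by (intro G_cong) auto
   then have "v \<in> X (\<psi> t')" using N span_G_subset[of "\<psi> t'" N] by auto
   then show "t' \<in> {t. X (\<psi> t) \<inter> U ~= {}}" using v(1) by blast
  qed
  ultimately show "\<exists>T. open T \<and> t \<in> T \<and> T \<subseteq> {t. X (\<psi> t) \<inter> U ~= {}}" by blast
 qed
 moreover have "(%t. X (\<psi> t)) -` y \<inter> space borel = {t. X (\<psi> t) \<inter> U ~= {}}"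
  unfolding U(1) using X_in_SB by auto
 ultimately show "(%t. X (\<psi> t)) -` y \<inter> space borel \<in> sets borel" by simp
qed auto

text \<open>Prescribing the approximate values \<open>u\<close> on block \<open>N\<close> makes
  isomorphisms that belong to different pairs comparable there, although they act on different
  spaces.\<close>

definition close_pairs :: "real => nat => real => (nat => 'a) => ((nat => bool) \<times> (nat => bool)) set" where
 "close_pairs K N \<tau> u = {(t, s). \<exists>T S. bounded_linear_on (X t) (X s) T \<and> bounded_linear_on (X s) (X t) S \<and>
   (\<forall>x\<in>X t. S (T x) = x) \<and> (\<forall>x\<in>X t. norm (T x) <= K * norm x) \<and> (\<forall>y\<in>X s. norm (S y) <= K * norm y) \<and>
   (\<forall>j\<in>dyadic_block N. norm (T (z j (t N)) - u j) <= \<tau>)}"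

lemma finite_expansion:
 assumes "y \<in> span (G t N)"
 shows "y = (\<Sum>m\<in>{1..N}. \<Sum>j\<in>dyadic_block m. blinfun_apply (z' j (t m)) y *\<^sub>R z j (t m))"
proof -
 have "(%y. y) y = (%y. \<Sum>m\<in>{1..N}. \<Sum>j\<in>dyadic_block m. blinfun_apply (z' j (t m)) y *\<^sub>R z j (t m)) y"
 proof (rule linear_eq_on_span[OF _ _ _ assms])
  show "linear (%y. \<Sum>m\<in>{1..N}. \<Sum>j\<in>dyadic_block m. blinfun_apply (z' j (t m)) y *\<^sub>R z j (t m))"
   by (intro bounded_linear.linear bounded_linear_sum bounded_linear_compose[OF bounded_linear_scaleR_left blinfun.bounded_linear_right])
  fix g assume "g \<in> G t N"
  then obtain i n where g: "g = z i (t n)" "1 <= n" "n <= N" "i \<in> dyadic_block n" unfolding G_def by blast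
  have "(\<Sum>j\<in>dyadic_block m. blinfun_apply (z' j (t m)) g *\<^sub>R z j (t m)) = (if m = n then g else 0)" for m
  proof -
   have "(\<Sum>j\<in>dyadic_block m. blinfun_apply (z' j (t m)) g *\<^sub>R z j (t m)) = (\<Sum>j\<in>dyadic_block m. if j = i then (if m = n then g else 0) else 0)"
   proof (rule sum.cong[OF refl])
    fix j assume j: "j \<in> dyadic_block m"
    show "blinfun_apply (z' j (t m)) g *\<^sub>R z j (t m) = (if j = i then (if m = n then g else 0) else 0)"
     unfolding g(1) using z'_z[OF j g(4)] block_unique[OF j] g(4) by auto
   qed
   then show ?thesis using g(4) by simp
  qed
  then show "g = (\<Sum>m\<in>{1..N}. \<Sum>j\<in>dyadic_block m. blinfun_apply (z' j (t m)) g *\<^sub>R z j (t m))" using g by simp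
 qed (rule linear_id[unfolded id_def])
 then show ?thesis .
qed

text \<open>This makes the trace zero on a level where the domain and the target have different
  bits.\<close>

lemma z'_vanish:
 assumes "j \<in> dyadic_block n" "t n ~= \<xi>" "v \<in> X t" shows "blinfun_apply (z' j \<xi>) v = 0"
proof -
 have "blinfun_apply (z' j \<xi>) v = blinfun_apply 0 v"
 proof (rule blinfun_eq_on_closure_span[OF _ assms(3)[unfolded cantor_subspace_def]])
  fix y assume "y \<in> {z j (t n) | j n. 1 <= n \<and> j \<in> dyadic_block n}"
  then obtain i m where y: "y = z i (t m)" "i \<in> dyadic_block m" by blast
  show "blinfun_apply (z' j \<xi>) y = blinfun_apply 0 y"
   unfolding y(1) z'_z[OF assms(1) y(2)] using block_unique[OF assms(1)] y(2) assms(2) by auto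
 qed
 then show ?thesis by simp
qed

text \<open>The first isomorphism cannot be composed directly with the inverse of the second, since
  it maps into \<open>X s\<close> and not into \<open>X s2\<close>. Its approximation
  \<open>T0\<close> uses only levels on which \<open>s\<close> and \<open>s2\<close> agree. In
  exchange the composition is estimated only on the first \<open>N1\<close> levels of
  \<open>t\<close>, which is all that the tests for these levels require. The margins are a trace of
  at least 3/4 on level \<open>N\<close>, zero on level \<open>N1\<close> and a change of at most
  1/2 in between.\<close>

lemma nowhere_dense_close_pairs:
 assumes N: "1 <= N" and K: "0 <= K" and \<tau>: "0 < \<tau>" "3 * M * K * \<tau> <= 1 / 4"
  and tail: "!!n. K * (K + 1) * (\<Sum>i\<in>{N<..n}. \<alpha> i) <= 1 / 2"
 shows "nowhere_dense (close_pairs K N \<tau> u)"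
 unfolding nowhere_dense_def
proof (intro allI, rule ccontr)
 fix t0 s0 :: "nat => bool" and l
 assume no: "\<nexists>t' s' l'. l <= l' \<and> (\<forall>n<l. t' n = t0 n \<and> s' n = s0 n) \<and>
   (\<forall>t'' s''. (\<forall>n<l'. t'' n = t' n \<and> s'' n = s' n) --> (t'', s'') \<notin> close_pairs K N \<tau> u)"
 have dense: "\<exists>t'' s''. (\<forall>n<l'. t'' n = t' n \<and> s'' n = s' n) \<and> (t'', s'') \<in> close_pairs K N \<tau> u"
  if l': "l <= l'" "\<forall>n<l. t' n = t0 n \<and> s' n = s0 n" for t' s' l'
 proof (rule ccontr)
  assume "\<not> ?thesis"
  then have *: "\<forall>t'' s''. (\<forall>n<l'. t'' n = t' n \<and> s'' n = s' n) --> (t'', s'') \<notin> close_pairs K N \<tau> u" by blast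
  have "\<exists>t' s' l'. l <= l' \<and> (\<forall>n<l. t' n = t0 n \<and> s' n = s0 n) \<and>
    (\<forall>t'' s''. (\<forall>n<l'. t'' n = t' n \<and> s'' n = s' n) --> (t'', s'') \<notin> close_pairs K N \<tau> u)"
   by (rule exI[of _ t'], rule exI[of _ s'], rule exI[of _ l'], intro conjI l' *)
  with no show False by (rule notE)
 qed
 obtain t s where ts: "\<forall>n<l. t n = t0 n \<and> s n = s0 n" "(t, s) \<in> close_pairs K N \<tau> u"
  using dense[of l t0 s0] by auto
 obtain T where T: "bounded_linear_on (X t) (X s) T" "\<forall>x\<in>X t. norm (T x) <= K * norm x"
  "\<forall>j\<in>dyadic_block N. norm (T (z j (t N)) - u j) <= \<tau>"
  using ts(2) unfolding close_pairs_def by blast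
 define N1 where "N1 = max (N + 1) l"
 have N1: "N < N1" "l <= N1" "1 <= N1" unfolding N1_def by auto
 define J where "J = Sigma {1..N1} dyadic_block"
 have finJ: "finite J" unfolding J_def by auto
 \<comment> \<open>The bound by \<open>\<tau>\<close> keeps \<open>T0\<close> close to
   \<open>u\<close> on block \<open>N\<close>. The other bound makes \<open>T0 y\<close> differ from
   \<open>T y\<close> by at most \<open>norm y\<close> on the first \<open>N1\<close> levels, whence
   the constant \<open>K + 1\<close>.\<close>
 define \<eta> where "\<eta> = min \<tau> (1 / (M * real (card J) + 1))"
 have cJ: "0 <= M * real (card J)" using M_nonneg by simp
 have \<eta>: "0 < \<eta>" "\<eta> <= \<tau>" using \<tau>(1) cJ by (auto simp: \<eta>_def)
 have "\<eta> * (M * real (card J) + 1) <= 1 / (M * real (card J) + 1) * (M * real (card J) + 1)"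
  unfolding \<eta>_def using cJ by (intro mult_right_mono) auto
 then have \<eta>3: "\<eta> * (M * real (card J) + 1) <= 1" using cJ by simp
 let ?z = "%i. z (snd i) (t (fst i))" and ?z' = "%i. z' (snd i) (t (fst i))"
 have zX: "?z i \<in> X t" if "i \<in> J" for i using that z_in_X unfolding J_def by auto
 have "\<exists>p n. p \<in> span (G s n) \<and> norm (p - T (?z i)) < \<eta>" if "i \<in> J" for i
 proof -
  have "T (?z i) \<in> closure (span (\<Union>n. G s n))" using T(1) zX[OF that] unfolding bounded_linear_on_def X_eq by blast
  then obtain p where p: "p \<in> span (\<Union>n. G s n)" "dist p (T (?z i)) < \<eta>" using \<eta>(1) unfolding closure_approachable by blast
  then show ?thesis using span_UN_G[OF p(1)] by (auto simp: dist_norm)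
 qed
 then obtain p \<nu> where p: "!!i. i \<in> J ==> p i \<in> span (G s (\<nu> i))" "!!i. i \<in> J ==> norm (p i - T (?z i)) < \<eta>"
  by metis
 define N2 where "N2 = (\<Sum>i\<in>J. \<nu> i)"
 have pN2: "p i \<in> span (G s N2)" if "i \<in> J" for i
 proof -
  have "\<nu> i <= N2" unfolding N2_def using that finJ by (intro member_le_sum) auto
  then show ?thesis using p(1)[OF that] span_mono[OF G_mono] by blast
 qed
 \<comment> \<open>Only the bit \<open>N1\<close> is changed, which is beyond \<open>N\<close> and
   beyond the prescribed \<open>l\<close> bits. Density then gives a second pair with this bit that
   agrees with \<open>s\<close> on all levels used by \<open>T0\<close>.\<close>
 define t' where "t' = t(N1 := \<not> t N1)"
 have "\<exists>t2 s2. (\<forall>n<Suc (max N1 N2). t2 n = t' n \<and> s2 n = s n) \<and> (t2, s2) \<in> close_pairs K N \<tau> u"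
  using ts(1) N1 by (intro dense) (auto simp: t'_def)
 then obtain t2 s2 where t2: "\<forall>n<Suc (max N1 N2). t2 n = t' n \<and> s2 n = s n" "(t2, s2) \<in> close_pairs K N \<tau> u"
  by blast
 have t2N: "t2 N1 ~= t N1" "t2 N = t N" using t2(1) N1 by (auto simp: t'_def)
 have Gs: "G s2 N2 = G s N2" using t2(1) by (intro G_cong) auto
 obtain T2 S2 where T2: "bounded_linear_on (X t2) (X s2) T2" "bounded_linear_on (X s2) (X t2) S2"
  "\<forall>x\<in>X t2. S2 (T2 x) = x" "\<forall>y\<in>X s2. norm (S2 y) <= K * norm y"
  "\<forall>j\<in>dyadic_block N. norm (T2 (z j (t2 N)) - u j) <= \<tau>"
  using t2(2) unfolding close_pairs_def by blast
 define T0 where "T0 y = (\<Sum>i\<in>J. blinfun_apply (?z' i) y *\<^sub>R p i)" for y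
 have linT0: "T0 (a + b) = T0 a + T0 b" "T0 (c *\<^sub>R a) = c *\<^sub>R T0 a" for a b c
  unfolding T0_def by (simp_all add: blinfun.add_right blinfun.scaleR_right scaleR_add_left sum.distrib scaleR_sum_right)
 have T0in: "T0 y \<in> X s2" for y
 proof -
  have "T0 y \<in> span (G s N2)" unfolding T0_def using pN2 by (intro span_sum span_scale)
  then show ?thesis using Gs span_G_subset[of s2 N2] by auto
 qed
 have T0_norm: "norm (T0 y) <= (K + 1) * norm y" if y: "y \<in> span (G t N1)" for y
 proof -
  have "(\<Sum>m\<in>{1..N1}. \<Sum>j\<in>dyadic_block m. blinfun_apply (z' j (t m)) y *\<^sub>R z j (t m)) = (\<Sum>i\<in>J. blinfun_apply (?z' i) y *\<^sub>R ?z i)"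
   unfolding J_def by (subst sum.Sigma) (auto simp: case_prod_beta)
  then have "y = (\<Sum>i\<in>J. blinfun_apply (?z' i) y *\<^sub>R ?z i)" using finite_expansion[OF y] by simp
  then have "T y = T (\<Sum>i\<in>J. blinfun_apply (?z' i) y *\<^sub>R ?z i)" by simp
  also have "... = (\<Sum>i\<in>J. blinfun_apply (?z' i) y *\<^sub>R T (?z i))"
   using zX by (intro lin_on_sum[OF bounded_linear_on_lin_on[OF T(1)] subspace_X]) auto
  finally have "T0 y - T y = (\<Sum>i\<in>J. blinfun_apply (?z' i) y *\<^sub>R (p i - T (?z i)))"
   by (simp add: T0_def scaleR_diff_right sum_subtractf)
  also have "norm ... <= (\<Sum>i\<in>J. M * norm y * \<eta>)"
  proof (rule sum_norm_le)
   fix i assume i: "i \<in> J"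
   then have "1 <= snd i" unfolding J_def using block_pos by auto
   then have "\<bar>blinfun_apply (?z' i) y\<bar> * norm (p i - T (?z i)) <= (M * norm y) * \<eta>"
    using abs_z' p(2)[OF i] M_nonneg by (intro mult_mono) auto
   then show "norm (blinfun_apply (?z' i) y *\<^sub>R (p i - T (?z i))) <= M * norm y * \<eta>" by simp
  qed
  also have "... = (\<eta> * (M * real (card J))) * norm y" by simp
  also have "... <= 1 * norm y" using \<eta> \<eta>3 by (intro mult_right_mono) (auto simp: distrib_left)
  finally have "norm (T0 y - T y) <= norm y" by simp
  moreover have "norm (T y) <= K * norm y" using T(2) y span_G_subset by blast
  ultimately show ?thesis using norm_triangle_sub[of "T0 y" "T y"] by (simp add: algebra_simps)
 qed
 define R where "R y = S2 (T0 y)" for y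
 have R: "lin_on (span (G t N1)) R" using T2(2) T0in unfolding lin_on_def R_def linT0 bounded_linear_on_def by blast
 have RX: "R y \<in> X t2" for y using T2(2) T0in unfolding R_def bounded_linear_on_def by blast
 have step: "\<bar>\<beta> t n R - \<beta> t (n - 1) R\<bar> <= \<alpha> n * (K * (K + 1))" if n: "N < n" "n <= N1" for n
 proof -
  have n2: "2 <= n" using n N by simp
  have sub: "span (G t n) \<subseteq> span (G t N1)" by (intro span_mono G_mono n(2))
  obtain y where y: "y \<in> test_set t n" "\<bar>\<beta> t n R - \<beta> t (n - 1) R\<bar> <= \<alpha> n * norm (R y)"
   using test_set(4)[OF n2 lin_on_subset[OF R sub], of t2] RX by blast
  have "norm (R y) <= K * norm (T0 y)" using T2(4) T0in unfolding R_def by blast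
  also have "... <= K * ((K + 1) * norm y)" using T0_norm y(1) test_set(2)[OF n2] sub K by (intro mult_left_mono) blast+
  also have "... <= K * ((K + 1) * 1)" using test_set(3)[OF n2 y(1)] K by (intro mult_left_mono) auto
  finally have "\<alpha> n * norm (R y) <= \<alpha> n * (K * (K + 1))" using alpha(1)[of n] by (intro mult_left_mono) auto
  then show ?thesis using y(2) by linarith
 qed
 have "\<bar>\<beta> t n R - \<beta> t N R\<bar> <= K * (K + 1) * (\<Sum>i\<in>{N<..n}. \<alpha> i)" if "N <= n" "n <= N1" for n
  using that
 proof (induction n rule: dec_induct)
  case base then show ?case by simp
 next
  case (step n)
  have "{N<..Suc n} = insert (Suc n) {N<..n}" using step.hyps by auto
  moreover have "\<bar>\<beta> t (Suc n) R - \<beta> t n R\<bar> <= \<alpha> (Suc n) * (K * (K + 1))"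
   using \<open>!!n. N < n ==> n <= N1 ==> \<bar>\<beta> t n R - \<beta> t (n - 1) R\<bar> <= \<alpha> n * (K * (K + 1))\<close>[of "Suc n"] step by simp
  moreover have "\<bar>\<beta> t n R - \<beta> t N R\<bar> <= K * (K + 1) * (\<Sum>i\<in>{N<..n}. \<alpha> i)" using step by simp
  ultimately show ?case by (simp add: algebra_simps)
 qed
 from this[of N1] have diff: "\<bar>\<beta> t N1 R - \<beta> t N R\<bar> <= 1 / 2" using tail[of N1] N1 by simp
 have zero: "\<beta> t N1 R = 0" unfolding enflo_beta_def using z'_vanish[OF _ t2N(1) RX] by simp
 have near: "\<bar>blinfun_apply (z' j (t N)) (R (z j (t N))) - 1\<bar> <= 1 / 4" if j: "j \<in> dyadic_block N" for j
 proof -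
  let ?y = "z j (t N)"
  have NJ: "(N, j) \<in> J" unfolding J_def using N N1 j by simp
  have "T0 ?y = (\<Sum>i\<in>J. if i = (N, j) then p (N, j) else 0)"
   unfolding T0_def
  proof (rule sum.cong[OF refl])
   fix i assume "i \<in> J"
   then have i: "snd i \<in> dyadic_block (fst i)" unfolding J_def by auto
   show "blinfun_apply (?z' i) ?y *\<^sub>R p i = (if i = (N, j) then p (N, j) else 0)"
    using z'_z[OF i j] block_unique[of "snd i" "fst i" N] i j by (cases i) auto
  qed
  then have T0y: "T0 ?y = p (N, j)" using NJ finJ by simp
  have yX: "?y \<in> X t2" using z_in_X[OF N j, of t2] t2N(2) by simp
  have T2X: "T2 ?y \<in> X s2" using T2(1) yX unfolding bounded_linear_on_def by blast
  have "R ?y - ?y = S2 (p (N, j)) - S2 (T2 ?y)" using T2(3) yX by (simp add: R_def T0y)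
  also have "... = S2 (p (N, j) + (- 1) *\<^sub>R T2 ?y)"
  proof -
   have "S2 (p (N, j) + (- 1) *\<^sub>R T2 ?y) = S2 (p (N, j)) + S2 ((- 1) *\<^sub>R T2 ?y)"
    using T2(2) T0in[of ?y] T0y T2X subspace_scale[OF subspace_X] unfolding bounded_linear_on_def by metis
   also have "S2 ((- 1) *\<^sub>R T2 ?y) = (- 1) *\<^sub>R S2 (T2 ?y)" using T2(2) T2X unfolding bounded_linear_on_def by blast
   finally show ?thesis by simp
  qed
  also have "norm ... <= K * norm (p (N, j) + (- 1) *\<^sub>R T2 ?y)"
   using T2(4) T0in[of ?y] T2X unfolding T0y by (metis subspace_X subspace_add subspace_scale)
  also have "... <= K * (3 * \<tau>)"
  proof (rule mult_left_mono[OF _ K])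
   have a: "norm (p (N, j) - T ?y) <= \<tau>" using p(2)[OF NJ] \<eta>(2) by simp
   have b: "norm (T ?y - u j) <= \<tau>" using T(3) j by blast
   have c: "norm (T2 ?y - u j) <= \<tau>" using T2(5) j t2N(2) by auto
   have "p (N, j) + (- 1) *\<^sub>R T2 ?y = (p (N, j) - T ?y) + (T ?y - u j) - (T2 ?y - u j)" by simp
   also have "norm ... <= norm (p (N, j) - T ?y) + norm (T ?y - u j) + norm (T2 ?y - u j)"
    by (intro norm_triangle_le_diff norm_triangle_le add_mono order_refl)
   finally show "norm (p (N, j) + (- 1) *\<^sub>R T2 ?y) <= 3 * \<tau>" using a b c by linarith
  qed
  finally have d: "norm (R ?y - ?y) <= K * (3 * \<tau>)" .
  have "blinfun_apply (z' j (t N)) (R ?y) - 1 = blinfun_apply (z' j (t N)) (R ?y - ?y)"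
   using z'_z[OF j j] by (simp add: blinfun.diff_right)
  also have "\<bar>...\<bar> <= M * norm (R ?y - ?y)" by (rule abs_z'[OF block_pos[OF j]])
  also have "... <= M * (K * (3 * \<tau>))" using d M_nonneg by (rule mult_left_mono)
  also have "... <= 1 / 4" using \<tau>(2) by (simp add: mult_ac)
  finally show ?thesis .
 qed
 have "(\<Sum>j\<in>dyadic_block N. 3 / 4) <= (\<Sum>j\<in>dyadic_block N. blinfun_apply (z' j (t N)) (R (z j (t N))))"
 proof (rule sum_mono)
  fix j assume "j \<in> dyadic_block N"
  from near[OF this] show "3 / 4 <= blinfun_apply (z' j (t N)) (R (z j (t N)))" unfolding abs_le_iff by linarith
 qed
 then have "3 / 4 <= \<beta> t N R" unfolding enflo_beta_def by (simp add: le_divide_eq)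
 then show False using diff zero by linarith
qed

text \<open>Countably many sets suffice: an integer \<open>K\<close> bounds both operators, and on
  the finite block \<open>N K\<close> the values are approximated by a list of indices into a
  countable dense set.\<close>

lemma isomorphic_pairs_meager:
 assumes sep: "separable_space (euclidean :: 'a topology)"
 obtains A :: "nat => ((nat => bool) \<times> (nat => bool)) set"
 where "!!k. nowhere_dense (A k)" "\<forall>t s. isomorphic_subspaces (X t) (X s) --> (\<exists>k. (t, s) \<in> A k)"
proof -
 obtain Q :: "'a set" where Q: "countable Q" "closure Q = UNIV"
  using sep unfolding separable_space_def by auto
 then have Q0: "Q ~= {}" by auto
 define q where "q = from_nat_into Q"
 have q: "\<exists>i. norm (v - q i) <= \<tau>" if "0 < \<tau>" for v \<tau>
 proof -
  have "\<exists>y\<in>Q. dist y v < \<tau>" using Q(2) that closure_approachable[of v Q] by simp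
  then obtain y where y: "y \<in> Q" "dist y v < \<tau>" by blast
  obtain i where "y = q i" using from_nat_into_surj[OF Q(1) y(1)] unfolding q_def by metis
  then show ?thesis using y(2) by (intro exI[of _ i]) (auto simp: dist_norm norm_minus_commute)
 qed
 have "\<exists>N\<ge>1. \<forall>n. real K * (real K + 1) * (\<Sum>i\<in>{N<..n}. \<alpha> i) <= 1 / 2" for K :: nat
 proof -
  define c where "c = real K * (real K + 1) + 1"
  have c: "c > 0" unfolding c_def by (intro add_nonneg_pos) auto
  then obtain N where N: "!!m n. N <= m ==> norm (sum \<alpha> {m..<n}) < 1 / (2 * c)"
   using alpha(2) unfolding summable_Cauchy by (metis divide_pos_pos mult_pos_pos zero_less_numeral zero_less_one)
  have "real K * (real K + 1) * (\<Sum>i\<in>{Suc N<..n}. \<alpha> i) <= 1 / 2" for n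
  proof -
   have "{Suc N<..n} = {Suc (Suc N)..<Suc n}" by auto
   then have "(\<Sum>i\<in>{Suc N<..n}. \<alpha> i) <= 1 / (2 * c)" using N[of "Suc (Suc N)" "Suc n"] by simp
   moreover have "0 <= (\<Sum>i\<in>{Suc N<..n}. \<alpha> i)" using alpha(1) by (intro sum_nonneg) (simp add: less_imp_le)
   ultimately have "real K * (real K + 1) * (\<Sum>i\<in>{Suc N<..n}. \<alpha> i) <= c * (1 / (2 * c))"
    unfolding c_def by (intro mult_mono) auto
   then show ?thesis using c by simp
  qed
  then show ?thesis by (intro exI[of _ "Suc N"]) auto
 qed
 then obtain N where N: "!!K. 1 <= N K" "!!K n. real K * (real K + 1) * (\<Sum>i\<in>{N K<..n}. \<alpha> i) <= 1 / 2" by metis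
 define \<tau> where "\<tau> K = 1 / (12 * M * real K + 1)" for K :: nat
 have \<tau>: "0 < \<tau> K" "3 * M * real K * \<tau> K <= 1 / 4" for K
 proof -
  have "0 <= M * real K" using M_nonneg by simp
  then show "0 < \<tau> K" "3 * M * real K * \<tau> K <= 1 / 4" unfolding \<tau>_def by (auto simp: divide_le_eq)
 qed
 define B where "B = (%(K, g). close_pairs (real K) (N K) (\<tau> K) (%j. q (g ! (j - 2 ^ N K))))"
 define A where "A k = B (from_nat k)" for k
 show thesis
 proof (rule that)
  show "nowhere_dense (A k)" for k
   unfolding A_def B_def case_prod_beta using N \<tau> by (intro nowhere_dense_close_pairs) auto
  show "\<forall>t s. isomorphic_subspaces (X t) (X s) --> (\<exists>k. (t, s) \<in> A k)"
  proof (intro allI impI)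
   fix t s assume "isomorphic_subspaces (X t) (X s)"
   then obtain T S where TS: "bounded_linear_on (X t) (X s) T" "bounded_linear_on (X s) (X t) S" "\<forall>x\<in>X t. S (T x) = x"
    unfolding isomorphic_subspaces_def by blast
   obtain KT KS where "\<forall>x\<in>X t. norm (T x) <= KT * norm x" "\<forall>y\<in>X s. norm (S y) <= KS * norm y"
    using TS unfolding bounded_linear_on_def by blast
   moreover obtain K :: nat where K: "max KT KS <= real K" using real_arch_simple by blast
   ultimately have bd: "\<forall>x\<in>X t. norm (T x) <= real K * norm x" "\<forall>y\<in>X s. norm (S y) <= real K * norm y"
    by (meson max.boundedE mult_right_mono norm_ge_zero order_trans)+
   have "\<forall>j. \<exists>i. norm (T (z j (t (N K))) - q i) <= \<tau> K" using q[OF \<tau>(1)] by blast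
   from choice[OF this] obtain g where g: "\<forall>j. norm (T (z j (t (N K))) - q (g j)) <= \<tau> K" ..
   have "(t, s) \<in> B (K, map g [2 ^ N K..<2 ^ (N K + 1)])"
    unfolding B_def close_pairs_def case_prod_conv mem_Collect_eq
   proof (rule exI[of _ T], rule exI[of _ S], intro conjI TS bd ballI)
    fix j assume "j \<in> dyadic_block (N K)"
    then have j: "2 ^ N K <= j" "j < 2 ^ (N K + 1)" by (auto simp: dyadic_block_def)
    then have "map g [2 ^ N K..<2 ^ (N K + 1)] ! (j - 2 ^ N K) = g j" by (subst nth_map) auto
    then show "norm (T (z j (t (N K))) - q (map g [2 ^ N K..<2 ^ (N K + 1)] ! (j - 2 ^ N K))) <= \<tau> K" using g by simp
   qed
   then have "(t, s) \<in> A (to_nat (K, map g [2 ^ N K..<2 ^ (N K + 1)]))" unfolding A_def by simp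
   then show "\<exists>k. (t, s) \<in> A k" by blast
  qed
 qed
qed

end

section \<open>Avoiding nowhere dense sets outside \<open>E\<^sub>0\<close>\<close>

lemma nowhere_denseD:
 assumes "nowhere_dense A"
 obtains t' s' l' where "l <= l'" "\<forall>n<l. t' n = t n \<and> s' n = s n"
  "\<forall>t'' s''. (\<forall>n<l'. t'' n = t' n \<and> s'' n = s' n) --> (t'', s'') \<notin> A"
proof -
 have "\<exists>t' s' l'. l <= l' \<and> (\<forall>n<l. t' n = t n \<and> s' n = s n) \<and>
   (\<forall>t'' s''. (\<forall>n<l'. t'' n = t' n \<and> s'' n = s' n) --> (t'', s'') \<notin> A)"
  using assms unfolding nowhere_dense_def by (elim allE)
 then show thesis by (elim exE conjE) (rule that)
qed

lemma nowhere_dense_converse: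
 assumes "nowhere_dense A" shows "nowhere_dense (A\<inverse>)"
 unfolding nowhere_dense_def
proof (intro allI)
 fix t s l
 obtain s' t' l' where *: "l <= l'" "\<forall>n<l. s' n = s n \<and> t' n = t n"
  "\<forall>s'' t''. (\<forall>n<l'. s'' n = s' n \<and> t'' n = t' n) --> (s'', t'') \<notin> A"
  by (rule nowhere_denseD[OF assms, of l s t])
 have c: "\<forall>t'' s''. (\<forall>n<l'. t'' n = t' n \<and> s'' n = s' n) --> (t'', s'') \<notin> A\<inverse>"
  using *(3) by simp
 have b: "\<forall>n<l. t' n = t n \<and> s' n = s n" using *(2) by simp
 show "\<exists>t' s' l'. l <= l' \<and> (\<forall>n<l. t' n = t n \<and> s' n = s n) \<and>
   (\<forall>t'' s''. (\<forall>n<l'. t'' n = t' n \<and> s'' n = s' n) --> (t'', s'') \<notin> A\<inverse>)"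
  by (rule exI[of _ t'], rule exI[of _ s'], rule exI[of _ l'], intro conjI *(1) b c)
qed

definition splice_at :: "nat => (nat => 'a) => (nat => 'a) => nat => 'a" where
 "splice_at l p u = (%n. if n < l then p n else u n)"

text \<open>The finitely many requirements are met one after another. The words found so far are
  only extended, so a set that has been avoided remains avoided.\<close>

lemma avoiding_block:
 assumes "finite I" "!!p q A. (p, q, A) \<in> I ==> nowhere_dense A"
 shows "\<exists>u v l'. l < l' \<and> (\<forall>(p, q, A)\<in>I. \<forall>t s. (\<forall>n<l'. t n = splice_at l p u n \<and> s n = splice_at l q v n) --> (t, s) \<notin> A)"
 using assms
proof (induction I rule: finite_induct)
  case empty
  then show ?case by auto
 next
  case (insert i I)
  obtain p q A where i: "i = (p, q, A)" by (cases i)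
  have "\<exists>u v l'. l < l' \<and> (\<forall>(p, q, A)\<in>I. \<forall>t s. (\<forall>n<l'. t n = splice_at l p u n \<and> s n = splice_at l q v n) --> (t, s) \<notin> A)"
   using insert.prems by (intro insert.IH) blast
  then obtain u v l' where IH: "l < l'"
   "\<forall>(p, q, A)\<in>I. \<forall>t s. (\<forall>n<l'. t n = splice_at l p u n \<and> s n = splice_at l q v n) --> (t, s) \<notin> A" by blast
  have nd: "nowhere_dense A" using insert.prems[of p q A] i by blast
  obtain t' s' l'' where n: "l' <= l''" "\<forall>n<l'. t' n = splice_at l p u n \<and> s' n = splice_at l q v n"
   "\<forall>t'' s''. (\<forall>n<l''. t'' n = t' n \<and> s'' n = s' n) --> (t'', s'') \<notin> A"
   by (rule nowhere_denseD[OF nd, of l' "splice_at l p u" "splice_at l q v"])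
  have new: "(t, s) \<notin> A" if ts: "\<forall>n<l''. t n = splice_at l p t' n \<and> s n = splice_at l q s' n" for t s
  proof -
   have "t n = t' n \<and> s n = s' n" if "n < l''" for n
    using ts n(2) that IH(1) by (cases "n < l") (auto simp: splice_at_def)
   then show ?thesis using n(3) by blast
  qed
  have old: "(t, s) \<notin> A'" if pq: "(p', q', A') \<in> I" and ts: "\<forall>n<l''. t n = splice_at l p' t' n \<and> s n = splice_at l q' s' n" for p' q' A' t s
  proof -
   have "t n = splice_at l p' u n \<and> s n = splice_at l q' v n" if "n < l'" for n
    using ts n(1,2) that by (cases "n < l") (auto simp: splice_at_def)
   then show ?thesis using IH(2) pq by blast
  qed
  show ?case
   by (rule exI[of _ t'], rule exI[of _ s'], rule exI[of _ l'']) (use IH(1) n(1) new old i in auto)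
qed

text \<open>A block of bits is assigned to each bit of \<open>x\<close> so that whenever the \<open>k\<close>-th bits of \<open>x\<close> and
 \<open>y\<close> differ, the \<open>k\<close>-th blocks force the pair of images out of the first \<open>k\<close> sets.\<close>

lemma E0_reduction_avoiding:
 fixes A :: "nat => ((nat => bool) \<times> (nat => bool)) set"
 assumes nd: "!!k. nowhere_dense (A k)"
 obtains \<psi> :: "(nat => bool) => nat => bool"
 where "\<forall>x y N. (\<forall>n<N. x n = y n) --> (\<forall>n<N. \<psi> x n = \<psi> y n)"
  "\<forall>x y. E0 x y --> E0 (\<psi> x) (\<psi> y)" "\<forall>x y k. \<not> E0 x y --> (\<psi> x, \<psi> y) \<notin> A k"
proof -
 \<comment> \<open>\<open>S\<close> contains the words of length \<open>l\<close> reached so far and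
   \<open>u\<close> the two possible continuations up to \<open>l'\<close>. Both orders of a pair
   are excluded, since the bit \<open>True\<close> may belong to either sequence. The clause for
   \<open>k = 0\<close> carries the initial values through the recursion.\<close>
 define P where "P k S l u l' \<longleftrightarrow> (k = 0 --> l = 0 \<and> S ~= {}) \<and> finite S \<and> l < l' \<and>
  (\<forall>p\<in>S. \<forall>q\<in>S. \<forall>i\<le>k. \<forall>t s. (\<forall>n<l'. t n = splice_at l p (u False) n \<and> s n = splice_at l q (u True) n) -->
   (t, s) \<notin> A i \<and> (s, t) \<notin> A i)"
  for k :: nat and S :: "(nat => bool) set" and l and u :: "bool => nat => bool" and l' :: nat
 have ex: "\<exists>u l'. P k S l u l'" if "finite S" "k = 0 --> l = 0 \<and> S ~= {}" for k S l
 proof -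
  let ?I = "(%(p, q, i). (p, q, A i)) ` (S \<times> S \<times> {..k}) \<union> (%(p, q, i). (p, q, (A i)\<inverse>)) ` (S \<times> S \<times> {..k})"
  have fin: "finite ?I" using that(1) by blast
  have nd': "nowhere_dense B" if "(p, q, B) \<in> ?I" for p q B
   using that nd nowhere_dense_converse by auto
  have "\<exists>u v l'. l < l' \<and> (\<forall>(p, q, A)\<in>?I. \<forall>t s. (\<forall>n<l'. t n = splice_at l p u n \<and> s n = splice_at l q v n) --> (t, s) \<notin> A)"
   by (rule avoiding_block[OF fin nd'])
  then obtain u v l' where uv: "l < l'"
   "\<forall>(p, q, A)\<in>?I. \<forall>t s. (\<forall>n<l'. t n = splice_at l p u n \<and> s n = splice_at l q v n) --> (t, s) \<notin> A"
   by (elim exE conjE)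
  have "P k S l (%b. if b then v else u) l'" unfolding P_def
  proof (intro conjI ballI allI impI)
   fix p q i t s
   assume pq: "p \<in> S" "q \<in> S" and i: "i <= k"
    and ts: "\<forall>n<l'. t n = splice_at l p (if False then v else u) n \<and> s n = splice_at l q (if True then v else u) n"
   have 1: "(p, q, A i) \<in> ?I" "(p, q, (A i)\<inverse>) \<in> ?I" using pq i by force+
   show "(t, s) \<notin> A i" using bspec[OF uv(2) 1(1)] ts by simp
   show "(s, t) \<notin> A i" using bspec[OF uv(2) 1(2)] ts by simp
  qed (use that uv(1) in auto)
  then show ?thesis by blast
 qed
 define nextS where "nextS S l u = (%(p, b). splice_at l p (u b)) ` (S \<times> (UNIV :: bool set))" for S l and u :: "bool => nat => bool"
 have "\<exists>f. \<forall>k. (case f k of (S, l, u, l') => P k S l u l') \<and>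
   (case (f k, f (Suc k)) of ((S, l, u, l'), (S2, l2, u2, l2')) => l2 = l' \<and> S2 = nextS S l u)"
 proof (rule dependent_nat_choice)
  obtain u l' where "P 0 {%_. False} 0 u l'" using ex[of "{%_. False}" 0 0] by blast
  then show "\<exists>x. case x of (S, l, u, l') => P 0 S l u l'" by blast
 next
  fix y k
  assume y: "case y of (S, l, u, l') => P k S l u l'"
  obtain S l u l' where yd: "y = (S, l, u, l')" by (cases y)
  have "finite (nextS S l u)" using y unfolding yd nextS_def P_def by auto
  then obtain u2 l2 where "P (Suc k) (nextS S l u) l' u2 l2" using ex by blast
  then show "\<exists>z. (case z of (S, l, u, l') => P (Suc k) S l u l') \<and>
    (case (y, z) of ((S, l, u, l'), (S2, l2, u2, l2')) => l2 = l' \<and> S2 = nextS S l u)"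
   unfolding yd by (intro exI[of _ "(nextS S l u, l', u2, l2)"]) simp
 qed
 then obtain f where f0: "\<forall>k. (case f k of (S, l, u, l') => P k S l u l') \<and>
   (case (f k, f (Suc k)) of ((S, l, u, l'), (S2, l2, u2, l2')) => l2 = l' \<and> S2 = nextS S l u)" ..
 note f = f0[THEN spec, THEN conjunct1] f0[THEN spec, THEN conjunct2]
 define S where "S k = fst (f k)" for k
 define l where "l k = fst (snd (f k))" for k
 define u where "u k = fst (snd (snd (f k)))" for k
 have l': "snd (snd (snd (f k))) = l (Suc k)" and S': "S (Suc k) = nextS (S k) (l k) (u k)" for k
  using f(2)[of k] unfolding S_def l_def u_def by (auto split: prod.splits)
 have Pk: "P k (S k) (l k) (u k) (l (Suc k))" for k
  using f(1)[of k] l'[of k] unfolding S_def l_def u_def by (auto split: prod.splits)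
 have mono: "l k < l (Suc k)" for k using Pk[of k] unfolding P_def by blast
 have smono: "strict_mono l" using mono by (rule strict_monoI_Suc)
 define kk where "kk m = (LEAST k. m < l (Suc k))" for m
 define \<psi> where "\<psi> x m = u (kk m) (x (kk m)) m" for x m
 \<comment> \<open>Blocks are nonempty, so a position lies in a block of no larger number. Hence the
   first \<open>N\<close> bits of \<open>\<psi> x\<close> depend only on the first \<open>N\<close>
   bits of \<open>x\<close>.\<close>
 have kk_le: "kk m <= m" for m
  unfolding kk_def using strict_mono_imp_increasing[OF smono, of "Suc m"] by (intro Least_le) simp
 have kk_eq: "kk m = k" if "l k <= m" "m < l (Suc k)" for m k
  unfolding kk_def
 proof (rule Least_equality)
  fix y assume "m < l (Suc y)"
  then have "l k < l (Suc y)" using that by simp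
  then show "k <= y" using strict_mono_less[OF smono] by auto
 qed (use that in simp)
 have kk_less: "m < l (Suc (kk m))" for m
  unfolding kk_def by (rule LeastI[of "%k. m < l (Suc k)" m])
   (use strict_mono_imp_increasing[OF smono, of "Suc m"] in simp)
 have prefix: "\<exists>p\<in>S k. \<forall>m<l k. \<psi> x m = p m" for x k
 proof (induction k)
  case 0
  have "l 0 = 0" "S 0 ~= {}" using Pk[of 0] unfolding P_def by auto
  then show ?case by auto
 next
  case (Suc k)
  then obtain p where p: "p \<in> S k" "\<forall>m<l k. \<psi> x m = p m" by blast
  have "splice_at (l k) p (u k (x k)) \<in> S (Suc k)" unfolding S' nextS_def using p(1) by force
  moreover have "\<psi> x m = splice_at (l k) p (u k (x k)) m" if "m < l (Suc k)" for m
   using p(2) kk_eq[of k m] that by (auto simp: splice_at_def \<psi>_def)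
  ultimately show ?case by blast
 qed
 show thesis
 proof (rule that)
  have "\<psi> x n = \<psi> y n" if "\<forall>n<N. x n = y n" "n < N" for N x y n
   using that kk_le[of n] unfolding \<psi>_def by simp
  then show "\<forall>x y N. (\<forall>n<N. x n = y n) --> (\<forall>n<N. \<psi> x n = \<psi> y n)" by blast
  show "\<forall>x y. E0 x y --> E0 (\<psi> x) (\<psi> y)"
  proof (intro allI impI)
   fix x y assume xy: "E0 x y"
   obtain N where N: "\<forall>n\<ge>N. x n = y n" using xy unfolding E0_def by blast
   have "\<psi> x m = \<psi> y m" if m: "l N <= m" for m
   proof -
    have "l N < l (Suc (kk m))" using m kk_less[of m] by simp
    then have "N <= kk m" using strict_mono_less[OF smono] by auto
    then show ?thesis using N by (simp add: \<psi>_def)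
   qed
   then show "E0 (\<psi> x) (\<psi> y)" unfolding E0_def by blast
  qed
  show "\<forall>x y k. \<not> E0 x y --> (\<psi> x, \<psi> y) \<notin> A k"
  proof (intro allI impI)
   fix x y k assume xy: "\<not> E0 x y"
   \<comment> \<open>Sequences that are not equivalent differ arbitrarily late, in particular at
     some \<open>n\<close> whose block avoids \<open>A k\<close>.\<close>
   obtain n where n: "k <= n" "x n ~= y n" using xy unfolding E0_def by blast
   have ext: "\<exists>p\<in>S n. \<forall>m<l (Suc n). \<psi> w m = splice_at (l n) p (u n (w n)) m" for w
   proof -
    obtain p where p: "p \<in> S n" "\<forall>m<l n. \<psi> w m = p m" using prefix by blast
    have "\<psi> w m = splice_at (l n) p (u n (w n)) m" if "m < l (Suc n)" for m
     using p(2) kk_eq[of n m] that by (auto simp: splice_at_def \<psi>_def)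
    then show ?thesis using p(1) by blast
   qed
   obtain p where p: "p \<in> S n" "\<forall>m<l (Suc n). \<psi> x m = splice_at (l n) p (u n (x n)) m" using ext by blast
   obtain q where q: "q \<in> S n" "\<forall>m<l (Suc n). \<psi> y m = splice_at (l n) q (u n (y n)) m" using ext by blast
   have avoid: "(t, s) \<notin> A k \<and> (s, t) \<notin> A k" if "p \<in> S n" "q \<in> S n"
    "\<forall>m<l (Suc n). t m = splice_at (l n) p (u n False) m \<and> s m = splice_at (l n) q (u n True) m" for p q t s
    using Pk[of n] n(1) that unfolding P_def by blast
   show "(\<psi> x, \<psi> y) \<notin> A k"
   proof (cases "x n")
    case True
    then have "y n = False" "x n = True" using n(2) by auto
    then show ?thesis using avoid[of q p "\<psi> y" "\<psi> x"] p q by simp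
   next
    case False
    then have "x n = False" "y n = True" using n(2) by auto
    then show ?thesis using avoid[of p q "\<psi> x" "\<psi> y"] p q by simp
   qed
  qed
 qed
qed

section \<open>Assembling the Enflo system\<close>

lemma summable_two_powr_div:
 assumes "0 < c" shows "summable (%n. 2 powr (- c * real ((n - 2) div 64)))"
proof (rule summable_comparison_test')
 have "2 powr (- c / 64) < 1" using assms powr_less_mono[of "- c / 64" 0 2] by simp
 then show "summable (%n. 2 powr (2 * c) * (2 powr (- c / 64)) ^ n)"
  by (intro summable_mult summable_geometric) simp
 fix n :: nat
 have "n <= 64 * ((n - 2) div 64) + 65" by presburger
 then have "real n <= 64 * real ((n - 2) div 64) + 65" by linarith
 then have "c * (real n / 64) <= c * (real ((n - 2) div 64) + 2)" using assms by (intro mult_left_mono) auto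
 then have "- c * real ((n - 2) div 64) <= 2 * c + real n * (- c / 64)" by (simp add: algebra_simps)
 then have "2 powr (- c * real ((n - 2) div 64)) <= 2 powr (2 * c + real n * (- c / 64))" by (intro powr_mono) auto
 also have "... = 2 powr (2 * c) * (2 powr (- c / 64)) ^ n"
  unfolding powr_add by (simp add: powr_realpow[symmetric] powr_powr mult.commute)
 finally show "norm (2 powr (- c * real ((n - 2) div 64))) <= 2 powr (2 * c) * (2 powr (- c / 64)) ^ n" by simp
qed

lemma (in szankowski) alpha_summable: "summable alpha" "summable (%n. sqrt (alpha n))" "0 < alpha n"
proof -
 have h: "axis_size (n + 1) = (n - 2) div 64" for n by (simp add: axis_size_def)
 have "summable (%n. 180224 * C * 2 powr (- (2 * \<delta>) * real ((n - 2) div 64)))"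
  using \<delta> by (intro summable_mult summable_two_powr_div) simp
 then show "summable alpha" unfolding alpha_def h by simp
 have "sqrt (alpha n) = sqrt (180224 * C) * 2 powr (- \<delta> * real ((n - 2) div 64))" for n
  unfolding alpha_def h real_sqrt_mult by (simp add: powr_powr flip: powr_half_sqrt)
 moreover have "summable (%n. sqrt (180224 * C) * 2 powr (- \<delta> * real ((n - 2) div 64)))"
  using \<delta> by (intro summable_mult summable_two_powr_div)
 ultimately show "summable (%n. sqrt (alpha n))" by simp
 show "0 < alpha n" unfolding alpha_def using C by simp
qed

definition string_of :: "nat => nat => nat set" where
 "string_of n = (SOME f. bij_betw f (dyadic_block n) (Pow {..<n}))"

lemma string_of: "bij_betw (string_of n) (dyadic_block n) (Pow {..<n})"
proof -
 have "\<exists>f. bij_betw f (dyadic_block n) (Pow {..<n})"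
  by (intro finite_same_card_bij) (simp_all add: dyadic_block_def card_Pow)
 then show ?thesis unfolding string_of_def by (rule someI_ex)
qed

definition level :: "nat => nat" where "level j = (SOME n. j \<in> dyadic_block n)"

lemma in_block_level: "1 <= j ==> j \<in> dyadic_block (level j)"
 unfolding level_def dyadic_block_def atLeastLessThan_iff
 by (rule someI_ex, rule ex_power_ivl1) simp_all

lemma level_eq: "j \<in> dyadic_block n ==> level j = n"
proof (rule ccontr)
 assume j: "j \<in> dyadic_block n" and ne: "level j ~= n"
 have "0 < j" using j zero_less_power[of "2 :: nat" n] unfolding dyadic_block_def by (simp only: atLeastLessThan_iff) linarith
 then have "j \<in> dyadic_block (level j)" using in_block_level by simp
 then have l: "2 ^ level j <= j" "j < 2 ^ (level j + 1)" "2 ^ n <= j" "j < 2 ^ (n + 1)" using j by (auto simp: dyadic_block_def)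
 show False
 proof (cases "level j < n")
  case True
  then have "(2::nat) ^ (level j + 1) <= 2 ^ n" by (intro power_increasing) auto
  then show False using l by linarith
 next
  case False
  then have "(2::nat) ^ (n + 1) <= 2 ^ level j" using ne by (intro power_increasing) auto
  then show False using l by linarith
 qed
qed

lemma level_pos: "1 <= j ==> j ~= 1 ==> 1 <= level j"
 using in_block_level[of j] by (cases "level j") (auto simp: dyadic_block_def)

lemma string_subset: "j \<in> dyadic_block n ==> string_of n j \<subseteq> {..<n}"
 using bij_betwE[OF string_of[of n]] by blast

context szankowski
begin

text \<open>The index \<open>1\<close> lies outside the blocks that span the subspaces; the vectors attached to it only
 have to keep the system biorthogonal.\<close>

definition seq :: "nat => bool => 'a" where
 "seq j \<xi> = (if j = 1 then x 2 {} (\<xi>, True) else z (level j) (string_of (level j) j) \<xi>)"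

definition dual :: "nat => bool => 'a \<Rightarrow>\<^sub>L real" where
 "dual j \<xi> = (if j = 1 then xs 2 {} (\<xi>, True) - xs 2 {} (\<xi>, False)
   else zs (level j) (string_of (level j) j) \<xi> False)"

lemma seq_block: "1 <= n ==> j \<in> dyadic_block n ==> seq j \<xi> = z n (string_of n j) \<xi>"
 and dual_block: "1 <= n ==> j \<in> dyadic_block n ==> dual j \<xi> = zs n (string_of n j) \<xi> False"
proof -
 assume n: "1 <= n" and j: "j \<in> dyadic_block n"
 have "(2::nat) ^ 1 <= 2 ^ n" using n by (intro power_increasing) auto
 then have "j ~= 1" using j by (auto simp: dyadic_block_def)
 then show "seq j \<xi> = z n (string_of n j) \<xi>" "dual j \<xi> = zs n (string_of n j) \<xi> False"
  by (simp_all add: seq_def dual_def level_eq[OF j])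
qed

lemma seq_bounds:
 assumes j: "1 <= j"
 shows "norm (seq j \<xi>) <= 512" "seq j \<xi> \<in> W" "v \<in> W ==> \<bar>blinfun_apply (dual j \<xi>) v\<bar> <= 512 * norm v"
proof -
 show "seq j \<xi> \<in> W"
  using subsetD[OF closure_subset x_in_W[OF order_refl empty_subsetI, of "(\<xi>, True)"]]
   subsetD[OF closure_subset z_in_span[OF level_pos[OF j] string_subset[OF in_block_level[OF j]], of \<xi>]]
  unfolding seq_def W_def by (simp only: split: if_split) blast
 show "norm (seq j \<xi>) <= 512"
  using norm_x[of 2 "{}" "(\<xi>, True)"] norm_z[OF level_pos[OF j] string_subset[OF in_block_level[OF j]], of \<xi>]
  unfolding seq_def by auto
 show "\<bar>blinfun_apply (dual j \<xi>) v\<bar> <= 512 * norm v" if v: "v \<in> W"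
 proof (cases "j = 1")
  case True
  then show ?thesis
   using abs_xs[OF _ _ v, of 2 "{}" "(\<xi>, True)"] abs_xs[OF _ _ v, of 2 "{}" "(\<xi>, False)"]
   by (simp add: dual_def blinfun.diff_left)
 next
  case False
  then show ?thesis
   using abs_zs[OF level_pos[OF j] string_subset[OF in_block_level[OF j]] v, of \<xi> False] by (simp add: dual_def)
 qed
qed

lemma dual_seq:
 assumes i: "1 <= i" and j: "1 <= j"
 shows "blinfun_apply (dual i \<xi>) (seq j \<tau>) = (if i = j \<and> \<xi> = \<tau> then 1 else 0)"
proof -
 consider "i = 1" "j = 1" | "i = 1" "j ~= 1" | "i ~= 1" "j = 1" | "i ~= 1" "j ~= 1" by blast
 then show ?thesis
 proof cases
  case 1
  then show ?thesis by (simp add: dual_def seq_def blinfun.diff_left xs_x)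
 next
  case 2
  \<comment> \<open>On level 2 the vector \<open>z m\<close> with \<open>m >= 1\<close> is seen only
    through its first summand, where the second copy bit is summed out; so the two functionals in
    \<open>dual 1\<close> agree on it.\<close>
  have "blinfun_apply (xs 2 {} (\<xi>, False)) (seq j \<tau>) = blinfun_apply (xs 2 {} (\<xi>, True)) (seq j \<tau>)"
   using 2 level_pos[OF j] string_subset[OF in_block_level[OF j]] by (simp add: seq_def xs_z)
  then show ?thesis using 2 by (simp add: dual_def blinfun.diff_left)
 next
  case 3
  have s: "string_of (level i) i \<subseteq> {..<level i + 1}" "insert (level i) (string_of (level i) i) \<subseteq> {..<level i + 1}"
   using string_subset[OF in_block_level[OF i]] by auto
  have n: "2 <= level i + 1" using level_pos[OF i 3(1)] by simp
  show ?thesis using 3 xs_x[OF n _ s(1), of 2 "{}"] xs_x[OF n _ s(2), of 2 "{}"]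
   by (simp add: dual_def seq_def zs_def blinfun.diff_left blinfun.scaleR_left)
 next
  case 4
  have "level i = level j \<and> string_of (level i) i = string_of (level j) j \<longleftrightarrow> i = j"
   using inj_onD[OF bij_betw_imp_inj_on[OF string_of[of "level i"]], of i j] in_block_level[OF i] in_block_level[OF j] by auto
  then show ?thesis using 4
   zs_z[OF level_pos[OF i 4(1)] level_pos[OF j 4(2)] string_subset[OF in_block_level[OF i]] string_subset[OF in_block_level[OF j]], of \<xi> False \<tau>]
   by (simp add: dual_def seq_def) blast
 qed
qed

text \<open>The functionals are controlled on \<open>W\<close> only. Their restrictions to
  \<open>W\<close> are extended anew to obtain norms bounded on the whole space.\<close>

lemma extended_dual_exists:
 "\<exists>z'. \<forall>j \<xi>. 1 <= j --> norm (z' j \<xi>) <= 512 \<and> (\<forall>v\<in>W. blinfun_apply (z' j \<xi>) v = blinfun_apply (dual j \<xi>) v)"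
proof -
 have W: "subspace W" unfolding W_def by (intro subspace_closure subspace_span)
 have "\<exists>f. norm f <= 512 \<and> (\<forall>v\<in>W. blinfun_apply f v = blinfun_apply (dual j \<xi>) v)" if j: "1 <= j" for j \<xi>
 proof -
  let ?G = "{(v, blinfun_apply (dual j \<xi>) v) | v. v \<in> W}"
  obtain f where "!!x r. (x, r) \<in> ?G ==> blinfun_apply f x = r" "norm f <= 512"
  proof (rule hahn_banach_graph[of ?G 512])
   show "?G ~= {}" using subspace_0[OF W] by blast
   show "(x + y, r + s) \<in> ?G" if "(x, r) \<in> ?G" "(y, s) \<in> ?G" for x r y s
    using that subspace_add[OF W] by (auto simp: blinfun.add_right)
   show "(c *\<^sub>R x, c * r) \<in> ?G" if "(x, r) \<in> ?G" for c x r
    using that subspace_scale[OF W] by (auto simp: blinfun.scaleR_right)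
   show "\<bar>r\<bar> <= 512 * norm x" if "(x, r) \<in> ?G" for x r using that seq_bounds(3)[OF j] by blast
  qed auto
  then show ?thesis by blast
 qed
 then have "\<forall>j. \<forall>\<xi>. \<exists>f. 1 <= j --> norm f <= 512 \<and> (\<forall>v\<in>W. blinfun_apply f v = blinfun_apply (dual j \<xi>) v)" by blast
 then show ?thesis unfolding choice_iff .
qed

lemma image_blocks:
 assumes "1 <= n" shows "(%j. seq j \<xi>) ` dyadic_block n = (%w. z n w \<xi>) ` Pow {..<n}"
proof -
 have "(%j. seq j \<xi>) ` dyadic_block n = (%w. z n w \<xi>) ` (string_of n ` dyadic_block n)"
  unfolding image_image using seq_block[OF assms] by (intro image_cong) auto
 then show ?thesis using bij_betw_imp_surj_on[OF string_of] by simp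
qed

lemma Zt_eq: "levels_upto seq t n = Zt t n"
proof -
 have "levels_upto seq t n = (\<Union>m\<in>{1..n}. (%j. seq j (t m)) ` dyadic_block m)" unfolding levels_upto_def by force
 also have "... = (\<Union>m\<in>{1..n}. (%w. z m w (t m)) ` Pow {..<m})" using image_blocks by (intro SUP_cong refl) auto
 also have "... = Zt t n" unfolding Zt_def by force
 finally show ?thesis .
qed

lemma ZZ_eq: "full_space seq = ZZ"
proof -
 have "{seq j \<xi> | j m \<xi>. 1 <= m \<and> j \<in> dyadic_block m} = (\<Union>m\<in>{1..}. \<Union>\<xi>. (%j. seq j \<xi>) ` dyadic_block m)" by force
 also have "... = (\<Union>m\<in>{1..}. \<Union>\<xi>. (%w. z m w \<xi>) ` Pow {..<m})" using image_blocks by (intro SUP_cong refl) auto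
 also have "... = {z m w \<xi> | m w \<xi>. 1 <= m \<and> w \<subseteq> {..<m}}" by force
 finally show ?thesis unfolding ZZ_def full_space_def by simp
qed

lemma enflo_beta_eq:
 assumes z': "\<forall>j \<xi>. 1 <= j --> (\<forall>v\<in>W. blinfun_apply (z' j \<xi>) v = blinfun_apply (dual j \<xi>) v)"
  and n: "1 <= n" and R: "!!w. w \<subseteq> {..<n} ==> R (z n w (t n)) \<in> ZZ"
 shows "enflo_beta seq z' t n R = beta t n R"
proof -
 have "(\<Sum>j\<in>dyadic_block n. blinfun_apply (z' j (t n)) (R (seq j (t n)))) =
   (\<Sum>j\<in>dyadic_block n. blinfun_apply (zs n (string_of n j) (t n) False) (R (z n (string_of n j) (t n))))"
 proof (rule sum.cong[OF refl])
  fix j assume j: "j \<in> dyadic_block n"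
  have "0 < j" using j zero_less_power[of "2 :: nat" n] unfolding dyadic_block_def by (simp only: atLeastLessThan_iff) linarith
  moreover have "R (z n (string_of n j) (t n)) \<in> W" using R[OF string_subset[OF j]] ZZ_subset by blast
  ultimately show "blinfun_apply (z' j (t n)) (R (seq j (t n))) =
    blinfun_apply (zs n (string_of n j) (t n) False) (R (z n (string_of n j) (t n)))"
   using z' by (simp add: seq_block[OF n j] dual_block[OF n j])
 qed
 also have "... = (\<Sum>w\<in>Pow {..<n}. blinfun_apply (zs n w (t n) False) (R (z n w (t n))))"
  by (rule sum.reindex_bij_betw[OF string_of])
 finally show ?thesis by (simp add: enflo_beta_def beta_def)
qed

end

lemma enflo_system_exists:
 fixes e :: "nat => nat => 'a::banach"
 assumes "szankowski e D C \<delta> ty"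
 shows "\<exists>(z :: nat => bool => 'a) z' \<alpha> M. enflo_system z z' \<alpha> M"
proof -
 interpret szankowski e D C \<delta> ty by fact
 obtain z' where z': "\<forall>j \<xi>. 1 <= j --> norm (z' j \<xi>) <= 512 \<and> (\<forall>v\<in>W. blinfun_apply (z' j \<xi>) v = blinfun_apply (dual j \<xi>) v)"
  using extended_dual_exists by blast
 have "enflo_system seq z' alpha 512"
 proof
  fix t :: "nat => bool" and n :: nat
  assume n: "2 <= n"
  obtain F where F: "finite F" "F \<subseteq> span (Zt t n)" "\<forall>y\<in>F. norm y <= 1"
   "\<forall>R. lin_on (span (Zt t n)) R --> (\<forall>y\<in>span (Zt t n). R y \<in> ZZ) -->
     (\<exists>y\<in>F. \<bar>beta t n R - beta t (n - 1) R\<bar> <= alpha n * norm (R y))"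
   by (rule strong_enflo[OF n, where t = t])
  have "\<exists>y\<in>F. \<bar>enflo_beta seq z' t n R - enflo_beta seq z' t (n - 1) R\<bar> <= alpha n * norm (R y)"
   if R: "lin_on (span (Zt t n)) R" "\<forall>y\<in>span (Zt t n). R y \<in> ZZ" for R
  proof -
   have z0: "\<forall>j \<xi>. 1 <= j --> (\<forall>v\<in>W. blinfun_apply (z' j \<xi>) v = blinfun_apply (dual j \<xi>) v)" using z' by blast
   have "z m w (t m) \<in> span (Zt t n)" if "1 <= m" "m <= n" "w \<subseteq> {..<m}" for m w
    using that unfolding Zt_def by (intro span_base) blast
   then have "enflo_beta seq z' t n R = beta t n R" "enflo_beta seq z' t (n - 1) R = beta t (n - 1) R"
    using n R(2) by (auto intro!: enflo_beta_eq[OF z0])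
   then show ?thesis using F(4) R by simp
  qed
  then show "\<exists>F. enflo_test seq z' alpha t n F"
   unfolding enflo_test_def Zt_eq ZZ_eq using F(1-3) by (intro exI[of _ F]) blast
 next
  fix i j :: nat and \<xi> \<tau> assume i: "1 <= i" and j: "1 <= j"
  have "blinfun_apply (z' i \<xi>) (seq j \<tau>) = blinfun_apply (dual i \<xi>) (seq j \<tau>)" using z' i seq_bounds(2)[OF j] by blast
  then show "blinfun_apply (z' i \<xi>) (seq j \<tau>) = (if i = j \<and> \<xi> = \<tau> then 1 else 0)" using dual_seq[OF i j] by simp
 qed (use seq_bounds(1) z' alpha_summable in auto)
 then show ?thesis by blast
qed

text \<open>Lets \<open>\<delta>\<close> be lowered to at most 1/2, as the locale
  \<open>szankowski\<close> requires.\<close>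

lemma type_rates_mono:
 assumes "type_rates C \<delta> n e" "\<delta>' <= \<delta>" shows "type_rates C \<delta>' n e"
proof -
 have "2 powr (2 * real (axis_size n) * (1 / 2 + \<delta>')) <= 2 powr (2 * real (axis_size n) * (1 / 2 + \<delta>))"
  using assms(2) by (intro powr_mono mult_left_mono) auto
 then have "2 powr (2 * real (axis_size n) * (1 / 2 + \<delta>')) * flat e (2 ^ (n - 2 - 2 * axis_size n)) <=
   2 powr (2 * real (axis_size n) * (1 / 2 + \<delta>)) * flat e (2 ^ (n - 2 - 2 * axis_size n))"
  by (intro mult_right_mono) (simp_all add: flat_def)
 then show ?thesis using assms(1) unfolding type_rates_def by linarith
qed

lemma cotype_rates_mono:
 assumes "cotype_rates C \<delta> n e" "\<delta>' <= \<delta>" "0 <= C" shows "cotype_rates C \<delta>' n e"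
proof -
 have "2 powr (2 * real (axis_size n) * (1 / 2 - \<delta>)) <= 2 powr (2 * real (axis_size n) * (1 / 2 - \<delta>'))"
  using assms(2) by (intro powr_mono mult_left_mono) auto
 then have "C * 2 powr (2 * real (axis_size n) * (1 / 2 - \<delta>)) * flat e (2 ^ (2 * axis_size n)) <=
   C * 2 powr (2 * real (axis_size n) * (1 / 2 - \<delta>')) * flat e (2 ^ (2 * axis_size n))"
  using assms(3) by (intro mult_right_mono mult_left_mono) (simp_all add: flat_def)
 then show ?thesis using assms(1) unfolding cotype_rates_def by linarith
qed

lemma szankowski_exists:
 assumes "\<not> near_hilbert TYPE('a::real_normed_vector)"
 shows "\<exists>(e :: nat => nat => 'a) D C \<delta> ty. szankowski e D C \<delta> ty"
proof -
 have "\<exists>C \<delta> ty. 0 < C \<and> 0 < \<delta> \<and> \<delta> <= 1 / 2 \<and>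
   spread_everywhere (%n (e :: nat => 'a). if ty then type_rates C \<delta> n e else cotype_rates C \<delta> n e)"
 proof (cases "type_index TYPE('a) = 2")
  case False
  obtain C \<delta> where C: "C > 0" "\<delta> > 0" "spread_everywhere (type_rates C \<delta> :: nat => (nat => 'a) => bool)"
   by (rule type_structures[OF False])
  have "spread_everywhere (%n (e :: nat => 'a). if True then type_rates C (min \<delta> (1 / 2)) n e else cotype_rates C (min \<delta> (1 / 2)) n e)"
   by (rule spread_everywhere_mono[OF C(3)]) (use type_rates_mono in fastforce)
  then show ?thesis using C(1,2) by (intro exI[of _ C] exI[of _ "min \<delta> (1 / 2)"] exI[of _ True]) simp
 next
  case True
  then have False: "cotype_index TYPE('a) ~= 2" using assms unfolding near_hilbert_def by simp
  obtain C \<delta> where C: "C > 0" "\<delta> > 0" "spread_everywhere (cotype_rates C \<delta> :: nat => (nat => 'a) => bool)"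
   by (rule cotype_structures[OF False])
  have "spread_everywhere (%n (e :: nat => 'a). if False then type_rates C (min \<delta> (1 / 2)) n e else cotype_rates C (min \<delta> (1 / 2)) n e)"
   by (rule spread_everywhere_mono[OF C(3)]) (use cotype_rates_mono C(1) in fastforce)
  then show ?thesis using C(1,2) by (intro exI[of _ C] exI[of _ "min \<delta> (1 / 2)"] exI[of _ False]) simp
 qed
 then obtain C \<delta> ty where C: "0 < C" "0 < \<delta>" "\<delta> <= 1 / 2"
  and ex: "spread_everywhere (%n (e :: nat => 'a). if ty then type_rates C \<delta> n e else cotype_rates C \<delta> n e)" by blast
 define good where "good n e \<longleftrightarrow> spreading (2 ^ (n + 2)) e \<and> norm (e 0) = 1 \<and>
   (if ty then type_rates C \<delta> n e else cotype_rates C \<delta> n e)" for n and e :: "nat => 'a"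
 obtain e D where eD: "!!n. 2 <= n ==> good n (e n)"
  "!!n m i j. 2 <= n ==> 2 <= m ==> i < 2 ^ (n + 2) ==> j < 2 ^ (m + 2) ==>
    blinfun_apply (D n i) (e m j) = (if n = m \<and> i = j then 1 else 0)"
  "!!n v. 2 <= n ==> v \<in> closure (span {e m i | m i. 2 <= m \<and> i < 2 ^ (m + 2)}) ==>
    norm (\<Sum>i<2 ^ (n + 2). blinfun_apply (D n i) v *\<^sub>R e n i) <= 4 * norm v"
 proof (rule fdd_exists[of good])
  show "\<exists>e. (\<forall>i<2 ^ (n + 2). e i \<in> common_kernel \<Phi>) \<and> good n e" if \<Phi>: "finite \<Phi>" "2 <= n" for \<Phi> :: "('a \<Rightarrow>\<^sub>L real) set" and n
   using ex \<Phi> unfolding spread_everywhere_def good_def by blast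
 qed (auto simp: good_def)
 have g: "spreading (2 ^ (n + 2)) (e n)" "norm (e n 0) = 1"
  "if ty then type_rates C \<delta> n (e n) else cotype_rates C \<delta> n (e n)" if "2 <= n" for n
  using eD(1)[OF that] unfolding good_def by blast+
 have "szankowski e D C \<delta> ty"
  by (rule szankowski.intro) (rule g eD(2,3) C; assumption)+
 then show ?thesis by blast
qed

theorem theorem16:
  assumes "separable_space (euclidean :: 'a::banach topology)"
    and "\<not> near_hilbert TYPE('a)"
  shows "cantorized_enflo TYPE('a) \<and> ergodic TYPE('a) \<and>
    (\<exists>\<phi> :: (nat \<Rightarrow> bool) \<Rightarrow> 'a set. \<phi> \<in> borel \<rightarrow>\<^sub>M effros_borel \<and>
       (\<forall>s t. E0 s t \<longleftrightarrow> isomorphic_subspaces (\<phi> s) (\<phi> t)) \<and>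
       (\<forall>t. \<not> approximation_property (\<phi> t)))"
proof -
 obtain z :: "nat => bool => 'a" and z' \<alpha> M where "enflo_system z z' \<alpha> M"
  using szankowski_exists[OF assms(2)] enflo_system_exists by blast
 then interpret enflo_system z z' \<alpha> M .
 obtain A :: "nat => ((nat => bool) \<times> (nat => bool)) set" where A: "!!k. nowhere_dense (A k)" "\<forall>t s. isomorphic_subspaces (X t) (X s) --> (\<exists>k. (t, s) \<in> A k)"
  by (rule isomorphic_pairs_meager[OF assms(1)]) (rule that)
 obtain \<psi> where \<psi>: "\<forall>x y N. (\<forall>n<N. x n = y n) --> (\<forall>n<N. \<psi> x n = \<psi> y n)"
  "\<forall>x y. E0 x y --> E0 (\<psi> x) (\<psi> y)" "\<forall>x y k. \<not> E0 x y --> (\<psi> x, \<psi> y) \<notin> A k"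
  by (rule E0_reduction_avoiding[OF A(1)])
 have meas: "(%t. X (\<psi> t)) \<in> borel \<rightarrow>\<^sub>M (effros_borel :: 'a set measure)"
  by (rule X_measurable) (use \<psi>(1) in blast)
 have iso: "E0 s t \<longleftrightarrow> isomorphic_subspaces (X (\<psi> s)) (X (\<psi> t))" for s t
  using E0_isomorphic \<psi>(2,3) A(2) by blast
 show ?thesis
 proof (intro conjI)
  show "cantorized_enflo TYPE('a)" by (rule cantorized_enflo)
  show "ergodic TYPE('a)" unfolding ergodic_def
   by (rule exI[of _ "%t. X (\<psi> t)"]) (use meas iso in simp)
  show "\<exists>\<phi> :: (nat => bool) => 'a set. \<phi> \<in> borel \<rightarrow>\<^sub>M effros_borel \<and>
    (\<forall>s t. E0 s t \<longleftrightarrow> isomorphic_subspaces (\<phi> s) (\<phi> t)) \<and> (\<forall>t. \<not> approximation_property (\<phi> t))"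
   by (rule exI[of _ "%t. X (\<psi> t)"]) (use meas iso not_approximation_property in simp)
 qed
qed

end
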